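(* Let $\mathcal C\subset\mathbb T$ be a smooth curve with nowhere zero curvature of total length $L$, and let $\{n\}\subset S$ be a sequence such that $\mathcal N_n\to+\infty$ and the sequence $\{4B_{\mathcal C}(\mu_n)-L^2\}$ is bounded away from zero. Then, along this sequence, $$\frac{\mathcal Z_n-\mathbb E[\mathcal Z_n]}{\sqrt{\mathrm{Var}(\mathcal Z_n)}}\ \xrightarrow{\ d\ }\ Z,$$ where $Z\sim\mathcal N(0,1)$ is a standard Gaussian random variable.
   Context: $\mathbb T=\mathbb R^2/\mathbb Z^2$; $S=\{a^2+b^2: a,b\in\mathbb Z\}$. For $n\in S$, $n\ge 1$: $\Lambda_n=\{\lambda\in\mathbb Z^2:\|\lambda\|^2=n\}$, $\mathcal N_n=|\Lambda_n|$, and $\mu_n=\frac1{\mathcal N_n}\sum_{\lambda\in\Lambda_n}\delta_{\lambda/\sqrt n}$, a probability measure on the unit circle $\mathcal S^1\subset\mathbb R^2$. Arithmetic random wave: $T_n(x)=\frac1{\sqrt{\mathcal N_n}}\sum_{\lambda\in\Lambda_n}a_\lambda e^{2\pi i\langle\lambda,x\rangle}$, $x\in\mathbb T$, where the $a_\lambda$ are standard complex Gaussian ($\mathbb E|a_\lambda|^2=1$, real and imaginary parts independent centered Gaussians of variance $1/2$), independent except for the relation $a_{-\lambda}=\overline{a_\lambda}$, all defined on one probability space. Thus $T_n$ is a real centered stationary Gaussian field. For a smooth curve $\mathcal C\subset\mathbb T$ of length $L$ with arc-length parametrization $\gamma:[0,L]\to\mathbb T$, $\mathcal Z_n$ is the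 number of nodal intersections of $T_n$ with $\mathcal C$, i.e. the number of zeros of $f_n(t)=T_n(\gamma(t))$ in $[0,L]$ (almost surely finite). For a probability measure $\mu$ on $\mathcal S^1$, $$B_{\mathcal C}(\mu)=\int_0^L\int_0^L\int_{\mathcal S^1}\langle\theta,\dot\gamma(t_1)\rangle^2\langle\theta,\dot\gamma(t_2)\rangle^2\,d\mu(\theta)\,dt_1\,dt_2 .$$ $\xrightarrow{d}$ denotes convergence in distribution. *)

theory Defs
  imports "HOL-Probability.Probability"
begin

section \<open>The torus and curves on it\<close>

quotient_type torus = "real ^ 2" / "\<lambda>x y :: real ^ 2. \<forall>i. x $ i - y $ i \<in> \<int>"
  morphisms rep_torus to_torus
proof (rule equivpI)
  show "reflp (\<lambda>x y :: real ^ 2. \<forall>i. x $ i - y $ i \<in> \<int>)"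
    by (simp add: reflp_def)
  show "symp (\<lambda>x y :: real ^ 2. \<forall>i. x $ i - y $ i \<in> \<int>)"
    unfolding symp_def by (metis Ints_minus minus_diff_eq)
  show "transp (\<lambda>x y :: real ^ 2. \<forall>i. x $ i - y $ i \<in> \<int>)"
    unfolding transp_def
  proof (intro allI impI)
    fix x y z :: "real ^ 2" and i
    assume "\<forall>i. x $ i - y $ i \<in> \<int>" "\<forall>i. y $ i - z $ i \<in> \<int>"
    then have "(x $ i - y $ i) + (y $ i - z $ i) \<in> \<int>"
      by (intro Ints_add) auto
    then show "x $ i - z $ i \<in> \<int>" by simp
  qed
qed

text \<open>
  The derivative of a torus-valued curve is read off through the covering map \<open>to_torus\<close>.
  The lift \<open>c\<close> need not be continuous away from \<open>t\<close>, so this is a local notion at \<open>t\<close>.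
  Since the tangent bundle of the torus is trivial, the velocity is an element of \<open>real ^ 2\<close>.
\<close>

definition has_velocity :: "(real \<Rightarrow> torus) \<Rightarrow> real set \<Rightarrow> real \<Rightarrow> real ^ 2 \<Rightarrow> bool" where
  "has_velocity \<gamma> A t v \<longleftrightarrow>
     (\<exists>c :: real \<Rightarrow> real ^ 2. (\<forall>s\<in>A. \<gamma> s = to_torus (c s)) \<and>
        (c has_vector_derivative v) (at t within A))"

definition velocity :: "(real \<Rightarrow> torus) \<Rightarrow> real set \<Rightarrow> real \<Rightarrow> real ^ 2" where
  "velocity \<gamma> A t = (THE v. has_velocity \<gamma> A t v)"

lemma has_velocity_unique:
  assumes "has_velocity \<gamma> A t v" "has_velocity \<gamma> A t w" "t \<in> A" "at t within A \<noteq> bot"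
  shows "v = w"
proof -
  obtain c d where c: "\<forall>s\<in>A. \<gamma> s = to_torus (c s)" "(c has_vector_derivative v) (at t within A)"
    and d: "\<forall>s\<in>A. \<gamma> s = to_torus (d s)" "(d has_vector_derivative w) (at t within A)"
    using assms(1,2) unfolding has_velocity_def by blast
  define e where "e = (\<lambda>s. c s - d s)"
  have der: "(e has_vector_derivative (v - w)) (at t within A)"
    unfolding e_def using c(2) d(2) by (rule has_vector_derivative_diff)
  have int: "e s $ i \<in> \<int>" if "s \<in> A" for s i
  proof -
    have "to_torus (c s) = to_torus (d s)" using c(1) d(1) that by metis
    then show ?thesis by (simp add: torus.abs_eq_iff e_def)
  qed
  have "continuous (at t within A) e"
    using der by (rule has_vector_derivative_continuous)
  then have "\<forall>\<^sub>F s in at t within A. dist (e s) (e t) < 1"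
    unfolding continuous_within by (rule tendstoD) simp
  then have ev: "\<forall>\<^sub>F s in at t within A. e s = e t"
    unfolding eventually_at_filter
  proof eventually_elim
    case (elim s)
    show ?case
    proof (intro impI)
      assume s: "s \<noteq> t" "s \<in> A"
      show "e s = e t"
      proof (rule vec_eq_iff[THEN iffD2], rule allI)
        fix i
        have small: "\<bar>e s $ i - e t $ i\<bar> < 1"
          using component_le_norm_cart[of "e s - e t" i] elim s by (simp add: dist_norm)
        have "e s $ i - e t $ i \<in> \<int>"
          using int s(2) assms(3) by (intro Ints_diff) auto
        then have "e s $ i - e t $ i = 0"
          using small by (rule Ints_nonzero_abs_less1)
        then show "e s $ i = e t $ i" by simp
      qed
    qed
  qed
  have "((\<lambda>s. e t) has_vector_derivative (v - w)) (at t within A)"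
    unfolding has_vector_derivative_def
    by (rule has_derivative_transform_eventually[OF der[unfolded has_vector_derivative_def] ev])
       (use assms(3) in auto)
  moreover have "((\<lambda>s. e t) has_vector_derivative 0) (at t within A)"
    by (rule has_vector_derivative_const)
  ultimately have "v - w = 0"
    using assms(4) vector_derivative_unique_within by blast
  then show ?thesis by simp
qed

lemma velocity_eq:
  assumes "has_velocity \<gamma> {0..L} t v" "t \<in> {0..L}" "0 < L"
  shows "velocity \<gamma> {0..L} t = v"
  unfolding velocity_def
  using assms by (intro the_equality has_velocity_unique[of \<gamma> "{0..L}" t _ v])
    (auto simp: trivial_limit_within islimpt_Icc)

text \<open>Smoothness on the closed interval, with one-sided derivatives at the endpoints.\<close>

definition smooth_curve :: "real \<Rightarrow> (real \<Rightarrow> torus) \<Rightarrow> bool" where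
  "smooth_curve L \<gamma> \<longleftrightarrow>
     (\<exists>D :: nat \<Rightarrow> real \<Rightarrow> real ^ 2.
        (\<forall>t\<in>{0..L}. has_velocity \<gamma> {0..L} t (D 0 t)) \<and>
        (\<forall>k. \<forall>t\<in>{0..L}. (D k has_vector_derivative D (Suc k) t) (at t within {0..L})))"

definition arc_length_curve :: "real \<Rightarrow> (real \<Rightarrow> torus) \<Rightarrow> bool" where
  "arc_length_curve L \<gamma> \<longleftrightarrow>
     0 < L \<and> smooth_curve L \<gamma> \<and> (\<forall>t\<in>{0..L}. norm (velocity \<gamma> {0..L} t) = 1)"

text \<open>The (unsigned) curvature of a curve parametrized by arc length.\<close>

definition curvature :: "real \<Rightarrow> (real \<Rightarrow> torus) \<Rightarrow> real \<Rightarrow> real" where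
  "curvature L \<gamma> t = norm (vector_derivative (velocity \<gamma> {0..L}) (at t within {0..L}))"


section \<open>Lattice points on circles\<close>

definition sums_of_two_squares :: "nat set" where
  "sums_of_two_squares = {n. \<exists>a b :: int. int n = a\<^sup>2 + b\<^sup>2}"

definition lattice_vec :: "int ^ 2 \<Rightarrow> real ^ 2" where
  "lattice_vec l = (\<chi> i. real_of_int (l $ i))"

definition lattice_points :: "nat \<Rightarrow> (int ^ 2) set" where
  "lattice_points n = {l. (norm (lattice_vec l))\<^sup>2 = real n}"

lemma lattice_vec_uminus: "lattice_vec (- l) = - lattice_vec l"
  by (simp add: lattice_vec_def vec_eq_iff)

lemma uminus_lattice_points_iff: "- l \<in> lattice_points n \<longleftrightarrow> l \<in> lattice_points n"
  by (simp add: lattice_points_def lattice_vec_uminus)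

lemma norm_lattice_vec: "(norm (lattice_vec l))\<^sup>2 = real_of_int ((l $ 1)\<^sup>2 + (l $ 2)\<^sup>2)"
  by (simp add: norm_vec_def L2_set_def lattice_vec_def UNIV_2)

lemma finite_lattice_points: "finite (lattice_points n)"
proof -
  have "lattice_points n \<subseteq> (\<lambda>(a, b). vector [a, b]) ` ({- int n..int n} \<times> {- int n..int n})"
  proof
    fix l assume "l \<in> lattice_points n"
    then have "real_of_int ((l $ 1)\<^sup>2 + (l $ 2)\<^sup>2) = real_of_int (int n)"
      by (simp add: lattice_points_def norm_lattice_vec)
    then have eq: "(l $ 1)\<^sup>2 + (l $ 2)\<^sup>2 = int n" by linarith
    have *: "\<bar>x\<bar> \<le> x\<^sup>2" for x :: int
    proof (cases "x = 0")
      case False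
      then have "\<bar>x\<bar> * 1 \<le> \<bar>x\<bar> * \<bar>x\<bar>" by (intro mult_left_mono) auto
      then show ?thesis by (simp add: power2_eq_square abs_mult_self_eq)
    qed simp
    have "\<bar>l $ 1\<bar> \<le> int n" "\<bar>l $ 2\<bar> \<le> int n"
      using eq *[of "l $ 1"] *[of "l $ 2"] zero_le_power2[of "l $ 1"] zero_le_power2[of "l $ 2"]
      by linarith+
    then show "l \<in> (\<lambda>(a, b). vector [a, b]) ` ({- int n..int n} \<times> {- int n..int n})"
      by (intro image_eqI[of _ _ "(l $ 1, l $ 2)"]) (auto simp: vec_eq_iff forall_2)
  qed
  then show ?thesis by (rule finite_subset) simp
qed

lemma lattice_points_nonempty:
  assumes "n \<in> sums_of_two_squares"
  shows "lattice_points n \<noteq> {}"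
proof -
  obtain a b :: int where "int n = a\<^sup>2 + b\<^sup>2"
    using assms by (auto simp: sums_of_two_squares_def)
  then have "real_of_int (a\<^sup>2 + b\<^sup>2) = real n"
    by (metis of_int_of_nat_eq)
  then have "vector [a, b] \<in> lattice_points n"
    by (simp add: lattice_points_def norm_lattice_vec)
  then show ?thesis by blast
qed

text \<open>
  The measure \<open>\<mu>\<^sub>n\<close> on the unit circle: the image of the normalized counting measure on
  \<open>lattice_points n\<close> under \<open>l \<mapsto> l / \<surd>n\<close>.
\<close>

definition spectral_measure :: "nat \<Rightarrow> (real ^ 2) measure" where
  "spectral_measure n =
     distr (uniform_count_measure (lattice_points n)) (restrict_space borel (sphere 0 1))
       (\<lambda>l. lattice_vec l /\<^sub>R sqrt (real n))"

lemma measurable_lattice_direction: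
  assumes "1 \<le> n"
  shows "(\<lambda>l. lattice_vec l /\<^sub>R sqrt (real n)) \<in>
    measurable (uniform_count_measure (lattice_points n)) (restrict_space borel (sphere 0 1))"
proof -
  have "norm (lattice_vec l) = sqrt (real n)" if "l \<in> lattice_points n" for l
    using that by (simp add: lattice_points_def real_sqrt_unique)
  then show ?thesis
    using assms
    by (intro measurable_restrict_space2) (auto simp: uniform_count_measure_def point_measure_def)
qed

lemma prob_space_spectral_measure:
  assumes "1 \<le> n" "n \<in> sums_of_two_squares"
  shows "prob_space (spectral_measure n)"
  unfolding spectral_measure_def
  by (intro prob_space.prob_space_distr prob_space_uniform_count_measure
      measurable_lattice_direction finite_lattice_points lattice_points_nonempty assms)

lemma emeasure_spectral_measure:
  assumes "1 \<le> n" "A \<in> sets (restrict_space borel (sphere 0 1))"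
  shows "emeasure (spectral_measure n) A =
    ennreal (card {l \<in> lattice_points n. lattice_vec l /\<^sub>R sqrt (real n) \<in> A}
      / card (lattice_points n))"
proof -
  have "(\<lambda>l. lattice_vec l /\<^sub>R sqrt (real n)) -` A \<inter> lattice_points n
      = {l \<in> lattice_points n. lattice_vec l /\<^sub>R sqrt (real n) \<in> A}"
    by auto
  then show ?thesis
    unfolding spectral_measure_def
    by (subst emeasure_distr[OF measurable_lattice_direction[OF assms(1)] assms(2)])
       (simp add: space_uniform_count_measure emeasure_uniform_count_measure finite_lattice_points
         measure_uniform_count_measure)
qed

definition B_functional :: "real \<Rightarrow> (real \<Rightarrow> torus) \<Rightarrow> (real ^ 2) measure \<Rightarrow> real" where
  "B_functional L \<gamma> \<mu> =
     (LBINT t1:{0..L}. LBINT t2:{0..L}. LINT \<theta>|\<mu>.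
        (\<theta> \<bullet> velocity \<gamma> {0..L} t1)\<^sup>2 * (\<theta> \<bullet> velocity \<gamma> {0..L} t2)\<^sup>2)"


section \<open>Arithmetic random waves\<close>

text \<open>
  Standard complex Gaussian coefficients indexed by a symmetric set \<open>\<Lambda>\<close> not containing the
  origin, independent except for the reality constraint: independence is required on every subset
  that contains no pair of opposite points. Note that the second parameter of
  \<open>normal_density\<close> is the standard deviation, so the variances are \<open>1 / 2\<close>.
\<close>

definition gaussian_coefficients ::
    "'w measure \<Rightarrow> (int ^ 2) set \<Rightarrow> (int ^ 2 \<Rightarrow> 'w \<Rightarrow> complex) \<Rightarrow> bool" where
  "gaussian_coefficients M \<Lambda> a \<longleftrightarrow>
     (\<forall>l\<in>\<Lambda>.
        distributed M lborel (\<lambda>w. Re (a l w)) (\<lambda>x. ennreal (normal_density 0 (sqrt (1 / 2)) x)) \<and>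
        distributed M lborel (\<lambda>w. Im (a l w)) (\<lambda>x. ennreal (normal_density 0 (sqrt (1 / 2)) x)) \<and>
        prob_space.indep_var M borel (\<lambda>w. Re (a l w)) borel (\<lambda>w. Im (a l w))) \<and>
     (\<forall>l\<in>\<Lambda>. \<forall>w\<in>space M. a (- l) w = cnj (a l w)) \<and>
     (\<forall>H\<subseteq>\<Lambda>. (\<forall>l\<in>H. - l \<notin> H) \<longrightarrow> prob_space.indep_vars M (\<lambda>_. borel) a H)"

lift_definition random_wave ::
    "(int ^ 2 \<Rightarrow> 'w \<Rightarrow> complex) \<Rightarrow> nat \<Rightarrow> 'w \<Rightarrow> torus \<Rightarrow> complex" is
  "\<lambda>a n w x. (\<Sum>l\<in>lattice_points n. a l w * exp (2 * of_real pi * \<i> * of_real (lattice_vec l \<bullet> x)))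
     / of_real (sqrt (real (card (lattice_points n))))"
proof -
  fix a :: "int ^ 2 \<Rightarrow> 'w \<Rightarrow> complex" and n w and x y :: "real ^ 2"
  assume xy: "\<And>i. x $ i - y $ i \<in> \<int>"
  have "exp (2 * of_real pi * \<i> * of_real (lattice_vec l \<bullet> x)) =
        exp (2 * of_real pi * \<i> * of_real (lattice_vec l \<bullet> y))" for l
  proof -
    have "lattice_vec l \<bullet> x - lattice_vec l \<bullet> y =
        (\<Sum>i\<in>UNIV. real_of_int (l $ i) * (x $ i - y $ i))"
      by (simp add: inner_vec_def lattice_vec_def right_diff_distrib sum_subtractf)
    also have "\<dots> \<in> \<int>"
      using xy by (intro Ints_sum Ints_mult) auto
    finally obtain m where "lattice_vec l \<bullet> x - lattice_vec l \<bullet> y = of_int m"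
      by (auto elim: Ints_cases)
    then have "lattice_vec l \<bullet> x = lattice_vec l \<bullet> y + of_int m" by simp
    then have "2 * of_real pi * \<i> * of_real (lattice_vec l \<bullet> x) =
        2 * of_real pi * \<i> * complex_of_real (lattice_vec l \<bullet> y) + of_int (2 * m) * pi * \<i>"
      by (simp add: algebra_simps)
    then show ?thesis
      unfolding exp_eq by blast
  qed
  then show "(\<Sum>l\<in>lattice_points n. a l w * exp (2 * of_real pi * \<i> * of_real (lattice_vec l \<bullet> x)))
     / of_real (sqrt (real (card (lattice_points n)))) =
    (\<Sum>l\<in>lattice_points n. a l w * exp (2 * of_real pi * \<i> * of_real (lattice_vec l \<bullet> y)))
     / of_real (sqrt (real (card (lattice_points n))))"
    by simp
qed

lemma random_wave_real:
  assumes "gaussian_coefficients M (lattice_points n) a" "w \<in> space M"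
  shows "random_wave a n w x \<in> \<real>"
proof -
  define y where "y = rep_torus x"
  let ?f = "\<lambda>l. a l w * exp (2 * of_real pi * \<i> * of_real (lattice_vec l \<bullet> y))"
  have cnj_f: "cnj (?f l) = ?f (- l)" if "l \<in> lattice_points n" for l
    using assms that
    by (simp add: gaussian_coefficients_def exp_cnj lattice_vec_uminus)
  have "cnj (\<Sum>l\<in>lattice_points n. ?f l) = (\<Sum>l\<in>lattice_points n. ?f (- l))"
    unfolding cnj_sum by (intro sum.cong refl cnj_f)
  also have "\<dots> = (\<Sum>l\<in>lattice_points n. ?f l)"
    by (rule sum.reindex_bij_witness[of _ uminus uminus]) (auto simp: uminus_lattice_points_iff)
  finally have "(\<Sum>l\<in>lattice_points n. ?f l) \<in> \<real>"
    by (simp add: Reals_cnj_iff)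
  moreover have "x = to_torus y"
    unfolding y_def by (rule Quotient3_abs_rep[OF Quotient3_torus, symmetric])
  ultimately show ?thesis
    by (simp add: random_wave.abs_eq)
qed

text \<open>
  The cardinality of an infinite set is \<open>0\<close> by convention; this concerns only a null event.
\<close>

definition nodal_intersections ::
    "(int ^ 2 \<Rightarrow> 'w \<Rightarrow> complex) \<Rightarrow> real \<Rightarrow> (real \<Rightarrow> torus) \<Rightarrow> nat \<Rightarrow> 'w \<Rightarrow> real" where
  "nodal_intersections a L \<gamma> n w = real (card {t \<in> {0..L}. random_wave a n w (\<gamma> t) = 0})"

end

(*
  Let S = (sqrt(n/2) / N) * sum over l of (|a_l|^2 - 1) c_l, where N is the number of lattice points
  and c_l is the integral of 2 <l/|l|, gamma'>^2 - 1 along the curve; the mean of the c_l^2 is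
  4 B(mu_n) - L^2. The zero count Z of the wave is the almost sure limit of the number of sign
  changes on finer and finer grids. Elementary Gaussian estimates for one and two sign changes give
  E Z, the exact covariance of Z with every |a_l|^2, hence Cov(Z, S) = Var S, and an upper bound for
  Var Z of Kac-Rice type: its leading term is Var S, the error is a quartic form in the covariances of
  the wave and its derivative. This form is o(n/N), because oscillatory integrals along a curve
  without inflection decay and few pairs or quadruples of lattice points have a small sum. Therefore
  E (Z - E Z - S)^2 = Var Z - Var S = o(n/N), while Var S is of order n/N, and S is a sum of
  independent terms, to which the classical central limit argument applies.
*)
theory Submission
 imports Defs "HOL-Real_Asymp.Real_Asymp"
begin

abbreviation (input) "LP \<equiv> lattice_points"

section \<open>Gaussian spaces\<close>

text \<open>After normalisation the weight is a density of a new probability measure. The hypothesis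
  says that \<open>G\<close> has the same characteristic function under both measures, hence the
  same law. A weight of mean zero vanishes almost surely and is treated apart.\<close>

lemma (in prob_space) expectation_bounded_weight:
 fixes W G :: "'a \<Rightarrow> real"
 assumes W[measurable]: "W \<in> borel_measurable M" and G[measurable]: "G \<in> borel_measurable M"
  and W0: "\<And>w. 0 \<le> W w" and W2: "\<And>w. W w \<le> b"
  and cf: "\<And>s x. expectation (\<lambda>w. W w * cos (s * G w + x)) = expectation W * expectation (\<lambda>w. cos (s * G w + x))"
  and A[measurable]: "A \<in> sets borel"
 shows "expectation (\<lambda>w. W w * indicator A (G w)) = expectation W * expectation (\<lambda>w. indicator A (G w))"
proof -
 have intW: "integrable M W"
  by (rule integrable_const_bound[of _ b]) (auto simp: W0 W2)
 show ?thesis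
 proof (cases "expectation W = 0")
  case True
  hence "AE w in M. W w = 0"
   using integral_nonneg_eq_0_iff_AE[OF intW] W0 by auto
  hence "expectation (\<lambda>w. W w * indicator A (G w)) = expectation (\<lambda>w. 0)"
   by (intro integral_cong_AE) auto
  thus ?thesis using True by simp
 next
  case False
  define e where "e = expectation W"
  have e: "0 < e" using False W0 by (simp add: e_def order_less_le integral_nonneg_AE)
  define P where "P = density M (\<lambda>w. ennreal (W w / e))"
  have mP[simp]: "measurable P N = measurable M N" for N
   by (simp add: P_def measurable_def)
  have dens: "integral\<^sup>L P f = (\<integral>w. W w * f w \<partial>M) / e" if "f \<in> borel_measurable M" for f :: "'a \<Rightarrow> real"
   unfolding P_def using e W0 that by (subst integral_density) auto
  have "emeasure P (space P) = (\<integral>\<^sup>+w. ennreal (W w / e) \<partial>M)"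
   unfolding P_def by (subst emeasure_density) (auto intro!: nn_integral_cong)
  also have "... = ennreal (\<integral>w. W w / e \<partial>M)" using intW W0 e by (intro nn_integral_eq_integral) auto
  also have "(\<integral>w. W w / e \<partial>M) = 1" using e by (simp add: e_def)
  finally interpret P: prob_space P by (intro prob_spaceI) simp
  have ch: "char (distr Q borel G) s = Complex (\<integral>w. cos (s * G w + 0) \<partial>Q) (\<integral>w. cos (s * G w + (- pi / 2)) \<partial>Q)"
   if "prob_space Q" and [measurable]: "G \<in> borel_measurable Q" for Q s
  proof -
   interpret Q: prob_space Q by fact
   have i: "integrable Q (\<lambda>w. iexp (s * G w))" by (rule Q.integrable_const_bound[of _ 1]) auto
   have "char (distr Q borel G) s = (CLINT w|Q. iexp (s * G w))"
    unfolding char_def by (subst integral_distr) auto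
   thus ?thesis
    using integral_Re[OF i, symmetric] integral_Im[OF i, symmetric] 
    by (simp add: complex_eq_iff Re_exp Im_exp cos_diff)
  qed
  \<comment> \<open>The phases \<open>0\<close> and \<open>- pi / 2\<close> give the real and the
    imaginary part of the characteristic function.\<close>
  have "distr P borel G = distr M borel G"
   by (intro Levy_uniqueness P.real_distribution_distr real_distribution_distr ext)
    (use e cf[of _ 0] cf[of _ "- pi / 2"] in \<open>auto simp: ch prob_space_axioms P.prob_space_axioms dens e_def\<close>)
  hence "(\<integral>x. indicat_real A x \<partial>distr P borel G) = (\<integral>x. indicator A x \<partial>distr M borel G)" by simp
  hence "(\<integral>w. indicat_real A (G w) \<partial>P) = (\<integral>w. indicator A (G w) \<partial>M)"
   by (subst (asm) (1 2) integral_distr) auto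
  thus ?thesis using e by (subst (asm) dens) (auto simp: e_def field_simps)
 qed
qed

text \<open>A Gaussian space described by characteristic functions alone: since \<open>H\<close> is
  closed under linear combinations, the value at 1 for every member determines all joint laws.
  Members of variance zero are allowed, so differences and projections never leave the
  space.\<close>

locale gauss_space = prob_space M for M :: "'w measure" +
 fixes H :: "('w \<Rightarrow> real) set"
 assumes H_meas: "X \<in> H \<Longrightarrow> X \<in> borel_measurable M"
  and H_sq: "X \<in> H \<Longrightarrow> integrable M (\<lambda>w. (X w)^2)"
  and H_add: "X \<in> H \<Longrightarrow> Y \<in> H \<Longrightarrow> (\<lambda>w. X w + Y w) \<in> H"
  and H_scale: "X \<in> H \<Longrightarrow> (\<lambda>w. c * X w) \<in> H"
  and H_cf: "X \<in> H \<Longrightarrow>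
   (CLINT w|M. iexp (X w)) = complex_of_real (exp (- expectation (\<lambda>w. (X w)^2) / 2))"
begin

definition ip :: "('w \<Rightarrow> real) \<Rightarrow> ('w \<Rightarrow> real) \<Rightarrow> real" where
 "ip X Y = expectation (\<lambda>w. X w * Y w)"

lemma H_diff: "X \<in> H \<Longrightarrow> Y \<in> H \<Longrightarrow> (\<lambda>w. X w - Y w) \<in> H"
 using H_add[OF _ H_scale[of Y "-1"], of X] by simp

lemma H_uminus: "X \<in> H \<Longrightarrow> (\<lambda>w. - X w) \<in> H"
 using H_scale[of X "-1"] by simp

lemma H_divide: "X \<in> H \<Longrightarrow> (\<lambda>w. X w / c) \<in> H"
 using H_scale[of X "inverse c"] by (simp add: field_simps)

lemmas H_intros = H_add H_diff H_scale H_uminus H_divide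

lemma H_int: "X \<in> H \<Longrightarrow> integrable M X"
 by (rule square_integrable_imp_integrable[OF H_meas H_sq])

lemma H_int_mult: 
 assumes "X \<in> H" "Y \<in> H" shows "integrable M (\<lambda>w. X w * Y w)"
proof (rule Bochner_Integration.integrable_bound)
 show "integrable M (\<lambda>w. (X w)^2 + (Y w)^2)" using H_sq assms by auto
 have "\<bar>X w * Y w\<bar> \<le> \<bar>(X w)\<^sup>2 + (Y w)^2\<bar>" for w
  using sum_squares_bound[of "\<bar>X w\<bar>" "\<bar>Y w\<bar>"] mult_nonneg_nonneg[of "\<bar>X w\<bar>" "\<bar>Y w\<bar>"]
  unfolding abs_mult power2_abs by linarith
 thus "AE x in M. norm (X x * Y x) \<le> norm ((X x)^2 + (Y x)^2)" by auto
qed (use H_meas assms in auto)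

lemma ip_commute: "ip X Y = ip Y X"
 by (simp add: ip_def mult.commute)

lemma ip_self: "ip X X = expectation (\<lambda>w. (X w)^2)"
 by (simp add: ip_def power2_eq_square)

lemma ip_self_nonneg: "0 \<le> ip X X"
 by (simp add: ip_self)

lemma ip_add_left: "X \<in> H \<Longrightarrow> Y \<in> H \<Longrightarrow> Z \<in> H \<Longrightarrow> ip (\<lambda>w. X w + Y w) Z = ip X Z + ip Y Z"
 unfolding ip_def by (simp add: distrib_right H_int_mult)

lemma ip_diff_left: "X \<in> H \<Longrightarrow> Y \<in> H \<Longrightarrow> Z \<in> H \<Longrightarrow> ip (\<lambda>w. X w - Y w) Z = ip X Z - ip Y Z"
 unfolding ip_def by (simp add: left_diff_distrib H_int_mult)

lemma ip_scale_left: "ip (\<lambda>w. c * X w) Z = c * ip X Z"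
 unfolding ip_def by (simp add: mult.assoc)

lemma ip_divide_left: "ip (\<lambda>w. X w / c) Z = ip X Z / c"
 unfolding ip_def by simp

lemma ip_add_right: "X \<in> H \<Longrightarrow> Y \<in> H \<Longrightarrow> Z \<in> H \<Longrightarrow> ip Z (\<lambda>w. X w + Y w) = ip Z X + ip Z Y"
 by (simp add: ip_commute[of Z] ip_add_left)

lemma ip_diff_right: "X \<in> H \<Longrightarrow> Y \<in> H \<Longrightarrow> Z \<in> H \<Longrightarrow> ip Z (\<lambda>w. X w - Y w) = ip Z X - ip Z Y"
 by (simp add: ip_commute[of Z] ip_diff_left)

lemma ip_scale_right: "ip Z (\<lambda>w. c * X w) = c * ip Z X"
 by (simp add: ip_commute[of Z] ip_scale_left)

lemma ip_divide_right: "ip Z (\<lambda>w. X w / c) = ip Z X / c"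
 by (simp add: ip_commute[of Z] ip_divide_left)

lemmas ip_linear = ip_add_left ip_diff_left ip_scale_left ip_divide_left
 ip_add_right ip_diff_right ip_scale_right ip_divide_right

definition nrm :: "('w \<Rightarrow> real) \<Rightarrow> real" where "nrm X = sqrt (ip X X)"

lemma nrm_nonneg [simp]: "0 \<le> nrm X" by (simp add: nrm_def ip_self_nonneg)

lemma nrm_sq: "(nrm X)^2 = ip X X" by (simp add: nrm_def ip_self_nonneg)

lemma expectation_abs_mult_le:
 assumes "X \<in> H" "Y \<in> H" shows "expectation (\<lambda>w. \<bar>X w * Y w\<bar>) \<le> nrm X * nrm Y"
proof -
 have "(ennreal (expectation (\<lambda>w. \<bar>X w * Y w\<bar>)))^2 = (\<integral>\<^sup>+w. ennreal \<bar>X w\<bar> * ennreal \<bar>Y w\<bar> \<partial>M)^2"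
  using integrable_abs[OF H_int_mult[OF assms]]
  by (subst nn_integral_eq_integral[symmetric]) (auto simp: abs_mult ennreal_mult)
 also have "... \<le> (\<integral>\<^sup>+w. (ennreal \<bar>X w\<bar>)\<^sup>2 \<partial>M) * (\<integral>\<^sup>+w. (ennreal \<bar>Y w\<bar>)\<^sup>2 \<partial>M)"
  using H_meas assms by (intro Cauchy_Schwarz_nn_integral) auto
 also have "... = ennreal ((nrm X * nrm Y)^2)"
  using H_sq assms by (simp add: ennreal_power nn_integral_eq_integral power_mult_distrib nrm_sq ip_self ennreal_mult)
 finally show ?thesis by (simp add: ennreal_power power_mono_iff)
qed

lemma ip_le_nrm: assumes "X \<in> H" "Y \<in> H" shows "\<bar>ip X Y\<bar> \<le> nrm X * nrm Y"
 using order_trans[OF integral_abs_bound expectation_abs_mult_le[OF assms]] by (simp add: ip_def)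

lemma ip_cauchy: assumes "X \<in> H" "Y \<in> H" shows "(ip X Y)^2 \<le> ip X X * ip Y Y"
 using power_mono[OF ip_le_nrm[OF assms] abs_ge_zero, of 2] by (simp add: power_mult_distrib nrm_sq)

lemma nrm_add: assumes "X \<in> H" "Y \<in> H" shows "nrm (\<lambda>w. X w + Y w) \<le> nrm X + nrm Y"
proof -
 have "(nrm (\<lambda>w. X w + Y w))^2 = ip X X + 2 * ip X Y + ip Y Y"
  using assms by (simp add: nrm_sq ip_linear H_intros ip_commute[of Y X])
 also have "... \<le> (nrm X + nrm Y)^2"
  using ip_le_nrm[OF assms] by (simp add: power2_sum nrm_sq)
 finally show ?thesis by (rule power2_le_imp_le) simp
qed

lemma nrm_scale: "nrm (\<lambda>w. c * X w) = \<bar>c\<bar> * nrm X"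
 by (simp add: nrm_def ip_linear real_sqrt_mult mult.assoc[symmetric])

lemma nrm_minus: "nrm (\<lambda>w. - X w) = nrm X"
 using nrm_scale[of "-1" X] by simp

lemma nrm_diff: assumes "X \<in> H" "Y \<in> H" shows "nrm (\<lambda>w. X w - Y w) \<le> nrm X + nrm Y"
 using nrm_add[OF assms(1) H_uminus[OF assms(2)]] by (simp add: nrm_minus)

lemma expectation_cos:
 assumes X: "X \<in> H" shows "expectation (\<lambda>w. cos (X w + x)) = cos x * exp (- ip X X / 2)"
proof -
 have [measurable]: "X \<in> borel_measurable M" using X H_meas by simp
 have i: "integrable M (\<lambda>w. iexp (X w))" by (rule integrable_const_bound[of _ 1]) auto
 have "expectation (\<lambda>w. cos (X w)) = exp (- ip X X / 2)" "expectation (\<lambda>w. sin (X w)) = 0"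
  using integral_Re[OF i] integral_Im[OF i] H_cf[OF X] by (simp_all add: ip_self Re_exp Im_exp)
 moreover have "integrable M (\<lambda>w. cos (X w))" "integrable M (\<lambda>w. sin (X w))"
  using integrable_Re[OF i] integrable_Im[OF i] by (simp_all add: Re_exp Im_exp)
 ultimately show ?thesis by (simp add: cos_add)
qed

text \<open>Independence from the part of \<open>H\<close> orthogonal to \<open>K\<close>, in a form that can be tested by
 one-dimensional characteristic functions only.\<close>

definition free_weight :: "('w \<Rightarrow> real) set \<Rightarrow> ('w \<Rightarrow> real) \<Rightarrow> bool" where
 "free_weight K Y \<longleftrightarrow> Y \<in> borel_measurable M \<and> (\<forall>w. 0 \<le> Y w \<and> Y w \<le> 1) \<and>
  (\<forall>X\<in>H. (\<forall>Z\<in>K. ip X Z = 0) \<longrightarrow> (\<forall>x. expectation (\<lambda>w. Y w * cos (X w + x)) = expectation Y * (cos x * exp (- ip X X / 2))))"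

text \<open>The weight \<open>Y * (1 + cos (X + y))\<close> is again nonnegative and bounded, so the
  criterion \<open>expectation_bounded_weight\<close> applies to it. The product formulas turn its
  cosines into cosines of \<open>X + s * G\<close> and \<open>X - s * G\<close>, which are
  orthogonal to \<open>K\<close> and have the same variance.\<close>

lemma free_weight_step:
 assumes Y: "free_weight K Y" and K: "K \<subseteq> H" and G: "G \<in> H" "\<And>Z. Z \<in> K \<Longrightarrow> ip G Z = 0"
  and A[measurable]: "A \<in> sets borel"
 shows "expectation (\<lambda>w. Y w * indicator A (G w)) = expectation Y * expectation (\<lambda>w. indicator A (G w))"
  and "free_weight (insert G K) (\<lambda>w. Y w * indicator A (G w))"
proof -
 let ?p = "expectation (\<lambda>w. indicator A (G w))"
 have [measurable]: "Y \<in> borel_measurable M" "G \<in> borel_measurable M" using Y G H_meas by (auto simp: free_weight_def)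
 have Y01: "0 \<le> Y w" "Y w \<le> 1" for w using Y by (auto simp: free_weight_def)
 have YX: "expectation (\<lambda>w. Y w * cos (X w + x)) = expectation Y * (cos x * exp (- ip X X / 2))"
  if "X \<in> H" "\<And>Z. Z \<in> K \<Longrightarrow> ip X Z = 0" for X x
  using Y that by (auto simp: free_weight_def)
 have b: "\<bar>Y w * c\<bar> \<le> 1" if "\<bar>c\<bar> \<le> 1" for w c
  using mult_mono[of "Y w" 1 "\<bar>c\<bar>" 1] Y01[of w] that by (simp add: abs_mult)
 have i: "integrable M (\<lambda>w. Y w * g w)" if "g \<in> borel_measurable M" "\<And>w. \<bar>g w\<bar> \<le> 1" for g :: "'w \<Rightarrow> real"
  by (rule integrable_const_bound[of _ 1]) (use that b in auto)
 have iY: "integrable M Y" using i[of "\<lambda>_. 1"] by simp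
 have w: "expectation (\<lambda>w. Y w * indicator A (G w)) + expectation (\<lambda>w. Y w * indicator A (G w) * cos (X w + y)) =
   expectation Y * (1 + cos y * exp (- ip X X / 2)) * ?p"
  if X: "X \<in> H" "\<And>Z. Z \<in> insert G K \<Longrightarrow> ip X Z = 0" for X y
 proof -
  have [measurable]: "X \<in> borel_measurable M" using X H_meas by simp
  have o: "ip X G = 0" "ip G X = 0" "\<And>Z. Z \<in> K \<Longrightarrow> ip X Z = 0" using X(2) ip_commute by auto
  let ?W = "\<lambda>w. Y w * (1 + cos (X w + y))"
  have EW: "expectation ?W = expectation Y * (1 + cos y * exp (- ip X X / 2))"
   using iY i[of "\<lambda>w. cos (X w + y)"] YX[OF X(1) o(3)] by (simp add: distrib_left)
  have "expectation (\<lambda>w. ?W w * indicator A (G w)) = expectation ?W * ?p"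
  proof (rule expectation_bounded_weight[of _ _ 2])
   fix s x
   have HG: "(\<lambda>w. s * G w) \<in> H" "(\<lambda>w. X w + s * G w) \<in> H" "(\<lambda>w. X w - s * G w) \<in> H"
    using G X by (auto simp: H_intros)
   have K0: "ip (\<lambda>w. s * G w) Z = 0" "ip (\<lambda>w. X w + s * G w) Z = 0" "ip (\<lambda>w. X w - s * G w) Z = 0" if "Z \<in> K" for Z
    using that K G X o by (auto simp: ip_linear H_intros subset_iff)
   have v: "ip (\<lambda>w. X w + s * G w) (\<lambda>w. X w + s * G w) = ip X X + s * s * ip G G"
    "ip (\<lambda>w. X w - s * G w) (\<lambda>w. X w - s * G w) = ip X X + s * s * ip G G"
    using G X o by (simp_all add: ip_linear H_intros)
   have "?W w * cos (s * G w + x) = Y w * cos (s * G w + x) + (1/2) * (Y w * cos (X w + s * G w + (y + x)))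
     + (1/2) * (Y w * cos (X w - s * G w + (y - x)))" for w
   proof -
    have "X w + s * G w + (y + x) = (X w + y) + (s * G w + x)" "X w - s * G w + (y - x) = (X w + y) - (s * G w + x)" by auto
    thus ?thesis by (simp only: cos_add[of "X w + y"] cos_diff[of "X w + y"]) (simp add: field_simps)
   qed
   hence "expectation (\<lambda>w. ?W w * cos (s * G w + x)) = expectation Y * (cos x * exp (- (s * s * ip G G) / 2)) +
     (1/2) * (expectation Y * (cos (y + x) * exp (- (ip X X + s * s * ip G G) / 2))) + 
     (1/2) * (expectation Y * (cos (y - x) * exp (- (ip X X + s * s * ip G G) / 2)))"
    using i by (simp add: YX[OF HG(1) K0(1)] YX[OF HG(2) K0(2)] YX[OF HG(3) K0(3)] v ip_scale_left ip_scale_right mult.assoc)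
   also have "... = expectation ?W * (cos x * exp (- (s * s * ip G G) / 2))"
    unfolding EW cos_add[of y x] cos_diff[of y x]
    by (simp add: exp_add[symmetric] add_divide_distrib diff_divide_distrib algebra_simps)
   also have "cos x * exp (- (s * s * ip G G) / 2) = expectation (\<lambda>w. cos (s * G w + x))"
    using expectation_cos[OF HG(1)] by (simp add: ip_linear mult.assoc)
   finally show "expectation (\<lambda>w. ?W w * cos (s * G w + x)) = expectation ?W * expectation (\<lambda>w. cos (s * G w + x))" .
  next
   fix w have "0 \<le> 1 + cos (X w + y)" using cos_ge_minus_one[of "X w + y"] by linarith
   thus "0 \<le> ?W w" using Y01 by simp
   show "?W w \<le> 2" using mult_mono[of "Y w" 1 "1 + cos (X w + y)" 2] Y01[of w] cos_ge_minus_one[of "X w + y"] by simp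
  qed auto
  moreover have "integrable M (\<lambda>w. Y w * indicator A (G w))" "integrable M (\<lambda>w. Y w * (indicator A (G w) * cos (X w + y)))"
   by (intro i; auto simp: indicator_def)+
  ultimately show ?thesis unfolding EW by (simp add: algebra_simps)
 qed
 \<comment> \<open>The zero vector with phase \<open>pi / 2\<close> makes the cosine vanish, which
   isolates the plain indicator; subtracting it from the general case leaves the cosine
   term.\<close>
 have "(\<lambda>w. 0 * G w) \<in> H" using G by (simp only: H_scale)
 from w[OF this, of "pi / 2"] show 1: "expectation (\<lambda>w. Y w * indicator A (G w)) = expectation Y * ?p"
  by (simp add: ip_def)
 show "free_weight (insert G K) (\<lambda>w. Y w * indicator A (G w))"
  unfolding free_weight_def
 proof (intro conjI ballI impI allI)
  fix X x assume X: "X \<in> H" "\<forall>Z\<in>insert G K. ip X Z = 0"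
  show "expectation (\<lambda>w. Y w * indicator A (G w) * cos (X w + x)) =
    expectation (\<lambda>w. Y w * indicator A (G w)) * (cos x * exp (- ip X X / 2))"
   using w[OF X(1) bspec[OF X(2)], of x] unfolding 1 by (simp add: algebra_simps)
 qed (use Y01 in \<open>auto simp: indicator_def\<close>)
qed

text \<open>Induction on the set: the empty product is a free weight, and each further variable is
  orthogonal to the previous ones, so its indicator splits off as a factor and the product remains a
  free weight.\<close>

lemma orthogonal_indep_vars:
 assumes K: "finite K" "K \<noteq> {}" "K \<subseteq> H" and o: "pairwise (\<lambda>X Y. ip X Y = 0) K"
 shows "indep_vars (\<lambda>_. borel) (\<lambda>X. X) K"
proof -
 have m: "X \<in> borel_measurable M" if "X \<in> K" for X using that K H_meas by auto
 have ind: "expectation (\<lambda>w. \<Prod>X\<in>J. indicat_real (A X) (X w)) = (\<Prod>X\<in>J. expectation (\<lambda>w. indicat_real (A X) (X w))) \<and>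
   free_weight J (\<lambda>w. \<Prod>X\<in>J. indicator (A X) (X w))"
  if A: "A \<in> K \<rightarrow> sets borel" and "finite J" "J \<subseteq> K" for A J
  using that(2,3)
 proof induction
  case empty
  show ?case using expectation_cos by (simp add: free_weight_def prob_space)
 next
  case (insert G J)
  have o': "ip G Z = 0" if "Z \<in> J" for Z using o insert.hyps insert.prems that by (intro pairwiseD[OF o]) auto
  have *: "free_weight J (\<lambda>w. \<Prod>X\<in>J. indicator (A X) (X w))" "J \<subseteq> H" "G \<in> H" "A G \<in> sets borel"
   using insert K A by auto
  show ?case
   using free_weight_step[OF *(1-3) o' *(4)] insert by (simp add: mult.commute)
 qed
 have p: "prob {w \<in> space M. P w} = expectation (\<lambda>w. of_bool (P w))" if "{w \<in> space M. P w} \<in> events" for P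
 proof -
  have "expectation (\<lambda>w. of_bool (P w)) = expectation (indicat_real {w \<in> space M. P w})"
   by (intro Bochner_Integration.integral_cong) (auto simp: indicator_def)
  thus ?thesis using that by simp
 qed
 show ?thesis
 proof (subst indep_vars_finite[where E="\<lambda>_. sets borel"], goal_cases)
  case 8
  show ?case
  proof
   fix A assume A: "A \<in> K \<rightarrow> sets (borel :: real measure)"
   have e: "X -` A X \<inter> space M \<in> events" if "X \<in> K" for X
    using that A m by (intro measurable_sets[OF m]) auto
   have "(\<Inter>X\<in>K. X -` A X \<inter> space M) = {w \<in> space M. \<forall>X\<in>K. X w \<in> A X}" using K by auto
   moreover have "(\<Inter>X\<in>K. X -` A X \<inter> space M) \<in> events" using K e by (intro sets.finite_INT) auto
   moreover have "of_bool (\<forall>X\<in>K. X w \<in> A X) = (\<Prod>X\<in>K. indicat_real (A X) (X w))" for w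
    using K(1) by (induction) (auto simp: indicator_def)
   moreover have "X -` A X \<inter> space M = {w \<in> space M. X w \<in> A X}" for X :: "'w \<Rightarrow> real" by auto
   ultimately show "prob (\<Inter>X\<in>K. X -` A X \<inter> space M) = (\<Prod>X\<in>K. prob (X -` A X \<inter> space M))"
    using ind[OF A K(1)] e by (simp add: p indicator_def cong: prod.cong)
  qed
 qed (use K m in \<open>auto simp: Int_stable_def sets.sigma_sets_eq[of borel, simplified]\<close>)
qed

lemma orthogonal_indep_var:
 assumes K: "finite K" "insert G K \<subseteq> H" "pairwise (\<lambda>X Y. ip X Y = 0) (insert G K)" "G \<notin> K"
  and h: "h \<in> borel_measurable (PiM K (\<lambda>_. borel))" and g: "g \<in> borel_measurable borel"
 shows "indep_var borel (\<lambda>w. h (\<lambda>X\<in>K. X w)) borel (\<lambda>w. g (G w))"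
proof -
 have "indep_vars (\<lambda>_. borel) (\<lambda>X. X) (insert G K)" using K by (intro orthogonal_indep_vars) auto
 hence "indep_var (PiM K (\<lambda>_. borel)) (\<lambda>w. \<lambda>X\<in>K. X w) (PiM {G} (\<lambda>_. borel)) (\<lambda>w. \<lambda>X\<in>{G}. X w)"
  by (rule indep_var_restrict) (use K in auto)
 from indep_var_compose[OF this h, of "\<lambda>z. g (z G)" borel] show ?thesis using g by (simp add: comp_def)
qed

lemma distr_unit_normal:
 assumes "X \<in> H" "ip X X = 1" shows "distr M borel X = std_normal_distribution"
proof (rule Levy_uniqueness)
 have [measurable]: "X \<in> borel_measurable M" using H_meas assms by simp
 show "real_distribution (distr M borel X)" by (rule real_distribution_distr) simp
 show "real_distribution std_normal_distribution" by (rule real_dist_normal_dist)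
 have "char (distr M borel X) s = char std_normal_distribution s" for s
 proof -
  have "char (distr M borel X) s = (CLINT w|M. iexp (s * X w))"
   unfolding char_def by (subst integral_distr) auto
  thus ?thesis
   using H_cf[OF H_scale[OF assms(1), of s]] assms(2)
   by (simp add: ip_self char_std_normal_distribution power_mult_distrib exp_of_real)
 qed
 thus "char (distr M borel X) = char std_normal_distribution" by auto
qed

lemma nn_integral_orthogonal:
 assumes K: "finite K" "insert G K \<subseteq> H" "pairwise (\<lambda>X Y. ip X Y = 0) (insert G K)" and G: "ip G G = 1" "G \<notin> K"
  and F[measurable]: "(\<lambda>z. F (h z, z G)) \<in> borel_measurable (PiM (insert G K) (\<lambda>_. borel))"
  and h: "\<And>z x. h (z(G := x)) = h z" and V: "\<And>w. V w = h (\<lambda>X\<in>insert G K. X w)"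
 shows "(\<integral>\<^sup>+w. F (V w, G w) \<partial>M) = (\<integral>\<^sup>+w. (\<integral>\<^sup>+x. F (V w, x) * ennreal (std_normal_density x) \<partial>lborel) \<partial>M)"
proof -
 let ?J = "insert G K"
 have m: "X \<in> borel_measurable M" if "X \<in> ?J" for X using that K H_meas by auto
 \<comment> \<open>Outside the finite index set any probability law will do; it only completes
   \<open>D\<close> to a family indexed by all functions.\<close>
 define D where "D X = (if X \<in> ?J then distr M borel X else std_normal_distribution)" for X
 have "prob_space (D X)" for X
  using m[of X] by (auto simp: D_def prob_space_distr prob_space_normal_density)
 then interpret D: product_sigma_finite D
  by (auto simp: product_sigma_finite_def prob_space_imp_sigma_finite)
 interpret N: prob_space std_normal_distribution by (rule prob_space_normal_density) simp
 have DG: "D G = std_normal_distribution" using K G distr_unit_normal by (simp add: D_def)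
 have sD: "sets (PiM ?J D) = sets (PiM ?J (\<lambda>_. borel))" by (intro sets_PiM_cong) (auto simp: D_def)
 have "distr M (PiM ?J (\<lambda>_. borel)) (\<lambda>w. \<lambda>X\<in>?J. X w) = PiM ?J (\<lambda>X. distr M borel X)"
  using orthogonal_indep_vars[of ?J] K m by (subst (asm) indep_vars_iff_distr_eq_PiM') auto
 also have "... = PiM ?J D" by (intro PiM_cong) (auto simp: D_def)
 finally have d: "distr M (PiM ?J (\<lambda>_. borel)) (\<lambda>w. \<lambda>X\<in>?J. X w) = PiM ?J D" .
 have *: "(\<integral>\<^sup>+w. f (\<lambda>X\<in>?J. X w) \<partial>M) = (\<integral>\<^sup>+z. (\<integral>\<^sup>+y. f (z(G := y)) \<partial>std_normal_distribution) \<partial>PiM K D)"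
  if f: "f \<in> borel_measurable (PiM ?J (\<lambda>_. borel))" for f
 proof -
  have "(\<integral>\<^sup>+w. f (\<lambda>X\<in>?J. X w) \<partial>M) = integral\<^sup>N (PiM ?J D) f"
   unfolding d[symmetric] using f m by (intro nn_integral_distr[symmetric] measurable_restrict) auto
  thus ?thesis
   using D.product_nn_integral_insert[OF K(1) G(2), of f] f by (simp add: DG measurable_cong_sets[OF sD refl])
 qed
 let ?f = "\<lambda>z. (\<integral>\<^sup>+x. F (h z, x) \<partial>std_normal_distribution)"
 have [measurable]: "(\<lambda>p. (fst p)(G := snd p)) \<in> PiM ?J (\<lambda>_. borel) \<Otimes>\<^sub>M borel \<rightarrow>\<^sub>M PiM ?J (\<lambda>_. borel :: real measure)"
  by (rule measurable_fun_upd[of _ ?J]) auto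
 have [measurable]: "(\<lambda>p. F (h (fst p), snd p)) \<in> borel_measurable (PiM ?J (\<lambda>_. borel) \<Otimes>\<^sub>M borel)"
  using measurable_compose[OF \<open>(\<lambda>p. (fst p)(G := snd p)) \<in> _\<close> F] by (simp add: h)
 have fm: "?f \<in> borel_measurable (PiM ?J (\<lambda>_. borel))"
  using N.borel_measurable_nn_integral_fst[of "\<lambda>p. F (h (fst p), snd p)" "PiM ?J (\<lambda>_. borel)"]
  by (simp add: measurable_cong_sets[OF sets_pair_measure_cong[OF refl sets_density[of lborel]]])
 \<comment> \<open>\<open>?f\<close> ignores the coordinate \<open>G\<close>, so when it is expanded
   in the same way the inner integral runs over a constant and has mass 1.\<close>
 have "(\<integral>\<^sup>+w. F (V w, G w) \<partial>M) = (\<integral>\<^sup>+w. ?f (\<lambda>X\<in>?J. X w) \<partial>M)"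
  using *[OF F] *[OF fm] N.emeasure_space_1 by (simp add: h V)
 also have "... = (\<integral>\<^sup>+w. (\<integral>\<^sup>+x. F (V w, x) * ennreal (std_normal_density x) \<partial>lborel) \<partial>M)"
 proof (rule nn_integral_cong)
  fix w assume "w \<in> space M"
  hence "(\<lambda>X\<in>?J. X w) \<in> space (PiM ?J (\<lambda>_. borel))" by (auto simp: space_PiM)
  from measurable_Pair2[OF \<open>(\<lambda>p. F (h (fst p), snd p)) \<in> _\<close> this]
  show "?f (\<lambda>X\<in>?J. X w) = (\<integral>\<^sup>+x. F (V w, x) * ennreal (std_normal_density x) \<partial>lborel)"
   by (subst nn_integral_density) (auto simp: V ac_simps)
 qed
 finally show ?thesis .
qed

end

section \<open>Integrals against the standard normal density\<close>

lemma has_bochner_integral_imp_nn_integral: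
 fixes f :: "'a \<Rightarrow> real"
 assumes "has_bochner_integral M f c" "\<And>x. 0 \<le> f x"
 shows "(\<integral>\<^sup>+x. ennreal (f x) \<partial>M) = ennreal c"
 using assms by (metis AE_I2 has_bochner_integral_iff nn_integral_eq_integral)

lemma std_normal_density_le: "std_normal_density x \<le> 1 / sqrt (2 * pi)"
 by (simp add: std_normal_density_def divide_right_mono)

lemma std_normal_density_ge: "(1 - x^2 / 2) / sqrt (2 * pi) \<le> std_normal_density x"
 using exp_ge_add_one_self[of "- x\<^sup>2 / 2"] by (simp add: std_normal_density_def divide_right_mono)

lemma nn_integral_normal_interval_le:
 assumes q: "0 < q"
 shows "(\<integral>\<^sup>+x. indicator {a<..<b} (c + q * x) * ennreal (std_normal_density x) \<partial>lborel)
  \<le> ennreal (max (b - a) 0 / (q * sqrt (2 * pi)))"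
proof -
 have "(\<integral>\<^sup>+x. indicator {a<..<b} (c + q * x) * ennreal (std_normal_density x) \<partial>lborel) \<le>
   (\<integral>\<^sup>+x. ennreal (1 / sqrt (2 * pi)) * indicator {(a - c) / q<..<(b - c) / q} x \<partial>lborel)"
  using q std_normal_density_le
  by (intro nn_integral_mono) (auto simp: indicator_def field_simps intro!: ennreal_leI)
 also have "... = ennreal (1 / sqrt (2 * pi)) * emeasure lborel {(a - c) / q<..<(b - c) / q}"
  by (subst nn_integral_cmult_indicator) auto
 also have "... = ennreal (max (b - a) 0 / (q * sqrt (2 * pi)))"
 proof (cases "a \<le> b")
  case True
  hence "(a - c) / q \<le> (b - c) / q" using q by (simp add: divide_right_mono)
  thus ?thesis using True q
   by (simp add: ennreal_mult[symmetric] diff_divide_distrib[symmetric] max_def field_simps)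
 next
  case False
  hence "(b - c) / q < (a - c) / q" using q by (simp add: divide_strict_right_mono)
  thus ?thesis using False by simp
 qed
 finally show ?thesis .
qed

text \<open>All positions from which a displacement within \<open>et\<close> of \<open>e\<close> can
  change the sign. Replacing the true displacement by this enclosure removes its dependence on the
  position; the two intervals have total length at most
  \<open>\<bar>e\<bar> + 2 * et\<close>.\<close>

definition hit :: "real \<Rightarrow> real \<Rightarrow> real \<Rightarrow> bool" where
 "hit e et x \<longleftrightarrow> (0 < x \<and> x < et - e) \<or> (x < 0 \<and> - e - et < x)"

lemma hit_of_neg_product:
 assumes "x * (x + d) < 0" "\<bar>d - e\<bar> \<le> et" shows "hit e et x"
 using assms unfolding hit_def mult_less_0_iff by auto

lemma nn_integral_normal_hit_le:
 assumes q: "0 < q" and et: "0 \<le> et"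
 shows "(\<integral>\<^sup>+x. of_bool (hit e et (c + q * x)) * ennreal (std_normal_density x) \<partial>lborel)
  \<le> ennreal ((\<bar>e\<bar> + 2 * et) / (q * sqrt (2 * pi)))"
proof -
 have "(\<integral>\<^sup>+x. of_bool (hit e et (c + q * x)) * ennreal (std_normal_density x) \<partial>lborel) \<le>
   (\<integral>\<^sup>+x. indicator {0<..<et - e} (c + q * x) * ennreal (std_normal_density x) +
      indicator {- e - et<..<0} (c + q * x) * ennreal (std_normal_density x) \<partial>lborel)"
  by (intro nn_integral_mono) (auto simp: hit_def indicator_def)
 also have "... \<le> ennreal (max (et - e) 0 / (q * sqrt (2 * pi))) + ennreal (max (et + e) 0 / (q * sqrt (2 * pi)))"
  using nn_integral_normal_interval_le[OF q, of 0 "et - e" c] nn_integral_normal_interval_le[OF q, of "- e - et" 0 c]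
  by (subst nn_integral_add) (auto intro!: add_mono)
 also have "... \<le> ennreal ((\<bar>e\<bar> + 2 * et) / (q * sqrt (2 * pi)))"
  using q et by (subst ennreal_plus[symmetric])
   (auto intro!: ennreal_leI divide_right_mono simp: add_divide_distrib[symmetric] simp del: ennreal_plus)
 finally show ?thesis .
qed

lemma nn_integral_normal_sign_change_ge:
 "ennreal (\<bar>u\<bar> * (1 - u^2 / 2) / sqrt (2 * pi)) \<le>
  (\<integral>\<^sup>+x. of_bool (x * (x + u) < 0) * ennreal (std_normal_density x) \<partial>lborel)"
proof -
 let ?I = "if 0 \<le> u then {-u<..<0} else {0<..<-u}"
 have "ennreal (\<bar>u\<bar> * (1 - u^2 / 2) / sqrt (2 * pi)) = ennreal ((1 - u^2 / 2) / sqrt (2 * pi)) * emeasure lborel ?I"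
 proof -
  have "emeasure lborel ?I = ennreal \<bar>u\<bar>" by simp
  moreover have "\<bar>u\<bar> * (1 - u^2 / 2) / sqrt (2 * pi) = ((1 - u^2 / 2) / sqrt (2 * pi)) * \<bar>u\<bar>" by simp
  ultimately show ?thesis by (metis abs_ge_zero ennreal_mult'')
 qed
 also have "... = (\<integral>\<^sup>+x. ennreal ((1 - u^2 / 2) / sqrt (2 * pi)) * indicator ?I x \<partial>lborel)"
  by (subst nn_integral_cmult_indicator) auto
 also have "... \<le> (\<integral>\<^sup>+x. of_bool (x * (x + u) < 0) * ennreal (std_normal_density x) \<partial>lborel)"
 proof (rule nn_integral_mono)
  fix x :: real
  have "(1 - u^2 / 2) / sqrt (2 * pi) \<le> std_normal_density x" if "x \<in> ?I"
  proof -
   have "\<bar>x\<bar> \<le> \<bar>u\<bar>" using that by (auto split: if_splits)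
   hence "x^2 \<le> u^2" by (simp add: abs_le_square_iff)
   hence "(1 - u^2 / 2) / sqrt (2 * pi) \<le> (1 - x^2 / 2) / sqrt (2 * pi)"
    by (intro divide_right_mono) auto
   thus ?thesis using std_normal_density_ge[of x] by linarith
  qed
  thus "ennreal ((1 - u^2 / 2) / sqrt (2 * pi)) * indicator ?I x \<le> of_bool (x * (x + u) < 0) * ennreal (std_normal_density x)"
   by (auto simp: indicator_def mult_less_0_iff intro!: ennreal_leI)
 qed
 finally show ?thesis .
qed

lemma nn_integral_tent:
 assumes v: "0 < v" and m: "0 \<le> m"
 shows "(\<integral>\<^sup>+x. ennreal (max (m - v * \<bar>x\<bar>) 0) \<partial>lborel) = ennreal (m^2 / v)"
proof -
 have a0: "0 \<le> m / v" using assms by simp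
 have 1: "(\<integral>\<^sup>+x. ennreal (m - v * x) * indicator {0..m/v} x \<partial>lborel) = ennreal (m^2 / v / 2)"
 proof -
  have "(\<integral>\<^sup>+x. ennreal (m - v * x) * indicator {0..m/v} x \<partial>lborel) =
   ennreal ((m * (m/v) - v * (m/v)^2 / 2) - (m * 0 - v * 0^2 / 2))"
   using assms a0 by (intro nn_integral_FTC_Icc) (auto intro!: derivative_eq_intros simp: field_simps)
  also have "(m * (m/v) - v * (m/v)^2 / 2) - (m * 0 - v * 0^2 / 2) = m^2 / v / 2"
   using v by (simp add: power2_eq_square field_simps)
  finally show ?thesis .
 qed
 have 2: "(\<integral>\<^sup>+x. ennreal (m + v * x) * indicator {-m/v..0} x \<partial>lborel) = ennreal (m^2 / v / 2)"
 proof -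
  have "(\<integral>\<^sup>+x. ennreal (m + v * x) * indicator {-m/v..0} x \<partial>lborel) =
   ennreal ((m * 0 + v * 0^2 / 2) - (m * (-m/v) + v * (-m/v)^2 / 2))"
   using assms a0 by (intro nn_integral_FTC_Icc) (auto intro!: derivative_eq_intros simp: field_simps)
  also have "(m * 0 + v * 0^2 / 2) - (m * (-m/v) + v * (-m/v)^2 / 2) = m^2 / v / 2"
   using v by (simp add: power2_eq_square field_simps)
  finally show ?thesis .
 qed
 have "(\<integral>\<^sup>+x. ennreal (max (m - v * \<bar>x\<bar>) 0) \<partial>lborel) =
  (\<integral>\<^sup>+x. ennreal (m - v * x) * indicator {0..m/v} x + ennreal (m + v * x) * indicator {-m/v..0} x \<partial>lborel)"
 proof (rule nn_integral_cong_AE, rule AE_I[of _ _ "{0}"], safe)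
  fix x :: real
  assume h: "ennreal (max (m - v * \<bar>x\<bar>) 0) \<noteq> ennreal (m - v * x) * indicator {0..m/v} x + ennreal (m + v * x) * indicator {-m/v..0} x"
  show "x = 0"
  proof (rule ccontr)
   assume x: "x \<noteq> 0"
   have le: "x \<le> m / v \<longleftrightarrow> v * x \<le> m" "- m / v \<le> x \<longleftrightarrow> 0 \<le> m + v * x"
    using v by (auto simp: field_simps)
   show False
   proof (cases "0 < x")
    case True
    thus False using h le(1) by (auto simp: indicator_def max_def split: if_splits)
   next
    case False
    hence "x < 0" using x by simp
    thus False using h le(2) by (auto simp: indicator_def max_def split: if_splits)
   qed
  qed
 qed auto
 also have "... = ennreal (m^2 / v / 2) + ennreal (m^2 / v / 2)"
  using 1 2 by (subst nn_integral_add) auto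
 also have "... = ennreal (m^2 / v)"
  using assms by (subst ennreal_plus[symmetric]) auto
 finally show ?thesis .
qed

text \<open>By symmetry of the density the value is the mean of those for \<open>m\<close> and
  \<open>- m\<close>, and \<open>\<bar>m + y\<bar> + \<bar>- m + y\<bar>\<close> is twice
  \<open>\<bar>y\<bar>\<close> plus a tent of height \<open>\<bar>m\<bar>\<close>. The first part is
  a Gaussian moment; in the second the density is replaced by its maximum.\<close>

lemma nn_integral_normal_abs_affine_le:
 assumes v: "0 < v"
 shows "(\<integral>\<^sup>+x. ennreal \<bar>m + v * x\<bar> * ennreal (std_normal_density x) \<partial>lborel) \<le>
  ennreal (v * sqrt (2 / pi) + m^2 / (v * sqrt (2 * pi)))"
proof -
 let ?fi = std_normal_density
 let ?L = "\<lambda>m. \<integral>\<^sup>+x. ennreal (\<bar>m + v * x\<bar> * ?fi x) \<partial>lborel"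
 have sym: "?L (- m) = ?L m"
 proof -
  have "?L m = (\<integral>\<^sup>+x. ennreal (\<bar>m + v * (0 + (-1) * x)\<bar> * ?fi (0 + (-1) * x)) \<partial>lborel)"
   by (subst nn_integral_real_affine[where c="-1" and t=0]) auto
  also have "... = ?L (- m)"
   by (intro nn_integral_cong) (auto simp: std_normal_density_def intro!: arg_cong[where f=ennreal])
  finally show ?thesis by simp
 qed
 have abs1: "(\<integral>\<^sup>+x. ennreal (v * \<bar>x\<bar> * ?fi x) \<partial>lborel) = ennreal (v * sqrt (2 / pi))"
 proof -
  have hb: "has_bochner_integral lborel (\<lambda>x. v * (?fi x * \<bar>x\<bar>)) (v * sqrt (2 / pi))"
   using std_normal_moment_abs_odd[of 0] by (intro has_bochner_integral_mult_right) auto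
  have "(\<integral>\<^sup>+x. ennreal (v * (?fi x * \<bar>x\<bar>)) \<partial>lborel) = ennreal (v * sqrt (2 / pi))"
   using v by (intro has_bochner_integral_imp_nn_integral hb) simp
  thus ?thesis by (simp add: ac_simps)
 qed
 have "2 * ?L m = ?L m + ?L (- m)" unfolding sym by (simp add: mult_2)
 also have "... = (\<integral>\<^sup>+x. ennreal (\<bar>m + v * x\<bar> * ?fi x) + ennreal (\<bar>- m + v * x\<bar> * ?fi x) \<partial>lborel)"
  by (subst nn_integral_add) auto
 also have "... \<le> (\<integral>\<^sup>+x. 2 * (ennreal (v * \<bar>x\<bar> * ?fi x) + ennreal (1 / sqrt (2 * pi)) * ennreal (max (\<bar>m\<bar> - v * \<bar>x\<bar>) 0)) \<partial>lborel)"
 proof (rule nn_integral_mono)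
  fix x
  let ?t = "max (\<bar>m\<bar> - v * \<bar>x\<bar>) 0"
  have "\<bar>m + v * x\<bar> + \<bar>- m + v * x\<bar> = 2 * (v * \<bar>x\<bar> + ?t)"
  proof -
   have gen: "\<bar>m + y\<bar> + \<bar>- m + y\<bar> = 2 * (\<bar>y\<bar> + max (\<bar>m\<bar> - \<bar>y\<bar>) 0)" for y :: real
    by (auto simp: max_def abs_if)
   have "v * \<bar>x\<bar> = \<bar>v * x\<bar>" using v by (simp add: abs_mult)
   thus ?thesis using gen[of "v * x"] by simp
  qed
  hence "\<bar>m + v * x\<bar> * ?fi x + \<bar>- m + v * x\<bar> * ?fi x = 2 * (v * \<bar>x\<bar> * ?fi x + ?t * ?fi x)"
   by (simp only: distrib_right[symmetric] mult.assoc[symmetric])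
  also have "... \<le> 2 * (v * \<bar>x\<bar> * ?fi x + ?t * (1 / sqrt (2 * pi)))"
   using std_normal_density_le by (intro mult_left_mono add_left_mono) auto
  finally have "ennreal (\<bar>m + v * x\<bar> * ?fi x + \<bar>- m + v * x\<bar> * ?fi x) \<le> ennreal (2 * (v * \<bar>x\<bar> * ?fi x + (1 / sqrt (2 * pi)) * ?t))"
   by (intro ennreal_leI) (simp add: mult.commute)
  thus "ennreal (\<bar>m + v * x\<bar> * ?fi x) + ennreal (\<bar>- m + v * x\<bar> * ?fi x) \<le>
   2 * (ennreal (v * \<bar>x\<bar> * ?fi x) + ennreal (1 / sqrt (2 * pi)) * ennreal ?t)"
   using v by (simp add: ennreal_mult ennreal_plus del: times_divide_eq_right times_divide_eq_left)
 qed
 also have "... = 2 * (ennreal (v * sqrt (2 / pi)) + ennreal (1 / sqrt (2 * pi)) * ennreal (\<bar>m\<bar>\<^sup>2 / v))"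
  using nn_integral_tent[OF v, of "\<bar>m\<bar>"] abs1
  by (subst nn_integral_cmult) (auto simp: nn_integral_add nn_integral_cmult)
 also have "... = 2 * ennreal (v * sqrt (2 / pi) + m^2 / (v * sqrt (2 * pi)))"
  using v by (simp add: ennreal_mult[symmetric] ennreal_plus[symmetric] ac_simps del: ennreal_plus)
 finally have "?L m \<le> ennreal (v * sqrt (2 / pi) + m^2 / (v * sqrt (2 * pi)))"
  by (subst (asm) ennreal_mult_le_mult_iff) auto
 thus ?thesis by (simp add: ennreal_mult)
qed

context gauss_space
begin

lemma has_bochner_integral_unit_normal:
 assumes G: "G \<in> H" "ip G G = 1" and [measurable]: "f \<in> borel_measurable borel"
  and hb: "has_bochner_integral lborel (\<lambda>x. std_normal_density x * f x) (c::real)"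
 shows "has_bochner_integral M (\<lambda>w. f (G w)) c"
proof -
 have [measurable]: "G \<in> borel_measurable M" using G H_meas by simp
 have "has_bochner_integral (distr M borel G) f c"
  unfolding distr_unit_normal[OF G]
  by (rule has_bochner_integral_density) (use hb in auto)
 thus ?thesis
  by (simp add: has_bochner_integral_iff integrable_distr_eq integral_distr)
qed

lemma abs_moments:
 assumes "G \<in> H" "ip G G = 1"
 shows "has_bochner_integral M (\<lambda>w. \<bar>G w\<bar>) (sqrt (2 / pi))"
  and "has_bochner_integral M (\<lambda>w. \<bar>G w\<bar> ^ 3) (2 * sqrt (2 / pi))"
  and "has_bochner_integral M (\<lambda>w. \<bar>G w\<bar> ^ 5) (8 * sqrt (2 / pi))"
 using has_bochner_integral_unit_normal[OF assms _ std_normal_moment_abs_odd[of 0]]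
  has_bochner_integral_unit_normal[OF assms _ std_normal_moment_abs_odd[of 1]]
  has_bochner_integral_unit_normal[OF assms _ std_normal_moment_abs_odd[of 2]]
 by (simp_all add: fact_numeral mult.commute[of "sqrt _"])

lemma abs_moments_scaled:
 assumes "X \<in> H" "0 < ip X X"
 shows "has_bochner_integral M (\<lambda>w. \<bar>X w\<bar>) (nrm X * sqrt (2 / pi))"
  and "has_bochner_integral M (\<lambda>w. \<bar>X w\<bar> ^ 3) (nrm X ^ 3 * (2 * sqrt (2 / pi)))"
proof -
 let ?G = "\<lambda>w. X w / nrm X"
 have n: "0 < nrm X" using assms by (simp add: nrm_def)
 have G: "?G \<in> H" "ip ?G ?G = 1"
  using assms n by (auto simp: H_intros ip_linear nrm_sq[symmetric] power2_eq_square)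
 have e: "(\<lambda>w. \<bar>X w\<bar>) = (\<lambda>w. nrm X * \<bar>?G w\<bar>)" "(\<lambda>w. \<bar>X w\<bar> ^ 3) = (\<lambda>w. nrm X ^ 3 * \<bar>?G w\<bar> ^ 3)"
  using n by (auto simp: abs_divide power_divide)
 show "has_bochner_integral M (\<lambda>w. \<bar>X w\<bar>) (nrm X * sqrt (2 / pi))"
  unfolding e(1) by (intro has_bochner_integral_mult_right abs_moments G)
 show "has_bochner_integral M (\<lambda>w. \<bar>X w\<bar> ^ 3) (nrm X ^ 3 * (2 * sqrt (2 / pi)))"
  unfolding e(2) by (intro has_bochner_integral_mult_right abs_moments G)
qed

text \<open>\<open>E2\<close> is split into a multiple of \<open>E1\<close> and a multiple of an
  independent unit vector, which is integrated out first; the first and third absolute moments of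
  \<open>E1\<close> finish. For correlation c the bound is the product of the norms times 2 / (pi *
  sqrt (1 - c^2)), which agrees with the exact value up to second order in c. That is the accuracy
  needed for the leading term of the variance.\<close>

lemma expectation_abs_product_le:
 assumes E: "E1 \<in> H" "E2 \<in> H" and pos: "(ip E1 E2)^2 < ip E1 E1 * ip E2 E2"
 shows "expectation (\<lambda>w. \<bar>E1 w * E2 w\<bar>) \<le>
  2 / pi * (ip E1 E1 * ip E2 E2 / sqrt (ip E1 E1 * ip E2 E2 - (ip E1 E2)\<^sup>2))"
proof -
 have [measurable]: "E1 \<in> borel_measurable M" "E2 \<in> borel_measurable M" using E H_meas by auto
 define s1 where "s1 = nrm E1"
 define c where "c = ip E1 E2"
 have p1: "0 < ip E1 E1"
  using pos ip_self_nonneg[of E1] by (cases "ip E1 E1 = 0") (auto simp: order_less_le not_sum_power2_lt_zero)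
 have s1: "0 < s1" "ip E1 E1 = s1^2" using p1 by (simp_all add: s1_def nrm_sq) (simp add: nrm_def)
 define al where "al = c / s1^2"
 define Z where "Z = (\<lambda>w. E2 w - al * E1 w)"
 have ZH: "Z \<in> H" using E by (simp add: Z_def H_intros)
 have ZE: "ip Z E1 = 0" using E s1 by (simp add: Z_def ip_linear H_intros al_def c_def ip_commute[of E2 E1])
 have ZZ: "ip Z Z = ip E2 E2 - c\<^sup>2 / s1^2"
  using E s1 by (simp add: Z_def ip_linear H_intros al_def c_def ip_commute[of E2 E1]) (simp add: power2_eq_square field_simps)
 have Zpos: "0 < ip Z Z" using pos s1 by (simp add: ZZ c_def field_simps)
 define v where "v = nrm Z"
 have v: "0 < v" "v^2 = ip Z Z" using Zpos by (simp_all add: v_def nrm_sq) (simp add: nrm_def)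
 define G where "G = (\<lambda>w. Z w / v)"
 have G: "G \<in> H" "ip G E1 = 0" "ip G G = 1"
  using ZH ZE v by (auto simp: G_def H_intros ip_linear v(2)[symmetric] power2_eq_square)
 have E2: "E2 w = al * E1 w + v * G w" for w using v by (simp add: G_def Z_def)
 have I3: "has_bochner_integral M (\<lambda>w. (v * sqrt (2 / pi)) * \<bar>E1 w\<bar> + (al^2 / (v * sqrt (2 * pi))) * \<bar>E1 w\<bar> ^ 3)
   ((v * sqrt (2 / pi)) * (s1 * sqrt (2 / pi)) + (al^2 / (v * sqrt (2 * pi))) * (s1 ^ 3 * (2 * sqrt (2 / pi))))"
  unfolding s1_def using p1 E
  by (intro has_bochner_integral_add has_bochner_integral_mult_right abs_moments_scaled) auto
 let ?R = "(v * sqrt (2 / pi)) * (s1 * sqrt (2 / pi)) + (al^2 / (v * sqrt (2 * pi))) * (s1 ^ 3 * (2 * sqrt (2 / pi)))"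
 have "(\<integral>\<^sup>+w. ennreal \<bar>E1 w * E2 w\<bar> \<partial>M) = (\<integral>\<^sup>+w. (\<lambda>(e, x). ennreal \<bar>e * (al * e + v * x)\<bar>) (E1 w, G w) \<partial>M)"
  by (simp add: E2)
 also have "... = (\<integral>\<^sup>+w. (\<integral>\<^sup>+x. ennreal \<bar>E1 w * (al * E1 w + v * x)\<bar> * ennreal (std_normal_density x) \<partial>lborel) \<partial>M)"
  using G E by (subst nn_integral_orthogonal[where K="{E1}" and h="\<lambda>z. z E1"])
   (auto simp: pairwise_insert ip_commute[of E1 G])
 also have "... \<le> (\<integral>\<^sup>+w. ennreal ((v * sqrt (2 / pi)) * \<bar>E1 w\<bar> + (al^2 / (v * sqrt (2 * pi))) * \<bar>E1 w\<bar> ^ 3) \<partial>M)"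
 proof (rule nn_integral_mono)
  fix w
  have "(\<integral>\<^sup>+x. ennreal \<bar>E1 w * (al * E1 w + v * x)\<bar> * ennreal (std_normal_density x) \<partial>lborel) =
    ennreal \<bar>E1 w\<bar> * (\<integral>\<^sup>+x. ennreal \<bar>al * E1 w + v * x\<bar> * ennreal (std_normal_density x) \<partial>lborel)"
   by (subst nn_integral_cmult[symmetric]) (auto simp: abs_mult ennreal_mult ac_simps)
  also have "... \<le> ennreal \<bar>E1 w\<bar> * ennreal (v * sqrt (2 / pi) + (al * E1 w)^2 / (v * sqrt (2 * pi)))"
   by (intro mult_left_mono nn_integral_normal_abs_affine_le v) auto
  also have "... = ennreal ((v * sqrt (2 / pi)) * \<bar>E1 w\<bar> + (al^2 / (v * sqrt (2 * pi))) * \<bar>E1 w\<bar> ^ 3)"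
  proof -
   have "\<bar>E1 w\<bar> ^ 3 = \<bar>E1 w\<bar> * (E1 w)^2" by (simp add: power3_eq_cube power2_eq_square abs_mult_self_eq)
   thus ?thesis using v by (subst ennreal_mult[symmetric]) (auto simp: power_mult_distrib algebra_simps)
  qed
  finally show "(\<integral>\<^sup>+x. ennreal \<bar>E1 w * (al * E1 w + v * x)\<bar> * ennreal (std_normal_density x) \<partial>lborel) \<le>
   ennreal ((v * sqrt (2 / pi)) * \<bar>E1 w\<bar> + (al^2 / (v * sqrt (2 * pi))) * \<bar>E1 w\<bar> ^ 3)" .
 qed
 also have "... = ennreal ?R"
  using v by (intro has_bochner_integral_imp_nn_integral I3) simp
 finally have le: "(\<integral>\<^sup>+w. ennreal \<bar>E1 w * E2 w\<bar> \<partial>M) \<le> ennreal ?R" .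
 have "expectation (\<lambda>w. \<bar>E1 w * E2 w\<bar>) \<le> ?R"
 proof -
  have "ennreal (expectation (\<lambda>w. \<bar>E1 w * E2 w\<bar>)) = (\<integral>\<^sup>+w. ennreal \<bar>E1 w * E2 w\<bar> \<partial>M)"
   using H_int_mult[OF E] by (intro nn_integral_eq_integral[symmetric]) auto
  hence "ennreal (expectation (\<lambda>w. \<bar>E1 w * E2 w\<bar>)) \<le> ennreal ?R" using le by simp
  moreover have "0 \<le> ?R" using v s1 by simp
  ultimately show ?thesis by (simp add: ennreal_le_iff)
 qed
 also have "?R = 2 / pi * (ip E1 E1 * ip E2 E2 / sqrt (ip E1 E1 * ip E2 E2 - (ip E1 E2)\<^sup>2))"
 proof -
  have sq: "sqrt (2 / pi) * sqrt (2 / pi) = 2 / pi" by simp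
  have sq2: "sqrt (2 / pi) / sqrt (2 * pi) = 1 / pi"
  proof -
   have "(2 / pi) / (2 * pi) = (1 / pi)^2" by (simp add: power2_eq_square)
   thus ?thesis unfolding real_sqrt_divide[symmetric] by simp
  qed
  have sr: "sqrt (ip E1 E1 * ip E2 E2 - (ip E1 E2)\<^sup>2) = s1 * v"
  proof -
   have "ip E1 E1 * ip E2 E2 - (ip E1 E2)\<^sup>2 = (s1 * v)^2"
    using s1 by (simp add: power_mult_distrib v(2) ZZ c_def field_simps)
   thus ?thesis using s1 v by simp
  qed
  have E22: "ip E2 E2 = v^2 + al^2 * s1^2" 
  proof -
   have "al^2 * s1^2 = c^2 / s1^2" using s1 by (simp add: al_def power_divide power2_eq_square)
   thus ?thesis by (simp add: v(2) ZZ)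
  qed
  have "?R = (2 / pi) * (v * s1) + 2 * (al^2 * s1 ^ 3 / v) * (sqrt (2 / pi) / sqrt (2 * pi))"
   using sq by (simp add: algebra_simps)
  also have "... = 2 / pi * (v * s1 + al^2 * s1 ^ 3 / v)"
   unfolding sq2 by (simp add: algebra_simps)
  also have "v * s1 + al^2 * s1 ^ 3 / v = s1^2 * ip E2 E2 / (s1 * v)"
   unfolding E22 using s1 v by (simp add: power2_eq_square power3_eq_cube field_simps)
  finally show ?thesis using sr s1 by simp
 qed
 finally show ?thesis .
qed

end

section \<open>Sign changes\<close>

lemma divide_pi_le: "0 \<le> x \<Longrightarrow> x / pi \<le> x / 3"
 by (intro divide_left_mono) (use pi_gt3 in auto)

context gauss_space
begin

text \<open>On the event each value is smaller than its displacement. As the regression coefficients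
  are at most 1/4, this bounds \<open>\<bar>X1\<bar> + \<bar>X2\<bar>\<close> by
  \<open>2 * (\<bar>E1\<bar> + \<bar>E2\<bar>)\<close>, so the displacements differ from
  \<open>E1\<close> and \<open>E2\<close> by a margin depending on these alone. The event is thus
  contained in two \<open>hit\<close> events with data independent of the positions. Integrating
  first \<open>G\<close>, where \<open>X2 = r * X1 + q * G\<close>, and then \<open>X1\<close> costs
  the two maximal densities, which produce the denominator.\<close>

lemma two_sign_changes_le:
 assumes X: "X1 \<in> H" "X2 \<in> H" and XX: "ip X1 X1 = 1" "ip X2 X2 = 1"
  and r: "(ip X1 X2)^2 < 1"
  and E: "E1 \<in> H" "E2 \<in> H"
  and orth: "ip E1 X1 = 0" "ip E1 X2 = 0" "ip E2 X1 = 0" "ip E2 X2 = 0"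
  and b: "\<bar>b11\<bar> \<le> bt" "\<bar>b12\<bar> \<le> bt" "\<bar>b21\<bar> \<le> bt" "\<bar>b22\<bar> \<le> bt" and bt: "bt \<le> 1/4"
  and D1: "\<And>w. D1 w = b11 * X1 w + b12 * X2 w + E1 w"
  and D2: "\<And>w. D2 w = b21 * X1 w + b22 * X2 w + E2 w"
 shows "prob {w \<in> space M. X1 w * (X1 w + D1 w) < 0 \<and> X2 w * (X2 w + D2 w) < 0} \<le>
  (expectation (\<lambda>w. \<bar>E1 w * E2 w\<bar>) + 16 * bt * (ip E1 E1 + ip E2 E2)) / (2 * pi * sqrt (1 - (ip X1 X2)^2))"
proof -
 have [measurable]: "X1 \<in> borel_measurable M" "X2 \<in> borel_measurable M" "E1 \<in> borel_measurable M" "E2 \<in> borel_measurable M"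
  using X E H_meas by auto
 have D_eq: "D1 = (\<lambda>w. b11 * X1 w + b12 * X2 w + E1 w)" "D2 = (\<lambda>w. b21 * X1 w + b22 * X2 w + E2 w)"
  using D1 D2 by auto
 have [measurable]: "D1 \<in> borel_measurable M" "D2 \<in> borel_measurable M" unfolding D_eq by measurable
 define r where "r = ip X1 X2"
 define q where "q = sqrt (1 - r^2)"
 have q: "0 < q" "q^2 = 1 - r^2" using r by (auto simp: q_def r_def)
 have bt0: "0 \<le> bt" using b(1) by linarith
 define al where "al = ip E1 E2 / ip E1 E1"
 define Z where "Z = (\<lambda>w. E2 w - al * E1 w)"
 have Z: "Z \<in> H" "ip Z X1 = 0" "ip Z X2 = 0"
  using X E orth by (auto simp: Z_def H_intros ip_linear)
 \<comment> \<open>If \<open>E1\<close> has variance zero, division gives \<open>al = 0\<close>, and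
   Cauchy-Schwarz supplies the orthogonality instead.\<close>
 have ZE: "ip Z E1 = 0"
 proof (cases "ip E1 E1 = 0")
  case True
  hence "(ip E1 E2)^2 \<le> 0" using ip_cauchy[OF E] by simp
  hence "ip E1 E2 = 0" by simp
  thus ?thesis using E by (simp add: Z_def ip_linear H_intros al_def ip_commute[of E2 E1])
 next
  case False
  thus ?thesis using E by (simp add: Z_def ip_linear H_intros al_def ip_commute[of E2 E1])
 qed
 have [measurable]: "Z \<in> borel_measurable M" using Z H_meas by auto
 define G where "G = (\<lambda>w. (X2 w - r * X1 w) / q)"
 have G: "G \<in> H" "ip G E1 = 0" "ip G Z = 0" "ip G X1 = 0" "ip G G = 1"
 proof -
  have o: "ip X1 E1 = 0" "ip X2 E1 = 0" "ip X1 Z = 0" "ip X2 Z = 0" "ip X2 X1 = r" "ip X1 X2 = r"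
   using orth Z by (simp_all add: ip_commute[of X1 E1] ip_commute[of X2 E1] ip_commute[of X1 Z] ip_commute[of X2 Z] ip_commute[of X2 X1] r_def)
  show "G \<in> H" using X by (simp add: G_def H_intros)
  show "ip G E1 = 0" "ip G Z = 0" "ip G X1 = 0"
   using X E Z o XX by (simp_all add: G_def H_intros ip_linear)
  have "ip G G = (1 - r * r) / (q * q)"
   using X o XX by (simp add: G_def H_intros ip_linear)
  moreover have "1 - r * r = q * q" using q(2) by (simp add: power2_eq_square)
  moreover have "q * q \<noteq> 0" using q(1) by simp
  ultimately show "ip G G = 1" by simp
 qed
 have [measurable]: "G \<in> borel_measurable M" using G H_meas by auto
 have X2_eq: "X2 w = r * X1 w + q * G w" for w using q by (simp add: G_def)
 have E2_eq: "E2 w = Z w + al * E1 w" for w by (simp add: Z_def)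
 have XE: "ip X1 E1 = 0" "ip X1 Z = 0" using orth Z by (simp_all add: ip_commute[of X1 E1] ip_commute[of X1 Z])
 have o: "ip Z X1 = 0" "ip E1 Z = 0" "ip E1 X1 = 0" "ip E1 G = 0" "ip Z G = 0" "ip X1 G = 0" "ip X1 X1 = 1"
  using orth XE Z ZE G XX by (simp_all add: ip_commute[of Z X1] ip_commute[of E1 Z] ip_commute[of E1 G] ip_commute[of Z G] ip_commute[of X1 G])
 define et where "et e z = 2 * bt * (\<bar>e\<bar> + \<bar>z + al * e\<bar>)" for e z
 have et0: "0 \<le> et e z" for e z using bt0 by (simp add: et_def)
 have etm[measurable]: "(\<lambda>x. et (f x) (g x)) \<in> borel_measurable N" if [measurable]: "f \<in> borel_measurable N" "g \<in> borel_measurable N" for f g N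
  unfolding et_def by measurable
 have hm[measurable]: "Measurable.pred N (\<lambda>x. hit (f x) (g x) (h x))" if [measurable]: "f \<in> borel_measurable N" "g \<in> borel_measurable N" "h \<in> borel_measurable N"
  for f g h N unfolding hit_def by measurable
 define F :: "((real \<times> real) \<times> real) \<times> real \<Rightarrow> ennreal" where
  "F = (\<lambda>p. of_bool (hit (fst (fst (fst p))) (et (fst (fst (fst p))) (snd (fst (fst p)))) (snd (fst p))) *
   of_bool (hit (snd (fst (fst p)) + al * fst (fst (fst p))) (et (fst (fst (fst p))) (snd (fst (fst p)))) (r * snd (fst p) + q * snd p)))"
 have Fm[measurable]: "F \<in> borel_measurable (((borel \<Otimes>\<^sub>M borel) \<Otimes>\<^sub>M borel) \<Otimes>\<^sub>M borel)"
  unfolding F_def by measurable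
 define F2 :: "(real \<times> real) \<times> real \<Rightarrow> ennreal" where
  "F2 = (\<lambda>p. of_bool (hit (fst (fst p)) (et (fst (fst p)) (snd (fst p))) (snd p)) *
   ennreal ((\<bar>snd (fst p) + al * fst (fst p)\<bar> + 2 * et (fst (fst p)) (snd (fst p))) / (q * sqrt (2 * pi))))"
 have F2m[measurable]: "F2 \<in> borel_measurable ((borel \<Otimes>\<^sub>M borel) \<Otimes>\<^sub>M borel)"
  unfolding F2_def by measurable
 let ?A = "{w \<in> space M. X1 w * (X1 w + D1 w) < 0 \<and> X2 w * (X2 w + D2 w) < 0}"
 have hitA: "hit (E1 w) (et (E1 w) (Z w)) (X1 w) \<and> hit (E2 w) (et (E1 w) (Z w)) (X2 w)" if "w \<in> ?A" for w
 proof -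
  have neg: "\<bar>x\<bar> < \<bar>d\<bar>" if "x * (x + d) < 0" for x d :: real using that unfolding mult_less_0_iff by linarith
  have a: "\<bar>X1 w\<bar> < \<bar>D1 w\<bar>" "\<bar>X2 w\<bar> < \<bar>D2 w\<bar>" using that neg by auto
  have lin: "\<bar>c * x + d * y\<bar> \<le> bt * (\<bar>x\<bar> + \<bar>y\<bar>)" if "\<bar>c\<bar> \<le> bt" "\<bar>d\<bar> \<le> bt" for c d x y :: real
  proof -
   have "\<bar>c * x + d * y\<bar> \<le> \<bar>c\<bar> * \<bar>x\<bar> + \<bar>d\<bar> * \<bar>y\<bar>"
    using abs_triangle_ineq[of "c * x" "d * y"] by (simp add: abs_mult)
   also have "... \<le> bt * \<bar>x\<bar> + bt * \<bar>y\<bar>"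
    by (intro add_mono mult_right_mono that) auto
   finally show ?thesis by (simp add: distrib_left)
  qed
  have d1: "\<bar>D1 w - E1 w\<bar> \<le> bt * (\<bar>X1 w\<bar> + \<bar>X2 w\<bar>)" using lin[OF b(1,2)] by (simp add: D1)
  have d2: "\<bar>D2 w - E2 w\<bar> \<le> bt * (\<bar>X1 w\<bar> + \<bar>X2 w\<bar>)" using lin[OF b(3,4)] by (simp add: D2)
  let ?s = "\<bar>X1 w\<bar> + \<bar>X2 w\<bar>"
  have "bt * ?s \<le> 1/4 * ?s" using bt by (intro mult_right_mono) auto
  moreover have "\<bar>D1 w\<bar> \<le> \<bar>E1 w\<bar> + \<bar>D1 w - E1 w\<bar>" "\<bar>D2 w\<bar> \<le> \<bar>E2 w\<bar> + \<bar>D2 w - E2 w\<bar>" by linarith+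
  ultimately have "?s \<le> 2 * (\<bar>E1 w\<bar> + \<bar>E2 w\<bar>)" using a d1 d2
   unfolding distrib_left by linarith
  hence "bt * ?s \<le> bt * (2 * (\<bar>E1 w\<bar> + \<bar>E2 w\<bar>))" using bt0 by (rule mult_left_mono)
  also have "... = et (E1 w) (Z w)" by (simp add: et_def E2_eq)
  finally have bs: "bt * ?s \<le> et (E1 w) (Z w)" .
  show ?thesis
   using that hit_of_neg_product[OF _ order_trans[OF d1 bs], of "X1 w"]
    hit_of_neg_product[OF _ order_trans[OF d2 bs], of "X2 w"] by simp
 qed
 have "ennreal (prob ?A) = (\<integral>\<^sup>+w. indicator ?A w \<partial>M)"
  by (simp add: emeasure_eq_measure)
 also have "... \<le> (\<integral>\<^sup>+w. F (((E1 w, Z w), X1 w), G w) \<partial>M)"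
  using hitA by (intro nn_integral_mono) (auto simp: F_def indicator_def E2_eq X2_eq)
 also have "... = (\<integral>\<^sup>+w. (\<integral>\<^sup>+g. F (((E1 w, Z w), X1 w), g) * ennreal (std_normal_density g) \<partial>lborel) \<partial>M)"
  using G E Z X XE ZE o by (subst nn_integral_orthogonal[where K="{X1, Z, E1}" and h="\<lambda>z. ((z E1, z Z), z X1)"])
   (auto simp: pairwise_insert)
 also have "... \<le> (\<integral>\<^sup>+w. of_bool (hit (E1 w) (et (E1 w) (Z w)) (X1 w)) *
   ennreal ((\<bar>E2 w\<bar> + 2 * et (E1 w) (Z w)) / (q * sqrt (2 * pi))) \<partial>M)"
 proof (rule nn_integral_mono)
  fix w
  have "(\<integral>\<^sup>+g. F (((E1 w, Z w), X1 w), g) * ennreal (std_normal_density g) \<partial>lborel) =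
   of_bool (hit (E1 w) (et (E1 w) (Z w)) (X1 w)) *
   (\<integral>\<^sup>+g. of_bool (hit (E2 w) (et (E1 w) (Z w)) (r * X1 w + q * g)) * ennreal (std_normal_density g) \<partial>lborel)"
   unfolding F_def E2_eq by (subst nn_integral_cmult[symmetric]) (simp_all add: mult.assoc)
  also have "... \<le> of_bool (hit (E1 w) (et (E1 w) (Z w)) (X1 w)) *
   ennreal ((\<bar>E2 w\<bar> + 2 * et (E1 w) (Z w)) / (q * sqrt (2 * pi)))"
   by (intro mult_left_mono nn_integral_normal_hit_le q et0) auto
  finally show "(\<integral>\<^sup>+g. F (((E1 w, Z w), X1 w), g) * ennreal (std_normal_density g) \<partial>lborel) \<le>
   of_bool (hit (E1 w) (et (E1 w) (Z w)) (X1 w)) *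
   ennreal ((\<bar>E2 w\<bar> + 2 * et (E1 w) (Z w)) / (q * sqrt (2 * pi)))" .
 qed
 also have "... = (\<integral>\<^sup>+w. F2 ((E1 w, Z w), X1 w) \<partial>M)"
  by (simp add: E2_eq F2_def)
 also have "... = (\<integral>\<^sup>+w. (\<integral>\<^sup>+x. F2 ((E1 w, Z w), x) * ennreal (std_normal_density x) \<partial>lborel) \<partial>M)"
  using E Z X XE ZE o by (subst nn_integral_orthogonal[where K="{Z, E1}" and h="\<lambda>z. (z E1, z Z)"])
   (auto simp: pairwise_insert)
 also have "... \<le> (\<integral>\<^sup>+w. ennreal ((\<bar>E1 w * E2 w\<bar> + 16 * bt * ((E1 w)^2 + (E2 w)^2)) / (2 * pi * q)) \<partial>M)"
 proof (rule nn_integral_mono)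
  fix w
  let ?et = "et (E1 w) (Z w)"
  have "(\<integral>\<^sup>+x. F2 ((E1 w, Z w), x) * ennreal (std_normal_density x) \<partial>lborel) =
    ennreal ((\<bar>E2 w\<bar> + 2 * ?et) / (q * sqrt (2 * pi))) * (\<integral>\<^sup>+x. of_bool (hit (E1 w) ?et (0 + 1 * x)) * ennreal (std_normal_density x) \<partial>lborel)"
   unfolding F2_def E2_eq by (subst nn_integral_cmult[symmetric]) (simp_all add: ac_simps)
  also have "... \<le> ennreal ((\<bar>E2 w\<bar> + 2 * ?et) / (q * sqrt (2 * pi))) * ennreal ((\<bar>E1 w\<bar> + 2 * ?et) / (1 * sqrt (2 * pi)))"
   by (intro mult_left_mono nn_integral_normal_hit_le et0) auto
  also have "... = ennreal ((\<bar>E2 w\<bar> + 2 * ?et) * (\<bar>E1 w\<bar> + 2 * ?et) / (2 * pi * q))"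
  proof -
   have "(a / (q * c)) * (b / (1 * c)) = a * b / (q * (c * c))" for a b c :: real by simp
   hence "((\<bar>E2 w\<bar> + 2 * ?et) / (q * sqrt (2 * pi))) * ((\<bar>E1 w\<bar> + 2 * ?et) / (1 * sqrt (2 * pi))) =
     (\<bar>E2 w\<bar> + 2 * ?et) * (\<bar>E1 w\<bar> + 2 * ?et) / (q * (2 * pi))" by simp
   moreover have "0 \<le> (\<bar>E2 w\<bar> + 2 * ?et) / (q * sqrt (2 * pi))"
    using q(1) et0[of "E1 w" "Z w"] by simp
   moreover have "0 \<le> (\<bar>E1 w\<bar> + 2 * ?et) / (1 * sqrt (2 * pi))"
    using et0[of "E1 w" "Z w"] by simp
   ultimately show ?thesis by (simp only: ennreal_mult[symmetric] mult.commute[of q])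
  qed
  also have "... \<le> ennreal ((\<bar>E1 w * E2 w\<bar> + 16 * bt * ((E1 w)^2 + (E2 w)^2)) / (2 * pi * q))"
  proof (intro ennreal_leI divide_right_mono)
   let ?t = "\<bar>E1 w\<bar> + \<bar>E2 w\<bar>"
   have eta: "?et = 2 * bt * ?t" by (simp add: et_def E2_eq)
   have b2: "bt^2 \<le> bt / 4" using mult_left_mono[OF bt bt0] by (simp add: power2_eq_square)
   have "(\<bar>E2 w\<bar> + 2 * ?et) * (\<bar>E1 w\<bar> + 2 * ?et) = \<bar>E1 w * E2 w\<bar> + 4 * bt * ?t^2 + 16 * bt^2 * ?t^2"
    unfolding eta by (simp add: abs_mult power2_eq_square algebra_simps)
   also have "... \<le> \<bar>E1 w * E2 w\<bar> + 4 * bt * ?t^2 + 16 * (bt / 4) * ?t^2"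
    using b2 by (intro add_left_mono mult_right_mono mult_left_mono) auto
   also have "... = \<bar>E1 w * E2 w\<bar> + 8 * bt * ?t^2" by simp
   also have "... \<le> \<bar>E1 w * E2 w\<bar> + 8 * bt * (2 * ((E1 w)^2 + (E2 w)^2))"
   proof -
    have "?t^2 \<le> 2 * ((E1 w)^2 + (E2 w)^2)"
     using sum_squares_bound[of "\<bar>E1 w\<bar>" "\<bar>E2 w\<bar>"] by (simp add: power2_sum)
    thus ?thesis using bt0 by (intro add_left_mono mult_left_mono) auto
   qed
   finally show "(\<bar>E2 w\<bar> + 2 * ?et) * (\<bar>E1 w\<bar> + 2 * ?et) \<le> \<bar>E1 w * E2 w\<bar> + 16 * bt * ((E1 w)^2 + (E2 w)^2)"
    by (simp add: algebra_simps)
  qed (use q in auto)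
  finally show "(\<integral>\<^sup>+x. F2 ((E1 w, Z w), x) * ennreal (std_normal_density x) \<partial>lborel)
   \<le> ennreal ((\<bar>E1 w * E2 w\<bar> + 16 * bt * ((E1 w)^2 + (E2 w)^2)) / (2 * pi * q))" .
 qed
 also have "... = ennreal (expectation (\<lambda>w. (\<bar>E1 w * E2 w\<bar> + 16 * bt * ((E1 w)^2 + (E2 w)^2)) / (2 * pi * q)))"
  using H_int_mult[OF E] H_sq[OF E(1)] H_sq[OF E(2)] q bt0
  by (intro nn_integral_eq_integral) auto
 also have "expectation (\<lambda>w. (\<bar>E1 w * E2 w\<bar> + 16 * bt * ((E1 w)^2 + (E2 w)^2)) / (2 * pi * q)) =
   (expectation (\<lambda>w. \<bar>E1 w * E2 w\<bar>) + 16 * bt * (ip E1 E1 + ip E2 E2)) / (2 * pi * q)"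
  using H_int_mult[OF E] H_sq[OF E(1)] H_sq[OF E(2)] by (simp add: ip_self)
 finally have "ennreal (prob ?A) \<le> ennreal ((expectation (\<lambda>w. \<bar>E1 w * E2 w\<bar>) + 16 * bt * (ip E1 E1 + ip E2 E2)) / (2 * pi * q))" .
 moreover have "0 \<le> (expectation (\<lambda>w. \<bar>E1 w * E2 w\<bar>) + 16 * bt * (ip E1 E1 + ip E2 E2)) / (2 * pi * q)"
  using q bt0 by (intro divide_nonneg_nonneg add_nonneg_nonneg mult_nonneg_nonneg) (auto simp: ip_self_nonneg)
 ultimately show ?thesis by (simp add: ennreal_le_iff q_def r_def)
qed

text \<open>Given \<open>E\<close>, the probability of a sign change is
  \<open>\<bar>u\<bar> / sqrt (2 * pi)\<close> with \<open>u = ta * E\<close>, up to a cubic error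
  below. Weights 1 and \<open>E^2\<close> then lead to the absolute moments of orders 1, 3 and 5. On
  the event \<open>\<bar>X\<bar> \<le> ta * \<bar>E\<bar>\<close>, which settles the weight
  \<open>X^2\<close>.\<close>

lemma one_sign_change:
 assumes X: "X \<in> H" "ip X X = 1" and E: "E \<in> H" "ip E E = 1" and XE: "ip X E = 0" and ta: "0 \<le> ta"
 defines "A \<equiv> {w \<in> space M. X w * (X w + ta * E w) < 0}"
 shows "prob A \<le> ta / pi" and "ta / pi - ta ^ 3 \<le> prob A"
  and "expectation (\<lambda>w. indicator A w * (X w)^2) \<le> ta ^ 3"
  and "expectation (\<lambda>w. indicator A w * (E w)^2) \<le> 2 * ta / pi"
  and "2 * ta / pi - 2 * ta ^ 3 \<le> expectation (\<lambda>w. indicator A w * (E w)^2)"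
proof -
 have Xm[measurable]: "X \<in> borel_measurable M" and Em[measurable]: "E \<in> borel_measurable M" using X E H_meas by auto
 have Am[measurable]: "A \<in> sets M" unfolding A_def by measurable
 define p where "p u = (\<integral>\<^sup>+x. of_bool (x * (x + u) < 0) * ennreal (std_normal_density x) \<partial>lborel)" for u :: real
 have pm[measurable]: "p \<in> borel_measurable borel" unfolding p_def by measurable
 have p_le: "p u \<le> ennreal (\<bar>u\<bar> / sqrt (2 * pi))" for u
 proof -
  have "p u \<le> (\<integral>\<^sup>+x. of_bool (hit u 0 (0 + 1 * x)) * ennreal (std_normal_density x) \<partial>lborel)"
   unfolding p_def by (intro nn_integral_mono) (auto simp: hit_def mult_less_0_iff)
  also have "... \<le> ennreal ((\<bar>u\<bar> + 2 * 0) / (1 * sqrt (2 * pi)))" by (rule nn_integral_normal_hit_le) auto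
  finally show ?thesis by simp
 qed
 have p_ge: "ennreal (\<bar>u\<bar> * (1 - u^2 / 2) / sqrt (2 * pi)) \<le> p u" for u
  unfolding p_def by (rule nn_integral_normal_sign_change_ge)
 have repr: "(\<integral>\<^sup>+w. ennreal (g (E w)) * indicator A w \<partial>M) = (\<integral>\<^sup>+w. ennreal (g (E w)) * p (ta * E w) \<partial>M)"
  if [measurable]: "g \<in> borel_measurable borel" for g
 proof -
  have "(\<integral>\<^sup>+w. ennreal (g (E w)) * indicator A w \<partial>M) =
    (\<integral>\<^sup>+w. (\<lambda>(e, x). ennreal (g e) * of_bool (x * (x + ta * e) < 0)) (E w, X w) \<partial>M)"
   by (intro nn_integral_cong) (auto simp: A_def indicator_def)
  also have "... = (\<integral>\<^sup>+w. (\<integral>\<^sup>+x. (\<lambda>(e, x). ennreal (g e) * of_bool (x * (x + ta * e) < 0)) (E w, x) * ennreal (std_normal_density x) \<partial>lborel) \<partial>M)"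
   using X E XE by (subst nn_integral_orthogonal[where K="{E}" and h="\<lambda>z. z E"])
    (auto simp: pairwise_insert ip_commute[of E X])
  also have "... = (\<integral>\<^sup>+w. ennreal (g (E w)) * p (ta * E w) \<partial>M)"
   unfolding p_def by (subst nn_integral_cmult[symmetric]) (auto simp: mult.assoc)
  finally show ?thesis .
 qed
 have c: "sqrt (2 / pi) / sqrt (2 * pi) = 1 / pi"
 proof -
  have "(2 / pi) / (2 * pi) = (1 / pi)^2" by (simp add: power2_eq_square)
  thus ?thesis unfolding real_sqrt_divide[symmetric] by simp
 qed
 have up: "(\<integral>\<^sup>+w. ennreal (\<bar>E w\<bar> ^ k) * indicator A w \<partial>M) \<le> ennreal (ta * m / sqrt (2 * pi))"
  if m: "has_bochner_integral M (\<lambda>w. \<bar>E w\<bar> ^ Suc k) m" for k m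
 proof -
  have "(\<integral>\<^sup>+w. ennreal (\<bar>E w\<bar> ^ k) * indicator A w \<partial>M) = (\<integral>\<^sup>+w. ennreal (\<bar>E w\<bar> ^ k) * p (ta * E w) \<partial>M)"
   using repr[of "\<lambda>e. \<bar>e\<bar> ^ k"] by simp
  also have "... \<le> (\<integral>\<^sup>+w. ennreal (\<bar>E w\<bar> ^ k) * ennreal (\<bar>ta * E w\<bar> / sqrt (2 * pi)) \<partial>M)"
   by (intro nn_integral_mono mult_left_mono p_le) auto
  also have "... = (\<integral>\<^sup>+w. ennreal (ta / sqrt (2 * pi) * \<bar>E w\<bar> ^ Suc k) \<partial>M)"
   using ta by (intro nn_integral_cong) (auto simp: ennreal_mult[symmetric] abs_mult ac_simps)
  also have "... = ennreal (ta / sqrt (2 * pi) * m)"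
   using m ta by (intro has_bochner_integral_imp_nn_integral has_bochner_integral_mult_right) auto
  finally show ?thesis by simp
 qed
 have low: "ennreal ((ta * m - ta ^ 3 * m' / 2) / sqrt (2 * pi)) \<le> (\<integral>\<^sup>+w. ennreal (\<bar>E w\<bar> ^ k) * indicator A w \<partial>M)"
  if m: "has_bochner_integral M (\<lambda>w. \<bar>E w\<bar> ^ Suc k) m" and m': "has_bochner_integral M (\<lambda>w. \<bar>E w\<bar> ^ (k + 3)) m'" for k m m'
 proof -
  let ?f = "\<lambda>w. ta / sqrt (2 * pi) * \<bar>E w\<bar> ^ Suc k - ta ^ 3 / (2 * sqrt (2 * pi)) * \<bar>E w\<bar> ^ (k + 3)"
  have hb: "has_bochner_integral M ?f (ta / sqrt (2 * pi) * m - ta ^ 3 / (2 * sqrt (2 * pi)) * m')"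
   using m m' by (intro has_bochner_integral_diff has_bochner_integral_mult_right) auto
  \<comment> \<open>\<open>ennreal\<close> cuts negative values off at 0, so the right side is the
    integral of the positive part.\<close>
  have "ennreal (expectation ?f) \<le> (\<integral>\<^sup>+w. ennreal (?f w) \<partial>M)"
  proof -
   have "expectation ?f \<le> expectation (\<lambda>w. max (?f w) 0)"
    using hb by (intro integral_mono) (auto simp: has_bochner_integral_iff)
   moreover have "(\<integral>\<^sup>+w. ennreal (max (?f w) 0) \<partial>M) = ennreal (expectation (\<lambda>w. max (?f w) 0))"
    using hb by (intro nn_integral_eq_integral) (auto simp: has_bochner_integral_iff)
   moreover have "(\<integral>\<^sup>+w. ennreal (max (?f w) 0) \<partial>M) = (\<integral>\<^sup>+w. ennreal (?f w) \<partial>M)"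
    by (intro nn_integral_cong) (auto simp: max_def ennreal_neg)
   ultimately show ?thesis by (simp add: ennreal_leI)
  qed
  also have "(\<integral>\<^sup>+w. ennreal (?f w) \<partial>M) \<le> (\<integral>\<^sup>+w. ennreal (\<bar>E w\<bar> ^ k) * p (ta * E w) \<partial>M)"
  proof (rule nn_integral_mono)
   fix w
   have "?f w = \<bar>E w\<bar> ^ k * (\<bar>ta * E w\<bar> * (1 - (ta * E w)^2 / 2) / sqrt (2 * pi))"
   proof -
    have gen: "ta / c * x ^ Suc k - ta ^ 3 / (2 * c) * x ^ (k + 3) = x ^ k * (ta * x * (1 - (ta * x)^2 / 2) / c)"
     for x c :: real
     by (cases "c = 0") (simp_all add: power_add field_simps power2_eq_square power3_eq_cube)
    have "\<bar>ta * E w\<bar> = ta * \<bar>E w\<bar>" "(ta * E w)^2 = (ta * \<bar>E w\<bar>)^2" using ta by (auto simp: abs_mult power_mult_distrib)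
    thus ?thesis using gen[of "sqrt (2 * pi)" "\<bar>E w\<bar>"] by simp
   qed
   hence "ennreal (?f w) = ennreal (\<bar>E w\<bar> ^ k * (\<bar>ta * E w\<bar> * (1 - (ta * E w)^2 / 2) / sqrt (2 * pi)))"
    by (rule arg_cong)
   also have "... = ennreal (\<bar>E w\<bar> ^ k) * ennreal (\<bar>ta * E w\<bar> * (1 - (ta * E w)^2 / 2) / sqrt (2 * pi))"
    by (rule ennreal_mult') simp
   also have "... \<le> ennreal (\<bar>E w\<bar> ^ k) * p (ta * E w)" by (intro mult_left_mono p_ge) auto
   finally show "ennreal (?f w) \<le> ennreal (\<bar>E w\<bar> ^ k) * p (ta * E w)" .
  qed
  also have "... = (\<integral>\<^sup>+w. ennreal (\<bar>E w\<bar> ^ k) * indicator A w \<partial>M)"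
   using repr[of "\<lambda>e. \<bar>e\<bar> ^ k"] by simp
  finally show ?thesis using hb by (simp add: has_bochner_integral_iff diff_divide_distrib)
 qed
 have m1: "has_bochner_integral M (\<lambda>w. \<bar>E w\<bar> ^ Suc 0) (sqrt (2 / pi))"
  and m3: "has_bochner_integral M (\<lambda>w. \<bar>E w\<bar> ^ Suc 2) (2 * sqrt (2 / pi))"
  and m3': "has_bochner_integral M (\<lambda>w. \<bar>E w\<bar> ^ (0 + 3)) (2 * sqrt (2 / pi))"
  and m5: "has_bochner_integral M (\<lambda>w. \<bar>E w\<bar> ^ (2 + 3)) (8 * sqrt (2 / pi))"
  using abs_moments[OF E] by (simp_all add: eval_nat_numeral)
 have nnA: "(\<integral>\<^sup>+w. ennreal (\<bar>E w\<bar> ^ 0) * indicator A w \<partial>M) = ennreal (prob A)"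
  by (simp add: emeasure_eq_measure)
 have intE: "integrable M (\<lambda>w. indicator A w * (E w)^2)"
  using integrable_mult_indicator[OF Am H_sq[OF E(1)]] by simp
 have intX: "integrable M (\<lambda>w. indicator A w * (X w)^2)"
  using integrable_mult_indicator[OF Am H_sq[OF X(1)]] by simp
 have nnE: "(\<integral>\<^sup>+w. ennreal (\<bar>E w\<bar> ^ 2) * indicator A w \<partial>M) = ennreal (expectation (\<lambda>w. indicator A w * (E w)^2))"
  using intE by (subst nn_integral_eq_integral[symmetric]) (auto intro!: nn_integral_cong simp: indicator_def)
 have "ennreal (prob A) \<le> ennreal (ta * sqrt (2 / pi) / sqrt (2 * pi))"
  using up[OF m1] nnA by simp
 hence "prob A \<le> ta * (sqrt (2 / pi) / sqrt (2 * pi))" using ta by (simp add: ennreal_le_iff)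
 thus "prob A \<le> ta / pi" unfolding c by simp
 have cc: "x * sqrt (2 / pi) / sqrt (2 * pi) = x / pi" for x
  using c by (metis mult.right_neutral times_divide_eq_right)
 have "ennreal ((ta * sqrt (2 / pi) - ta ^ 3 * (2 * sqrt (2 / pi)) / 2) / sqrt (2 * pi)) \<le> ennreal (prob A)"
  using low[OF m1 m3'] nnA by simp
 hence "(ta * sqrt (2 / pi) - ta ^ 3 * (2 * sqrt (2 / pi)) / 2) / sqrt (2 * pi) \<le> prob A"
  by (simp add: ennreal_le_iff)
 moreover have "(ta * sqrt (2 / pi) - ta ^ 3 * (2 * sqrt (2 / pi)) / 2) / sqrt (2 * pi) = ta / pi - ta ^ 3 / pi"
  using cc[of ta] cc[of "ta ^ 3"] by (simp add: diff_divide_distrib)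
 moreover have "ta ^ 3 / pi \<le> ta ^ 3 / 3" "0 \<le> ta ^ 3" using ta divide_pi_le[of "ta ^ 3"] by auto
 ultimately show "ta / pi - ta ^ 3 \<le> prob A" by linarith
 have "ennreal (expectation (\<lambda>w. indicator A w * (E w)^2)) \<le> ennreal (ta * (2 * sqrt (2 / pi)) / sqrt (2 * pi))"
  using up[OF m3] nnE by simp
 hence le2: "expectation (\<lambda>w. indicator A w * (E w)^2) \<le> ta * (2 * sqrt (2 / pi)) / sqrt (2 * pi)"
  using ta by (subst (asm) ennreal_le_iff) auto
 thus leE: "expectation (\<lambda>w. indicator A w * (E w)^2) \<le> 2 * ta / pi"
  using cc[of "2 * ta"] by (simp add: ac_simps)
 have "ennreal ((ta * (2 * sqrt (2 / pi)) - ta ^ 3 * (8 * sqrt (2 / pi)) / 2) / sqrt (2 * pi)) \<le> ennreal (expectation (\<lambda>w. indicator A w * (E w)^2))"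
  using low[OF m3 m5] nnE by simp
 hence "(ta * (2 * sqrt (2 / pi)) - ta ^ 3 * (8 * sqrt (2 / pi)) / 2) / sqrt (2 * pi) \<le> expectation (\<lambda>w. indicator A w * (E w)^2)"
  by (subst (asm) ennreal_le_iff) auto
 moreover have "(ta * (2 * sqrt (2 / pi)) - ta ^ 3 * (8 * sqrt (2 / pi)) / 2) / sqrt (2 * pi) = 2 * ta / pi - 4 * ta ^ 3 / pi"
  using cc[of "2 * ta"] cc[of "4 * ta ^ 3"] by (simp add: diff_divide_distrib ac_simps)
 moreover have "4 * ta ^ 3 / pi \<le> 2 * ta ^ 3"
  using divide_pi_le[of "4 * ta ^ 3"] zero_le_power[OF ta, of 3] by linarith
 ultimately show "2 * ta / pi - 2 * ta ^ 3 \<le> expectation (\<lambda>w. indicator A w * (E w)^2)" by linarith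
 have "expectation (\<lambda>w. indicator A w * (X w)^2) \<le> expectation (\<lambda>w. ta^2 * (indicator A w * (E w)^2))"
 proof (rule integral_mono[OF intX])
  show "integrable M (\<lambda>w. ta^2 * (indicator A w * (E w)^2))" using intE by simp
  fix w
  have "(X w)^2 \<le> ta^2 * (E w)^2" if "w \<in> A"
  proof -
   have "X w * (X w + ta * E w) < 0" using that by (simp add: A_def)
   hence "\<bar>X w\<bar> \<le> \<bar>ta * E w\<bar>" unfolding mult_less_0_iff by linarith
   hence "(X w)^2 \<le> (ta * E w)^2" by (simp add: abs_le_square_iff)
   thus ?thesis by (simp add: power_mult_distrib)
  qed
  thus "indicator A w * (X w)^2 \<le> ta^2 * (indicator A w * (E w)^2)" by (auto simp: indicator_def)
 qed
 also have "... = ta^2 * expectation (\<lambda>w. indicator A w * (E w)^2)" by simp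
 also have "... \<le> ta^2 * (2 * ta / pi)" by (intro mult_left_mono leE) auto
 also have "... \<le> ta ^ 3"
 proof -
  have "ta^2 * (2 * ta / pi) = 2 * ta ^ 3 / pi" by (simp add: power2_eq_square power3_eq_cube)
  thus ?thesis using divide_pi_le[of "2 * ta ^ 3"] zero_le_power[OF ta, of 3] by linarith
 qed
 finally show "expectation (\<lambda>w. indicator A w * (X w)^2) \<le> ta ^ 3" .
qed

text \<open>On a sign change \<open>X\<close> is nearly 0, and \<open>E\<close> is biased by its
  size: its mean square is 2 instead of 1. The component of \<open>xs\<close> orthogonal to both is
  independent of the event. Hence the mean of \<open>xs^2\<close> gains \<open>(ip xs E)^2\<close>
  and loses \<open>(ip xs X)^2\<close>, in proportion to the probability of the event.\<close>

lemma sign_change_square_covariance: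
 assumes X: "X \<in> H" "ip X X = 1" and E: "E \<in> H" "ip E E = 1" and XE: "ip X E = 0"
  and ta: "0 \<le> ta" and xs: "xs \<in> H"
 defines "A \<equiv> {w \<in> space M. X w * (X w + ta * E w) < 0}"
 shows "\<bar>expectation (\<lambda>w. indicator A w * (xs w)^2) - prob A * ip xs xs - ta / pi * ((ip xs E)^2 - (ip xs X)^2)\<bar>
  \<le> (ta^2 + 3 * ta ^ 3) * ip xs xs"
proof -
 have [measurable]: "X \<in> borel_measurable M" "E \<in> borel_measurable M" "xs \<in> borel_measurable M" using X E xs H_meas by auto
 have Am[measurable]: "A \<in> sets M" unfolding A_def by measurable
 define al where "al = ip xs X"
 define bt where "bt = ip xs E"
 define et where "et = (\<lambda>w. xs w - al * X w - bt * E w)"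
 have EX: "ip E X = 0" using XE by (simp add: ip_commute)
 have et: "et \<in> H" "ip et X = 0" "ip et E = 0" "ip et et = ip xs xs - al^2 - bt^2"
  using X E xs XE EX
  by (auto simp: et_def H_intros ip_linear al_def bt_def ip_commute[of X xs] ip_commute[of E xs])
   (simp add: power2_eq_square algebra_simps)
 have [measurable]: "et \<in> borel_measurable M" using et H_meas by auto
 have xs_eq: "xs w = al * X w + bt * E w + et w" for w by (simp add: et_def)
 \<comment> \<open>Any function of the remainder \<open>et\<close> splits off, because the event and
   the factor \<open>g\<close> depend on \<open>X\<close> and \<open>E\<close> only.\<close>
 have ind: "expectation (\<lambda>w. indicator A w * g (X w) (E w) * k (et w)) =
   expectation (\<lambda>w. indicator A w * g (X w) (E w)) * expectation (\<lambda>w. k (et w))"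
  if k: "k \<in> borel_measurable borel"
   and g: "(\<lambda>z. g (z X) (z E)) \<in> borel_measurable (PiM {X, E} (\<lambda>_. borel))"
   and i: "integrable M (\<lambda>w. indicator A w * g (X w) (E w))" "integrable M (\<lambda>w. k (et w))" for g :: "real \<Rightarrow> real \<Rightarrow> real" and k
 proof -
  let ?h = "\<lambda>z. of_bool (z X * (z X + ta * z E) < 0) * g (z X) (z E)"
  let ?V = "\<lambda>w. ?h (\<lambda>Y\<in>{X, E}. Y w)"
  have V: "of_bool (X w * (X w + ta * E w) < 0) = indicat_real A w" if "w \<in> space M" for w using that by (simp add: A_def indicator_def)
  have "(\<lambda>z. z X) \<in> borel_measurable (PiM {X, E} (\<lambda>_. borel))" "(\<lambda>z. z E) \<in> borel_measurable (PiM {X, E} (\<lambda>_. borel))"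
   by (simp_all add: measurable_component_singleton)
  hence "?h \<in> borel_measurable (PiM {X, E} (\<lambda>_. borel))"
   by (intro borel_measurable_times g) simp
  hence "indep_var borel ?V borel (\<lambda>w. k (et w))"
   using X E et XE EX by (intro orthogonal_indep_var k) (auto simp: pairwise_insert ip_commute[of X et] ip_commute[of E et])
  hence "expectation (\<lambda>w. ?V w * k (et w)) = expectation ?V * expectation (\<lambda>w. k (et w))"
   using i by (intro indep_var_lebesgue_integral) (simp_all add: V cong: Bochner_Integration.integrable_cong)
  thus ?thesis by (simp add: V cong: Bochner_Integration.integral_cong)
 qed
 have ib: "integrable M (\<lambda>w. indicator A w * f w)" if "integrable M f" for f :: "_ \<Rightarrow> real"
  using integrable_mult_indicator[OF Am that] by simp
 have i1: "integrable M (\<lambda>w. indicator A w * (X w)^2)" "integrable M (\<lambda>w. indicator A w * (E w)^2)"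
  "integrable M (\<lambda>w. indicator A w * (X w * E w))" "integrable M (\<lambda>w. indicator A w * (et w)^2)"
  "integrable M (\<lambda>w. indicator A w * (X w * et w))" "integrable M (\<lambda>w. indicator A w * (E w * et w))"
  using X E et by (auto intro!: ib H_sq H_int_mult)
 have Eet: "expectation et = 0"
 proof -
  have "expectation (\<lambda>w. 1 * et w) = 0" 
  proof (cases "ip et et = 0")
   case True
   hence "AE w in M. (et w)\<^sup>2 = 0" using integral_nonneg_eq_0_iff_AE[OF H_sq[OF et(1)]] by (auto simp: ip_self)
   hence "expectation et = expectation (\<lambda>w. 0)" by (intro integral_cong_AE) auto
   thus ?thesis by simp
  next
   case False
   hence n: "nrm et \<noteq> 0" by (simp add: nrm_def)
   let ?G = "\<lambda>w. et w / nrm et"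
   have G: "?G \<in> H" "ip ?G ?G = 1" using et n by (auto simp: H_intros ip_linear nrm_sq[symmetric] power2_eq_square)
   have "has_bochner_integral M (\<lambda>w. ?G w) 0"
    by (rule has_bochner_integral_unit_normal[OF G]) (use std_normal_moment_odd[of 0] in auto)
   thus ?thesis using n by (simp add: has_bochner_integral_iff)
  qed
  thus ?thesis by simp
 qed
 have z: "expectation (\<lambda>w. indicator A w * (Y w * et w)) = 0" if Y: "Y = X \<or> Y = E" for Y
 proof -
  have "expectation (\<lambda>w. indicator A w * Y w * et w) = 0"
   using Y ind[of id "\<lambda>x e. x"] ind[of id "\<lambda>x e. e"] X E H_int et(1) by (auto simp: ib Eet)
  thus ?thesis by (simp add: mult.assoc)
 qed
 have pA: "expectation (\<lambda>w. indicator A w) = prob A" by simp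
 have zz: "expectation (\<lambda>w. indicator A w * (et w)^2) = prob A * ip et et"
  using ind[of power2 "\<lambda>x e. 1"] ib[of "\<lambda>_. 1"] H_sq[OF et(1)] by (simp add: ip_self)
 let ?x = "expectation (\<lambda>w. indicator A w * (X w)^2)" and ?e = "expectation (\<lambda>w. indicator A w * (E w)^2)"
  and ?m = "expectation (\<lambda>w. indicator A w * (X w * E w))" and ?p = "prob A"
 have main: "expectation (\<lambda>w. indicator A w * (xs w)^2) = al^2 * ?x + bt^2 * ?e + 2 * al * bt * ?m + ?p * ip et et"
 proof -
  have "expectation (\<lambda>w. indicator A w * (xs w)^2) = expectation (\<lambda>w. al^2 * (indicator A w * (X w)^2) + bt^2 * (indicator A w * (E w)^2)
    + (2 * al * bt) * (indicator A w * (X w * E w)) + indicator A w * (et w)^2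
    + (2 * al) * (indicator A w * (X w * et w)) + (2 * bt) * (indicator A w * (E w * et w)))"
   by (intro Bochner_Integration.integral_cong) (auto simp: xs_eq power2_eq_square algebra_simps)
  also have "... = al^2 * ?x + bt^2 * ?e + 2 * al * bt * ?m + ?p * ip et et"
   using i1 by (simp add: zz z)
  finally show ?thesis .
 qed
 note one = one_sign_change[OF X E XE ta, folded A_def]
 have m_le: "\<bar>?m\<bar> \<le> ta^2"
 proof -
  have "\<bar>?m\<bar> \<le> expectation (\<lambda>w. \<bar>indicator A w * (X w * E w)\<bar>)" by (rule integral_abs_bound)
  also have "... \<le> expectation (\<lambda>w. ta * (indicator A w * (E w)^2))"
  proof (rule integral_mono)
   show "integrable M (\<lambda>w. \<bar>indicator A w * (X w * E w)\<bar>)" using i1 by auto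
   show "integrable M (\<lambda>w. ta * (indicator A w * (E w)^2))" using i1 by auto
   fix w
   have "\<bar>X w * E w\<bar> \<le> ta * (E w)^2" if "w \<in> A"
   proof -
    have "X w * (X w + ta * E w) < 0" using that by (simp add: A_def)
    hence "\<bar>X w\<bar> \<le> \<bar>ta * E w\<bar>" unfolding mult_less_0_iff by linarith
    hence "\<bar>X w\<bar> * \<bar>E w\<bar> \<le> \<bar>ta * E w\<bar> * \<bar>E w\<bar>" by (rule mult_right_mono) simp
    also have "\<bar>ta * E w\<bar> * \<bar>E w\<bar> = ta * (E w)^2" using ta by (simp add: abs_mult power2_eq_square mult.assoc)
    finally show ?thesis by (simp add: abs_mult)
   qed
   thus "\<bar>indicator A w * (X w * E w)\<bar> \<le> ta * (indicator A w * (E w)^2)" by (auto simp: indicator_def)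
  qed
  also have "... = ta * ?e" by simp
  also have "... \<le> ta * (2 * ta / pi)" by (intro mult_left_mono one ta)
  also have "... \<le> ta^2" 
  proof -
   have "ta * (2 * ta / pi) = 2 * ta^2 / pi" by (simp add: power2_eq_square)
   thus ?thesis using divide_pi_le[of "2 * ta^2"] zero_le_power2[of ta] by linarith
  qed
  finally show ?thesis .
 qed
 have x0: "0 \<le> ?x" "0 \<le> ?e" by simp_all
 have t30: "0 \<le> ta ^ 3" using ta by simp
 have bes: "al^2 + bt^2 \<le> ip xs xs" using et(4) ip_self_nonneg[of et] by linarith
 let ?T = "ta ^ 3"
 have b1: "\<bar>?x - (?p - ta / pi)\<bar> \<le> 3 * ?T" using one(1,2,3) x0 t30 by linarith
 have b2: "\<bar>?e - ?p - ta / pi\<bar> \<le> 3 * ?T"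
 proof -
  have "2 * ta / pi = ta / pi + ta / pi" by simp
  thus ?thesis using one(1,2,4,5) t30 by linarith
 qed
 have b3: "\<bar>2 * al * bt * ?m\<bar> \<le> (al^2 + bt^2) * ta^2"
 proof -
  have "\<bar>2 * al * bt\<bar> \<le> al^2 + bt^2" using sum_squares_bound[of "\<bar>al\<bar>" "\<bar>bt\<bar>"] by (simp add: abs_mult)
  thus ?thesis unfolding abs_mult[of _ ?m] using m_le by (intro mult_mono) auto
 qed
 have "expectation (\<lambda>w. indicator A w * (xs w)^2) - ?p * ip xs xs - ta / pi * (bt^2 - al^2) =
   al^2 * (?x - (?p - ta / pi)) + bt^2 * (?e - ?p - ta / pi) + 2 * al * bt * ?m"
  unfolding main et(4) by (simp add: algebra_simps)
 also have "\<bar>...\<bar> \<le> al^2 * (3 * ?T) + bt^2 * (3 * ?T) + (al^2 + bt^2) * ta^2"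
 proof -
  have "\<bar>al^2 * (?x - (?p - ta / pi))\<bar> \<le> al^2 * (3 * ?T)" unfolding abs_mult using b1 by (simp add: mult_left_mono)
  moreover have "\<bar>bt^2 * (?e - ?p - ta / pi)\<bar> \<le> bt^2 * (3 * ?T)" unfolding abs_mult using b2 by (simp add: mult_left_mono)
  ultimately show ?thesis using b3 by linarith
 qed
 also have "... = (ta^2 + 3 * ?T) * (al^2 + bt^2)" by (simp add: algebra_simps)
 also have "... \<le> (ta^2 + 3 * ?T) * ip xs xs" using bes t30 by (intro mult_left_mono) auto
 finally show ?thesis by (simp add: al_def bt_def)
qed

end

text \<open>The Kac-Rice two-point density, expanded around independence. The factor \<open>P / sqrt (P - e^2)\<close>
 comes from the bound on the mean absolute product of two correlated normal variables.\<close>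

lemma kac_rice_density_le:
 fixes r b c d :: real
 assumes small: "\<bar>r\<bar> \<le> 1/5" "\<bar>b\<bar> \<le> 1/5" "\<bar>c\<bar> \<le> 1/5" "\<bar>d\<bar> \<le> 1/5"
 defines "u \<equiv> 1 - r^2"
 defines "P \<equiv> (1 - b^2 / u) * (1 - c^2 / u)" and "e \<equiv> d + r * b * c / u"
  and "F \<equiv> r ^ 4 + b ^ 4 + c ^ 4 + d ^ 4"
 shows "e^2 < P" and "P / (sqrt (P - e^2) * sqrt u) \<le> 1 + (r^2 - b^2 - c^2 + d^2) / 2 + 6 * F"
proof -
 define R B C D where "R = r^2" and "B = b^2" and "C = c^2" and "D = d^2"
 have sq: "x^2 \<le> 1/25" if "\<bar>x\<bar> \<le> 1/5" for x :: real
  using power_mono[OF that, of 2] by (simp add: power_divide)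
 have nn: "0 \<le> R" "0 \<le> B" "0 \<le> C" "0 \<le> D" by (simp_all add: R_def B_def C_def D_def)
 have le: "R \<le> 1/25" "B \<le> 1/25" "C \<le> 1/25" "D \<le> 1/25"
  using sq small by (simp_all add: R_def B_def C_def D_def)
 have F: "F = R^2 + B^2 + C^2 + D^2" by (simp add: F_def R_def B_def C_def D_def)
 have sqle: "x^2 \<le> x / 25" "x^2 \<le> 1/625" if "0 \<le> x" "x \<le> 1/25" for x :: real
 proof -
  have "x * x \<le> x * (1/25)" using that by (intro mult_left_mono)
  thus "x^2 \<le> x / 25" by (simp add: power2_eq_square)
  thus "x^2 \<le> 1/625" using that by linarith
 qed
 have F0: "0 \<le> F" by (simp add: F)
 have F1: "F \<le> 4/625" using sqle[OF nn(1) le(1)] sqle[OF nn(2) le(2)] sqle[OF nn(3) le(3)] sqle[OF nn(4) le(4)] F by linarith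
 have u: "24/25 \<le> u" "u \<le> 1" using le nn by (simp_all add: u_def R_def)
 have iu: "1 \<le> 1 / u" "1 / u \<le> 25/24" using u by (simp_all add: field_simps)
 \<comment> \<open>All terms of \<open>e^2\<close> other than \<open>d^2\<close> have order at least
   four and go into \<open>F\<close>.\<close>
 have "e^2 \<le> D + F"
 proof -
  have "e^2 = D + 2 * (d * r * b * c) / u + R * B * C / u^2"
   using u by (simp add: e_def D_def R_def B_def C_def power2_sum power_divide algebra_simps)
  moreover have "2 * (d * r * b * c) / u \<le> 25/48 * F"
  proof -
   have a1: "2 * (d * r * b * c) \<le> D * R + B * C"
    using sum_squares_bound[of "d * r" "b * c"] by (simp add: D_def R_def B_def C_def algebra_simps)
   also have "... \<le> F / 2"
    using sum_squares_bound[of D R] sum_squares_bound[of B C] by (simp add: F)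
   finally have "2 * (d * r * b * c) / u \<le> (F / 2) / u" using u by (intro divide_right_mono) auto
   also have "... = (F / 2) * (1 / u)" by simp
   also have "... \<le> (F / 2) * (25/24)" using iu F0 by (intro mult_left_mono) auto
   finally show ?thesis by simp
  qed
  moreover have "R * B * C / u^2 \<le> F / 25"
  proof -
   have "(1 / u)^2 \<le> (25/24)^2" by (rule power_mono[OF iu(2)]) (use iu(1) in linarith)
   hence i2: "1 / u^2 \<le> 2" by (simp add: power_divide)
   have "R * B * C \<le> (1/25) * (B * C)" using le nn by (subst mult.assoc) (intro mult_right_mono, auto)
   also have "... \<le> (1/25) * (F / 2)"
   proof -
    have "2 * (B * C) \<le> F"
     using sum_squares_bound[of B C, unfolded mult.assoc] zero_le_power2[of R] zero_le_power2[of D] unfolding F by linarith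
    thus ?thesis by simp
   qed
   finally have "R * B * C * (1 / u^2) \<le> ((1/25) * (F / 2)) * 2"
    by (rule mult_mono[OF _ i2]) (use F0 nn in simp_all)
   thus ?thesis by simp
  qed
  ultimately show ?thesis using F0 by linarith
 qed
 note e2 = this
 define Q where "Q = (1 - B) * (1 - C)"
 have Bu: "B \<le> B / u" "B / u \<le> 1/24" "C \<le> C / u" "C / u \<le> 1/24"
 proof -
  have gen: "x \<le> x / u" "x / u \<le> 1/24" if "0 \<le> x" "x \<le> 1/25" for x
  proof -
   show "x \<le> x / u" using mult_left_mono[OF iu(1) that(1)] by simp
   have "x * (1 / u) \<le> (1/25) * (25/24)" by (rule mult_mono[OF that(2) iu(2)]) (use u(1) in auto)
   thus "x / u \<le> 1/24" by simp
  qed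
  show "B \<le> B / u" "B / u \<le> 1/24" "C \<le> C / u" "C / u \<le> 1/24" using gen nn le by auto
 qed
 have fac: "1 - B / u \<le> 1 - B" "1 - C / u \<le> 1 - C" "0 \<le> 1 - B" "0 \<le> 1 - C / u" "23/24 \<le> 1 - B / u" "23/24 \<le> 1 - C / u" "0 \<le> 1 - B / u"
  using Bu le by linarith+
 have PQ: "P \<le> Q"
  unfolding P_def Q_def B_def[symmetric] C_def[symmetric] by (rule mult_mono) (fact fac)+
 have Plow: "529/576 \<le> P"
 proof -
  have "(23/24) * (23/24) \<le> (1 - B / u) * (1 - C / u)" by (rule mult_mono) (use fac in auto)
  thus ?thesis by (simp add: P_def B_def C_def)
 qed
 have e2s: "e^2 \<le> 1/20" using e2 le F1 by linarith
 thus eP: "e^2 < P" using Plow by linarith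
 have Qe: "0 < Q - e^2" using eP PQ by linarith
 \<comment> \<open>The function \<open>x^2 / (x - e^2)\<close> increases once \<open>x\<close>
   exceeds \<open>2 * e^2\<close>, so \<open>P\<close> may be replaced by the larger
   \<open>Q\<close>, which no longer contains \<open>u\<close>.\<close>
 have mono: "P^2 / (P - e^2) \<le> Q^2 / (Q - e^2)"
 proof -
  have "0 \<le> (Q - P) * (P * Q - e^2 * (P + Q))"
  proof (intro mult_nonneg_nonneg)
   have "Q \<le> 1" unfolding Q_def using le nn by (intro mult_le_one) auto
   hence "e^2 * (P + Q) \<le> (1/20) * 2" using e2s PQ Plow by (intro mult_mono) auto
   moreover have "(529/576) * (529/576) \<le> P * Q" using Plow PQ by (intro mult_mono) auto
   ultimately show "0 \<le> P * Q - e^2 * (P + Q)" by simp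
  qed (use PQ in simp)
  hence "P^2 * (Q - e^2) \<le> Q^2 * (P - e^2)" by (simp add: power2_eq_square algebra_simps)
  thus ?thesis using eP Qe by (simp add: divide_simps)
 qed
 define q where "q = R - B - C + D"
 define m where "m = B + C + D + R + F"
 have sum4: "(R + B + C + D)^2 \<le> 4 * F"
 proof -
  have "0 \<le> (R-B)^2 + (R-C)^2 + (R-D)^2 + (B-C)^2 + (B-D)^2 + (C-D)^2" by simp
  thus ?thesis unfolding F by (simp add: power2_eq_square algebra_simps)
 qed
 have qm: "q * m \<le> 5 * F"
 proof -
  let ?s = "R + B + C + D"
  have "q * m \<le> ?s * (?s + F)" unfolding q_def m_def using nn F0 by (intro mult_mono) auto
  also have "... = ?s^2 + ?s * F" by (simp add: power2_eq_square algebra_simps)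
  also have "... \<le> 4 * F + 1 * F" using sum4 le F0 by (intro add_mono mult_right_mono) auto
  finally show ?thesis by simp
 qed
 have m1: "m \<le> 104/625" using le F1 by (simp add: m_def)
 have Q2: "Q^2 \<le> 1 - 2 * B - 2 * C + 4 * F"
 proof -
  let ?s = "B + C" and ?p = "B * C"
  have p: "0 \<le> ?p" "?p \<le> 1/25" using nn le mult_mono[of B "1/25" C 1] by auto
  have p2: "?p * ?p \<le> 1 * ?p" using p by (intro mult_right_mono) auto
  have sp: "0 \<le> ?s * ?p" using p nn by simp
  have "Q^2 = 1 - 2 * ?s + ?s^2 + 2 * ?p - 2 * (?s * ?p) + ?p * ?p"
   by (simp add: Q_def power2_eq_square algebra_simps)
  also have "... \<le> 1 - 2 * ?s + ?s^2 + 3 * ?p" using p2 sp by linarith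
  also have "... \<le> 1 - 2 * ?s + 4 * F"
  proof -
   have "?s^2 = B^2 + C^2 + 2 * ?p" by (simp add: power2_sum)
   moreover have "2 * ?p \<le> B^2 + C^2" using sum_squares_bound[of B C] by simp
   moreover have "B^2 + C^2 \<le> F" by (simp add: F)
   ultimately show ?thesis using F0 by linarith
  qed
  finally show ?thesis by simp
 qed
 have den: "1 - m \<le> (Q - e^2) * u"
 proof -
  have "(Q - e^2) * u = Q - e^2 - R * (Q - e^2)" by (simp add: u_def R_def algebra_simps)
  moreover have "R * (Q - e^2) \<le> R * 1"
  proof (rule mult_left_mono)
   have "Q \<le> 1" unfolding Q_def using le nn by (intro mult_le_one) auto
   thus "Q - e^2 \<le> 1" using zero_le_power2[of e] by linarith
  qed (rule nn)
  moreover have "1 - B - C \<le> Q" using nn by (simp add: Q_def algebra_simps)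
  ultimately show ?thesis using e2 by (simp add: m_def)
 qed
 \<comment> \<open>The budget in units of \<open>F\<close>: \<open>q * m\<close> costs 5,
   \<open>m\<close> itself contains 1, the bound for \<open>Q^2\<close> contains 4, and
   \<open>12 * (1 - m)\<close> still exceeds 10.\<close>
 have key: "Q^2 \<le> (1 + q + 12 * F) * (1 - m)"
 proof -
  have "(1 + q + 12 * F) * (1 - m) = 1 - m + q - q * m + 12 * F * (1 - m)" by (simp add: algebra_simps)
  moreover have "12 * F * (521/625) \<le> 12 * F * (1 - m)" using m1 F0 by (intro mult_left_mono) auto
  ultimately show ?thesis using Q2 qm F0 m_def q_def by linarith
 qed
 have x0: "0 \<le> 1 + q / 2 + 6 * F" using le nn F0 q_def by linarith
 have T0: "0 \<le> P / (sqrt (P - e^2) * sqrt u)" using eP u Plow by simp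
 have "(P / (sqrt (P - e^2) * sqrt u))^2 = (P^2 / (P - e^2)) / u"
  using eP u by (simp add: power_divide power_mult_distrib)
 also have "... \<le> (Q^2 / (Q - e^2)) / u" using mono u by (intro divide_right_mono) auto
 also have "... = Q^2 / ((Q - e^2) * u)" by simp
 also have "... \<le> Q^2 / (1 - m)" using den m1 Qe u by (intro divide_left_mono) auto
 also have "... \<le> 1 + q + 12 * F" using key m1 by (simp add: divide_le_eq)
 also have "... \<le> (1 + q / 2 + 6 * F)^2"
  using zero_le_power2[of "q / 2 + 6 * F"] by (simp add: power2_eq_square algebra_simps)
 finally have "P / (sqrt (P - e^2) * sqrt u) \<le> 1 + q / 2 + 6 * F"
  using x0 by (rule power2_le_imp_le)
 thus "P / (sqrt (P - e^2) * sqrt u) \<le> 1 + (r^2 - b^2 - c^2 + d^2) / 2 + 6 * F"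
  by (simp add: q_def R_def B_def C_def D_def)
qed

section \<open>Regression on two values and the probability of two crossings\<close>

context gauss_space
begin

text \<open>The residual of \<open>V\<close> after regression on two unit vectors; the coefficients
  come from the inverse of their Gram matrix.\<close>

definition perp :: "('w \<Rightarrow> real) \<Rightarrow> ('w \<Rightarrow> real) \<Rightarrow> ('w \<Rightarrow> real) \<Rightarrow> 'w \<Rightarrow> real" where
 "perp X1 X2 V = (\<lambda>w. V w - (ip V X1 - ip X1 X2 * ip V X2) / (1 - (ip X1 X2)^2) * X1 w
   - (ip V X2 - ip X1 X2 * ip V X1) / (1 - (ip X1 X2)^2) * X2 w)"

context
 fixes X1 X2 :: "'w \<Rightarrow> real"
 assumes X: "X1 \<in> H" "X2 \<in> H" and XX: "ip X1 X1 = 1" "ip X2 X2 = 1" and r: "(ip X1 X2)^2 < 1"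
begin

lemma perp_H: "V \<in> H \<Longrightarrow> perp X1 X2 V \<in> H"
 using X by (simp add: perp_def H_intros)

lemma perp_orth:
 assumes V: "V \<in> H"
 shows "ip (perp X1 X2 V) X1 = 0" "ip (perp X1 X2 V) X2 = 0"
  "ip X1 (perp X1 X2 V) = 0" "ip X2 (perp X1 X2 V) = 0"
proof -
 define u where "u = 1 - (ip X1 X2)^2"
 have u: "u \<noteq> 0" using r by (simp add: u_def)
 have X21: "ip X2 X1 = ip X1 X2" by (rule ip_commute)
 define al where "al = (ip V X1 - ip X1 X2 * ip V X2) / u"
 define bt where "bt = (ip V X2 - ip X1 X2 * ip V X1) / u"
 have pe: "perp X1 X2 V = (\<lambda>w. V w - al * X1 w - bt * X2 w)" by (simp add: perp_def al_def bt_def u_def)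
 have "al + bt * ip X1 X2 = ip V X1" "al * ip X1 X2 + bt = ip V X2"
  using u unfolding al_def bt_def by (simp_all add: add_divide_distrib[symmetric] divide_eq_eq)
   (simp_all add: u_def power2_eq_square algebra_simps)
 thus 1: "ip (perp X1 X2 V) X1 = 0" and 2: "ip (perp X1 X2 V) X2 = 0"
  unfolding pe using V X by (simp_all add: ip_linear H_intros XX X21)
 show "ip X1 (perp X1 X2 V) = 0" using 1 by (simp add: ip_commute)
 show "ip X2 (perp X1 X2 V) = 0" using 2 by (simp add: ip_commute)
qed

lemma ip_perp_right: "V \<in> H \<Longrightarrow> W \<in> H \<Longrightarrow> ip (perp X1 X2 V) (perp X1 X2 W) = ip V (perp X1 X2 W)"
 unfolding perp_def[of X1 X2 V] using X perp_H[of W] perp_orth[of W]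
 by (simp add: ip_linear H_intros)

lemma nrm_perp_le: assumes V: "V \<in> H" shows "nrm (perp X1 X2 V) \<le> nrm V"
proof -
 have "(nrm (perp X1 X2 V))^2 = ip V (perp X1 X2 V)" using ip_perp_right[OF V V] by (simp add: nrm_sq)
 also have "... \<le> nrm V * nrm (perp X1 X2 V)" using ip_le_nrm[OF V perp_H[OF V]] by linarith
 finally have "nrm (perp X1 X2 V) * nrm (perp X1 X2 V) \<le> nrm V * nrm (perp X1 X2 V)" by (simp add: power2_eq_square)
 thus ?thesis using nrm_nonneg[of "perp X1 X2 V"]
  by (cases "nrm (perp X1 X2 V) = 0") auto
qed

text \<open>A regression coefficient is the pairing of \<open>V\<close> with
  \<open>X1 - r * X2\<close> or \<open>X2 - r * X1\<close>, where \<open>r = ip X1 X2\<close>,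
  divided by the square of the norm \<open>sqrt (1 - r^2)\<close> of that vector; Cauchy-Schwarz
  does the rest.\<close>

lemma perp_coeff_le:
 assumes V: "V \<in> H"
 shows "\<bar>(ip V X1 - ip X1 X2 * ip V X2) / (1 - (ip X1 X2)^2)\<bar> \<le> nrm V / sqrt (1 - (ip X1 X2)^2)"
  and "\<bar>(ip V X2 - ip X1 X2 * ip V X1) / (1 - (ip X1 X2)^2)\<bar> \<le> nrm V / sqrt (1 - (ip X1 X2)^2)"
proof -
 define rh where "rh = ip X1 X2"
 define u where "u = 1 - rh^2"
 have u: "0 < u" using r by (simp add: u_def rh_def)
 have X21: "ip X2 X1 = rh" by (simp add: rh_def ip_commute)
 have gen: "\<bar>(ip V A - rh * ip V B) / u\<bar> \<le> nrm V / sqrt u"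
  if "A \<in> H" "B \<in> H" "ip A A = 1" "ip B B = 1" "ip A B = rh" "ip B A = rh" for A B
 proof -
  let ?G = "\<lambda>w. A w - rh * B w"
  have G: "?G \<in> H" using that by (simp add: H_intros)
  have "ip ?G ?G = u" using that by (simp add: ip_linear H_intros u_def power2_eq_square)
  hence nG: "nrm ?G = sqrt u" by (simp add: nrm_def)
  have "\<bar>ip V ?G\<bar> \<le> nrm V * sqrt u" using ip_le_nrm[OF V G] nG by simp
  moreover have "ip V ?G = ip V A - rh * ip V B" using that V by (simp add: ip_linear H_intros)
  ultimately have "\<bar>ip V A - rh * ip V B\<bar> / u \<le> nrm V * sqrt u / u" using u by (intro divide_right_mono) auto
  also have "nrm V * sqrt u / u = nrm V / sqrt u" using u by (simp add: field_simps)
  finally show ?thesis using u by simp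
 qed
 show "\<bar>(ip V X1 - ip X1 X2 * ip V X2) / (1 - (ip X1 X2)^2)\<bar> \<le> nrm V / sqrt (1 - (ip X1 X2)^2)"
  by (rule gen[OF X(1) X(2) XX(1) XX(2) rh_def[symmetric] X21, unfolded u_def rh_def])
 show "\<bar>(ip V X2 - ip X1 X2 * ip V X1) / (1 - (ip X1 X2)^2)\<bar> \<le> nrm V / sqrt (1 - (ip X1 X2)^2)"
  by (rule gen[OF X(2) X(1) XX(2) XX(1) X21 rh_def[symmetric], unfolded u_def rh_def])
qed

lemma perp_diff_scale:
 "V \<in> H \<Longrightarrow> W \<in> H \<Longrightarrow> perp X1 X2 (\<lambda>w. V w - c * W w) = (\<lambda>w. perp X1 X2 V w - c * perp X1 X2 W w)"
 unfolding perp_def using X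
 by (simp add: ip_linear H_intros) (simp add: diff_divide_distrib add_divide_distrib algebra_simps)

text \<open>The residual does not see the span, so an increment may be corrected by any multiple of
  the chord \<open>X2 - X1\<close>. For close points this removes its first-order part.\<close>

lemma perp_diff_X:
 assumes V: "V \<in> H" shows "perp X1 X2 (\<lambda>w. V w - c * (X2 w - X1 w)) = perp X1 X2 V"
proof -
 define u where "u = 1 - (ip X1 X2)^2"
 have u: "u \<noteq> 0" using r by (simp add: u_def)
 have "ip X2 X1 = ip X1 X2" by (rule ip_commute)
 moreover have "perp X1 X2 (\<lambda>w. X2 w - X1 w) = (\<lambda>w. 0)"
 proof -
  have z: "ip (\<lambda>w. X2 w - X1 w) X1 = ip X1 X2 - 1" "ip (\<lambda>w. X2 w - X1 w) X2 = 1 - ip X1 X2"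
   using X XX \<open>ip X2 X1 = ip X1 X2\<close> by (simp_all add: ip_linear)
  have "(ip X1 X2 - 1 - ip X1 X2 * (1 - ip X1 X2)) / u = -1" "(1 - ip X1 X2 - ip X1 X2 * (ip X1 X2 - 1)) / u = 1"
   using u by (simp_all add: u_def power2_eq_square field_simps)
  thus ?thesis unfolding perp_def z u_def[symmetric] by simp
 qed
 ultimately show ?thesis
  using perp_diff_scale[OF V, of "\<lambda>w. X2 w - X1 w" c] X by (simp add: H_intros)
qed

lemma sign_changes_perp_le:
 assumes D: "D1 \<in> H" "D2 \<in> H"
  and bt: "nrm D1 / sqrt (1 - (ip X1 X2)^2) \<le> bt" "nrm D2 / sqrt (1 - (ip X1 X2)^2) \<le> bt" "bt \<le> 1/4"
 shows "prob {w \<in> space M. X1 w * (X1 w + D1 w) < 0 \<and> X2 w * (X2 w + D2 w) < 0} \<le>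
  (expectation (\<lambda>w. \<bar>perp X1 X2 D1 w * perp X1 X2 D2 w\<bar>)
   + 16 * bt * (ip (perp X1 X2 D1) (perp X1 X2 D1) + ip (perp X1 X2 D2) (perp X1 X2 D2))) / (2 * pi * sqrt (1 - (ip X1 X2)^2))"
proof (rule two_sign_changes_le[OF X XX r perp_H[OF D(1)] perp_H[OF D(2)]])
 show "\<bar>(ip D1 X1 - ip X1 X2 * ip D1 X2) / (1 - (ip X1 X2)^2)\<bar> \<le> bt"
  "\<bar>(ip D1 X2 - ip X1 X2 * ip D1 X1) / (1 - (ip X1 X2)^2)\<bar> \<le> bt"
  using perp_coeff_le[OF D(1)] bt by linarith+
 show "\<bar>(ip D2 X1 - ip X1 X2 * ip D2 X2) / (1 - (ip X1 X2)^2)\<bar> \<le> bt"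
  "\<bar>(ip D2 X2 - ip X1 X2 * ip D2 X1) / (1 - (ip X1 X2)^2)\<bar> \<le> bt"
  using perp_coeff_le[OF D(2)] bt by linarith+
qed (use perp_orth D bt in \<open>auto simp: perp_def\<close>)

end

end

text \<open>\<open>si\<close> is the standard deviation of the derivative, so that \<open>y\<close>
  is the derivative in the natural time unit, and \<open>C1\<close> controls the second derivative
  in that unit. The mean-square bounds \<open>taylor\<close> and \<open>y_lip\<close> serve the
  probability estimates; the bounds on single paths serve to identify sign changes with
  zeros.\<close>

locale gauss_process = gauss_space M H for M :: "'w measure" and H +
 fixes f y :: "real \<Rightarrow> 'w \<Rightarrow> real" and L si C1 :: real
 assumes L_pos: "0 < L" and sg_pos: "0 < si" and C1_ge: "1 \<le> C1"
  and f_H: "t \<in> {0..L} \<Longrightarrow> f t \<in> H" and y_H: "t \<in> {0..L} \<Longrightarrow> y t \<in> H"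
  and ff: "t \<in> {0..L} \<Longrightarrow> ip (f t) (f t) = 1"
  and yy: "t \<in> {0..L} \<Longrightarrow> ip (y t) (y t) = 1"
  and fy: "t \<in> {0..L} \<Longrightarrow> ip (f t) (y t) = 0"
  and taylor: "t \<in> {0..L} \<Longrightarrow> s \<in> {0..L} \<Longrightarrow>
   nrm (\<lambda>w. f s w - f t w - (s - t) * si * y t w) \<le> C1 / 2 * (si * (s - t))^2"
  and y_lip: "t \<in> {0..L} \<Longrightarrow> s \<in> {0..L} \<Longrightarrow> nrm (\<lambda>w. y s w - y t w) \<le> C1 * si * \<bar>s - t\<bar>"
  and path_deriv: "w \<in> space M \<Longrightarrow> t \<in> {0..L} \<Longrightarrow>
   ((\<lambda>t. f t w) has_real_derivative si * y t w) (at t within {0..L})"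
  and path_lip: "w \<in> space M \<Longrightarrow> \<exists>B. \<forall>t\<in>{0..L}. \<forall>s\<in>{0..L}. \<bar>y s w - y t w\<bar> \<le> B * \<bar>s - t\<bar>"
begin

lemma yf: "t \<in> {0..L} \<Longrightarrow> ip (y t) (f t) = 0"
 using fy by (simp add: ip_commute)

lemma nrm_f: "t \<in> {0..L} \<Longrightarrow> nrm (f t) = 1" and nrm_y: "t \<in> {0..L} \<Longrightarrow> nrm (y t) = 1"
 by (simp_all add: nrm_def ff yy)

lemma f_meas: "t \<in> {0..L} \<Longrightarrow> f t \<in> borel_measurable M" and y_meas: "t \<in> {0..L} \<Longrightarrow> y t \<in> borel_measurable M"
 using f_H y_H H_meas by auto

lemma nrm_increment:
 assumes t: "t \<in> {0..L}" and s: "s \<in> {0..L}" and small: "C1 * (si * \<bar>s - t\<bar>) \<le> 1"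
 shows "nrm (\<lambda>w. f s w - f t w) \<le> 2 * (si * \<bar>s - t\<bar>)"
  and "si * \<bar>s - t\<bar> / 2 \<le> nrm (\<lambda>w. f s w - f t w)"
  and "\<bar>nrm (\<lambda>w. f s w - f t w) - si * \<bar>s - t\<bar>\<bar> \<le> C1 / 2 * (si * \<bar>s - t\<bar>)^2"
proof -
 let ?te = "si * \<bar>s - t\<bar>"
 let ?D = "\<lambda>w. f s w - f t w" and ?R = "\<lambda>w. f s w - f t w - (s - t) * si * y t w" and ?Y = "\<lambda>w. (s - t) * si * y t w"
 have H: "?D \<in> H" "?R \<in> H" "?Y \<in> H" using f_H[OF t] f_H[OF s] y_H[OF t] by (auto intro!: H_intros)
 have nY: "nrm ?Y = ?te" using nrm_y[OF t] sg_pos by (simp add: nrm_scale abs_mult)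
 have sq: "(si * (s - t))^2 = ?te^2" by (simp add: power_mult_distrib)
 have nR: "nrm ?R \<le> C1 / 2 * ?te^2" using taylor[OF t s] by (simp only: sq)
 have a: "nrm ?D \<le> nrm ?R + nrm ?Y" using nrm_add[OF H(2,3)] by simp
 have b: "nrm ?Y \<le> nrm ?D + nrm ?R" using nrm_diff[OF H(1,2)] by simp
 show c: "\<bar>nrm ?D - ?te\<bar> \<le> C1 / 2 * ?te^2" using a b nY nR by linarith
 have "C1 / 2 * ?te^2 = (C1 * ?te) * ?te / 2" by (simp add: power2_eq_square)
 also have "... \<le> 1 * ?te / 2" using small sg_pos by (intro divide_right_mono mult_right_mono) auto
 finally have d: "C1 / 2 * ?te^2 \<le> ?te / 2" by simp
 have te0: "0 \<le> ?te" using sg_pos by simp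
 show "nrm ?D \<le> 2 * ?te" using c d by linarith
 show "?te / 2 \<le> nrm ?D" using c d by linarith
qed

lemma ip_increment:
 assumes t: "t \<in> {0..L}" and s: "s \<in> {0..L}"
 shows "ip (f t) (f s) = 1 - (nrm (\<lambda>w. f s w - f t w))^2 / 2"
 using f_H[OF t] f_H[OF s] ff[OF t] ff[OF s]
 by (simp add: nrm_sq ip_linear H_intros ip_commute[of "f s" "f t"] diff_divide_distrib)

definition cross :: "real \<Rightarrow> real \<Rightarrow> 'w set" where
 "cross h t = {w \<in> space M. f t w * f (t + h) w < 0}"

lemma cross_sets: "t \<in> {0..L} \<Longrightarrow> t + h \<in> {0..L} \<Longrightarrow> cross h t \<in> sets M"
proof -
 assume "t \<in> {0..L}" "t + h \<in> {0..L}"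
 hence [measurable]: "f t \<in> borel_measurable M" "f (t + h) \<in> borel_measurable M" using f_meas by auto
 show ?thesis unfolding cross_def by measurable
qed

text \<open>Twice the second-order term of \<open>kac_rice_density_le\<close>; its double integral
  becomes the leading part of the variance.\<close>

definition quad_cov :: "real \<Rightarrow> real \<Rightarrow> real" where
 "quad_cov t s = (ip (f t) (f s))^2 - (ip (y t) (f s))^2 - (ip (f t) (y s))^2 + (ip (y t) (y s))^2"

definition quart_cov :: "real \<Rightarrow> real \<Rightarrow> real" where
 "quart_cov t s = (ip (f t) (f s)) ^ 4 + (ip (y t) (f s)) ^ 4 + (ip (f t) (y s)) ^ 4 + (ip (y t) (y s)) ^ 4"

text \<open>With small covariances the regression is harmless and the increments may be replaced by
  \<open>si * h\<close> times \<open>y t\<close> and \<open>y s\<close>, at the cost of a cubic term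
  in \<open>si * h\<close>. The residuals of \<open>y t\<close> and \<open>y s\<close> have
  variances \<open>1 - b^2 / u\<close> and \<open>1 - c^2 / u\<close> and covariance
  \<open>d + r * b * c / u\<close>, which are the entries of
  \<open>kac_rice_density_le\<close>.\<close>

lemma prob_cross_cross_regular:
 assumes t: "t \<in> {0..L}" "t + h \<in> {0..L}" and s: "s \<in> {0..L}" "s + h \<in> {0..L}" and h: "0 < h"
  and small: "C1 * (si * h) \<le> 1/12"
  and cov: "\<bar>ip (f t) (f s)\<bar> \<le> 1/5" "\<bar>ip (y t) (f s)\<bar> \<le> 1/5" "\<bar>ip (f t) (y s)\<bar> \<le> 1/5" "\<bar>ip (y t) (y s)\<bar> \<le> 1/5"
 shows "prob (cross h t \<inter> cross h s) \<le>
  (si * h)^2 * ((1 + quad_cov t s / 2 + 6 * quart_cov t s) / pi^2 + (C1 + 67) * (si * h))"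
proof -
 define X1 X2 D1 D2 where "X1 = f t" and "X2 = f s" and "D1 = (\<lambda>w. f (t + h) w - f t w)" and "D2 = (\<lambda>w. f (s + h) w - f s w)"
 define te where "te = si * h"
 have te: "0 < te" using h sg_pos by (simp add: te_def)
 have tele: "te \<le> 1/12" "C1 * te \<le> 1"
  using small mult_right_mono[OF C1_ge, of te] te by (simp_all add: te_def)
 define r b c d where "r = ip (f t) (f s)" and "b = ip (y t) (f s)" and "c = ip (f t) (y s)" and "d = ip (y t) (y s)"
 define u where "u = 1 - r^2"
 have r25: "r^2 \<le> 1/25" using power_mono[of "\<bar>r\<bar>" "1/5" 2] cov(1) by (simp add: r_def power_divide)
 have u: "24/25 \<le> u" "u \<le> 1" using r25 by (simp_all add: u_def)
 have r1: "(ip X1 X2)^2 < 1" using r25 by (simp add: X1_def X2_def r_def)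
 have XH: "X1 \<in> H" "X2 \<in> H" and DH: "D1 \<in> H" "D2 \<in> H"
  using t s f_H by (auto simp: X1_def X2_def D1_def D2_def intro!: H_intros)
 have XX: "ip X1 X1 = 1" "ip X2 X2 = 1" using t s ff by (auto simp: X1_def X2_def)
 have YH: "y t \<in> H" "y s \<in> H" using t s y_H by auto
 note P = XH XX r1
 have nD: "nrm D1 \<le> 2 * te" "nrm D2 \<le> 2 * te"
  using nrm_increment(1)[OF t] nrm_increment(1)[OF s] h tele by (simp_all add: D1_def D2_def te_def)
 have su: "24/25 \<le> sqrt u"
 proof -
  have "(24/25::real)^2 \<le> u" using u by (simp add: power2_eq_square)
  thus ?thesis by (rule real_le_rsqrt)
 qed
 define p where "p = perp X1 X2"
 have pH: "p V \<in> H" if "V \<in> H" for V unfolding p_def by (rule perp_H[OF P that])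
 have pn: "nrm (p V) \<le> nrm V" if "V \<in> H" for V unfolding p_def by (rule nrm_perp_le[OF P that])
 have bt: "nrm D1 / sqrt (1 - (ip X1 X2)^2) \<le> 3 * te" "nrm D2 / sqrt (1 - (ip X1 X2)^2) \<le> 3 * te" "3 * te \<le> 1/4"
 proof -
  have ueq: "1 - (ip X1 X2)^2 = u" by (simp add: u_def r_def X1_def X2_def)
  have "3 * te * (24/25) \<le> 3 * te * sqrt u" using su te by (intro mult_left_mono) auto
  hence "2 * te \<le> 3 * te * sqrt u" using te by linarith
  moreover have "0 < sqrt u" using su by linarith
  ultimately show "nrm D1 / sqrt (1 - (ip X1 X2)^2) \<le> 3 * te" "nrm D2 / sqrt (1 - (ip X1 X2)^2) \<le> 3 * te"
   unfolding ueq using nD by (simp_all only: pos_divide_le_eq)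
  show "3 * te \<le> 1/4" using tele by simp
 qed
 have ev: "cross h t \<inter> cross h s = {w \<in> space M. X1 w * (X1 w + D1 w) < 0 \<and> X2 w * (X2 w + D2 w) < 0}"
  by (auto simp: cross_def X1_def X2_def D1_def D2_def)
 have bound: "prob (cross h t \<inter> cross h s) \<le> (expectation (\<lambda>w. \<bar>p D1 w * p D2 w\<bar>)
   + 16 * (3 * te) * (ip (p D1) (p D1) + ip (p D2) (p D2))) / (2 * pi * sqrt u)"
  using sign_changes_perp_le[OF P DH bt] unfolding ev p_def[symmetric]
  by (simp add: u_def r_def X1_def X2_def)
 define Y1 Y2 where "Y1 = p (y t)" and "Y2 = p (y s)"
 have Y: "Y1 \<in> H" "Y2 \<in> H" using pH YH by (auto simp: Y1_def Y2_def)
 have rem: "nrm (\<lambda>w. p D w - te * p V w) \<le> C1 / 2 * te^2"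
  if "D = D1 \<and> V = y t \<or> D = D2 \<and> V = y s" for D V
 proof -
  have DV: "D \<in> H" "V \<in> H" using that DH YH by auto
  have "nrm (\<lambda>w. D w - te * V w) \<le> C1 / 2 * te^2"
   using that taylor[OF t] taylor[OF s] by (auto simp: D1_def D2_def te_def mult.commute)
  hence "nrm (p (\<lambda>w. D w - te * V w)) \<le> C1 / 2 * te^2"
   using pn[of "\<lambda>w. D w - te * V w"] DV by (simp add: H_intros)
  thus ?thesis unfolding p_def perp_diff_scale[OF P DV] .
 qed
 have n1: "nrm (p D2) \<le> 2 * te" "nrm (p D1) \<le> 2 * te" using pn[OF DH(1)] pn[OF DH(2)] nD by linarith+
 have n2: "nrm (\<lambda>w. te * Y1 w) \<le> te"
  using pn[OF YH(1)] nrm_y[OF t(1)] te by (simp add: nrm_scale Y1_def)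
 have E1: "expectation (\<lambda>w. \<bar>p D1 w * p D2 w\<bar>) \<le> te^2 * expectation (\<lambda>w. \<bar>Y1 w * Y2 w\<bar>) + 2 * C1 * te ^ 3"
 proof -
  let ?A = "\<lambda>w. p D1 w - te * Y1 w" and ?B = "\<lambda>w. p D2 w - te * Y2 w"
  have AH: "?A \<in> H" "?B \<in> H" "(\<lambda>w. te * Y1 w) \<in> H" using pH DH Y by (auto intro!: H_intros)
  have nAB: "nrm ?A \<le> C1 / 2 * te^2" "nrm ?B \<le> C1 / 2 * te^2" using rem by (auto simp: Y1_def Y2_def)
  have int: "integrable M (\<lambda>w. \<bar>U w * V w\<bar>)" if "U \<in> H" "V \<in> H" for U V
   using H_int_mult[OF that] by auto
  have "expectation (\<lambda>w. \<bar>p D1 w * p D2 w\<bar>) \<le>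
   expectation (\<lambda>w. te^2 * \<bar>Y1 w * Y2 w\<bar> + \<bar>?A w * p D2 w\<bar> + \<bar>(te * Y1 w) * ?B w\<bar>)"
  proof (rule integral_mono)
   fix w
   have "p D1 w * p D2 w = te^2 * (Y1 w * Y2 w) + ?A w * p D2 w + (te * Y1 w) * ?B w"
    by (simp add: power2_eq_square algebra_simps)
   hence "\<bar>p D1 w * p D2 w\<bar> \<le> \<bar>te^2 * (Y1 w * Y2 w)\<bar> + \<bar>?A w * p D2 w\<bar> + \<bar>(te * Y1 w) * ?B w\<bar>" by linarith
   thus "\<bar>p D1 w * p D2 w\<bar> \<le> te^2 * \<bar>Y1 w * Y2 w\<bar> + \<bar>?A w * p D2 w\<bar> + \<bar>(te * Y1 w) * ?B w\<bar>"
    by (simp add: abs_mult)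
  qed (use int pH DH Y AH in \<open>auto simp del: abs_mult\<close>)
  also have "... = te^2 * expectation (\<lambda>w. \<bar>Y1 w * Y2 w\<bar>) + expectation (\<lambda>w. \<bar>?A w * p D2 w\<bar>) + expectation (\<lambda>w. \<bar>(te * Y1 w) * ?B w\<bar>)"
   using int[OF Y] int[OF AH(1) pH[OF DH(2)]] int[OF AH(3) AH(2)] by simp
  also have "expectation (\<lambda>w. \<bar>?A w * p D2 w\<bar>) \<le> (C1 / 2 * te^2) * (2 * te)"
   using expectation_abs_mult_le[OF AH(1) pH[OF DH(2)]] mult_mono[OF nAB(1) n1(1)] C1_ge by simp
  also have "expectation (\<lambda>w. \<bar>(te * Y1 w) * ?B w\<bar>) \<le> te * (C1 / 2 * te^2)"
   using expectation_abs_mult_le[OF AH(3) AH(2)] mult_mono[OF n2 nAB(2)] te by simp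
  finally have fin: "expectation (\<lambda>w. \<bar>p D1 w * p D2 w\<bar>) \<le>
   te^2 * expectation (\<lambda>w. \<bar>Y1 w * Y2 w\<bar>) + C1 / 2 * te^2 * (2 * te) + te * (C1 / 2 * te^2)" by simp
  have "0 \<le> C1 * (te * (te * te))" using te C1_ge by simp
  moreover have "C1 / 2 * te^2 * (2 * te) + te * (C1 / 2 * te^2) = 3/2 * (C1 * (te * (te * te)))"
   by (simp add: power2_eq_square)
  ultimately show ?thesis using fin by (simp add: power2_eq_square power3_eq_cube)
 qed
 have X21: "ip X2 X1 = r" "ip X1 X2 = r" by (simp_all add: r_def X1_def X2_def ip_commute[of "f s" "f t"])
 have covs: "ip (y t) X1 = 0" "ip (y t) X2 = b" "ip (y s) X1 = c" "ip (y s) X2 = 0" "ip (y s) (y t) = d"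
  using yf fy t s by (simp_all add: X1_def X2_def b_def c_def d_def ip_commute[of "y s"])
 have pYt: "Y1 = (\<lambda>w. y t w - (- (r * b) / u) * X1 w - (b / u) * X2 w)"
  unfolding Y1_def p_def perp_def covs X21 u_def by simp
 have pYs: "Y2 = (\<lambda>w. y s w - (c / u) * X1 w - (- (r * c) / u) * X2 w)"
  unfolding Y2_def p_def perp_def covs X21 u_def by simp
 have ipY: "ip (p V) (p W) = ip V (p W)" if "V \<in> H" "W \<in> H" for V W
  unfolding p_def by (rule ip_perp_right[OF P that])
 have Y11: "ip Y1 Y1 = 1 - b^2 / u"
 proof -
  have "ip Y1 Y1 = ip (y t) Y1" using ipY[OF YH(1) YH(1)] by (simp add: Y1_def)
  also have "... = 1 - b^2 / u" unfolding pYt using XH YH covs yy t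
   by (simp add: ip_linear H_intros power2_eq_square)
  finally show ?thesis .
 qed
 have Y22: "ip Y2 Y2 = 1 - c^2 / u"
 proof -
  have "ip Y2 Y2 = ip (y s) Y2" using ipY[OF YH(2) YH(2)] by (simp add: Y2_def)
  also have "... = 1 - c^2 / u" unfolding pYs using XH YH covs yy s
   by (simp add: ip_linear H_intros power2_eq_square)
  finally show ?thesis .
 qed
 have Y12: "ip Y1 Y2 = d + r * b * c / u"
 proof -
  have "ip Y1 Y2 = ip (y t) Y2" using ipY[OF YH(1) YH(2)] by (simp add: Y1_def Y2_def)
  also have "... = d + r * b * c / u" unfolding pYs using XH YH covs
   by (simp add: ip_linear H_intros d_def)
  finally show ?thesis .
 qed
 let ?P = "(1 - b^2 / u) * (1 - c^2 / u)" and ?e = "d + r * b * c / u"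
 have small': "\<bar>r\<bar> \<le> 1/5" "\<bar>b\<bar> \<le> 1/5" "\<bar>c\<bar> \<le> 1/5" "\<bar>d\<bar> \<le> 1/5" using cov by (simp_all add: r_def b_def c_def d_def)
 note K = kac_rice_density_le[OF small', folded u_def]
 have EY: "expectation (\<lambda>w. \<bar>Y1 w * Y2 w\<bar>) \<le> 2 / pi * (?P / sqrt (?P - ?e^2))"
  using expectation_abs_product_le[OF Y] K(1) unfolding Y11 Y22 Y12 by simp
 have ipD: "ip (p D1) (p D1) + ip (p D2) (p D2) \<le> 8 * te^2"
  using power_mono[OF n1(1), of 2] power_mono[OF n1(2), of 2] by (simp add: nrm_sq)
 let ?q = "1 + (r^2 - b^2 - c^2 + d^2) / 2 + 6 * (r ^ 4 + b ^ 4 + c ^ 4 + d ^ 4)"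
 have pos: "0 < 2 * pi * sqrt u" using u by simp
 have "prob (cross h t \<inter> cross h s) \<le>
   (te^2 * (2 / pi * (?P / sqrt (?P - ?e^2))) + 2 * C1 * te ^ 3 + 16 * (3 * te) * (8 * te^2)) / (2 * pi * sqrt u)"
 proof (rule order_trans[OF bound], rule divide_right_mono)
  have "te^2 * expectation (\<lambda>w. \<bar>Y1 w * Y2 w\<bar>) \<le> te^2 * (2 / pi * (?P / sqrt (?P - ?e^2)))"
   by (intro mult_left_mono EY) simp
  moreover have "16 * (3 * te) * (ip (p D1) (p D1) + ip (p D2) (p D2)) \<le> 16 * (3 * te) * (8 * te^2)"
   using te by (intro mult_left_mono ipD) auto
  ultimately show "expectation (\<lambda>w. \<bar>p D1 w * p D2 w\<bar>) + 16 * (3 * te) * (ip (p D1) (p D1) + ip (p D2) (p D2)) \<le>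
   te^2 * (2 / pi * (?P / sqrt (?P - ?e^2))) + 2 * C1 * te ^ 3 + 16 * (3 * te) * (8 * te^2)"
   using E1 by linarith
 qed (use pos in simp)
 also have "... = te^2 * ((?P / (sqrt (?P - ?e^2) * sqrt u)) / pi^2) + (2 * C1 + 384) * te ^ 3 / (2 * pi * sqrt u)"
 proof -
  have gen: "(a * (2 / k * (P / S)) + B + C) / (2 * k * U) = a * ((P / (S * U)) / k^2) + (B + C) / (2 * k * U)"
   for a k P S B C U :: real by (simp add: add_divide_distrib power2_eq_square)
  have "2 * C1 * te ^ 3 + 16 * (3 * te) * (8 * te^2) = (2 * C1 + 384) * te ^ 3"
   by (simp add: power2_eq_square power3_eq_cube algebra_simps)
  thus ?thesis unfolding gen by simp
 qed
 also have "... \<le> te^2 * (?q / pi^2) + (C1 + 67) * te ^ 3"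
 proof (rule add_mono)
  show "te^2 * ((?P / (sqrt (?P - ?e^2) * sqrt u)) / pi^2) \<le> te^2 * (?q / pi^2)"
   by (intro mult_left_mono divide_right_mono K(2)) auto
  have six: "144/25 \<le> 2 * pi * sqrt u"
  proof -
   have "2 * 3 * (24/25) \<le> 2 * pi * sqrt u" using su pi_gt3 by (intro mult_mono) auto
   thus ?thesis by simp
  qed
  have "(2 * C1 + 384) * te ^ 3 / (2 * pi * sqrt u) \<le> (2 * C1 + 384) * te ^ 3 / (144/25)"
   using six te C1_ge pos by (intro divide_left_mono) auto
  also have "... = ((2 * C1 + 384) / (144/25)) * te ^ 3" by simp
  \<comment> \<open>384 / (144/25) is slightly below 67.\<close>
  also have "... \<le> (C1 + 67) * te ^ 3" using C1_ge te by (intro mult_right_mono) auto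
  finally show "(2 * C1 + 384) * te ^ 3 / (2 * pi * sqrt u) \<le> (C1 + 67) * te ^ 3" .
 qed
 also have "... = te^2 * (?q / pi^2 + (C1 + 67) * te)" by (simp add: power2_eq_square power3_eq_cube algebra_simps)
 finally show ?thesis by (simp add: quad_cov_def quart_cov_def r_def b_def c_def d_def te_def)
qed

end

context gauss_process
begin

text \<open>Repulsion of zeros. With \<open>l\<close> the distance of the points in units of
  \<open>1 / si\<close>, the density factor \<open>1 / sqrt (1 - r^2)\<close> grows like 1 / l.
  After subtraction of the chord, however, the residual increments have norm at most
  \<open>C1 * (si * h) * l\<close>. Their product gains \<open>l^2\<close>, so the bound stays of
  order \<open>(si * h)^2\<close> uniformly down to \<open>24 * h\<close>.\<close>

lemma prob_cross_cross_near:
 assumes t: "t \<in> {0..L}" "t + h \<in> {0..L}" and s: "s \<in> {0..L}" "s + h \<in> {0..L}" and h: "0 < h"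
  and far: "24 * h \<le> \<bar>s - t\<bar>" and small: "C1 * (si * \<bar>s - t\<bar>) \<le> 1"
 shows "prob (cross h t \<inter> cross h s) \<le> 5 * C1^2 * (si * h)^2"
proof -
 define X1 X2 D1 D2 where "X1 = f t" and "X2 = f s" and "D1 = (\<lambda>w. f (t + h) w - f t w)" and "D2 = (\<lambda>w. f (s + h) w - f s w)"
 define te where "te = si * h"
 define l where "l = si * \<bar>s - t\<bar>"
 have te: "0 < te" using h sg_pos by (simp add: te_def)
 have l24: "24 * te \<le> l" using mult_left_mono[OF far less_imp_le[OF sg_pos]] by (simp add: te_def l_def mult.left_commute)
 have l: "0 < l" "C1 * l \<le> 1" "l \<le> 1"
  using l24 te small mult_right_mono[OF C1_ge, of l] by (simp_all add: l_def)
 have Cte: "C1 * te \<le> 1" using mult_left_mono[of te l C1] l24 te C1_ge l by linarith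
 define r where "r = ip (f t) (f s)"
 define u where "u = 1 - r^2"
 have nd: "nrm (\<lambda>w. f s w - f t w) \<le> 2 * l" "l / 2 \<le> nrm (\<lambda>w. f s w - f t w)"
  "\<bar>nrm (\<lambda>w. f s w - f t w) - l\<bar> \<le> C1 / 2 * l^2"
  using nrm_increment[OF t(1) s(1)] l by (simp_all add: l_def)
 have Cl: "C1 / 2 * l^2 \<le> l / 2" using mult_right_mono[OF l(2), of l] l by (simp add: power2_eq_square mult.assoc)
 have nd15: "nrm (\<lambda>w. f s w - f t w) \<le> 3/2 * l" using nd(3) Cl by linarith
 have rn: "r = 1 - (nrm (\<lambda>w. f s w - f t w))^2 / 2" unfolding r_def by (rule ip_increment[OF t(1) s(1)])
 have l2: "l^2 \<le> 1" using l by (simp add: power_le_one)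
 have "(l / 2)^2 \<le> (nrm (\<lambda>w. f s w - f t w))^2" using l by (intro power_mono nd) auto
 hence r_le: "r \<le> 1 - l^2 / 8" unfolding rn by (simp add: power_divide)
 have "(nrm (\<lambda>w. f s w - f t w))^2 \<le> (3/2 * l)^2" by (intro power_mono nd15) auto
 hence r_ge: "-1/8 \<le> r" unfolding rn using l2 by (simp add: power_mult_distrib power_divide)
 have u_ge: "l^2 / 9 \<le> u"
 proof -
  have ueq: "u = (1 - r) * (1 + r)" by (simp add: u_def power2_eq_square algebra_simps)
  show ?thesis
  proof (cases "0 \<le> r")
   case True
   have "(l^2 / 8) * 1 \<le> (1 - r) * (1 + r)" using r_le True zero_le_power2[of l] by (intro mult_mono) linarith+
   thus ?thesis using ueq zero_le_power2[of l] by linarith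
  next
   case False
   hence "r^2 \<le> (1/8)^2" using r_ge by (intro power2_le_iff_abs_le[THEN iffD2]) auto
   thus ?thesis using l2 by (simp add: u_def power_divide)
  qed
 qed
 have su: "l / 3 \<le> sqrt u"
 proof -
  have "(l / 3)^2 \<le> u" using u_ge by (simp add: power_divide)
  thus ?thesis by (rule real_le_rsqrt)
 qed
 have su0: "0 < sqrt u" using su l by linarith
 have r1: "(ip X1 X2)^2 < 1" 
 proof -
  have "0 < l^2" using l by simp
  hence "0 < u" using u_ge by linarith
  thus ?thesis by (simp add: X1_def X2_def r_def u_def)
 qed
 have XH: "X1 \<in> H" "X2 \<in> H" and DH: "D1 \<in> H" "D2 \<in> H"
  using t s f_H by (auto simp: X1_def X2_def D1_def D2_def intro!: H_intros)
 have XX: "ip X1 X1 = 1" "ip X2 X2 = 1" using t s ff by (auto simp: X1_def X2_def)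
 note P = XH XX r1
 have nD: "nrm D1 \<le> 2 * te" "nrm D2 \<le> 2 * te"
  using nrm_increment(1)[OF t] nrm_increment(1)[OF s] h Cte by (simp_all add: D1_def D2_def te_def mult.assoc)
 have bt: "nrm D1 / sqrt (1 - (ip X1 X2)^2) \<le> 1/4" "nrm D2 / sqrt (1 - (ip X1 X2)^2) \<le> 1/4"
 proof -
  have ueq: "1 - (ip X1 X2)^2 = u" by (simp add: u_def r_def X1_def X2_def)
  \<comment> \<open>Here the distance of 24 steps enters: \<open>2 * te \<le> l / 12\<close>, and
    \<open>l / 3 \<le> sqrt u\<close>.\<close>
  have "2 * te \<le> 1/4 * sqrt u" using su l24 by linarith
  thus "nrm D1 / sqrt (1 - (ip X1 X2)^2) \<le> 1/4" "nrm D2 / sqrt (1 - (ip X1 X2)^2) \<le> 1/4"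
   unfolding ueq using nD su0 by (simp_all only: pos_divide_le_eq)
 qed
 have ev: "cross h t \<inter> cross h s = {w \<in> space M. X1 w * (X1 w + D1 w) < 0 \<and> X2 w * (X2 w + D2 w) < 0}"
  by (auto simp: cross_def X1_def X2_def D1_def D2_def)
 define p where "p = perp X1 X2"
 have bound: "prob (cross h t \<inter> cross h s) \<le> (expectation (\<lambda>w. \<bar>p D1 w * p D2 w\<bar>)
   + 16 * (1/4) * (ip (p D1) (p D1) + ip (p D2) (p D2))) / (2 * pi * sqrt u)"
  using sign_changes_perp_le[OF P DH bt] unfolding ev p_def[symmetric]
  by (simp add: u_def r_def X1_def X2_def)
 have pDH: "p D1 \<in> H" "p D2 \<in> H" unfolding p_def using perp_H[OF P] DH by auto
 have np: "nrm (p D) \<le> C1 * te * l"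
  if D: "D = (\<lambda>w. f (a + h) w - f a w)" and ab: "a = t \<and> b = s \<or> a = s \<and> b = t" for D a b
 proof -
  have aL: "a \<in> {0..L}" "a + h \<in> {0..L}" "b \<in> {0..L}" using ab t s by auto
  have DH': "D \<in> H" using f_H aL by (auto simp: D intro!: H_intros)
  \<comment> \<open>With this multiple of the chord the linear terms of the two Taylor expansions at
    \<open>a\<close> cancel.\<close>
  define k where "k = h / (b - a)"
  have ba: "b - a \<noteq> 0" "\<bar>b - a\<bar> = \<bar>s - t\<bar>" using ab far h by auto
  let ?V = "\<lambda>w. D w - k * (f b w - f a w)"
  have VH: "?V \<in> H" using DH' f_H aL by (auto intro!: H_intros)
  have pV: "p D = p ?V"
  proof (cases "a = t")
   case True
   hence "b = s" using ab ba by auto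
   have "p (\<lambda>w. D w - k * (X2 w - X1 w)) = p D" unfolding p_def by (rule perp_diff_X[OF P DH'])
   thus ?thesis using True \<open>b = s\<close> by (simp add: X1_def X2_def)
  next
   case False
   hence "a = s" "b = t" using ab by auto
   have "p (\<lambda>w. D w - (- k) * (X2 w - X1 w)) = p D" unfolding p_def by (rule perp_diff_X[OF P DH'])
   thus ?thesis using \<open>a = s\<close> \<open>b = t\<close> by (simp add: X1_def X2_def algebra_simps)
  qed
  let ?A = "\<lambda>w. f (a + h) w - f a w - (a + h - a) * si * y a w" and ?B = "\<lambda>w. f b w - f a w - (b - a) * si * y a w"
  have AB: "?A \<in> H" "?B \<in> H" using f_H y_H aL by (auto intro!: H_intros)
  have "?V = (\<lambda>w. ?A w - k * ?B w)"
   using ba by (simp add: D k_def fun_eq_iff field_simps)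
  hence "nrm ?V \<le> nrm ?A + \<bar>k\<bar> * nrm ?B"
   using nrm_diff[OF AB(1) H_scale[OF AB(2), of k]] by (simp add: nrm_scale)
  also have "... \<le> C1 / 2 * te^2 + \<bar>k\<bar> * (C1 / 2 * l^2)"
  proof (intro add_mono mult_left_mono)
   show "nrm ?A \<le> C1 / 2 * te^2" using taylor[OF aL(1) aL(2)] by (simp add: te_def)
   have "(si * (b - a))^2 = l^2" unfolding l_def ba(2)[symmetric] by (simp add: power_mult_distrib)
   thus "nrm ?B \<le> C1 / 2 * l^2" using taylor[OF aL(1) aL(3)] by simp
  qed simp
  also have "\<bar>k\<bar> * (C1 / 2 * l^2) = C1 / 2 * (te * l)"
  proof -
   have "\<bar>k\<bar> * l = te" using h ba(1) sg_pos unfolding k_def l_def te_def ba(2)[symmetric] by (simp add: abs_divide)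
   thus ?thesis by (simp add: power2_eq_square) 
  qed
  also have "C1 / 2 * te^2 \<le> C1 / 2 * (te * l)"
   using l24 te C1_ge by (intro mult_left_mono) (auto simp: power2_eq_square)
  finally have "nrm ?V \<le> C1 * te * l" by (simp add: algebra_simps)
  moreover have "nrm (p ?V) \<le> nrm ?V" unfolding p_def by (rule nrm_perp_le[OF P VH])
  ultimately show ?thesis unfolding pV by linarith
 qed
 have n1: "nrm (p D1) \<le> C1 * te * l" by (rule np[of D1 t s]) (auto simp: D1_def)
 have n2: "nrm (p D2) \<le> C1 * te * l" by (rule np[of D2 s t]) (auto simp: D2_def)
 let ?k = "C1 * te * l"
 have k0: "0 \<le> ?k" using C1_ge te l by simp
 have e: "expectation (\<lambda>w. \<bar>p D1 w * p D2 w\<bar>) \<le> ?k^2"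
  using expectation_abs_mult_le[OF pDH] mult_mono[OF n1 n2 k0] by (simp add: power2_eq_square)
 have i: "ip (p D1) (p D1) \<le> ?k^2" "ip (p D2) (p D2) \<le> ?k^2"
  using power_mono[OF n1, of 2] power_mono[OF n2, of 2] by (simp_all add: nrm_sq)
 \<comment> \<open>One from the mean product and \<open>16 * (1/4) * 2\<close> from the error term
   make 9.\<close>
 have "prob (cross h t \<inter> cross h s) \<le> (9 * ?k^2) / (2 * pi * sqrt u)"
  using su0 e i by (intro order_trans[OF bound] divide_right_mono) auto
 also have "... \<le> (9 * ?k^2) / (2 * l)"
 proof (intro divide_left_mono)
  have "2 * 3 * (l / 3) \<le> 2 * pi * sqrt u" using su pi_gt3 l by (intro mult_mono) auto
  thus "2 * l \<le> 2 * pi * sqrt u" by simp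
 qed (use l su0 in auto)
 also have "... = 9/2 * (C1^2 * te^2) * l" using l by (simp add: power_mult_distrib) (simp add: power2_eq_square)
 also have "... \<le> 9/2 * (C1^2 * te^2) * 1" using l by (intro mult_left_mono) auto
 also have "... \<le> 5 * C1^2 * te^2" by simp
 finally show ?thesis by (simp add: te_def)
qed

text \<open>On the event of a sign change the pair \<open>(f t, f (t + h))\<close> is written as \<open>(X, rh X + q E)\<close>
 with \<open>E\<close> a unit vector orthogonal to \<open>X\<close> that is close to \<open>y t\<close>.\<close>

lemma cross_estimates:
 assumes t: "t \<in> {0..L}" "t + h \<in> {0..L}" and h: "0 < h" and small: "C1 * (si * h) \<le> 1/10" and xs: "xs \<in> H"
 shows "\<bar>prob (cross h t) - si * h / pi\<bar> \<le> 10 * C1 * (si * h)^2"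
  and "\<bar>expectation (\<lambda>w. indicator (cross h t) w * (xs w)^2) - prob (cross h t) * ip xs xs
   - si * h / pi * ((ip xs (y t))^2 - (ip xs (f t))^2)\<bar> \<le> 40 * C1 * (si * h)^2 * ip xs xs"
proof -
 define te where "te = si * h"
 have te: "0 < te" using h sg_pos by (simp add: te_def)
 have Cte: "C1 * te \<le> 1/10" using small by (simp add: te_def)
 have te1: "te \<le> 1/10" using mult_right_mono[OF C1_ge, of te] te Cte by linarith
 define X where "X = f t"
 define D where "D = (\<lambda>w. f (t + h) w - f t w)"
 have H: "X \<in> H" "f (t + h) \<in> H" "D \<in> H" "y t \<in> H" using f_H y_H t by (auto simp: X_def D_def intro!: H_intros)
 define rh where "rh = ip (f t) (f (t + h))"
 have nD: "nrm D \<le> 2 * te" "te / 2 \<le> nrm D" "\<bar>nrm D - te\<bar> \<le> C1 / 2 * te^2"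
  using nrm_increment[OF t] h Cte by (simp_all add: D_def te_def mult.assoc)
 have rhD: "rh = 1 - (nrm D)^2 / 2" unfolding rh_def D_def by (rule ip_increment[OF t])
 have "(nrm D)^2 \<le> (2 * te)^2" by (intro power_mono nD) auto
 hence rh: "1 - rh \<le> 2 * te^2" unfolding rhD by (simp add: power_mult_distrib)
 have rh0: "0 \<le> 1 - rh" unfolding rhD by simp
 have "0 < nrm D" using nD te by linarith
 hence rh1: "rh < 1" unfolding rhD by simp
 have te2: "te^2 \<le> te / 10" using mult_right_mono[OF te1, of te] te by (simp add: power2_eq_square)
 have rhh: "49/50 \<le> rh" using rh te2 te1 by linarith
 define q where "q = sqrt (1 - rh^2)"
 have q2: "0 < 1 - rh^2" using rh1 rhh by (simp add: abs_square_less_1)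
 have q: "0 < q" "q^2 = 1 - rh^2" using q2 by (simp_all add: q_def)
 define E where "E = (\<lambda>w. (f (t + h) w - rh * X w) / q)"
 have EH: "E \<in> H" using H by (auto simp: E_def intro!: H_intros)
 have XX: "ip X X = 1" using ff t by (simp add: X_def)
 have XE: "ip X E = 0" using H ff t by (simp add: E_def X_def ip_linear H_intros rh_def)
 have EE: "ip E E = 1"
 proof -
  have "ip E E = (1 - rh * rh) / (q * q)"
   using H ff t by (simp add: E_def X_def ip_linear H_intros rh_def ip_commute[of "f (t + h)" "f t"])
  moreover have "q * q = 1 - rh * rh" using q by (simp add: power2_eq_square)
  moreover have "q * q \<noteq> 0" using q(1) by simp
  ultimately show ?thesis by simp
 qed
 \<comment> \<open>Dividing the second value by the positive \<open>rh\<close> keeps its sign and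
   brings the pair to the form \<open>X\<close>, \<open>X + ta * E\<close> of
   \<open>one_sign_change\<close>.\<close>
 define ta where "ta = q / rh"
 have ta0: "0 < ta" using q rhh by (simp add: ta_def)
 have A: "cross h t = {w \<in> space M. X w * (X w + ta * E w) < 0}"
 proof -
  have eq: "f t w * f (t + h) w = rh * (X w * (X w + ta * E w))" for w
   using q rhh by (simp add: X_def E_def ta_def field_simps)
  have "(f t w * f (t + h) w < 0) = (X w * (X w + ta * E w) < 0)" for w
   unfolding eq using rhh by (simp add: mult_less_0_iff)
  thus ?thesis by (simp add: cross_def)
 qed
 \<comment> \<open>\<open>C1 / 2\<close> is the Taylor remainder, and 2 comes from
   \<open>1 - rh \<le> 2 * te^2\<close>.\<close>
 define kp where "kp = C1 / 2 + 2"
 have kp: "kp \<le> 5/2 * C1" "0 < kp" using C1_ge by (simp_all add: kp_def)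
 have qEy: "nrm (\<lambda>w. q * E w - te * y t w) \<le> kp * te^2"
 proof -
  let ?A = "\<lambda>w. f (t + h) w - f t w - (t + h - t) * si * y t w"
  have AH: "?A \<in> H" using H by (auto simp: X_def intro!: H_intros)
  have "(\<lambda>w. q * E w - te * y t w) = (\<lambda>w. ?A w + (1 - rh) * X w)"
  proof -
   have "q * E w = f (t + h) w - rh * X w" for w using q(1) by (simp add: E_def)
   thus ?thesis by (simp add: X_def te_def fun_eq_iff algebra_simps)
  qed
  hence "nrm (\<lambda>w. q * E w - te * y t w) \<le> nrm ?A + \<bar>1 - rh\<bar> * nrm X"
   using nrm_add[OF AH H_scale[OF H(1), of "1 - rh"]] by (simp add: nrm_scale)
  also have "... \<le> C1 / 2 * te^2 + 2 * te^2"
   using taylor[OF t] nrm_f[OF t(1)] rh rh0 by (intro add_mono) (simp_all add: X_def te_def)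
  finally show ?thesis by (simp add: kp_def algebra_simps)
 qed
 have nE: "nrm E = 1" "nrm (y t) = 1" using EE nrm_y t by (simp_all add: nrm_def)
 have qH: "(\<lambda>w. q * E w) \<in> H" "(\<lambda>w. te * y t w) \<in> H" using EH H by (auto intro!: H_intros)
 have qte: "\<bar>q - te\<bar> \<le> kp * te^2"
 proof -
  have dH: "(\<lambda>w. q * E w - te * y t w) \<in> H" using EH H by (auto intro!: H_intros)
  have "nrm (\<lambda>w. q * E w) \<le> nrm (\<lambda>w. q * E w - te * y t w) + nrm (\<lambda>w. te * y t w)"
   using nrm_add[OF dH qH(2)] by simp
  moreover have "nrm (\<lambda>w. te * y t w) \<le> nrm (\<lambda>w. q * E w) + nrm (\<lambda>w. q * E w - te * y t w)"
   using nrm_diff[OF qH(1) dH] by simp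
  moreover have "nrm (\<lambda>w. q * E w) = q" "nrm (\<lambda>w. te * y t w) = te" using nE q te by (simp_all add: nrm_scale)
  ultimately show ?thesis using qEy by linarith
 qed
 have kpte: "kp * te^2 \<le> te / 4"
 proof -
  have "kp * te^2 \<le> (5/2 * C1) * te^2" using kp by (intro mult_right_mono) auto
  also have "... = 5/2 * (C1 * te) * te" by (simp add: power2_eq_square)
  also have "... \<le> 5/2 * (1/10) * te" using Cte te by (intro mult_right_mono mult_left_mono) auto
  finally show ?thesis by simp
 qed
 have q2te: "q \<le> 5/4 * te" using qte kpte by linarith
 have taq: "ta - q \<le> 3 * te ^ 3" "q \<le> ta"
 proof -
  have "ta - q = q * (1 - rh) / rh" using rhh by (simp add: ta_def field_simps)
  also have "... \<le> (5/4 * te) * (2 * te^2) / (49/50)"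
   using q2te rh rhh rh0 q te by (intro frac_le mult_mono) auto
  also have "... \<le> 3 * te ^ 3" using te by (simp add: power2_eq_square power3_eq_cube)
  finally show "ta - q \<le> 3 * te ^ 3" .
  show "q \<le> ta" using q rhh rh1 by (simp add: ta_def field_simps)
 qed
 have te3: "te ^ 3 \<le> te^2 / 10" using mult_right_mono[OF te1, of "te^2"] by (simp add: power2_eq_square power3_eq_cube)
 have tate: "\<bar>ta - te\<bar> \<le> (kp + 1/2) * te^2" using taq qte te3 zero_le_power2[of te] by (simp add: distrib_right)
 have ta2: "ta \<le> 3/2 * te" using taq q2te te3 te2 by linarith
 have tasq: "ta^2 \<le> 9/4 * te^2" using power_mono[OF ta2, of 2] ta0 by (simp add: power_mult_distrib power_divide)
 have ta3: "ta ^ 3 \<le> te^2 / 2"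
 proof -
  have "ta ^ 3 \<le> (3/2 * te) ^ 3" using ta2 ta0 by (intro power_mono) auto
  also have "... = 27/8 * te ^ 3" by (simp add: power_mult_distrib power_divide)
  also have "... \<le> te^2 / 2" using te3 zero_le_power2[of te] by linarith
  finally show ?thesis .
 qed
 have Csq: "te^2 \<le> C1 * te^2" "kp * te^2 \<le> 5/2 * (C1 * te^2)"
  using mult_right_mono[OF C1_ge, of "te^2"] mult_right_mono[OF kp(1), of "te^2"] by simp_all
 have pi3: "\<bar>x / pi\<bar> \<le> \<bar>x\<bar> / 3" for x using divide_pi_le[of "\<bar>x\<bar>"] by (simp add: abs_divide)
 note one = one_sign_change[OF H(1) XX EH EE XE less_imp_le[OF ta0], folded A]
 show "\<bar>prob (cross h t) - si * h / pi\<bar> \<le> 10 * C1 * (si * h)^2"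
 proof -
  have "\<bar>ta / pi - te / pi\<bar> \<le> \<bar>ta - te\<bar> / 3" using pi3[of "ta - te"] by (simp add: diff_divide_distrib)
  moreover have "\<bar>prob (cross h t) - ta / pi\<bar> \<le> te^2 / 2" using one(1,2) ta3 zero_le_power2[of te] by linarith
  moreover have "\<bar>ta - te\<bar> \<le> 3 * (C1 * te^2)"
  proof -
   have "(kp + 1/2) * te^2 = kp * te^2 + te^2 / 2" by (simp add: algebra_simps)
   thus ?thesis using tate Csq by linarith
  qed
  moreover have "0 \<le> C1 * te^2" using Csq(1) zero_le_power2[of te] by linarith
  moreover have "\<bar>prob (cross h t) - te / pi\<bar> \<le> \<bar>prob (cross h t) - ta / pi\<bar> + \<bar>ta / pi - te / pi\<bar>" by linarith
  moreover have "z \<le> 10 * (C1 * te^2)" if "x \<le> d / 3" "p \<le> te^2 / 2" "d \<le> 3 * (C1 * te^2)" "0 \<le> C1 * te^2" "z \<le> p + x"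
   for x d p z using that Csq(1) by linarith
  ultimately have "\<bar>prob (cross h t) - te / pi\<bar> \<le> 10 * (C1 * te^2)" by blast
  thus ?thesis by (simp add: te_def)
 qed
 define n where "n = nrm xs"
 have n2: "n^2 = ip xs xs" "0 \<le> n" by (simp_all add: n_def nrm_sq)
 define e where "e = ip xs E"
 define g where "g = ip xs (y t)"
 define a where "a = ip xs X"
 have bes: "\<bar>e\<bar> \<le> n" "\<bar>g\<bar> \<le> n" "\<bar>a\<bar> \<le> n"
  using ip_le_nrm[OF xs EH] ip_le_nrm[OF xs H(4)] ip_le_nrm[OF xs H(1)] nE nrm_f[OF t(1)] by (simp_all add: e_def g_def a_def n_def X_def)
 have ev: "\<bar>q * e - te * g\<bar> \<le> kp * te^2 * n"
 proof -
  have dH: "(\<lambda>w. q * E w - te * y t w) \<in> H" using EH H by (auto intro!: H_intros)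
  have "ip xs (\<lambda>w. q * E w - te * y t w) = q * e - te * g" using xs EH H by (simp add: ip_linear H_intros e_def g_def)
  hence "\<bar>q * e - te * g\<bar> \<le> n * nrm (\<lambda>w. q * E w - te * y t w)" using ip_le_nrm[OF xs dH] by (simp add: n_def)
  also have "... \<le> n * (kp * te^2)" using n2 by (intro mult_left_mono qEy) auto
  finally show ?thesis by (simp add: mult.commute)
 qed
 have main1: "\<bar>te * e^2 - te * g^2\<bar> \<le> 4 * kp * te^2 * n^2"
 proof -
  have "te * e - te * g = (te - q) * e + (q * e - te * g)" by (simp add: algebra_simps)
  also have "\<bar>...\<bar> \<le> \<bar>(te - q) * e\<bar> + \<bar>q * e - te * g\<bar>" by (rule abs_triangle_ineq)
  also have "\<bar>(te - q) * e\<bar> \<le> kp * te^2 * n"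
   unfolding abs_mult using qte bes(1) kp by (intro mult_mono) auto
  finally have d: "\<bar>te * e - te * g\<bar> \<le> 2 * kp * te^2 * n" using ev by linarith
  have "te * e^2 - te * g^2 = (te * e - te * g) * (e + g)" by (simp add: power2_eq_square algebra_simps)
  also have "\<bar>...\<bar> \<le> (2 * kp * te^2 * n) * (2 * n)"
   unfolding abs_mult using d bes kp n2 by (intro mult_mono) auto
  finally show ?thesis by (simp add: power2_eq_square ac_simps)
 qed
 have sub: "\<bar>ta / pi * (e^2 - a^2) - te / pi * (g^2 - a^2)\<bar> \<le> (kp + 1/2) * te^2 * n^2 / 3 + 4 * kp * te^2 * n^2 / 3"
 proof -
  have ea: "\<bar>e^2 - a^2\<bar> \<le> n^2"
  proof -
   have "e^2 \<le> n^2" "a^2 \<le> n^2" using bes n2 abs_le_square_iff[of e n] abs_le_square_iff[of a n] by auto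
   thus ?thesis using zero_le_power2[of e] zero_le_power2[of a] by linarith
  qed
  have "ta / pi * (e^2 - a^2) - te / pi * (g^2 - a^2) = ((ta - te) * (e^2 - a^2)) / pi + (te * e^2 - te * g^2) / pi"
   by (simp add: field_simps)
  also have "\<bar>...\<bar> \<le> \<bar>(ta - te) * (e^2 - a^2)\<bar> / 3 + \<bar>te * e^2 - te * g^2\<bar> / 3"
   by (rule order_trans[OF abs_triangle_ineq add_mono[OF pi3 pi3]])
  finally have tri: "\<bar>ta / pi * (e^2 - a^2) - te / pi * (g^2 - a^2)\<bar> \<le>
   \<bar>(ta - te) * (e^2 - a^2)\<bar> / 3 + \<bar>te * e^2 - te * g^2\<bar> / 3" .
  have "\<bar>(ta - te) * (e^2 - a^2)\<bar> \<le> (kp + 1/2) * te^2 * n^2"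
   unfolding abs_mult using tate ea kp by (intro mult_mono) auto
  thus ?thesis using main1 by (intro order_trans[OF tri] add_mono divide_right_mono) auto
 qed
 have cov: "\<bar>expectation (\<lambda>w. indicator (cross h t) w * (xs w)^2) - prob (cross h t) * ip xs xs - ta / pi * (e^2 - a^2)\<bar>
  \<le> (ta^2 + 3 * ta ^ 3) * ip xs xs"
  using sign_change_square_covariance[OF H(1) XX EH EE XE less_imp_le[OF ta0] xs] unfolding A[symmetric] e_def a_def .
 have t1: "(ta^2 + 3 * ta ^ 3) * ip xs xs \<le> 4 * te^2 * n^2"
 proof -
  have "ta^2 + 3 * ta ^ 3 \<le> 4 * te^2" using tasq ta3 zero_le_power2[of te] by linarith
  thus ?thesis unfolding n2(1)[symmetric] by (rule mult_right_mono) simp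
 qed
 let ?c = "C1 * te^2 * n^2"
 have c1: "te^2 * n^2 \<le> ?c" "kp * te^2 * n^2 \<le> 5/2 * ?c" "0 \<le> ?c"
  using mult_right_mono[OF Csq(1), of "n^2"] mult_right_mono[OF Csq(2), of "n^2"] C1_ge by (simp_all add: mult.assoc)
 have "\<bar>expectation (\<lambda>w. indicator (cross h t) w * (xs w)^2) - prob (cross h t) * ip xs xs - te / pi * (g^2 - a^2)\<bar> \<le> 40 * ?c"
 proof -
  have gen: "\<bar>x - (T - S)\<bar> \<le> 40 * c" if "\<bar>x - T\<bar> \<le> A" "\<bar>S\<bar> \<le> B / 3 + D / 3" "A \<le> 4 * d" "B = k + d / 2" "D = 4 * k" "d \<le> c" "k \<le> 5/2 * c" "0 \<le> c"
   for x T S A B D c d k :: real using that by linarith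
  have "(kp + 1/2) * te^2 * n^2 = kp * te^2 * n^2 + te^2 * n^2 / 2" by (simp add: algebra_simps)
  from gen[OF cov sub _ this _ c1] t1 show ?thesis by (simp add: mult.assoc)
 qed
 thus "\<bar>expectation (\<lambda>w. indicator (cross h t) w * (xs w)^2) - prob (cross h t) * ip xs xs
   - si * h / pi * ((ip xs (y t))^2 - (ip xs (f t))^2)\<bar> \<le> 40 * C1 * (si * h)^2 * ip xs xs"
  by (simp add: te_def g_def a_def X_def n2(1)[symmetric] mult.assoc)
qed

end

section \<open>The zero count and its second moment\<close>

text \<open>An accumulation point of zeros is itself a zero, and the difference quotients along
  these zeros force its derivative to vanish.\<close>

lemma zeros_finite:
 fixes f f' :: "real \<Rightarrow> real"
 assumes der: "\<And>t. t \<in> {0..L} \<Longrightarrow> (f has_real_derivative f' t) (at t within {0..L})"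
  and simple: "\<And>t. t \<in> {0..L} \<Longrightarrow> f t = 0 \<Longrightarrow> f' t \<noteq> 0"
 shows "finite {t \<in> {0..L}. f t = 0}"
proof (rule ccontr)
 let ?Z = "{t \<in> {0..L}. f t = 0}"
 assume "infinite ?Z"
 then obtain x where x: "x \<in> {0..L}" "x islimpt ?Z"
 proof -
  have "?Z \<subseteq> {0..L}" by auto
  hence "\<exists>x\<in>{0..L}. x islimpt ?Z"
   using \<open>infinite ?Z\<close> compact_eq_Bolzano_Weierstrass[of "{0..L}"] compact_Icc[of 0 L] by blast
  thus ?thesis using that by blast
 qed
 have cont: "continuous_on {0..L} f"
  unfolding continuous_on_eq_continuous_within using der DERIV_continuous by blast
 have nb: "at x within ?Z \<noteq> bot" using x(2) by (simp add: trivial_limit_within)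
 have le: "at x within ?Z \<le> at x within {0..L}" by (rule at_le) auto
 have "(f \<longlongrightarrow> f x) (at x within ?Z)"
  using cont x(1) le unfolding continuous_on_def by (auto intro: tendsto_mono)
 moreover have ev0: "\<forall>\<^sub>F t in at x within ?Z. f t = 0"
  by (auto simp: eventually_at_filter)
 hence "(f \<longlongrightarrow> 0) (at x within ?Z)" by (rule tendsto_eventually)
 ultimately have fx: "f x = 0" using nb tendsto_unique by blast
 have "((\<lambda>t. (f t - f x) / (t - x)) \<longlongrightarrow> f' x) (at x within {0..L})"
  using der[OF x(1)] by (simp add: has_field_derivative_iff)
 hence "((\<lambda>t. (f t - f x) / (t - x)) \<longlongrightarrow> f' x) (at x within ?Z)" by (rule tendsto_mono[OF le])
 moreover have "((\<lambda>t. (f t - f x) / (t - x)) \<longlongrightarrow> 0) (at x within ?Z)"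
  by (rule tendsto_eventually, rule eventually_mono[OF ev0]) (simp add: fx)
 ultimately have "f' x = 0" using nb tendsto_unique by blast
 thus False using simple[OF x(1) fx] by simp
qed

lemma simple_zero_sign_change:
 fixes f :: "real \<Rightarrow> real"
 assumes der: "(f has_real_derivative d) (at z within {0..L})" and z: "f z = 0" "d \<noteq> 0"
 obtains e where "0 < e" "\<And>s t. s \<in> {0..L} \<Longrightarrow> t \<in> {0..L} \<Longrightarrow> z - e < s \<Longrightarrow> s < z \<Longrightarrow> z < t \<Longrightarrow> t < z + e \<Longrightarrow> f s * f t < 0"
proof -
 have "((\<lambda>t. (f t - f z) / (t - z)) \<longlongrightarrow> d) (at z within {0..L})"
  using der by (simp add: has_field_derivative_iff)
 hence "((\<lambda>t. d * ((f t - f z) / (t - z))) \<longlongrightarrow> d * d) (at z within {0..L})"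
  by (intro tendsto_intros)
 moreover have "0 < d * d" using z(2) not_real_square_gt_zero[of d] by blast
 ultimately have "\<forall>\<^sub>F t in at z within {0..L}. 0 < d * ((f t - f z) / (t - z))"
  by (rule order_tendstoD(1))
 then obtain e where e: "0 < e" "\<And>t. t \<in> {0..L} \<Longrightarrow> t \<noteq> z \<Longrightarrow> dist t z < e \<Longrightarrow> 0 < d * ((f t - f z) / (t - z))"
  unfolding eventually_at by blast
 show thesis
 proof (rule that[OF e(1)])
  fix s t assume h: "s \<in> {0..L}" "t \<in> {0..L}" "z - e < s" "s < z" "z < t" "t < z + e"
  have "0 < d * (f s / (s - z))" "0 < d * (f t / (t - z))"
   using e(2)[of s] e(2)[of t] h z by (auto simp: dist_real_def)
  hence "0 < (d * (f s / (s - z))) * (d * (f t / (t - z)))" by (rule mult_pos_pos)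
  also have "... = (d * d) / ((s - z) * (t - z)) * (f s * f t)" by simp
  finally have "0 < (d * d) / ((s - z) * (t - z)) * (f s * f t)" .
  moreover have "(d * d) / ((s - z) * (t - z)) < 0"
   using \<open>0 < d * d\<close> h by (intro divide_pos_neg mult_neg_pos) auto
  ultimately show "f s * f t < 0"
   using zero_less_mult_iff[of "(d * d) / ((s - z) * (t - z))" "f s * f t"] by linarith
 qed
qed

definition sign_changes :: "(real \<Rightarrow> real) \<Rightarrow> real \<Rightarrow> nat \<Rightarrow> nat set" where
 "sign_changes f h m = {i. i < m \<and> f (real i * h) * f (real i * h + h) < 0}"

lemma card_sign_changes_le:
 fixes f :: "real \<Rightarrow> real"
 assumes cont: "continuous_on {0..L} f" and fin: "finite {t \<in> {0..L}. f t = 0}" and h: "0 < h" "real m * h = L"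
 shows "card (sign_changes f h m) \<le> card {t \<in> {0..L}. f t = 0}"
proof -
 have "\<exists>z. real i * h < z \<and> z < real i * h + h \<and> f z = 0" if i: "i \<in> sign_changes f h m" for i
 proof -
  let ?a = "real i * h" and ?b = "real i * h + h"
  have ab: "f ?a * f ?b < 0" "i < m" using i by (auto simp: sign_changes_def)
  have bL: "?b \<le> L"
  proof -
   have "real (Suc i) * h \<le> real m * h" using ab h by (intro mult_right_mono) auto
   thus ?thesis using h by (simp add: algebra_simps)
  qed
  have c: "continuous_on {?a..?b} f" by (rule continuous_on_subset[OF cont]) (use bL h in auto)
  have "\<exists>z\<ge>?a. z \<le> ?b \<and> f z = 0"
  proof (cases "f ?a < 0")
   case True
   hence "0 < f ?b" using ab by (simp add: mult_less_0_iff)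
   thus ?thesis using IVT'[of f ?a 0 ?b] True c h by auto
  next
   case False
   hence "0 < f ?a" "f ?b < 0" using ab by (auto simp: mult_less_0_iff)
   thus ?thesis using IVT2'[of f ?b 0 ?a] c h by auto
  qed
  then obtain z where "?a \<le> z" "z \<le> ?b" "f z = 0" by auto
  moreover have "z \<noteq> ?a" "z \<noteq> ?b" using ab \<open>f z = 0\<close> by auto
  ultimately show ?thesis by (intro exI[of _ z]) auto
 qed
 then obtain Z where Z: "\<And>i. i \<in> sign_changes f h m \<Longrightarrow> real i * h < Z i \<and> Z i < real i * h + h \<and> f (Z i) = 0"
  by metis
 show ?thesis
 proof (rule card_inj_on_le[of Z])
  show "inj_on Z (sign_changes f h m)"
  proof (rule inj_onI)
   fix i j assume ij: "i \<in> sign_changes f h m" "j \<in> sign_changes f h m" "Z i = Z j"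
   have "real i * h < real j * h + h" "real j * h < real i * h + h" using Z[OF ij(1)] Z[OF ij(2)] ij(3) by auto
   hence "real i * h < (real j + 1) * h" "real j * h < (real i + 1) * h" by (simp_all add: algebra_simps)
   hence "real i < real j + 1" "real j < real i + 1" using h by simp_all
   thus "i = j" by linarith
  qed
  show "Z ` sign_changes f h m \<subseteq> {t \<in> {0..L}. f t = 0}"
  proof safe
   fix i assume i: "i \<in> sign_changes f h m"
   hence "real (Suc i) * h \<le> real m * h" using h by (intro mult_right_mono) (auto simp: sign_changes_def)
   hence "real i * h + h \<le> L" using h by (simp add: algebra_simps)
   moreover have "0 \<le> real i * h" using h by simp
   ultimately have "0 \<le> Z i" "Z i \<le> L" using Z[OF i] by linarith+
   thus "Z i \<in> {0..L}" by simp
   show "f (Z i) = 0" using Z[OF i] by simp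
  qed
 qed (rule fin)
qed

text \<open>Each of the finitely many simple zeros has a neighbourhood in which the sign changes
  exactly across it. A mesh finer than all of them puts the zeros into different steps, and the ends
  of such a step, not being zeros, have opposite signs.\<close>

lemma card_sign_changes_eventually_ge:
 fixes f f' :: "real \<Rightarrow> real"
 assumes L: "0 < L" and der: "\<And>t. t \<in> {0..L} \<Longrightarrow> (f has_real_derivative f' t) (at t within {0..L})"
  and simple: "\<And>t. t \<in> {0..L} \<Longrightarrow> f t = 0 \<Longrightarrow> f' t \<noteq> 0"
 obtains e where "0 < e" "\<And>h m. 0 < h \<Longrightarrow> h < e \<Longrightarrow> real m * h = L \<Longrightarrow>
  (\<And>i. i \<le> m \<Longrightarrow> f (real i * h) \<noteq> 0) \<Longrightarrow> card {t \<in> {0..L}. f t = 0} \<le> card (sign_changes f h m)"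
proof -
 let ?Z = "{t \<in> {0..L}. f t = 0}"
 have fin: "finite ?Z" by (rule zeros_finite[OF der simple])
 define Q where "Q z e \<longleftrightarrow> 0 < e \<and> (\<forall>s\<in>{0..L}. \<forall>t\<in>{0..L}. z - e < s \<longrightarrow> s < z \<longrightarrow> z < t \<longrightarrow> t < z + e \<longrightarrow> f s * f t < 0)" for z e
 have "\<forall>z\<in>?Z. \<exists>e. Q z e"
 proof
  fix z assume "z \<in> ?Z"
  hence z: "z \<in> {0..L}" "f z = 0" by auto
  show "\<exists>e. Q z e"
  proof (rule simple_zero_sign_change[OF der[OF z(1)] z(2) simple[OF z]])
   fix e assume "0 < e" and st: "\<And>s t. s \<in> {0..L} \<Longrightarrow> t \<in> {0..L} \<Longrightarrow> z - e < s \<Longrightarrow> s < z \<Longrightarrow> z < t \<Longrightarrow> t < z + e \<Longrightarrow> f s * f t < 0"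
   hence "Q z e" unfolding Q_def by (intro conjI ballI impI) (assumption, rule st)
   thus ?thesis by (rule exI)
  qed
 qed
 from bchoice[OF this] obtain E where EQ: "\<forall>z\<in>?Z. Q z (E z)" by (rule exE)
 have E: "0 < E z" if "z \<in> ?Z" for z
  using bspec[OF EQ that] by (simp add: Q_def)
 have E2: "f s * f t < 0"
  if "z \<in> ?Z" "s \<in> {0..L}" "t \<in> {0..L}" "z - E z < s" "s < z" "z < t" "t < z + E z" for z s t
  using bspec[OF EQ that(1)] that(2-) unfolding Q_def by meson
 define e where "e = Min (insert 1 (E ` ?Z))"
 have e: "0 < e" "\<And>z. z \<in> ?Z \<Longrightarrow> e \<le> E z"
  unfolding e_def using fin E by auto
 show thesis
 proof (rule that[OF e(1)])
  fix h m assume h: "0 < h" "h < e" "real m * h = L" and nz: "\<And>i. i \<le> m \<Longrightarrow> f (real i * h) \<noteq> 0"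
  define I where "I z = nat \<lfloor>z / h\<rfloor>" for z
  have I: "real (I z) * h < z \<and> z < real (I z) * h + h \<and> I z < m" if z: "z \<in> ?Z" for z
  proof -
   have z0: "0 \<le> z" "z \<le> L" "f z = 0" using z by auto
   have fl: "real (I z) \<le> z / h" "z / h < real (I z) + 1"
    unfolding I_def using z0 h by auto
   hence b: "real (I z) * h \<le> z" "z < real (I z) * h + h" using h by (simp_all add: field_simps)
   have "real (I z) * h \<le> real m * h" using b z0 h by linarith
   hence "real (I z) \<le> real m" by (rule mult_right_le_imp_le[OF _ h(1)])
   hence le: "I z \<le> m" by simp
   hence "real (I z) * h \<noteq> z" using nz[OF le] z0 by auto
   moreover have "I z \<noteq> m"
   proof
    assume "I z = m"
    hence "L \<le> z" using b h by simp
    hence "z = real m * h" using z0 h by simp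
    thus False using nz[of m] z0 by simp
   qed
   ultimately show ?thesis using b le by auto
  qed
  have inL: "real i * h \<in> {0..L} \<and> real i * h + h \<in> {0..L}" if "i < m" for i
  proof -
   have "real (Suc i) * h \<le> real m * h" using that h by (intro mult_right_mono) auto
   hence "real i * h + h \<le> L" using h by (simp add: algebra_simps)
   moreover have "0 \<le> real i * h" using h by simp
   ultimately show ?thesis using h by auto
  qed
  show "card ?Z \<le> card (sign_changes f h m)"
  proof (rule card_inj_on_le[of I])
   show "inj_on I ?Z"
   proof (rule inj_onI, rule ccontr)
    fix z z' assume zz: "z \<in> ?Z" "z' \<in> ?Z" "I z = I z'" "z \<noteq> z'"
    \<comment> \<open>The left end of the common step and the zero \<open>b\<close> would lie on
      opposite sides of \<open>a\<close> within \<open>E a\<close>, where products across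
      \<open>a\<close> are strictly negative.\<close>
    have no: False if "a \<in> ?Z" "b \<in> ?Z" "I a = I b" "a < b" for a b
    proof -
     have "f (real (I a) * h) * f b < 0"
      using E2[OF that(1), of "real (I a) * h" b] I[OF that(1)] I[OF that(2)] inL[of "I a"] that h e(2)[OF that(1)] by auto
     thus False using that by simp
    qed
    show False using no[of z z'] no[of z' z] zz by (cases "z < z'") auto
   qed
   show "I ` ?Z \<subseteq> sign_changes f h m"
   proof safe
    fix z assume "z \<in> {0..L}" "f z = 0"
    hence z: "z \<in> ?Z" by simp
    have "f (real (I z) * h) * f (real (I z) * h + h) < 0"
     using E2[OF z, of "real (I z) * h" "real (I z) * h + h"] I[OF z] inL[of "I z"] h e(2)[OF z] by auto
    thus "I z \<in> sign_changes f h m" using I[OF z] by (simp add: sign_changes_def)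
   qed
   show "finite (sign_changes f h m)" by (simp add: sign_changes_def)
  qed
 qed
qed

section \<open>Almost sure simplicity of the zeros\<close>

context gauss_space
begin

lemma prob_abs_le:
 assumes X: "X \<in> H" "ip X X = 1" and a: "0 < a"
 shows "prob {w \<in> space M. \<bar>X w\<bar> \<le> a} \<le> 2 * a"
proof -
 have [measurable]: "X \<in> borel_measurable M" using X H_meas by simp
 have "ennreal (prob {w \<in> space M. \<bar>X w\<bar> \<le> a}) = emeasure (distr M borel X) {x. \<bar>x\<bar> \<le> a}"
  by (simp add: emeasure_distr emeasure_eq_measure Int_def conj_commute)
 also have "... = (\<integral>\<^sup>+x. ennreal (std_normal_density x) * indicator {x. \<bar>x\<bar> \<le> a} x \<partial>lborel)"
  unfolding distr_unit_normal[OF X] by (subst emeasure_density) auto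
 also have "... \<le> (\<integral>\<^sup>+x. indicator {-2*a<..<2*a} (0 + 1 * x) * ennreal (std_normal_density x) \<partial>lborel)"
  using a by (intro nn_integral_mono) (auto simp: indicator_def)
 also have "... \<le> ennreal (max (2 * a - (-2*a)) 0 / (1 * sqrt (2 * pi)))"
  by (rule nn_integral_normal_interval_le) simp
 also have "... \<le> ennreal (2 * a)"
 proof (rule ennreal_leI)
  have "2 \<le> sqrt (2 * pi)" using pi_gt3 by (intro real_le_rsqrt) simp
  hence "4 * a / sqrt (2 * pi) \<le> 4 * a / 2" using a by (intro divide_left_mono) auto
  thus "max (2 * a - (-2*a)) 0 / (1 * sqrt (2 * pi)) \<le> 2 * a" using a by simp
 qed
 finally show ?thesis using a by simp
qed

lemma prob_abs_le_pair:
 assumes X: "X \<in> H" "ip X X = 1" and Y: "Y \<in> H" "ip Y Y = 1" "ip X Y = 0" and ab: "0 < a" "0 < b"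
 shows "prob {w \<in> space M. \<bar>X w\<bar> \<le> a \<and> \<bar>Y w\<bar> \<le> b} \<le> 4 * a * b"
proof -
 have [measurable]: "X \<in> borel_measurable M" "Y \<in> borel_measurable M" using X Y H_meas by auto
 have "Y \<noteq> X" using X Y by auto
 have ind: "indep_var borel (\<lambda>w. of_bool (\<bar>X w\<bar> \<le> a) :: real) borel (\<lambda>w. of_bool (\<bar>Y w\<bar> \<le> b))"
  using X Y \<open>Y \<noteq> X\<close> orthogonal_indep_var[of "{X}" Y "\<lambda>z. of_bool (\<bar>z X\<bar> \<le> a)" "\<lambda>y. of_bool (\<bar>y\<bar> \<le> b)"]
  by (auto simp: pairwise_insert ip_commute[of Y X])
 have pe: "prob {w \<in> space M. P w} = expectation (\<lambda>w. of_bool (P w))" if [measurable]: "Measurable.pred M P" for P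
 proof -
  have "expectation (\<lambda>w. of_bool (P w)) = expectation (indicat_real {w \<in> space M. P w})"
   by (intro Bochner_Integration.integral_cong) (auto)
  thus ?thesis by simp
 qed
 have "prob {w \<in> space M. \<bar>X w\<bar> \<le> a \<and> \<bar>Y w\<bar> \<le> b} = expectation (\<lambda>w. of_bool (\<bar>X w\<bar> \<le> a) * of_bool (\<bar>Y w\<bar> \<le> b))"
  by (subst pe) (auto simp: of_bool_conj)
 also have "... = expectation (\<lambda>w. of_bool (\<bar>X w\<bar> \<le> a)) * expectation (\<lambda>w. of_bool (\<bar>Y w\<bar> \<le> b))"
  by (rule indep_var_lebesgue_integral[OF ind]) (auto intro!: integrable_const_bound[of _ 1])
 also have "... = prob {w \<in> space M. \<bar>X w\<bar> \<le> a} * prob {w \<in> space M. \<bar>Y w\<bar> \<le> b}" by (simp add: pe)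
 also have "... \<le> (2 * a) * (2 * b)" by (intro mult_mono prob_abs_le X Y ab) (use ab in auto)
 finally show ?thesis by simp
qed

end

context gauss_process
begin

lemma AE_nonzero: assumes t: "t \<in> {0..L}" shows "AE w in M. f t w \<noteq> 0"
proof -
 have [measurable]: "f t \<in> borel_measurable M" using f_meas t by simp
 have "prob {w \<in> space M. f t w = 0} \<le> e" if "0 < e" for e
 proof -
  have "prob {w \<in> space M. f t w = 0} \<le> prob {w \<in> space M. \<bar>f t w\<bar> \<le> e / 2}"
   using that by (intro finite_measure_mono) auto
  also have "... \<le> 2 * (e / 2)" by (rule prob_abs_le) (use f_H ff t that in auto)
  finally show ?thesis by simp
 qed
 hence "prob {w \<in> space M. f t w = 0} = 0"
  using field_le_epsilon[of "prob {w \<in> space M. f t w = 0}" 0] by (simp add: measure_le_0_iff)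
 thus ?thesis by (subst AE_iff_measurable[OF _ refl]) (auto simp: emeasure_eq_measure)
qed

text \<open>Bulinskaya's argument. At the grid point next to a degenerate zero \<open>f\<close> is
  of order \<open>h^2\<close> and \<open>y\<close> of order \<open>h\<close>. Both being unit
  variables with covariance zero, this has probability of order \<open>h^3\<close>, while there are
  only of order \<open>1 / h\<close> grid points. The constant is the Lipschitz constant of the
  path, which is random; rounding it up to an integer leaves countably many null events.\<close>

lemma AE_no_degenerate_zero: "AE w in M. \<forall>t\<in>{0..L}. \<not> (f t w = 0 \<and> y t w = 0)"
proof -
 define h where "h m = L / real (Suc m)" for m
 have h0: "0 < h m" for m using L_pos by (simp add: h_def)
 define T where "T m i = real i * h m" for m i
 have T: "T m i \<in> {0..L}" if "i \<le> Suc m" for m i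
 proof -
  have "real i * h m \<le> real (Suc m) * h m" using that h0[of m] by (intro mult_right_mono) auto
  moreover have "real (Suc m) * h m = L" by (simp add: h_def)
  moreover have "0 \<le> real i * h m" using h0[of m] by simp
  ultimately show ?thesis by (simp add: T_def)
 qed
 define E where "E B m = (\<Union>i\<le>Suc m. {w \<in> space M. \<bar>f (T m i) w\<bar> \<le> si * B * (h m)^2 \<and> \<bar>y (T m i) w\<bar> \<le> B * h m})" for B :: real and m
 have meas1: "{w \<in> space M. \<bar>f (T m i) w\<bar> \<le> a \<and> \<bar>y (T m i) w\<bar> \<le> b} \<in> sets M" if "i \<le> Suc m" for a b m i
 proof -
  have [measurable]: "f (T m i) \<in> borel_measurable M" "y (T m i) \<in> borel_measurable M"
   using f_meas y_meas T[OF that] by auto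
  show ?thesis by measurable
 qed
 have Em: "E B m \<in> sets M" for B m unfolding E_def by (intro sets.finite_UN) (auto intro: meas1)
 have PE: "prob (E B m) \<le> (8 * si * B^2 * L ^ 3) * (1 / real (Suc m))" if B: "0 < B" for B m
 proof -
  have "prob (E B m) \<le> (\<Sum>i\<le>Suc m. prob {w \<in> space M. \<bar>f (T m i) w\<bar> \<le> si * B * (h m)^2 \<and> \<bar>y (T m i) w\<bar> \<le> B * h m})"
   unfolding E_def by (intro finite_measure_subadditive_finite) (auto intro: meas1)
  also have "... \<le> (\<Sum>i\<le>Suc m. 4 * (si * B * (h m)^2) * (B * h m))"
   using T f_H y_H ff yy fy B h0[of m] sg_pos by (intro sum_mono prob_abs_le_pair) auto
  also have "... = real (Suc (Suc m)) * (4 * (si * B * (h m)^2) * (B * h m))" by simp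
  also have "... \<le> (2 * real (Suc m)) * (4 * (si * B * (h m)^2) * (B * h m))"
   using B h0[of m] sg_pos by (intro mult_right_mono) auto
  also have "... = 8 * si * B^2 * ((real (Suc m) * h m) * (h m)^2)" by (simp add: power2_eq_square)
  also have "(real (Suc m) * h m) * (h m)^2 = L ^ 3 * (1 / (real (Suc m))^2)"
   by (simp add: h_def power2_eq_square power3_eq_cube)
  also have "8 * si * B^2 * (L ^ 3 * (1 / (real (Suc m))^2)) = (8 * si * B^2 * L ^ 3) * (1 / (real (Suc m))^2)" by simp
  also have "... \<le> (8 * si * B^2 * L ^ 3) * (1 / real (Suc m))"
   using B sg_pos L_pos by (intro mult_left_mono divide_left_mono) (auto simp: power2_eq_square)
  finally show ?thesis .
 qed
 define N where "N B = (\<Inter>m. E B m)" for B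
 have Nm: "N B \<in> sets M" for B unfolding N_def using Em by auto
 have PN: "prob (N B) = 0" if B: "0 < B" for B
 proof -
  have "prob (N B) \<le> (8 * si * B^2 * L ^ 3) * (1 / real (Suc m))" for m
  proof -
   have "prob (N B) \<le> prob (E B m)" by (rule finite_measure_mono[OF _ Em]) (auto simp: N_def)
   thus ?thesis using PE[OF B, of m] by (rule order_trans)
  qed
  moreover have "(\<lambda>m. (8 * si * B^2 * L ^ 3) * (1 / real (Suc m))) \<longlonglongrightarrow> (8 * si * B^2 * L ^ 3) * 0"
   by (intro tendsto_mult tendsto_const LIMSEQ_Suc[OF lim_1_over_n])
  ultimately have "prob (N B) \<le> 0" by (intro LIMSEQ_le_const[where X="\<lambda>m. (8 * si * B^2 * L ^ 3) * (1 / real (Suc m))"]) auto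
  thus ?thesis by (simp add: measure_le_0_iff)
 qed
 have "AE w in M. w \<notin> N (real (Suc k))" for k
  using PN[of "real (Suc k)"] Nm[of "real (Suc k)"] by (intro AE_not_in) (auto simp: emeasure_eq_measure)
 hence "AE w in M. \<forall>k. w \<notin> N (real (Suc k))" by (simp add: AE_all_countable)
 thus ?thesis
 proof (rule AE_mp, intro AE_I2 impI ballI notI)
  fix w t assume w: "w \<in> space M" and nN: "\<forall>k. w \<notin> N (real (Suc k))" and t: "t \<in> {0..L}" and z: "f t w = 0 \<and> y t w = 0"
  obtain B where B: "\<forall>t\<in>{0..L}. \<forall>s\<in>{0..L}. \<bar>y s w - y t w\<bar> \<le> B * \<bar>s - t\<bar>" using path_lip[OF w] by auto
  obtain k where k: "B \<le> real k" using real_arch_simple[of B] by (elim exE)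
  let ?B = "real (Suc k)"
  have B': "\<bar>y s w\<bar> \<le> ?B * \<bar>s - t\<bar>" if "s \<in> {0..L}" for s
  proof -
   have "\<bar>y s w - y t w\<bar> \<le> B * \<bar>s - t\<bar>" using B t that by auto
   also have "... \<le> ?B * \<bar>s - t\<bar>" using k by (intro mult_right_mono) auto
   finally show ?thesis using z by simp
  qed
  have "w \<in> E ?B m" for m
  proof -
   define i where "i = nat \<lfloor>t / h m\<rfloor>"
   have fl: "real i \<le> t / h m" "t / h m < real i + 1" unfolding i_def using t h0[of m] by auto
   hence b: "T m i \<le> t" "t < T m i + h m" using h0[of m] by (simp_all add: T_def field_simps)
   have "real i * h m \<le> real (Suc m) * h m" using b t by (simp add: T_def h_def)
   hence i: "i \<le> Suc m" using h0[of m] by simp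
   have d: "\<bar>T m i - t\<bar> \<le> h m" using b by simp
   have yT: "\<bar>y (T m i) w\<bar> \<le> ?B * h m"
    by (rule order_trans[OF B'[OF T[OF i]] mult_left_mono[OF d]]) simp
   have fT: "\<bar>f (T m i) w\<bar> \<le> si * ?B * (h m)^2"
   proof -
    have bnd: "norm (f (T m i) w - f t w) \<le> (si * (?B * h m)) * norm (T m i - t)"
    proof (rule field_differentiable_bound[where S="{T m i..t}" and f'="\<lambda>s. si * y s w"])
     fix s assume s: "s \<in> {T m i..t}"
     hence sL: "s \<in> {0..L}" using T[OF i] t by auto
     have sub: "{T m i..t} \<subseteq> {0..L}" using T[OF i] t by auto
     show "((\<lambda>t. f t w) has_field_derivative si * y s w) (at s within {T m i..t})"
      by (rule DERIV_subset[OF path_deriv[OF w sL] sub])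
     have "\<bar>s - t\<bar> \<le> h m" using s d by auto
     hence "?B * \<bar>s - t\<bar> \<le> ?B * h m" by (intro mult_left_mono) auto
     hence "\<bar>y s w\<bar> \<le> ?B * h m" using B'[OF sL] by linarith
     thus "norm (si * y s w) \<le> si * (?B * h m)" using sg_pos by (simp add: abs_mult)
    qed (use b in auto)
    also have "... \<le> (si * (?B * h m)) * h m" using d sg_pos by (intro mult_left_mono) auto
    finally show ?thesis using z by (simp add: power2_eq_square)
   qed
   show ?thesis unfolding E_def using i w yT fT by (intro UN_I[of i]) auto
  qed
  thus False using nN unfolding N_def by auto
 qed
qed

end

section \<open>Measurability of the zero count\<close>

lemma compact_zero_iff:
 fixes g :: "real \<Rightarrow> real"
 assumes S: "compact S" and g: "continuous_on S g" and T: "T \<subseteq> S" "S \<subseteq> closure T"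
 shows "(\<exists>t\<in>S. g t = 0) \<longleftrightarrow> (\<forall>n. \<exists>t\<in>T. \<bar>g t\<bar> < 1 / real (Suc n))"
proof
 assume "\<exists>t\<in>S. g t = 0"
 then obtain z where z: "z \<in> S" "g z = 0" by blast
 show "\<forall>n. \<exists>t\<in>T. \<bar>g t\<bar> < 1 / real (Suc n)"
 proof
  fix n
  obtain d where d: "0 < d" "\<And>t. t \<in> S \<Longrightarrow> dist t z < d \<Longrightarrow> dist (g t) (g z) < 1 / real (Suc n)"
   using g z(1) by (metis continuous_on_iff divide_pos_pos of_nat_0_less_iff zero_less_Suc zero_less_one)
  obtain t where "t \<in> T" "dist t z < d" using z T d(1) closure_approachable by blast
  thus "\<exists>t\<in>T. \<bar>g t\<bar> < 1 / real (Suc n)" using d(2)[of t] T z by (auto simp: dist_real_def)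
 qed
next
 assume h: "\<forall>n. \<exists>t\<in>T. \<bar>g t\<bar> < 1 / real (Suc n)"
 have "S \<noteq> {}" using h[rule_format, of 0] T(1) by auto
 then obtain z where z: "z \<in> S" "\<And>t. t \<in> S \<Longrightarrow> \<bar>g z\<bar> \<le> \<bar>g t\<bar>"
  using continuous_attains_inf[OF S _ continuous_on_rabs[OF g]] by auto
 have "\<bar>g z\<bar> \<le> 0"
 proof (rule ccontr)
  assume "\<not> \<bar>g z\<bar> \<le> 0"
  then obtain n where n: "1 / real (Suc n) < \<bar>g z\<bar>" using nat_approx_posE[of "\<bar>g z\<bar>"] by (metis not_le)
  obtain t where "t \<in> T" "\<bar>g t\<bar> < 1 / real (Suc n)" using h by blast
  thus False using z(2)[of t] T n by auto
 qed
 thus "\<exists>t\<in>S. g t = 0" using z by auto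
qed

text \<open>Having at least \<open>k\<close> points is witnessed by \<open>k\<close> disjoint
  intervals with rational ends, hence by countably many candidates.\<close>

lemma finite_separating_intervals:
 fixes Z :: "real set"
 shows "(\<exists>A\<subseteq>Z. finite A \<and> card A = k) \<longleftrightarrow> (\<exists>P. P \<subseteq> \<rat> \<times> \<rat> \<and> finite P \<and> card P = k \<and>
  pairwise (\<lambda>p q. {fst p..snd p} \<inter> {fst q..snd q} = {}) P \<and> (\<forall>p\<in>P. \<exists>t\<in>{fst p..snd p}. t \<in> Z))"
proof
 assume "\<exists>A\<subseteq>Z. finite A \<and> card A = k"
 then obtain A where A: "A \<subseteq> Z" "finite A" "card A = k" by blast
 obtain e where e: "0 < e" "\<And>x y. x \<in> A \<Longrightarrow> y \<in> A \<Longrightarrow> x \<noteq> y \<Longrightarrow> e \<le> dist x y"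
 proof -
  obtain e where "0 < e" "\<forall>x\<in>A. \<forall>y\<in>A. x \<noteq> y \<longrightarrow> e \<le> \<bar>x - y\<bar>"
   using finite_set_avoid[of "(\<lambda>(x, y). x - y) ` (A \<times> A)" 0] A(2) by auto
  thus ?thesis using that[of e] by (simp add: dist_real_def)
 qed
 have "\<exists>a\<in>\<rat>. x - e/2 < a \<and> a < x" "\<exists>b\<in>\<rat>. x < b \<and> b < x + e/2" for x
  using Rats_dense_in_real[of "x - e/2" x] Rats_dense_in_real[of x "x + e/2"] e(1) by auto
 then obtain a b where ab: "\<And>x. a x \<in> \<rat> \<and> x - e/2 < a x \<and> a x < x" "\<And>x. b x \<in> \<rat> \<and> x < b x \<and> b x < x + e/2"
  by metis
 have dj: "{a x..b x} \<inter> {a y..b y} = {}" if "x \<in> A" "y \<in> A" "x \<noteq> y" for x y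
  using e(2)[OF that] ab(1)[of x] ab(1)[of y] ab(2)[of x] ab(2)[of y] by (fastforce simp: dist_real_def)
 have inj: "inj_on (\<lambda>x. (a x, b x)) A"
 proof (rule inj_onI, rule ccontr)
  fix x y assume "x \<in> A" "y \<in> A" "(a x, b x) = (a y, b y)" "x \<noteq> y"
  hence "x \<in> {a x..b x} \<inter> {a y..b y}" using ab(1)[of x] ab(2)[of x] by simp
  thus False using dj[OF \<open>x \<in> A\<close> \<open>y \<in> A\<close> \<open>x \<noteq> y\<close>] by simp
 qed
 let ?P = "(\<lambda>x. (a x, b x)) ` A"
 have "pairwise (\<lambda>p q. {fst p..snd p} \<inter> {fst q..snd q} = {}) ?P"
  using dj unfolding pairwise_def by auto
 moreover have "\<exists>t\<in>{a x..b x}. t \<in> Z" if "x \<in> A" for x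
  using ab(1)[of x] ab(2)[of x] that A by (intro bexI[of _ x]) auto
 ultimately show "\<exists>P. P \<subseteq> \<rat> \<times> \<rat> \<and> finite P \<and> card P = k \<and>
  pairwise (\<lambda>p q. {fst p..snd p} \<inter> {fst q..snd q} = {}) P \<and> (\<forall>p\<in>P. \<exists>t\<in>{fst p..snd p}. t \<in> Z)"
  using A ab card_image[OF inj] by (intro exI[of _ ?P]) auto
next
 assume "\<exists>P. P \<subseteq> \<rat> \<times> \<rat> \<and> finite P \<and> card P = k \<and>
  pairwise (\<lambda>p q. {fst p..snd p} \<inter> {fst q..snd q} = {}) P \<and> (\<forall>p\<in>P. \<exists>t\<in>{fst p..snd p}. t \<in> Z)"
 then obtain P where P: "finite P" "card P = k" and dj: "pairwise (\<lambda>p q. {fst p..snd p} \<inter> {fst q..snd q} = {}) P"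
  and "\<forall>p\<in>P. \<exists>t\<in>{fst p..snd p}. t \<in> Z" by (elim exE conjE)
 then obtain f where f: "\<And>p. p \<in> P \<Longrightarrow> f p \<in> {fst p..snd p} \<and> f p \<in> Z"
  using bchoice[of P "\<lambda>p t. t \<in> {fst p..snd p} \<and> t \<in> Z"] by blast
 have "inj_on f P"
 proof (rule inj_onI, rule ccontr)
  fix p q assume "p \<in> P" "q \<in> P" "f p = f q" "p \<noteq> q"
  thus False using pairwiseD[OF dj, of p q] f[of p] f[of q] by auto
 qed
 thus "\<exists>A\<subseteq>Z. finite A \<and> card A = k"
  using P f by (intro exI[of _ "f ` P"]) (auto simp: card_image)
qed

text \<open>A zero in a closed interval is a countable condition on the path by
  \<open>compact_zero_iff\<close>, and \<open>k\<close> zeros are reduced to zeros in rational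
  intervals by \<open>finite_separating_intervals\<close>.\<close>

lemma borel_measurable_card_zeros:
 fixes g :: "real \<Rightarrow> 'w \<Rightarrow> real"
 assumes meas: "\<And>t. t \<in> {0..L} \<Longrightarrow> g t \<in> borel_measurable M"
  and cont: "\<And>w. w \<in> space M \<Longrightarrow> continuous_on {0..L} (\<lambda>t. g t w)"
 shows "(\<lambda>w. real (card {t \<in> {0..L}. g t w = 0})) \<in> borel_measurable M"
proof -
 let ?Z = "\<lambda>w. {t \<in> {0..L}. g t w = 0}"
 have hit: "{w \<in> space M. \<exists>t\<in>{a..b}. t \<in> ?Z w} \<in> sets M" for a b
 proof -
  let ?S = "{a..b} \<inter> {0..L}"
  obtain T where T: "countable T" "T \<subseteq> ?S" "?S \<subseteq> closure T" by (rule separable)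
  have "(\<exists>t\<in>{a..b}. t \<in> ?Z w) \<longleftrightarrow> (\<forall>n. \<exists>t\<in>T. \<bar>g t w\<bar> < 1 / real (Suc n))" if "w \<in> space M" for w
   using compact_zero_iff[OF _ _ T(2,3), of "\<lambda>t. g t w"] continuous_on_subset[OF cont[OF that], of ?S]
   by (auto simp: compact_Int)
  hence "{w \<in> space M. \<exists>t\<in>{a..b}. t \<in> ?Z w} = {w \<in> space M. \<forall>n. \<exists>t\<in>T. \<bar>g t w\<bar> < 1 / real (Suc n)}" by auto
  also have "... \<in> sets M"
   by (intro sets.sets_Collect_countable_All sets.sets_Collect_countable_Ex' T(1) borel_measurable_less
     borel_measurable_abs borel_measurable_const meas) (use T(2) in auto)
  finally show ?thesis .
 qed
 define ge where "ge k w \<longleftrightarrow> (\<exists>A\<subseteq>?Z w. finite A \<and> card A = k)" for k w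
 have ge: "Measurable.pred M (ge k)" for k
 proof -
  let ?P = "{P. P \<subseteq> \<rat> \<times> \<rat> \<and> finite P \<and> card P = k \<and> pairwise (\<lambda>p q. {fst p..snd p} \<inter> {fst q..snd q :: real} = {}) P}"
  have c: "countable ?P"
   by (rule countable_subset[OF _ countable_Collect_finite_subset[of "\<rat> \<times> \<rat>"]]) (auto simp: countable_rat)
  have eq: "{w \<in> space M. ge k w} = {w \<in> space M. \<exists>P\<in>?P. \<forall>p\<in>P. \<exists>t\<in>{fst p..snd p}. t \<in> ?Z w}"
   by (simp only: ge_def finite_separating_intervals Bex_def mem_Collect_eq conj_assoc)
  show ?thesis unfolding pred_def eq
   by (intro sets.sets_Collect_countable_Ex'[OF _ c] sets.sets_Collect_finite_All hit) simp
 qed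
 have ge_iff: "ge k w \<longleftrightarrow> infinite (?Z w) \<or> k \<le> card (?Z w)" for k w
 proof (cases "finite (?Z w)")
  case True
  thus ?thesis unfolding ge_def using obtain_subset_with_card_n[of k "?Z w"] card_mono[OF True] True by auto
 next
  case False
  thus ?thesis unfolding ge_def using infinite_arbitrarily_large[OF False, of k] by blast
 qed
 have "(\<lambda>w. card (?Z w)) \<in> measurable M (count_space UNIV)"
 proof (rule measurable_count_space_eq2_countable[THEN iffD2], safe)
  fix k
  \<comment> \<open>The last alternative reflects that an infinite set has cardinality 0.\<close>
  have "(\<lambda>w. card (?Z w)) -` {k} \<inter> space M = {w \<in> space M. ge k w \<and> \<not> ge (Suc k) w \<or> k = 0 \<and> (\<forall>j. ge j w)}"
  proof (intro set_eqI iffI)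
   fix w assume "w \<in> (\<lambda>w. card (?Z w)) -` {k} \<inter> space M"
   thus "w \<in> {w \<in> space M. ge k w \<and> \<not> ge (Suc k) w \<or> k = 0 \<and> (\<forall>j. ge j w)}"
    unfolding ge_iff by (cases "finite (?Z w)") auto
  next
   fix w assume *: "w \<in> {w \<in> space M. ge k w \<and> \<not> ge (Suc k) w \<or> k = 0 \<and> (\<forall>j. ge j w)}"
   have "\<exists>j. \<not> j \<le> card (?Z w)" using Suc_n_not_le_n by blast
   with * show "w \<in> (\<lambda>w. card (?Z w)) -` {k} \<inter> space M"
    unfolding ge_iff by (cases "finite (?Z w)") auto
  qed
  also have "... \<in> sets M" using ge by measurable
  finally show "(\<lambda>w. card (?Z w)) -` {k} \<inter> space M \<in> sets M" .
 qed auto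
 thus ?thesis by measurable
qed

section \<open>Grid crossings as approximations of the zero count\<close>

context gauss_process
begin

definition zero_count :: "'w \<Rightarrow> real" where
 "zero_count w = real (card {t \<in> {0..L}. f t w = 0})"

definition cross_count :: "nat \<Rightarrow> 'w \<Rightarrow> real" where
 "cross_count m w = (\<Sum>i<m. indicator (cross (L / m) (real i * (L / m))) w)"

lemma path_cont: "w \<in> space M \<Longrightarrow> continuous_on {0..L} (\<lambda>t. f t w)"
 unfolding continuous_on_eq_continuous_within using path_deriv DERIV_continuous by blast

lemma zero_count_measurable [measurable]: "zero_count \<in> borel_measurable M"
 unfolding zero_count_def[abs_def] by (rule borel_measurable_card_zeros[OF f_meas path_cont])

lemma grid_mem: "i \<le> m \<Longrightarrow> 0 < m \<Longrightarrow> real i * (L / m) \<in> {0..L}"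
proof -
 assume i: "i \<le> m" "0 < m"
 hence "real i * (L / m) \<le> real m * (L / m)" using L_pos by (intro mult_right_mono) auto
 thus ?thesis using L_pos i by auto
qed

lemma grid_mem_Suc: "i < m \<Longrightarrow> real i * (L / m) + L / m \<in> {0..L}"
 using grid_mem[of "Suc i" m] by (simp add: algebra_simps add_divide_distrib)

lemma cross_count_eq:
 "w \<in> space M \<Longrightarrow> cross_count m w = real (card (sign_changes (\<lambda>t. f t w) (L / m) m))"
proof -
 assume w: "w \<in> space M"
 have "cross_count m w = (\<Sum>i<m. if i \<in> sign_changes (\<lambda>t. f t w) (L / m) m then 1 else 0)"
  unfolding cross_count_def using w by (intro sum.cong) (auto simp: cross_def sign_changes_def)
 also have "... = real (card ({..<m} \<inter> sign_changes (\<lambda>t. f t w) (L / m) m))"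
  by (simp add: sum.inter_restrict[symmetric])
 also have "{..<m} \<inter> sign_changes (\<lambda>t. f t w) (L / m) m = sign_changes (\<lambda>t. f t w) (L / m) m"
  by (auto simp: sign_changes_def)
 finally show ?thesis .
qed

lemma cross_count_measurable [measurable]: "cross_count m \<in> borel_measurable M"
 unfolding cross_count_def[abs_def]
 by (intro borel_measurable_sum borel_measurable_indicator cross_sets) (use grid_mem grid_mem_Suc in auto)

lemma AE_grid_nonzero: "AE w in M. \<forall>m>0. \<forall>i\<le>m. f (real i * (L / real m)) w \<noteq> 0"
proof -
 have "AE w in M. 0 < m \<longrightarrow> i \<le> m \<longrightarrow> f (real i * (L / real m)) w \<noteq> 0" for m i
  using AE_nonzero[OF grid_mem[of i m]] by (cases "0 < m \<and> i \<le> m") auto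
 thus ?thesis by (simp add: AE_all_countable)
qed

text \<open>The numbers of steps are multiples of \<open>K\<close> because the second moment is
  estimated over \<open>K\<close> fixed cells, each divided equally. The bound by
  \<open>zero_count\<close> is recorded for dominated convergence.\<close>

lemma AE_cross_count:
 assumes K: "0 < K"
 shows "AE w in M. (\<forall>k. cross_count (K * Suc k) w \<le> zero_count w) \<and> (\<lambda>k. cross_count (K * Suc k) w) \<longlonglongrightarrow> zero_count w"
proof -
 let ?P = "\<lambda>w. (\<forall>t\<in>{0..L}. \<not> (f t w = 0 \<and> y t w = 0)) \<and> (\<forall>m>0. \<forall>i\<le>m. f (real i * (L / real m)) w \<noteq> 0)"
 let ?Q = "\<lambda>w. (\<forall>k. cross_count (K * Suc k) w \<le> zero_count w) \<and> (\<lambda>k. cross_count (K * Suc k) w) \<longlonglongrightarrow> zero_count w"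
 have "?Q w" if w: "w \<in> space M" and nd: "?P w" for w
 proof -
 let ?g = "\<lambda>t. f t w"
 have der: "\<And>t. t \<in> {0..L} \<Longrightarrow> (?g has_real_derivative si * y t w) (at t within {0..L})" by (rule path_deriv[OF w])
 have simple: "\<And>t. t \<in> {0..L} \<Longrightarrow> ?g t = 0 \<Longrightarrow> si * y t w \<noteq> 0" using nd sg_pos by auto
 have le: "cross_count m w \<le> zero_count w" if "0 < m" for m
  unfolding cross_count_eq[OF w] zero_count_def of_nat_le_iff
  by (rule card_sign_changes_le[OF path_cont[OF w] zeros_finite[OF der simple]]) (use L_pos that in auto)
 obtain e where e: "0 < e" "\<And>h m. 0 < h \<Longrightarrow> h < e \<Longrightarrow> real m * h = L \<Longrightarrow>
  (\<And>i. i \<le> m \<Longrightarrow> ?g (real i * h) \<noteq> 0) \<Longrightarrow> card {t \<in> {0..L}. ?g t = 0} \<le> card (sign_changes ?g h m)"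
 proof (rule card_sign_changes_eventually_ge[OF L_pos der simple])
  fix e assume e: "0 < e" "\<And>h m. 0 < h \<Longrightarrow> h < e \<Longrightarrow> real m * h = L \<Longrightarrow>
   (\<And>i. i \<le> m \<Longrightarrow> ?g (real i * h) \<noteq> 0) \<Longrightarrow> card {t \<in> {0..L}. ?g t = 0} \<le> card (sign_changes ?g h m)"
  show thesis by (rule that[OF e(1)]) (rule e(2))
 qed
 have "(\<lambda>k. L / real (K * Suc k)) \<longlonglongrightarrow> 0"
 proof -
  have "(\<lambda>k. (L / real K) * (1 / real (Suc k))) \<longlonglongrightarrow> (L / real K) * 0"
   by (intro tendsto_mult tendsto_const LIMSEQ_Suc[OF lim_1_over_n])
  moreover have "(L / real K) * (1 / real (Suc k)) = L / real (K * Suc k)" for k by (simp only: of_nat_mult) simp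
  ultimately show ?thesis by (simp only: mult_zero_right)
 qed
 hence "\<forall>\<^sub>F k in sequentially. L / real (K * Suc k) < e" by (rule order_tendstoD(2)) (rule e)
 hence "\<forall>\<^sub>F k in sequentially. cross_count (K * Suc k) w = zero_count w"
 proof eventually_elim
  case (elim k)
  define m where "m = K * Suc k"
  have m: "0 < m" using K by (simp add: m_def)
  have em: "L / real m < e" using elim by (simp only: m_def)
  have nz: "?g (real i * (L / real m)) \<noteq> 0" if "i \<le> m" for i using nd m that by blast
  have "zero_count w \<le> cross_count m w"
   unfolding cross_count_eq[OF w] zero_count_def of_nat_le_iff
   by (rule e(2)) (use em m nz L_pos in auto)
  thus ?case unfolding m_def[symmetric] using le[OF m] by simp
 qed
 hence "(\<lambda>k. cross_count (K * Suc k) w) \<longlonglongrightarrow> zero_count w" by (rule tendsto_eventually)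
 thus ?thesis using le K by auto
 qed
 hence "AE w in M. ?P w \<longrightarrow> ?Q w" by (intro AE_I2 impI)
 with AE_conjI[OF AE_no_degenerate_zero AE_grid_nonzero] show "AE w in M. ?Q w" by (rule AE_mp)
qed

end

lemma (in prob_space) fatou_square:
 fixes X :: "nat \<Rightarrow> 'a \<Rightarrow> real"
 assumes [measurable]: "\<And>n. X n \<in> borel_measurable M" "Z \<in> borel_measurable M"
  and sq: "\<And>n. integrable M (\<lambda>w. (X n w)^2)" and conv: "AE w in M. (\<lambda>n. X n w) \<longlonglongrightarrow> Z w"
  and U: "\<And>n. expectation (\<lambda>w. (X n w)^2) \<le> U n" "U \<longlonglongrightarrow> u"
 shows "integrable M (\<lambda>w. (Z w)^2)" and "expectation (\<lambda>w. (Z w)^2) \<le> u"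
proof -
 have U0: "0 \<le> U n" for n using U(1)[of n] by (rule order_trans[rotated]) simp
 have u0: "0 \<le> u" using U(2) U0 by (intro LIMSEQ_le_const[of U u 0]) auto
 have "(\<integral>\<^sup>+w. ennreal ((Z w)^2) \<partial>M) = (\<integral>\<^sup>+w. liminf (\<lambda>n. ennreal ((X n w)^2)) \<partial>M)"
 proof (rule nn_integral_cong_AE, rule AE_mp[OF conv], rule AE_I2, rule impI)
  fix w assume "(\<lambda>n. X n w) \<longlonglongrightarrow> Z w"
  hence "(\<lambda>n. ennreal ((X n w)^2)) \<longlonglongrightarrow> ennreal ((Z w)^2)" by (intro tendsto_ennrealI tendsto_power)
  thus "ennreal ((Z w)^2) = liminf (\<lambda>n. ennreal ((X n w)^2))"
   by (rule lim_imp_Liminf[symmetric, OF sequentially_bot])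
 qed
 also have "... \<le> liminf (\<lambda>n. \<integral>\<^sup>+w. ennreal ((X n w)^2) \<partial>M)" by (rule nn_integral_liminf) simp
 also have "... \<le> liminf (\<lambda>n. ennreal (U n))"
 proof (rule Liminf_mono, rule always_eventually, rule allI)
  fix n
  have "(\<integral>\<^sup>+w. ennreal ((X n w)^2) \<partial>M) = ennreal (expectation (\<lambda>w. (X n w)^2))"
   using sq by (intro nn_integral_eq_integral) auto
  thus "(\<integral>\<^sup>+w. ennreal ((X n w)^2) \<partial>M) \<le> ennreal (U n)" using U(1)[of n] by (simp add: ennreal_leI)
 qed
 also have "liminf (\<lambda>n. ennreal (U n)) = ennreal u"
  by (intro lim_imp_Liminf sequentially_bot tendsto_ennrealI U(2))
 finally have le: "(\<integral>\<^sup>+w. ennreal ((Z w)^2) \<partial>M) \<le> ennreal u" .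
 hence "(\<integral>\<^sup>+w. ennreal (norm ((Z w)^2)) \<partial>M) < \<infinity>" by (simp add: le_less_trans[OF _ ennreal_less_top])
 thus int: "integrable M (\<lambda>w. (Z w)^2)" by (intro integrableI_bounded) auto
 have "(\<integral>\<^sup>+w. ennreal ((Z w)^2) \<partial>M) = ennreal (expectation (\<lambda>w. (Z w)^2))"
  using int by (intro nn_integral_eq_integral) auto
 thus "expectation (\<lambda>w. (Z w)^2) \<le> u" using le u0 by simp
qed

section \<open>Second moment of the crossing count\<close>

context gauss_process
begin

lemma quart_nonneg: "0 \<le> quart_cov t s"
 by (simp add: quart_cov_def)

lemma quad_ge: assumes "t \<in> {0..L}" "s \<in> {0..L}" shows "-2 \<le> quad_cov t s"
proof -
 have "(ip (y t) (f s))^2 \<le> 1" "(ip (f t) (y s))^2 \<le> 1"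
  using ip_cauchy[OF y_H f_H, of t s] ip_cauchy[OF f_H y_H, of t s] assms ff yy by auto
 thus ?thesis unfolding quad_cov_def
  using zero_le_power2[of "ip (f t) (f s)"] zero_le_power2[of "ip (y t) (y s)"] by linarith
qed

lemma ip_diff_bound:
 assumes "X \<in> H" "Y \<in> H" "X' \<in> H" "Y' \<in> H" and n: "nrm X' = 1" "nrm Y = 1"
  and d: "nrm (\<lambda>w. X w - X' w) \<le> e1" "nrm (\<lambda>w. Y w - Y' w) \<le> e2"
 shows "\<bar>ip X Y - ip X' Y'\<bar> \<le> e1 + e2"
proof -
 have H: "(\<lambda>w. X w - X' w) \<in> H" "(\<lambda>w. Y w - Y' w) \<in> H" using assms by (auto intro: H_intros)
 have "ip X Y - ip X' Y' = ip (\<lambda>w. X w - X' w) Y + ip X' (\<lambda>w. Y w - Y' w)"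
  using assms by (simp add: ip_linear)
 also have "\<bar>...\<bar> \<le> \<bar>ip (\<lambda>w. X w - X' w) Y\<bar> + \<bar>ip X' (\<lambda>w. Y w - Y' w)\<bar>" by (rule abs_triangle_ineq)
 also have "... \<le> e1 + e2"
  using ip_le_nrm[OF H(1) assms(2)] ip_le_nrm[OF assms(3) H(2)] n d by (intro add_mono) auto
 finally show ?thesis .
qed

context
 fixes K p :: nat
 assumes K: "0 < K" and p: "0 < p"
  and mesh: "C1 * (si * (L / K)) \<le> 1/64" "1 / (128 * C1) \<le> si * (L / K)"
begin

definition "cell_len = L / K"
definition "step = L / (K * p)"
definition "nstep = si * step"
definition "node i = real i * step"
definition "cell k = {k * p..<k * p + p}"
definition "crossing i = cross step (node i)"

lemma step_pos: "0 < step" using L_pos K p by (simp add: step_def)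
lemma nstep_pos: "0 < nstep" using step_pos sg_pos by (simp add: nstep_def)
lemma p_step: "real p * step = cell_len" using p by (simp add: step_def cell_len_def)
lemma sg_cell: "si * cell_len \<le> 1/64" "C1 * (si * cell_len) \<le> 1/64" "0 < si * cell_len"
proof -
 have m: "C1 * (si * cell_len) \<le> 1/64" using mesh by (simp only: cell_len_def)
 moreover show pos: "0 < si * cell_len" using sg_pos L_pos K by (simp add: cell_len_def)
 moreover have "1 * (si * cell_len) \<le> C1 * (si * cell_len)" using pos by (intro mult_right_mono C1_ge) simp
 ultimately show "si * cell_len \<le> 1/64" "C1 * (si * cell_len) \<le> 1/64" by linarith+
qed
lemma p_nstep: "real p * nstep = si * cell_len" using p_step by (simp add: nstep_def)
lemma C_nstep: "C1 * nstep \<le> 1/64"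
proof -
 have "nstep \<le> real p * nstep" using p nstep_pos by simp
 hence "C1 * nstep \<le> C1 * (si * cell_len)" using C1_ge unfolding p_nstep by (intro mult_left_mono) auto
 thus ?thesis using sg_cell by linarith
qed

lemma node_mem: "i < K * p \<Longrightarrow> node i \<in> {0..L}" "i < K * p \<Longrightarrow> node i + step \<in> {0..L}"
 using grid_mem[of i "K * p"] grid_mem_Suc[of i "K * p"] K p by (auto simp: node_def step_def)

lemma cell_less: "k < K \<Longrightarrow> i \<in> cell k \<Longrightarrow> i < K * p"
proof -
 assume "k < K" "i \<in> cell k"
 hence "i < Suc k * p" by (simp add: cell_def)
 also have "... \<le> K * p" using \<open>k < K\<close> by (intro mult_right_mono) auto
 finally show ?thesis .
qed

lemma crossing_sets: "i < K * p \<Longrightarrow> crossing i \<in> sets M"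
 unfolding crossing_def using node_mem by (intro cross_sets)

lemma crossing_prob: "i < K * p \<Longrightarrow> prob (crossing i) \<le> 2 * nstep"
proof -
 assume i: "i < K * p"
 have "\<bar>prob (cross step (node i)) - si * step / pi\<bar> \<le> 10 * C1 * (si * step)^2"
  by (rule cross_estimates(1)[OF node_mem[OF i] step_pos _ f_H[of 0]]) (use C_nstep L_pos in \<open>auto simp: nstep_def\<close>)
 hence "prob (crossing i) \<le> nstep / pi + 10 * C1 * nstep^2" by (simp add: crossing_def nstep_def)
 moreover have "nstep / pi \<le> nstep / 3" using nstep_pos by (intro divide_pi_le) simp
 moreover have "10 * C1 * nstep^2 \<le> nstep"
  using mult_right_mono[OF C_nstep, of nstep] nstep_pos by (simp add: power2_eq_square)
 ultimately show ?thesis using nstep_pos by linarith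
qed

lemma node_dist: assumes "k < K" "i \<in> cell k" "j \<in> cell k" shows "\<bar>node i - node j\<bar> \<le> cell_len"
proof -
 have "\<bar>real i - real j\<bar> \<le> real p" using assms by (auto simp: cell_def)
 hence "\<bar>real i - real j\<bar> * step \<le> real p * step" using step_pos by (intro mult_right_mono) auto
 thus ?thesis using step_pos unfolding p_step node_def by (simp add: left_diff_distrib[symmetric] abs_mult)
qed

definition "cell_count k w = (\<Sum>i\<in>cell k. indicat_real (crossing i) w)"

lemma int_crossing: "i < K * p \<Longrightarrow> j < K * p \<Longrightarrow> expectation (\<lambda>w. indicat_real (crossing i) w * indicat_real (crossing j) w) = prob (crossing i \<inter> crossing j)"
  "i < K * p \<Longrightarrow> j < K * p \<Longrightarrow> integrable M (\<lambda>w. indicat_real (crossing i) w * indicat_real (crossing j) w)"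
proof -
 assume ij: "i < K * p" "j < K * p"
 have "(\<lambda>w. indicat_real (crossing i) w * indicat_real (crossing j) w) = indicat_real (crossing i \<inter> crossing j)"
  by (auto simp: indicator_def)
 moreover have "crossing i \<inter> crossing j \<in> sets M" using crossing_sets ij by auto
 ultimately show "expectation (\<lambda>w. indicat_real (crossing i) w * indicat_real (crossing j) w) = prob (crossing i \<inter> crossing j)"
  "integrable M (\<lambda>w. indicat_real (crossing i) w * indicat_real (crossing j) w)"
  by (simp_all add: emeasure_eq_measure)
qed

lemma cell_count_mult: assumes "k < K" "l < K"
 shows "expectation (\<lambda>w. cell_count k w * cell_count l w) = (\<Sum>i\<in>cell k. \<Sum>j\<in>cell l. prob (crossing i \<inter> crossing j))"
  and "integrable M (\<lambda>w. cell_count k w * cell_count l w)"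
proof -
 have e: "cell_count k w * cell_count l w = (\<Sum>i\<in>cell k. \<Sum>j\<in>cell l. indicat_real (crossing i) w * indicat_real (crossing j) w)" for w
  by (simp add: cell_count_def sum_product)
 show "integrable M (\<lambda>w. cell_count k w * cell_count l w)" unfolding e
  using cell_less assms by (intro Bochner_Integration.integrable_sum int_crossing(2)) auto
 have lt: "i < K * p" "j < K * p" if "i \<in> cell k" "j \<in> cell l" for i j using that cell_less assms by auto
 have "expectation (\<lambda>w. cell_count k w * cell_count l w) =
   (\<Sum>i\<in>cell k. expectation (\<lambda>w. \<Sum>j\<in>cell l. indicat_real (crossing i) w * indicat_real (crossing j) w))"
  unfolding e by (rule Bochner_Integration.integral_sum) (intro Bochner_Integration.integrable_sum int_crossing(2) lt)
 also have "... = (\<Sum>i\<in>cell k. \<Sum>j\<in>cell l. expectation (\<lambda>w. indicat_real (crossing i) w * indicat_real (crossing j) w))"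
  by (intro sum.cong refl Bochner_Integration.integral_sum int_crossing(2) lt)
 also have "... = (\<Sum>i\<in>cell k. \<Sum>j\<in>cell l. prob (crossing i \<inter> crossing j))"
  by (intro sum.cong refl int_crossing(1) lt)
 finally show "expectation (\<lambda>w. cell_count k w * cell_count l w) = (\<Sum>i\<in>cell k. \<Sum>j\<in>cell l. prob (crossing i \<inter> crossing j))" .
qed

text \<open>A step has at most 47 partners at distance below 24 steps; these pairs are bounded by a
  single crossing probability. All other pairs in the cell fall under the repulsion bound. As the
  cell has length at most \<open>1 / (64 * C1)\<close> in units of \<open>1 / si\<close>, the total
  stays below 2 however fine the steps are.\<close>

lemma cell_count_square_le: assumes k: "k < K" shows "expectation (\<lambda>w. cell_count k w * cell_count k w) \<le> 2"
proof -
 have card: "card (cell k) = p" by (simp add: cell_def)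
 have "expectation (\<lambda>w. cell_count k w * cell_count k w) = (\<Sum>i\<in>cell k. \<Sum>j\<in>cell k. prob (crossing i \<inter> crossing j))" by (rule cell_count_mult(1)[OF k k])
 also have "... \<le> (\<Sum>i\<in>cell k. \<Sum>j\<in>cell k. 2 * nstep * of_bool (\<bar>int i - int j\<bar> < 24) + 5 * C1^2 * nstep^2)"
 proof (intro sum_mono)
  fix i j assume ij: "i \<in> cell k" "j \<in> cell k"
  hence lt: "i < K * p" "j < K * p" using cell_less k by auto
  show "prob (crossing i \<inter> crossing j) \<le> 2 * nstep * of_bool (\<bar>int i - int j\<bar> < 24) + 5 * C1^2 * nstep^2"
  proof (cases "\<bar>int i - int j\<bar> < 24")
   case True
   have "prob (crossing i \<inter> crossing j) \<le> prob (crossing i)" using crossing_sets lt by (intro finite_measure_mono) auto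
   hence "prob (crossing i \<inter> crossing j) \<le> 2 * nstep" using crossing_prob[OF lt(1)] by linarith
   thus ?thesis using True by (simp add: add_increasing2)
  next
   case False
   have "prob (cross step (node i) \<inter> cross step (node j)) \<le> 5 * C1^2 * (si * step)^2"
   proof (rule prob_cross_cross_near[OF node_mem[OF lt(1)] node_mem[OF lt(2)] step_pos])
    have "24 \<le> \<bar>real j - real i\<bar>" using False by linarith
    hence "24 * step \<le> \<bar>real j - real i\<bar> * step" using step_pos by (intro mult_right_mono) auto
    thus "24 * step \<le> \<bar>node j - node i\<bar>" using step_pos by (simp add: node_def left_diff_distrib[symmetric] abs_mult)
    have "si * \<bar>node j - node i\<bar> \<le> si * cell_len" using node_dist[OF k ij(2,1)] sg_pos by (intro mult_left_mono) auto
    hence "C1 * (si * \<bar>node j - node i\<bar>) \<le> C1 * (si * cell_len)" by (rule mult_left_mono) (use C1_ge in simp)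
    thus "C1 * (si * \<bar>node j - node i\<bar>) \<le> 1" using sg_cell by linarith
   qed
   thus ?thesis using False by (simp add: crossing_def nstep_def)
  qed
 qed
 also have "... \<le> (\<Sum>i\<in>cell k. 94 * nstep + real p * (5 * C1^2 * nstep^2))"
 proof (rule sum_mono)
  fix i assume "i \<in> cell k"
  have "(\<Sum>j\<in>cell k. of_bool (\<bar>int i - int j\<bar> < 24) :: real) = real (card {j \<in> cell k. \<bar>int i - int j\<bar> < 24})"
   by (simp add: sum.If_cases cell_def Int_def)
  also have "... \<le> real (card {i - 23..i + 23})"
   by (intro of_nat_mono card_mono) auto
  also have "... \<le> 47" by simp
  finally have "2 * nstep * (\<Sum>j\<in>cell k. of_bool (\<bar>int i - int j\<bar> < 24)) \<le> 2 * nstep * 47"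
   using nstep_pos by (intro mult_left_mono) auto
  thus "(\<Sum>j\<in>cell k. 2 * nstep * of_bool (\<bar>int i - int j\<bar> < 24) + 5 * C1^2 * nstep^2) \<le> 94 * nstep + real p * (5 * C1^2 * nstep^2)"
   by (simp add: sum.distrib sum_distrib_left[symmetric] card)
 qed
 also have "... = 94 * (real p * nstep) + 5 * (C1 * (real p * nstep))^2"
  by (simp add: card power2_eq_square algebra_simps)
 also have "... \<le> 94 * (1/64) + 5 * (1/64)^2"
  unfolding p_nstep using sg_cell C1_ge by (intro add_mono mult_left_mono power_mono) auto
 also have "... \<le> 2" by (simp add: power2_eq_square)
 finally show ?thesis .
qed

text \<open>The price per unit of \<open>quart_cov\<close> on a pair of cells with a large
  covariance: 2 bounds the mean product of the counts, \<open>16 ^ 4\<close> is the inverse of the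
  least possible \<open>quart_cov\<close> there, and \<open>(128 * C1)^2\<close> is the inverse of
  the least product of the two cell lengths.\<close>

definition "C_sing = 2 * 16 ^ 4 * (128 * C1)^2"

definition "pair_bound i j = nstep^2 * ((1 + quad_cov (node i) (node j) / 2 + 6 * quart_cov (node i) (node j)) / pi^2
  + C_sing * quart_cov (node i) (node j) + (C1 + 67) * nstep)"

text \<open>A dichotomy at the corners of the two cells; inside, the covariances vary by at most
  1/16. If all four are at most 1/8 at the corner, they stay below 1/5 and the expansion around
  independence applies. Otherwise one of them stays above 1/16, so \<open>quart_cov\<close> is
  bounded below throughout and pays for the crude bound 2. The diagonal and distant
  near-coincidences are treated alike.\<close>

lemma cell_count_pair_le: assumes kl: "k < K" "l < K"
 shows "expectation (\<lambda>w. cell_count k w * cell_count l w) \<le> (\<Sum>i\<in>cell k. \<Sum>j\<in>cell l. pair_bound i j)"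
proof -
 define a where "a k = k * p" for k :: nat
 have a: "a k \<in> cell k" for k using p by (simp add: a_def cell_def)
 have aL: "node (a k) \<in> {0..L}" if "k < K" for k using node_mem(1)[OF cell_less[OF that a]] .
 have nd: "nrm (\<lambda>w. f (node i) w - f (node (a k)) w) \<le> 1/32" "nrm (\<lambda>w. y (node i) w - y (node (a k)) w) \<le> 1/32"
  "nrm (\<lambda>w. f (node (a k)) w - f (node i) w) \<le> 1/32" "nrm (\<lambda>w. y (node (a k)) w - y (node i) w) \<le> 1/32"
  if k: "k < K" and i: "i \<in> cell k" for i k
 proof -
  have *: "nrm (\<lambda>w. f s w - f t w) \<le> 1/32 \<and> nrm (\<lambda>w. y s w - y t w) \<le> 1/32"
   if st: "s \<in> {0..L}" "t \<in> {0..L}" "\<bar>s - t\<bar> \<le> cell_len" for s t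
  proof -
   have d: "si * \<bar>s - t\<bar> \<le> si * cell_len" using st sg_pos by (intro mult_left_mono) auto
   hence Cd: "C1 * (si * \<bar>s - t\<bar>) \<le> C1 * (si * cell_len)" by (rule mult_left_mono) (use C1_ge in simp)
   have "nrm (\<lambda>w. f s w - f t w) \<le> 2 * (si * \<bar>s - t\<bar>)"
    by (rule nrm_increment(1)[OF st(2,1)]) (use Cd sg_cell in linarith)
   moreover have "nrm (\<lambda>w. y s w - y t w) \<le> C1 * (si * \<bar>s - t\<bar>)" using y_lip[OF st(2,1)] by simp
   ultimately show ?thesis using d Cd sg_cell by (intro conjI) linarith+
  qed
  have 1: "\<bar>node i - node (a k)\<bar> \<le> cell_len" by (rule node_dist[OF k i a])
  hence 2: "\<bar>node (a k) - node i\<bar> \<le> cell_len" by linarith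
  show "nrm (\<lambda>w. f (node i) w - f (node (a k)) w) \<le> 1/32" "nrm (\<lambda>w. y (node i) w - y (node (a k)) w) \<le> 1/32"
   "nrm (\<lambda>w. f (node (a k)) w - f (node i) w) \<le> 1/32" "nrm (\<lambda>w. y (node (a k)) w - y (node i) w) \<le> 1/32"
   using *[OF node_mem(1)[OF cell_less[OF k i]] aL[OF k] 1] *[OF aL[OF k] node_mem(1)[OF cell_less[OF k i]] 2] by auto
 qed
 have cov: "\<bar>ip (u (node i)) (v (node j)) - ip (u (node (a k))) (v (node (a l)))\<bar> \<le> 1/16"
  if uv: "u = f \<or> u = y" "v = f \<or> v = y" and i: "i \<in> cell k" and j: "j \<in> cell l" for u v i j
 proof -
  have L4: "node i \<in> {0..L}" "node j \<in> {0..L}" "node (a k) \<in> {0..L}" "node (a l) \<in> {0..L}"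
   using node_mem(1) cell_less i j kl aL by auto
  have "\<bar>ip (u (node i)) (v (node j)) - ip (u (node (a k))) (v (node (a l)))\<bar> \<le> 1/32 + 1/32"
   by (rule ip_diff_bound) (use uv L4 f_H y_H nrm_f nrm_y nd[OF kl(1) i] nd[OF kl(2) j] in auto)
  thus ?thesis by simp
 qed
 define R where "R u v = \<bar>ip (u (node (a k))) (v (node (a l)))\<bar>" for u v :: "real \<Rightarrow> 'w \<Rightarrow> real"
 have base: "0 \<le> (1 + quad_cov (node i) (node j) / 2 + 6 * quart_cov (node i) (node j)) / pi^2"
  if "i \<in> cell k" "j \<in> cell l" for i j
  using quad_ge[of "node i" "node j"] quart_nonneg[of "node i" "node j"] node_mem(1) cell_less that kl by auto
 have Ct: "0 \<le> (C1 + 67) * nstep" "0 \<le> C_sing" using C1_ge nstep_pos by (simp_all add: C_sing_def)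
 show ?thesis
 proof (cases "R f f \<le> 1/8 \<and> R y f \<le> 1/8 \<and> R f y \<le> 1/8 \<and> R y y \<le> 1/8")
  case True
  have "expectation (\<lambda>w. cell_count k w * cell_count l w) = (\<Sum>i\<in>cell k. \<Sum>j\<in>cell l. prob (crossing i \<inter> crossing j))" by (rule cell_count_mult(1)[OF kl])
  also have "... \<le> (\<Sum>i\<in>cell k. \<Sum>j\<in>cell l. pair_bound i j)"
  proof (intro sum_mono)
   fix i j assume ij: "i \<in> cell k" "j \<in> cell l"
   hence lt: "i < K * p" "j < K * p" using cell_less kl by auto
   have sm: "\<bar>ip (u (node i)) (v (node j))\<bar> \<le> 1/5" if "u = f \<or> u = y" "v = f \<or> v = y" for u v
   proof -
    have "R u v \<le> 1/8" using True that by auto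
    thus ?thesis using cov[OF that ij] unfolding R_def by linarith
   qed
   have "prob (crossing i \<inter> crossing j) \<le> (si * step)^2 * ((1 + quad_cov (node i) (node j) / 2 + 6 * quart_cov (node i) (node j)) / pi^2 + (C1 + 67) * (si * step))"
    unfolding crossing_def
    by (rule prob_cross_cross_regular[OF node_mem[OF lt(1)] node_mem[OF lt(2)] step_pos])
     (use C_nstep sm in \<open>auto simp: nstep_def\<close>)
   also have "... \<le> pair_bound i j"
    unfolding pair_bound_def nstep_def[symmetric] using quart_nonneg[of "node i" "node j"] Ct by (intro mult_left_mono) auto
   finally show "prob (crossing i \<inter> crossing j) \<le> pair_bound i j" .
  qed
  finally show ?thesis .
 next
  case False
  then obtain u v where uv: "u = f \<or> u = y" "v = f \<or> v = y" "1/8 < R u v" by (auto simp: not_le)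
  have "expectation (\<lambda>w. cell_count k w * cell_count l w) \<le> expectation (\<lambda>w. (cell_count k w * cell_count k w + cell_count l w * cell_count l w) / 2)"
  proof (rule integral_mono)
   fix w show "cell_count k w * cell_count l w \<le> (cell_count k w * cell_count k w + cell_count l w * cell_count l w) / 2"
    using sum_squares_bound[of "cell_count k w" "cell_count l w"] by (simp add: power2_eq_square)
  qed (use cell_count_mult(2) kl in auto)
  also have "... \<le> 2" using cell_count_mult(2) kl cell_count_square_le[OF kl(1)] cell_count_square_le[OF kl(2)] by simp
  also have "2 \<le> (real p * nstep)^2 * (C_sing * (1/16) ^ 4)"
  proof -
   have "(1 / (128 * C1))^2 \<le> (real p * nstep)^2" unfolding p_nstep cell_len_def using mesh C1_ge by (intro power_mono) auto
   hence "(1 / (128 * C1))^2 * (C_sing * (1/16) ^ 4) \<le> (real p * nstep)^2 * (C_sing * (1/16) ^ 4)"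
    using Ct by (intro mult_right_mono) auto
   moreover have "(1 / (128 * C1))^2 * (C_sing * (1/16) ^ 4) = 2"
    using C1_ge by (simp add: C_sing_def power_divide)
   ultimately show ?thesis by simp
  qed
  also have "(real p * nstep)^2 * (C_sing * (1/16) ^ 4) = (\<Sum>i\<in>cell k. \<Sum>j\<in>cell l. nstep\<^sup>2 * (C_sing * (1/16) ^ 4))"
   by (simp add: cell_def power2_eq_square)
  also have "... \<le> (\<Sum>i\<in>cell k. \<Sum>j\<in>cell l. pair_bound i j)"
  proof (intro sum_mono)
   fix i j assume ij: "i \<in> cell k" "j \<in> cell l"
   have "1/16 \<le> \<bar>ip (u (node i)) (v (node j))\<bar>"
    using cov[OF uv(1,2) ij] uv(3) unfolding R_def by linarith
   hence "(1/16) ^ 4 \<le> \<bar>ip (u (node i)) (v (node j))\<bar> ^ 4" by (intro power_mono) auto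
   also have "... \<le> quart_cov (node i) (node j)" using uv by (auto simp: quart_cov_def)
   finally have "C_sing * (1/16) ^ 4 \<le> C_sing * quart_cov (node i) (node j)" using Ct by (intro mult_left_mono) auto
   thus "nstep^2 * (C_sing * (1/16) ^ 4) \<le> pair_bound i j"
    unfolding pair_bound_def using base[OF ij] Ct by (intro mult_left_mono) auto
  qed
  finally show ?thesis .
 qed
qed

lemma cross_count_cells: "cross_count (K * p) w = (\<Sum>k<K. cell_count k w)"
proof -
 have "cross_count (K * p) w = (\<Sum>i<K * p. indicat_real (crossing i) w)"
  by (simp add: cross_count_def crossing_def node_def step_def)
 also have "... = (\<Sum>k<K. cell_count k w)" unfolding cell_count_def cell_def by (rule sum.nat_group[symmetric])
 finally show ?thesis .
qed

lemma second_moment_cross_count: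
 "expectation (\<lambda>w. (cross_count (K * p) w)^2) \<le>
  (si * (L / real (K * p)))^2 * (\<Sum>i<K * p. \<Sum>j<K * p.
   (1 + quad_cov (real i * (L / real (K * p))) (real j * (L / real (K * p))) / 2
     + 6 * quart_cov (real i * (L / real (K * p))) (real j * (L / real (K * p)))) / pi^2
   + C_sing * quart_cov (real i * (L / real (K * p))) (real j * (L / real (K * p)))
   + (C1 + 67) * (si * (L / real (K * p))))"
 "integrable M (\<lambda>w. (cross_count (K * p) w)^2)"
proof -
 have e: "(cross_count (K * p) w)^2 = (\<Sum>k<K. \<Sum>l<K. cell_count k w * cell_count l w)" for w
  unfolding cross_count_cells by (simp add: power2_eq_square sum_product)
 show "integrable M (\<lambda>w. (cross_count (K * p) w)^2)" unfolding e
  by (intro Bochner_Integration.integrable_sum cell_count_mult(2)) auto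
 have "expectation (\<lambda>w. (cross_count (K * p) w)^2) = (\<Sum>k<K. \<Sum>l<K. expectation (\<lambda>w. cell_count k w * cell_count l w))"
 proof -
  have "expectation (\<lambda>w. \<Sum>k<K. \<Sum>l<K. cell_count k w * cell_count l w) =
    (\<Sum>k<K. expectation (\<lambda>w. \<Sum>l<K. cell_count k w * cell_count l w))"
   by (rule Bochner_Integration.integral_sum) (intro Bochner_Integration.integrable_sum cell_count_mult(2), auto)
  also have "... = (\<Sum>k<K. \<Sum>l<K. expectation (\<lambda>w. cell_count k w * cell_count l w))"
   by (intro sum.cong refl Bochner_Integration.integral_sum cell_count_mult(2)) auto
  finally show ?thesis unfolding e .
 qed
 also have "... \<le> (\<Sum>k<K. \<Sum>l<K. \<Sum>i\<in>cell k. \<Sum>j\<in>cell l. pair_bound i j)"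
  by (intro sum_mono cell_count_pair_le) auto
 also have "... = (\<Sum>k<K. \<Sum>i\<in>cell k. \<Sum>l<K. \<Sum>j\<in>cell l. pair_bound i j)"
  by (intro sum.cong refl sum.swap)
 also have "... = (\<Sum>k<K. \<Sum>i\<in>cell k. \<Sum>j<K * p. pair_bound i j)"
  unfolding cell_def by (intro sum.cong refl sum.nat_group)
 also have "... = (\<Sum>i<K * p. \<Sum>j<K * p. pair_bound i j)"
  unfolding cell_def by (rule sum.nat_group)
 finally show "expectation (\<lambda>w. (cross_count (K * p) w)^2) \<le>
  (si * (L / real (K * p)))^2 * (\<Sum>i<K * p. \<Sum>j<K * p.
   (1 + quad_cov (real i * (L / real (K * p))) (real j * (L / real (K * p))) / 2
     + 6 * quart_cov (real i * (L / real (K * p))) (real j * (L / real (K * p)))) / pi^2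
   + C_sing * quart_cov (real i * (L / real (K * p))) (real j * (L / real (K * p)))
   + (C1 + 67) * (si * (L / real (K * p))))"
  unfolding pair_bound_def node_def nstep_def step_def by (simp only: sum_distrib_left)
qed

end

end

section \<open>Refinement of the mesh: mean, second moment and covariances of the zero count\<close>

context gauss_process
begin

lemma fourth_power_integrable: assumes X: "X \<in> H" shows "integrable M (\<lambda>w. (X w) ^ 4)"
proof (cases "ip X X = 0")
 case True
 have [measurable]: "X \<in> borel_measurable M" using X H_meas by simp
 have "AE w in M. (X w)\<^sup>2 = 0" using True integral_nonneg_eq_0_iff_AE[OF H_sq[OF X]] by (auto simp: ip_self)
 hence "AE w in M. (X w) ^ 4 = 0" by auto
 thus ?thesis by (subst integrable_cong_AE[where g="\<lambda>w. 0"]) auto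
next
 case False
 hence n: "nrm X \<noteq> 0" by (simp add: nrm_def)
 let ?G = "\<lambda>w. X w / nrm X"
 have G: "?G \<in> H" "ip ?G ?G = 1" using X n by (auto simp: H_intros ip_linear nrm_sq[symmetric] power2_eq_square)
 have "has_bochner_integral M (\<lambda>w. (?G w) ^ (2 * 2)) (fact (2 * 2) / (2 ^ 2 * fact 2))"
  by (rule has_bochner_integral_unit_normal[OF G _ std_normal_moment_even]) simp
 hence "integrable M (\<lambda>w. (nrm X) ^ 4 * (?G w) ^ 4)" by (intro integrable_mult_right) (auto simp: has_bochner_integral_iff)
 thus ?thesis using n by (simp add: power_divide)
qed

context
 fixes K :: nat
 assumes K: "0 < K" and mesh: "C1 * (si * (L / K)) \<le> 1/64" "1 / (128 * C1) \<le> si * (L / K)"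
begin

abbreviation (input) "len p \<equiv> L / real (K * Suc p)"

lemma len_tendsto: "(\<lambda>p. len p) \<longlonglongrightarrow> 0"
proof -
 have "(\<lambda>k. (L / real K) * (1 / real (Suc k))) \<longlonglongrightarrow> (L / real K) * 0"
  by (intro tendsto_mult tendsto_const LIMSEQ_Suc[OF lim_1_over_n])
 moreover have "(L / real K) * (1 / real (Suc k)) = L / real (K * Suc k)" for k by (simp only: of_nat_mult) simp
 ultimately show ?thesis by (simp only: mult_zero_right)
qed

lemma nodes_pos: "0 < real (K * Suc p)"
 unfolding of_nat_0_less_iff using K by simp

lemma len_pos: "0 < len p"
 by (rule divide_pos_pos[OF L_pos nodes_pos])

lemma len_mult: "real (K * Suc p) * len p = L"
proof -
 have "x * (L / x) = L" if "0 < x" for x :: real using that by simp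
 thus ?thesis using nodes_pos by blast
qed

lemma len_small: "C1 * (si * len p) \<le> 1/64"
proof -
 have "real K \<le> real (K * Suc p)" by simp
 hence "len p \<le> L / real K" using L_pos K by (intro divide_left_mono mult_pos_pos) (simp_all only: of_nat_0_less_iff less_imp_le)
 hence "C1 * (si * len p) \<le> C1 * (si * (L / real K))" using C1_ge sg_pos by (intro mult_left_mono) auto
 thus ?thesis using mesh by linarith
qed

lemma expectation_cross_count:
 "\<bar>expectation (cross_count (K * Suc p)) - si * L / pi\<bar> \<le> 10 * C1 * si^2 * L * len p"
proof -
 let ?m = "K * Suc p" and ?h = "len p"
 have t: "real i * ?h \<in> {0..L}" "real i * ?h + ?h \<in> {0..L}" if "i < ?m" for i
  using grid_mem[of i ?m] grid_mem_Suc[of i ?m] that K by auto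
 have sets: "cross ?h (real i * ?h) \<in> sets M" if "i < ?m" for i using cross_sets t that by blast
 have ce: "expectation (cross_count ?m) = (\<Sum>i<?m. prob (cross ?h (real i * ?h)))"
 proof -
  have "expectation (cross_count ?m) = (\<Sum>i<?m. expectation (indicat_real (cross ?h (real i * ?h))))"
   unfolding cross_count_def[abs_def]
   by (rule Bochner_Integration.integral_sum) (use sets in \<open>auto simp: emeasure_eq_measure\<close>)
  also have "... = (\<Sum>i<?m. prob (cross ?h (real i * ?h)))"
   using sets by (intro sum.cong refl) (simp)
  finally show ?thesis .
 qed
 have s: "si * L / pi = (\<Sum>i<?m. si * ?h / pi)"
 proof -
  have gen: "a * (si * x / pi) = si * (a * x) / pi" for a x :: real by simp
  show ?thesis unfolding sum_constant card_lessThan gen len_mult ..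
 qed
 have "\<bar>expectation (cross_count ?m) - si * L / pi\<bar> = \<bar>\<Sum>i<?m. prob (cross ?h (real i * ?h)) - si * ?h / pi\<bar>"
  unfolding ce s sum_subtractf ..
 also have "... \<le> (\<Sum>i<?m. \<bar>prob (cross ?h (real i * ?h)) - si * ?h / pi\<bar>)" by (rule sum_abs)
 also have "... \<le> (\<Sum>i<?m. 10 * C1 * (si * ?h)^2)"
 proof (rule sum_mono)
  fix i assume "i \<in> {..<?m}"
  hence i: "i < ?m" by simp
  show "\<bar>prob (cross ?h (real i * ?h)) - si * ?h / pi\<bar> \<le> 10 * C1 * (si * ?h)^2"
   by (rule cross_estimates(1)[OF t[OF i] len_pos _ f_H[of 0]]) (use len_small[of p] L_pos in auto)
 qed
 also have "... = 10 * C1 * si^2 * (real ?m * ?h) * ?h" by (simp add: power2_eq_square)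
 also have "... = 10 * C1 * si^2 * L * ?h" unfolding len_mult ..
 finally show ?thesis .
qed

lemma expectation_cross_count_tendsto: "(\<lambda>p. expectation (cross_count (K * Suc p))) \<longlonglongrightarrow> si * L / pi"
proof -
 have "(\<lambda>p. 10 * C1 * si^2 * L * len p) \<longlonglongrightarrow> 10 * C1 * si^2 * L * 0"
  by (intro tendsto_mult tendsto_const len_tendsto)
 hence "(\<lambda>p. 10 * C1 * si^2 * L * len p) \<longlonglongrightarrow> 0" by (simp only: mult_zero_right)
 hence "(\<lambda>p. expectation (cross_count (K * Suc p)) - si * L / pi) \<longlonglongrightarrow> 0"
  by (rule Lim_null_comparison[rotated]) (use expectation_cross_count in auto)
 thus ?thesis by (rule LIM_zero_cancel)
qed

text \<open>The upper bound for the second moment passes to the limit by Fatou's lemma and thereby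
  makes the zero count integrable. Only then can it serve as a dominating function, which gives the
  exact mean.\<close>

lemma zero_count_moments:
 assumes lq: "(\<lambda>p. (len p)^2 * (\<Sum>i<K * Suc p. \<Sum>j<K * Suc p. quad_cov (real i * len p) (real j * len p))) \<longlonglongrightarrow> Iq"
  and lF: "(\<lambda>p. (len p)^2 * (\<Sum>i<K * Suc p. \<Sum>j<K * Suc p. quart_cov (real i * len p) (real j * len p))) \<longlonglongrightarrow> IF"
 shows "integrable M (\<lambda>w. (zero_count w)^2)"
  and "expectation zero_count = si * L / pi"
  and "expectation (\<lambda>w. (zero_count w)^2) \<le> (si * L / pi)^2 + si^2 * (Iq / (2 * pi^2) + (6 / pi^2 + C_sing) * IF)"
proof -
 let ?SS = "\<lambda>g p. (len p)\<^sup>2 * (\<Sum>i<K * Suc p. \<Sum>j<K * Suc p. g (real i * len p) (real j * len p))"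
 define U where "U p = si^2 * (L^2 / pi^2 + ?SS quad_cov p / (2 * pi^2) + (6 / pi^2 + C_sing) * ?SS quart_cov p + L^2 * (C1 + 67) * si * len p)" for p
 have le: "expectation (\<lambda>w. (cross_count (K * Suc p) w)^2) \<le> U p" for p
 proof -
  define m x where "m = K * Suc p" and "x = len p"
  have mx: "real m * x = L" unfolding m_def x_def by (rule len_mult)
  define Q R where "Q = (\<Sum>i<m. \<Sum>j<m. quad_cov (real i * x) (real j * x))" and "R = (\<Sum>i<m. \<Sum>j<m. quart_cov (real i * x) (real j * x))"
  have c: "(\<Sum>i<m. \<Sum>j<m. A) = (real m)^2 * A" for A :: real by (simp add: power2_eq_square)
  have "expectation (\<lambda>w. (cross_count m w)^2) \<le>
   (si * x)^2 * (\<Sum>i<m. \<Sum>j<m.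
    (1 + quad_cov (real i * x) (real j * x) / 2 + 6 * quart_cov (real i * x) (real j * x)) / pi^2
    + C_sing * quart_cov (real i * x) (real j * x) + (C1 + 67) * (si * x))"
   unfolding m_def x_def by (rule second_moment_cross_count(1)[OF K zero_less_Suc mesh])
  also have "... = (si * x)^2 * (\<Sum>i<m. \<Sum>j<m. (1 / pi^2 + (C1 + 67) * (si * x))
    + ((1 / (2 * pi^2)) * quad_cov (real i * x) (real j * x) + (6 / pi^2 + C_sing) * quart_cov (real i * x) (real j * x)))"
   by (intro arg_cong2[where f="(*)"] refl sum.cong) (simp add: add_divide_distrib algebra_simps)
  also have "... = (si * x)^2 * ((real m)^2 * (1 / pi^2 + (C1 + 67) * (si * x)) + ((1 / (2 * pi^2)) * Q + (6 / pi^2 + C_sing) * R))"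
   by (simp only: sum.distrib[of "\<lambda>_. 1 / pi^2 + (C1 + 67) * (si * x)"] sum.distrib[of "\<lambda>_. \<Sum>j<m. 1 / pi^2 + (C1 + 67) * (si * x)"] c
     sum.distrib[of "\<lambda>i. (1 / (2 * pi^2)) * F i" for F] sum.distrib[of "\<lambda>i. \<Sum>j<m. (1 / (2 * pi^2)) * F i j" for F] sum_distrib_left[symmetric] Q_def R_def)
  also have "... = si^2 * ((real m * x)^2 * (1 / pi^2 + (C1 + 67) * (si * x)) + (1 / (2 * pi^2)) * (x^2 * Q) + (6 / pi^2 + C_sing) * (x^2 * R))"
   by (simp add: algebra_simps)
  also have "... = si^2 * (L^2 / pi^2 + (x^2 * Q) / (2 * pi^2) + (6 / pi^2 + C_sing) * (x^2 * R) + L^2 * (C1 + 67) * si * x)"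
   unfolding mx by (simp add: algebra_simps)
  finally show ?thesis unfolding U_def m_def x_def Q_def R_def .
 qed
 have lim: "U \<longlonglongrightarrow> si\<^sup>2 * (L^2 / pi^2 + Iq / (2 * pi^2) + (6 / pi^2 + C_sing) * IF + L^2 * (C1 + 67) * si * 0)"
  unfolding U_def by (intro tendsto_mult tendsto_add tendsto_const tendsto_divide lq lF len_tendsto) auto
 have conv: "AE w in M. (\<lambda>p. cross_count (K * Suc p) w) \<longlonglongrightarrow> zero_count w"
  using AE_cross_count[OF K] by (rule AE_mp) (rule AE_I2, simp)
 have dom: "AE w in M. \<forall>p. cross_count (K * Suc p) w \<le> zero_count w"
  using AE_cross_count[OF K] by (rule AE_mp) (rule AE_I2, simp)
 note F = fatou_square[OF cross_count_measurable zero_count_measurable second_moment_cross_count(2)[OF K zero_less_Suc mesh] conv le lim]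
 show sq: "integrable M (\<lambda>w. (zero_count w)^2)" by (rule F(1))
 show "expectation (\<lambda>w. (zero_count w)^2) \<le> (si * L / pi)^2 + si^2 * (Iq / (2 * pi^2) + (6 / pi^2 + C_sing) * IF)"
  using F(2) by (simp add: power_divide algebra_simps)
 have int: "integrable M zero_count" by (rule square_integrable_imp_integrable[OF zero_count_measurable sq])
 have cc0: "0 \<le> cross_count m w" for m w by (simp add: cross_count_def sum_nonneg)
 have "(\<lambda>p. expectation (cross_count (K * Suc p))) \<longlonglongrightarrow> expectation zero_count"
 proof (rule integral_dominated_convergence[OF _ _ int conv])
  fix p
  show "AE w in M. norm (cross_count (K * Suc p) w) \<le> zero_count w"
   using dom by (rule AE_mp) (rule AE_I2, simp add: cc0 del: of_nat_mult mult_Suc_right)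
 qed simp_all
 thus "expectation zero_count = si * L / pi"
  using expectation_cross_count_tendsto by (rule LIMSEQ_unique)
qed

text \<open>A sum over single crossings: the error per step is quadratic in the mesh, so it
  disappears in the limit. Dominated convergence turns the remaining Riemann sum into an equality,
  in contrast to the inequality for the second moment.\<close>

lemma zero_count_square_covariance:
 assumes sq: "integrable M (\<lambda>w. (zero_count w)^2)" and xs: "xs \<in> H"
  and lJ: "(\<lambda>p. len p * (\<Sum>i<K * Suc p. (ip xs (y (real i * len p)))\<^sup>2 - (ip xs (f (real i * len p)))^2)) \<longlonglongrightarrow> J"
 shows "integrable M (\<lambda>w. zero_count w * (xs w)^2)"
  and "expectation (\<lambda>w. zero_count w * (xs w)^2) = si * L / pi * ip xs xs + si / pi * J"
proof -
 have [measurable]: "xs \<in> borel_measurable M" using xs H_meas by simp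
 show int: "integrable M (\<lambda>w. zero_count w * (xs w)^2)"
 proof (rule Bochner_Integration.integrable_bound)
  show "integrable M (\<lambda>w. (zero_count w)^2 + (xs w) ^ 4)"
   using sq fourth_power_integrable[OF xs] by auto
  have "\<bar>a * b^2\<bar> \<le> \<bar>a^2 + b ^ 4\<bar>" for a b :: real
  proof -
   have "2 * \<bar>a\<bar> * b^2 \<le> a^2 + b ^ 4" using sum_squares_bound[of "\<bar>a\<bar>" "b^2"] by simp
   moreover have "0 \<le> \<bar>a\<bar> * b^2" by simp
   moreover have "\<bar>a * b^2\<bar> = \<bar>a\<bar> * b^2" by (simp add: abs_mult)
   ultimately show ?thesis by linarith
  qed
  thus "AE w in M. norm (zero_count w * (xs w)^2) \<le> norm ((zero_count w)^2 + (xs w) ^ 4)" by auto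
 qed simp
 have conv: "AE w in M. (\<lambda>p. cross_count (K * Suc p) w * (xs w)^2) \<longlonglongrightarrow> zero_count w * (xs w)^2"
  using AE_cross_count[OF K] by (rule AE_mp) (rule AE_I2, intro impI tendsto_intros, simp)
 have cc0: "0 \<le> cross_count m w" for m w by (simp add: cross_count_def sum_nonneg)
 have L1: "(\<lambda>p. expectation (\<lambda>w. cross_count (K * Suc p) w * (xs w)^2)) \<longlonglongrightarrow> expectation (\<lambda>w. zero_count w * (xs w)^2)"
 proof (rule integral_dominated_convergence[OF _ _ int conv])
  fix p
  show "AE w in M. norm (cross_count (K * Suc p) w * (xs w)^2) \<le> zero_count w * (xs w)^2"
  proof (rule AE_mp[OF AE_cross_count[OF K]], rule AE_I2, rule impI)
   fix w assume "(\<forall>k. cross_count (K * Suc k) w \<le> zero_count w) \<and> (\<lambda>k. cross_count (K * Suc k) w) \<longlonglongrightarrow> zero_count w"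
   hence "cross_count (K * Suc p) w \<le> zero_count w" by blast
   thus "norm (cross_count (K * Suc p) w * (xs w)^2) \<le> zero_count w * (xs w)^2"
    using cc0[of "K * Suc p" w] by (simp add: mult_right_mono del: of_nat_mult mult_Suc_right)
  qed
 qed simp_all
 define T where "T p = len p * (\<Sum>i<K * Suc p. (ip xs (y (real i * len p)))\<^sup>2 - (ip xs (f (real i * len p)))^2)" for p
 have bnd: "\<bar>expectation (\<lambda>w. cross_count (K * Suc p) w * (xs w)^2) - expectation (cross_count (K * Suc p)) * ip xs xs - si / pi * T p\<bar>
   \<le> 40 * C1 * si^2 * L * ip xs xs * len p" for p
 proof -
  let ?m = "K * Suc p" and ?h = "len p"
  have t: "real i * ?h \<in> {0..L}" "real i * ?h + ?h \<in> {0..L}" if "i < ?m" for i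
   using grid_mem[of i ?m] grid_mem_Suc[of i ?m] that K by auto
  have sets: "cross ?h (real i * ?h) \<in> sets M" if "i < ?m" for i using cross_sets t that by blast
  have i1: "integrable M (\<lambda>w. indicat_real (cross ?h (real i * ?h)) w * (xs w)^2)" if "i < ?m" for i
   using integrable_mult_indicator[OF sets[OF that] H_sq[OF xs]] by simp
  have e1: "expectation (\<lambda>w. cross_count ?m w * (xs w)^2) = (\<Sum>i<?m. expectation (\<lambda>w. indicat_real (cross ?h (real i * ?h)) w * (xs w)^2))"
   unfolding cross_count_def sum_distrib_right by (rule Bochner_Integration.integral_sum) (use i1 in auto)
  have e2: "expectation (cross_count ?m) = (\<Sum>i<?m. prob (cross ?h (real i * ?h)))"
  proof -
   have "expectation (cross_count ?m) = (\<Sum>i<?m. expectation (indicat_real (cross ?h (real i * ?h))))"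
    unfolding cross_count_def[abs_def]
    by (rule Bochner_Integration.integral_sum) (use sets in \<open>auto simp: emeasure_eq_measure\<close>)
   also have "... = (\<Sum>i<?m. prob (cross ?h (real i * ?h)))"
    using sets by (intro sum.cong refl) (simp)
   finally show ?thesis .
  qed
  have e3: "si / pi * T p = (\<Sum>i<?m. si * ?h / pi * ((ip xs (y (real i * ?h)))^2 - (ip xs (f (real i * ?h)))^2))"
   unfolding T_def sum_distrib_left by (intro sum.cong refl) (simp only: times_divide_eq_left mult.assoc)
  have "\<bar>expectation (\<lambda>w. cross_count ?m w * (xs w)^2) - expectation (cross_count ?m) * ip xs xs - si / pi * T p\<bar> =
   \<bar>\<Sum>i<?m. expectation (\<lambda>w. indicat_real (cross ?h (real i * ?h)) w * (xs w)^2) - prob (cross ?h (real i * ?h)) * ip xs xs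
    - si * ?h / pi * ((ip xs (y (real i * ?h)))^2 - (ip xs (f (real i * ?h)))^2)\<bar>"
   unfolding e1 e2 e3 sum_distrib_right sum_subtractf ..
  also have "... \<le> (\<Sum>i<?m. \<bar>expectation (\<lambda>w. indicat_real (cross ?h (real i * ?h)) w * (xs w)^2) - prob (cross ?h (real i * ?h)) * ip xs xs
    - si * ?h / pi * ((ip xs (y (real i * ?h)))^2 - (ip xs (f (real i * ?h)))^2)\<bar>)"
   by (rule sum_abs)
  also have "... \<le> (\<Sum>i<?m. 40 * C1 * (si * ?h)^2 * ip xs xs)"
  proof (rule sum_mono)
   fix i assume "i \<in> {..<?m}"
   hence i: "i < ?m" by simp
   show "\<bar>expectation (\<lambda>w. indicat_real (cross ?h (real i * ?h)) w * (xs w)^2) - prob (cross ?h (real i * ?h)) * ip xs xs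
    - si * ?h / pi * ((ip xs (y (real i * ?h)))^2 - (ip xs (f (real i * ?h)))^2)\<bar> \<le> 40 * C1 * (si * ?h)^2 * ip xs xs"
    by (rule cross_estimates(2)[OF t[OF i] len_pos _ xs]) (use len_small[of p] in auto)
  qed
  also have "... = 40 * C1 * si^2 * (real ?m * ?h) * ip xs xs * ?h" by (simp add: power2_eq_square)
  also have "... = 40 * C1 * si^2 * L * ip xs xs * ?h" unfolding len_mult ..
  finally show ?thesis .
 qed
 have "(\<lambda>p. 40 * C1 * si^2 * L * ip xs xs * len p) \<longlonglongrightarrow> 40 * C1 * si^2 * L * ip xs xs * 0"
  by (intro tendsto_mult tendsto_const len_tendsto)
 hence "(\<lambda>p. 40 * C1 * si^2 * L * ip xs xs * len p) \<longlonglongrightarrow> 0" by (simp only: mult_zero_right)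
 hence "(\<lambda>p. expectation (\<lambda>w. cross_count (K * Suc p) w * (xs w)^2) - expectation (cross_count (K * Suc p)) * ip xs xs - si / pi * T p) \<longlonglongrightarrow> 0"
  by (rule Lim_null_comparison[rotated]) (use bnd in auto)
 moreover have "(\<lambda>p. expectation (\<lambda>w. cross_count (K * Suc p) w * (xs w)^2) - expectation (cross_count (K * Suc p)) * ip xs xs - si / pi * T p)
   \<longlonglongrightarrow> expectation (\<lambda>w. zero_count w * (xs w)^2) - si * L / pi * ip xs xs - si / pi * J"
  unfolding T_def by (intro tendsto_diff tendsto_mult tendsto_const L1 expectation_cross_count_tendsto lJ)
 ultimately have "expectation (\<lambda>w. zero_count w * (xs w)^2) - si * L / pi * ip xs xs - si / pi * J = 0"
  by (rule LIMSEQ_unique[symmetric])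
 thus "expectation (\<lambda>w. zero_count w * (xs w)^2) = si * L / pi * ip xs xs + si / pi * J" by simp
qed

end

end

section \<open>Oscillatory integrals along the curve\<close>

text \<open>Parseval in the frame \<open>e\<close>, \<open>d / norm d\<close>, with the denominator
  cleared so that \<open>d = 0\<close> is covered.\<close>

lemma orthonormal_frame_identity:
 fixes w e d :: "real ^ 2"
 assumes "norm w = 1" "norm e = 1" "e \<bullet> d = 0"
 shows "(w \<bullet> e)^2 * (norm d)^2 + (w \<bullet> d)^2 = (norm d)^2"
proof -
 have nd: "(norm d)^2 = (d $ 1)^2 + (d $ 2)^2" for d :: "real ^ 2"
  by (simp add: norm_vec_def UNIV_2)
 have w: "(w $ 1)^2 + (w $ 2)^2 = 1" and e: "(e $ 1)^2 + (e $ 2)^2 = 1"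
  using assms nd[of w] nd[of e] by auto
 have o: "e $ 1 * d $ 1 + e $ 2 * d $ 2 = 0" using assms(3) by (simp add: inner_vec_def UNIV_2)
 define k where "k = e $ 1 * d $ 2 - e $ 2 * d $ 1"
 have d: "d $ 1 = - k * e $ 2" "d $ 2 = k * e $ 1" using e o unfolding k_def by algebra+
 have "(w \<bullet> e)^2 * k^2 + (w \<bullet> d)^2 = k^2 * (((w $ 1)^2 + (w $ 2)^2) * ((e $ 1)^2 + (e $ 2)^2))"
  by (simp add: inner_vec_def UNIV_2 d) algebra
 moreover have "(norm d)^2 = k^2" unfolding nd d using e by algebra
 ultimately show ?thesis using w e by simp
qed

locale plane_curve =
 fixes L :: real and G :: "real \<Rightarrow> real ^ 2" and D :: "nat \<Rightarrow> real \<Rightarrow> real ^ 2" and kp\<^sub>0 kp :: real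
 assumes L_pos: "0 < L"
  and G_deriv: "t \<in> {0..L} \<Longrightarrow> (G has_vector_derivative D 0 t) (at t within {0..L})"
  and D_deriv: "t \<in> {0..L} \<Longrightarrow> (D k has_vector_derivative D (Suc k) t) (at t within {0..L})"
  and unit_speed: "t \<in> {0..L} \<Longrightarrow> norm (D 0 t) = 1"
  and curv_pos: "0 < kp\<^sub>0" and curv_low: "t \<in> {0..L} \<Longrightarrow> kp\<^sub>0 \<le> norm (D 1 t)"
  and curv_high: "t \<in> {0..L} \<Longrightarrow> norm (D 1 t) \<le> kp" "t \<in> {0..L} \<Longrightarrow> norm (D 2 t) \<le> kp"
begin

lemma kp_pos: "0 < kp"
 using curv_pos curv_low[of 0] curv_high(1)[of 0] L_pos by auto

lemma continuous_D: "continuous_on {0..L} (D k)"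
 unfolding continuous_on_eq_continuous_within using D_deriv has_vector_derivative_continuous by blast

lemma continuous_G: "continuous_on {0..L} G"
 unfolding continuous_on_eq_continuous_within using G_deriv has_vector_derivative_continuous by blast

lemma D_orthogonal: assumes t: "t \<in> {0..L}" shows "D 0 t \<bullet> D 1 t = 0"
proof -
 have "((\<lambda>t. D 0 t \<bullet> D 0 t) has_vector_derivative (D 0 t \<bullet> D 1 t + D 1 t \<bullet> D 0 t)) (at t within {0..L})"
  using bounded_bilinear.has_vector_derivative[OF bounded_bilinear_inner D_deriv[OF t, of 0] D_deriv[OF t, of 0]] by simp
 hence "((\<lambda>t. 1::real) has_vector_derivative (D 0 t \<bullet> D 1 t + D 1 t \<bullet> D 0 t)) (at t within {0..L})"
  by (rule has_vector_derivative_transform[OF t, rotated]) (use unit_speed in \<open>auto simp: dot_square_norm\<close>)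
 hence "D 0 t \<bullet> D 1 t + D 1 t \<bullet> D 0 t = 0"
  using vector_derivative_unique_within_closed_interval[of 0 L t "\<lambda>t. 1::real" _ 0] t L_pos by auto
 thus ?thesis by (simp add: inner_commute)
qed

lemma inner_D_bounds:
 assumes "norm w = 1" "t \<in> {0..L}"
 shows "\<bar>w \<bullet> D 1 t\<bar> \<le> kp" "\<bar>w \<bullet> D 2 t\<bar> \<le> kp"
 using Cauchy_Schwarz_ineq2[of w "D 1 t"] Cauchy_Schwarz_ineq2[of w "D 2 t"] curv_high[OF assms(2)]
 unfolding assms(1) by linarith+

lemma inner_deriv:
 assumes "t \<in> {0..L}"
 shows "((\<lambda>t. w \<bullet> G t) has_real_derivative w \<bullet> D 0 t) (at t within {0..L})"
  "((\<lambda>t. w \<bullet> D k t) has_real_derivative w \<bullet> D (Suc k) t) (at t within {0..L})"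
 unfolding has_real_derivative_iff_has_vector_derivative
 by (intro bounded_linear.has_vector_derivative[OF bounded_linear_inner_right] G_deriv D_deriv assms)+

definition "res_const = L + 2 * (2 * kp + kp * L) / kp\<^sub>0^2"

text \<open>Since the curve has no inflection, \<open>1 \<le> p^2 + p'^2 / kp\<^sub>0^2\<close> for \<open>p = w \<bullet> D 0\<close>, and
 \<open>p' / (p^2 + ep^2)\<close> is the derivative of \<open>arctan (p / ep) / ep\<close>.\<close>

lemma resonance_integral_le:
 assumes w: "norm w = 1" and ep: "0 < ep" "ep \<le> 1"
 shows "integral {0..L} (\<lambda>t. 1 / ((w \<bullet> D 0 t)^2 + ep^2)) \<le> res_const / ep"
proof -
 let ?p = "\<lambda>k t. w \<bullet> D k t"
 let ?q = "\<lambda>t. (?p 0 t)^2 + ep^2" and ?a = "\<lambda>t. arctan (?p 0 t / ep)"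
 have q: "0 < ?q t" for t using ep by (simp add: add_nonneg_pos)
 have q0: "?q t \<noteq> 0" for t using q[of t] by linarith
 have cq: "continuous_on {0..L} (\<lambda>t. (?p k t)^2 / ?q t)" "continuous_on {0..L} (\<lambda>t. 1 / ?q t)"
  "continuous_on {0..L} (\<lambda>t. ?p 2 t * ?a t)" for k
  using q0 ep by (auto intro!: continuous_intros continuous_D)
 have da: "(?a has_real_derivative ep * (?p 1 t / ?q t)) (at t within {0..L})" if t: "t \<in> {0..L}" for t
 proof -
  have "(?a has_real_derivative inverse (1 + (?p 0 t / ep)^2) * (?p (Suc 0) t / ep)) (at t within {0..L})"
   by (intro DERIV_chain'[OF _ DERIV_arctan] DERIV_cdivide inner_deriv t)
  moreover have "inverse (1 + (?p 0 t / ep)^2) * (?p (Suc 0) t / ep) = ep * (?p 1 t / ?q t)"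
   by (simp add: divide_simps) (simp add: power2_eq_square)
  ultimately show ?thesis by simp
 qed
 have i: "((\<lambda>t. ep * ((?p 1 t)^2 / ?q t) + ?p 2 t * ?a t) has_integral (?p 1 L * ?a L - ?p 1 0 * ?a 0)) {0..L}"
 proof (rule fundamental_theorem_of_calculus)
  fix t assume t: "t \<in> {0..L}"
  show "((\<lambda>t. ?p 1 t * ?a t) has_vector_derivative ep * ((?p 1 t)^2 / ?q t) + ?p 2 t * ?a t) (at t within {0..L})"
   using DERIV_mult'[OF inner_deriv(2)[OF t, of w 1] da[OF t]]
   unfolding has_real_derivative_iff_has_vector_derivative by (simp add: mult_ac numeral_2_eq_2)
 qed (use L_pos in simp)
 have "(\<lambda>t. ep * ((?p 1 t)^2 / ?q t)) integrable_on {0..L}" "(\<lambda>t. ?p 2 t * ?a t) integrable_on {0..L}"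
  by (intro integrable_continuous_interval continuous_on_mult_left cq)+
 note Henstock_Kurzweil_Integration.integral_add[OF this, unfolded integral_unique[OF i]]
 hence ftc: "ep * integral {0..L} (\<lambda>t. (?p 1 t)^2 / ?q t) = ?p 1 L * ?a L - ?p 1 0 * ?a 0 - integral {0..L} (\<lambda>t. ?p 2 t * ?a t)"
  unfolding integral_mult_right by linarith
 have a2: "\<bar>?a t\<bar> \<le> 2" for t using arctan_bounded[of "?p 0 t / ep"] pi_less_4 by auto
 have e: "\<bar>?p 1 t * ?a t\<bar> \<le> kp * 2" "\<bar>?p 2 t * ?a t\<bar> \<le> kp * 2" if "t \<in> {0..L}" for t
  unfolding abs_mult using inner_D_bounds[OF w that] a2[of t] by (auto intro!: mult_mono)
 have "norm (integral {0..L} (\<lambda>t. ?p 2 t * ?a t)) \<le> kp * 2 * (L - 0)"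
  by (rule integral_bound) (use e(2) L_pos cq(3) in auto)
 hence J: "ep * integral {0..L} (\<lambda>t. (?p 1 t)^2 / ?q t) \<le> 2 * (2 * kp + kp * L)"
  unfolding ftc using e(1)[of L] e(1)[of 0] L_pos by simp
 have "integral {0..L} (\<lambda>t. 1 / ?q t) \<le> integral {0..L} (\<lambda>t. 1 + 1 / kp\<^sub>0^2 * ((?p 1 t)^2 / ?q t))"
 proof (rule integral_le)
  fix t assume t: "t \<in> {0..L}"
  have id: "(?p 0 t)^2 * (norm (D 1 t))^2 + (?p 1 t)^2 = (norm (D 1 t))^2"
   by (rule orthonormal_frame_identity[OF w unit_speed[OF t] D_orthogonal[OF t]])
  have k: "kp\<^sub>0^2 \<le> (norm (D 1 t))^2" using curv_low[OF t] curv_pos by (intro power_mono) auto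
  have le1: "(?p 0 t)^2 \<le> 1"
   using Cauchy_Schwarz_ineq2[of w "D 0 t"] w unit_speed[OF t] by (simp add: abs_square_le_1)
  have "kp\<^sub>0^2 * (1 - (?p 0 t)^2) \<le> (norm (D 1 t))^2 * (1 - (?p 0 t)^2)" using k le1 by (intro mult_right_mono) auto
  hence "kp\<^sub>0^2 * (1 - (?p 0 t)^2) \<le> (?p 1 t)^2" using id by (simp add: right_diff_distrib mult.commute)
  hence "1 - (?p 0 t)^2 \<le> 1 / kp\<^sub>0^2 * (?p 1 t)^2" using curv_pos by (simp add: field_simps)
  hence "1 \<le> ?q t + 1 / kp\<^sub>0^2 * (?p 1 t)^2" using zero_le_power2[of ep] by linarith
  hence "1 / ?q t \<le> (?q t + 1 / kp\<^sub>0^2 * (?p 1 t)^2) / ?q t" by (intro divide_right_mono) auto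
  also have "... = 1 + 1 / kp\<^sub>0^2 * ((?p 1 t)^2 / ?q t)"
   unfolding add_divide_distrib[of "?q t"] divide_self[OF q0] by (simp only: times_divide_eq_right)
  finally show "1 / ?q t \<le> 1 + 1 / kp\<^sub>0^2 * ((?p 1 t)^2 / ?q t)" .
 qed (intro integrable_continuous_interval continuous_on_add continuous_on_const continuous_on_mult_left cq)+
 also have "... = L + 1 / kp\<^sub>0^2 * integral {0..L} (\<lambda>t. (?p 1 t)^2 / ?q t)"
 proof -
  have "(\<lambda>t. 1 / kp\<^sub>0^2 * ((?p 1 t)^2 / ?q t)) integrable_on {0..L}"
   by (intro integrable_continuous_interval continuous_on_mult_left cq)
  from Henstock_Kurzweil_Integration.integral_add[OF integrable_const_ivl this, of 1] show ?thesis
   unfolding integral_mult_right using L_pos by simp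
 qed
 also have "... \<le> L / ep + 1 / kp\<^sub>0^2 * (2 * (2 * kp + kp * L) / ep)"
  using J ep L_pos by (intro add_mono mult_left_mono) (auto simp: field_simps)
 also have "... = res_const / ep" by (simp add: res_const_def add_divide_distrib mult.commute)
 finally show ?thesis .
qed

definition "osc_const = 2 + L + (1 + kp) * res_const"

text \<open>Integration by parts against \<open>p / (p^2 + ep^2)\<close>, a regularisation of \<open>1 / p\<close>, with
 \<open>ep\<close> of the order of \<open>norm v powr (- 1 / 2)\<close>.\<close>

lemma oscillatory_integral_bound:
 fixes g g' :: "real \<Rightarrow> complex"
 assumes v: "1 \<le> norm v"
  and dg: "\<And>t. t \<in> {0..L} \<Longrightarrow> (g has_vector_derivative g' t) (at t within {0..L})"
  and cg': "continuous_on {0..L} g'"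
  and g: "\<And>t. t \<in> {0..L} \<Longrightarrow> norm (g t) \<le> A" "\<And>t. t \<in> {0..L} \<Longrightarrow> norm (g' t) \<le> A"
 shows "norm (integral {0..L} (\<lambda>t. g t * exp (\<i> * of_real (2 * pi * (v \<bullet> G t))))) \<le> osc_const * A / sqrt (norm v)"
proof -
 have ends: "L \<in> {0..L}" "0 \<in> {0..L}" using L_pos by auto
 have nv: "norm v \<noteq> 0" using v by linarith
 define w V where "w = v /\<^sub>R norm v" and "V = 2 * pi * norm v"
 have w: "norm w = 1" and V: "norm v \<le> V" "1 \<le> V"
 proof -
  show "norm w = 1" using nv by (simp add: w_def)
  have "1 * norm v \<le> 2 * pi * norm v" using pi_gt3 by (intro mult_right_mono) auto
  thus "norm v \<le> V" "1 \<le> V" using v by (auto simp: V_def)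
 qed
 \<comment> \<open>This balances the boundary terms, of order \<open>1 / (V * ep)\<close>, against
   the price of the regularisation, \<open>ep^2\<close> times a resonance integral of order
   \<open>1 / ep\<close>.\<close>
 define ep where "ep = 1 / sqrt V"
 have ep: "0 < ep" "ep \<le> 1" "V * ep = sqrt V" using V by (auto simp: ep_def real_div_sqrt)
 let ?p = "\<lambda>k t. w \<bullet> D k t" and ?e = "\<lambda>t. exp (\<i> * of_real (V * (w \<bullet> G t)))"
 define rh where "rh t = 1 / ((?p 0 t)^2 + ep^2)" for t
 define ps' where "ps' t = ?p 1 t * rh t * (1 - 2 * (?p 0 t)^2 * rh t)" for t
 have q: "0 < (?p 0 t)^2 + ep^2" for t using ep by (simp add: add_nonneg_pos)
 have q0: "(?p 0 t)^2 + ep^2 \<noteq> 0" for t using q[of t] by linarith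
 have rh: "0 < rh t" "(?p 0 t)^2 * rh t + ep^2 * rh t = 1" for t
  using q[of t] by (auto simp: rh_def add_divide_distrib[symmetric])
 have A: "0 \<le> A" using order_trans[OF norm_ge_zero g(1)[of 0]] L_pos by auto
 have alg: "a * (b^2 + c^2) - b * (2 * (a * b)) = a * (c^2 - b^2)" for a b c :: real
  by (simp add: power2_eq_square algebra_simps)
 have dp: "((\<lambda>t. ?p 0 t * rh t) has_real_derivative ps' t) (at t within {0..L})" if t: "t \<in> {0..L}" for t
  unfolding rh_def ps'_def using inner_deriv(2)[OF t, of w 0] q0[of t]
  by (auto intro!: derivative_eq_intros simp: divide_simps alg)
 have ps: "\<bar>?p 0 t * rh t\<bar> \<le> 1 / ep" for t
 proof -
  have "2 * (ep * \<bar>?p 0 t\<bar>) \<le> (?p 0 t)^2 + ep^2"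
   using sum_squares_bound[of "\<bar>?p 0 t\<bar>" ep] by (simp add: mult_ac)
  moreover have "0 \<le> ep * \<bar>?p 0 t\<bar>" using ep by simp
  ultimately have "ep * \<bar>?p 0 t\<bar> \<le> (?p 0 t)^2 + ep^2" by linarith
  thus ?thesis using q[of t] ep by (simp add: rh_def divide_simps mult.commute)
 qed
 have ps'_le: "\<bar>ps' t\<bar> \<le> kp * rh t" if t: "t \<in> {0..L}" for t
 proof -
  have "0 \<le> (?p 0 t)^2 * rh t" "0 \<le> ep^2 * rh t" using rh(1)[of t] by simp_all
  hence "\<bar>1 - 2 * (?p 0 t)^2 * rh t\<bar> \<le> 1" using rh(2)[of t] by linarith
  hence "\<bar>?p 1 t\<bar> * rh t * \<bar>1 - 2 * (?p 0 t)^2 * rh t\<bar> \<le> kp * rh t * 1"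
   using inner_D_bounds[OF w t] rh(1)[of t] by (intro mult_mono) auto
  thus ?thesis using rh(1)[of t] by (simp add: ps'_def abs_mult)
 qed
 define F where "F t = g t * of_real (?p 0 t * rh t) * ?e t / (\<i> * of_real V)" for t
 \<comment> \<open>The defect of \<open>F\<close> as a primitive. Its last term appears because
   \<open>p^2 / (p^2 + ep^2)\<close> equals \<open>1 - ep^2 * rh\<close> and not 1.\<close>
 define r where "r t = (g t * of_real (ps' t) + g' t * of_real (?p 0 t * rh t)) / (\<i> * of_real V) - g t * of_real (ep^2 * rh t)" for t
 have dF: "(F has_vector_derivative g t * ?e t + r t * ?e t) (at t within {0..L})" if t: "t \<in> {0..L}" for t
 proof -
  have dps: "((\<lambda>t. complex_of_real (?p 0 t * rh t)) has_vector_derivative of_real (ps' t)) (at t within {0..L})"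
   by (rule has_vector_derivative_of_real[OF dp[OF t]])
  have "((\<lambda>t. \<i> * complex_of_real (V * (w \<bullet> G t))) has_vector_derivative \<i> * of_real (V * ?p 0 t)) (at t within {0..L})"
   by (intro bounded_linear.has_vector_derivative[OF bounded_linear_mult_right] has_vector_derivative_of_real DERIV_cmult inner_deriv t)
  from field_vector_diff_chain_within[OF this, where g=exp and g'="?e t"]
  have de: "(?e has_vector_derivative \<i> * of_real (V * ?p 0 t) * ?e t) (at t within {0..L})"
   by (auto intro!: DERIV_subset[OF DERIV_exp] simp: o_def)
  have "of_real (?p 0 t * ?p 0 t * rh t) = 1 - complex_of_real (ep^2 * rh t)"
   unfolding rh(2)[of t, symmetric] of_real_1[symmetric] of_real_diff[symmetric] by (simp add: power2_eq_square)
  hence eq: "g t * of_real (?p 0 t * rh t) * (\<i> * of_real (V * ?p 0 t) * ?e t) / (\<i> * of_real V) = g t * (1 - of_real (ep^2 * rh t)) * ?e t"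
   using V by (simp add: mult_ac)
  have "(F has_vector_derivative (g t * of_real (?p 0 t * rh t) * (\<i> * of_real (V * ?p 0 t) * ?e t)
    + (g t * of_real (ps' t) + g' t * of_real (?p 0 t * rh t)) * ?e t) / (\<i> * of_real V)) (at t within {0..L})"
   unfolding F_def
   by (rule bounded_linear.has_vector_derivative[OF bounded_linear_divide
      has_vector_derivative_mult[OF has_vector_derivative_mult[OF dg[OF t] dps] de]])
  moreover have "x * (1 - c) * e + y * e / k = x * e + (y / k - x * c) * e" for x y c e k :: complex
   by (simp add: algebra_simps)
  ultimately show ?thesis unfolding r_def add_divide_distrib[of "g t * of_real (?p 0 t * rh t) * _"] eq by simp
 qed
 have cp: "continuous_on {0..L} rh" "continuous_on {0..L} (?p k)" "continuous_on {0..L} ?e" for k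
  unfolding rh_def using q0 by (auto intro!: continuous_intros continuous_D continuous_G)
 have cg: "continuous_on {0..L} g"
  unfolding continuous_on_eq_continuous_within using dg has_vector_derivative_continuous by blast
 have cr: "continuous_on {0..L} r" unfolding r_def ps'_def using V by (intro continuous_intros cp cg cg') auto
 have int: "(\<lambda>t. g t * ?e t) integrable_on {0..L}" "(\<lambda>t. r t * ?e t) integrable_on {0..L}"
  by (intro integrable_continuous_interval continuous_on_mult cg cr cp)+
 have "((\<lambda>t. g t * ?e t + r t * ?e t) has_integral (F L - F 0)) {0..L}"
  using L_pos by (intro fundamental_theorem_of_calculus dF) auto
 hence eq: "integral {0..L} (\<lambda>t. g t * ?e t) = F L - F 0 - integral {0..L} (\<lambda>t. r t * ?e t)"
  using Henstock_Kurzweil_Integration.integral_add[OF int] by (simp add: integral_unique)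
 have ne: "norm (?e t) = 1" for t by (rule norm_exp_i_times)
 have nF: "norm (F t) \<le> A * (1 / ep) / V" if "t \<in> {0..L}" for t
 proof -
  have "norm (g t) * \<bar>?p 0 t * rh t\<bar> \<le> A * (1 / ep)" using g(1)[OF that] ps[of t] A by (intro mult_mono) auto
  thus ?thesis
   unfolding F_def norm_divide norm_mult ne norm_of_real norm_ii mult_1_left mult_1_right using V
   by (simp only: abs_of_nonneg) (intro divide_right_mono, auto)
 qed
 have nr: "norm (r t * ?e t) \<le> A / V * (kp * rh t + 1 / ep) + A * ep^2 * rh t" if t: "t \<in> {0..L}" for t
 proof -
  have "norm (r t) \<le> norm (g t * of_real (ps' t) + g' t * of_real (?p 0 t * rh t)) / V + norm (g t * of_real (ep^2 * rh t))"
   unfolding r_def using V by (intro order_trans[OF norm_triangle_ineq4]) (simp add: norm_divide norm_mult)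
  also have "... \<le> (A * (kp * rh t) + A * (1 / ep)) / V + A * (ep^2 * rh t)"
  proof (intro add_mono divide_right_mono)
   have "norm (g t * of_real (ps' t)) \<le> A * (kp * rh t)" "norm (g' t * of_real (?p 0 t * rh t)) \<le> A * (1 / ep)"
    unfolding norm_mult norm_of_real using g[OF t] ps'_le[OF t] ps[of t] A by (intro mult_mono; simp)+
   thus "norm (g t * of_real (ps' t) + g' t * of_real (?p 0 t * rh t)) \<le> A * (kp * rh t) + A * (1 / ep)"
    by (rule norm_triangle_mono)
   show "norm (g t * of_real (ep^2 * rh t)) \<le> A * (ep^2 * rh t)"
    unfolding norm_mult norm_of_real using g(1)[OF t] A rh(1)[of t] by (auto intro!: mult_mono)
  qed (use V in auto)
  also have "... = A / V * (kp * rh t + 1 / ep) + A * ep^2 * rh t" by (simp add: add_divide_distrib distrib_left)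
  finally show ?thesis unfolding norm_mult ne by simp
 qed
 have R: "integral {0..L} rh \<le> res_const / ep" unfolding rh_def by (rule resonance_integral_le[OF w ep(1,2)])
 have irh: "rh integrable_on {0..L}" by (rule integrable_continuous_interval[OF cp(1)])
 let ?c = "A / V * kp + A * ep^2"
 have "norm (integral {0..L} (\<lambda>t. r t * ?e t)) \<le> integral {0..L} (\<lambda>t. ?c * rh t + A / V * (1 / ep))"
  by (rule integral_norm_bound_integral[OF int(2)])
   (use nr V in \<open>auto intro!: integrable_continuous_interval continuous_intros cp simp: algebra_simps\<close>)
 also have "... = ?c * integral {0..L} rh + A / V * (1 / ep) * L"
  using L_pos by (subst Henstock_Kurzweil_Integration.integral_add)
   (auto intro!: integrable_continuous_interval continuous_intros cp)
 also have "... \<le> ?c * (res_const / ep) + A / V * (1 / ep) * L" using R A V kp_pos by (intro add_right_mono mult_left_mono) auto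
 finally have "norm (integral {0..L} (\<lambda>t. r t * ?e t)) \<le> ?c * (res_const / ep) + A / V * (1 / ep) * L" .
 hence "norm (integral {0..L} (\<lambda>t. g t * ?e t)) \<le> 2 * (A * (1 / ep) / V) + (?c * (res_const / ep) + A / V * (1 / ep) * L)"
  unfolding eq using norm_triangle_ineq4[of "F L - F 0" "integral {0..L} (\<lambda>t. r t * ?e t)"] norm_triangle_ineq4[of "F L" "F 0"]
   nF[OF ends(1)] nF[OF ends(2)] by linarith
 also have "... = osc_const * A * (1 / sqrt V)"
 proof -
  define s where "s = sqrt V"
  have s: "0 < s" "V = s * s" "ep = 1 / s" using V by (auto simp: s_def ep_def)
  show ?thesis unfolding s(3) s_def[symmetric] unfolding s(2) osc_const_def using s(1)
   by (simp add: field_simps power2_eq_square)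
 qed
 also have "... \<le> osc_const * A * (1 / sqrt (norm v))"
 proof (rule mult_left_mono)
  show "1 / sqrt V \<le> 1 / sqrt (norm v)" using V v by (intro divide_left_mono) (auto intro!: mult_pos_pos)
  show "0 \<le> osc_const * A" unfolding osc_const_def res_const_def using A L_pos kp_pos by auto
 qed
 finally have "norm (integral {0..L} (\<lambda>t. g t * ?e t)) \<le> osc_const * A * (1 / sqrt (norm v))" .
 moreover have "V * (w \<bullet> x) = 2 * pi * (v \<bullet> x)" for x using nv by (simp add: V_def w_def)
 ultimately show ?thesis by simp
qed

end

section \<open>Lifting the curve from the torus to the plane\<close>

lemma to_torus_eq_iff: "to_torus x = to_torus y \<longleftrightarrow> (\<forall>i. x $ i - y $ i \<in> \<int>)"
 by (simp add: torus.abs_eq_iff)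

lemma to_torus_rep: "to_torus (rep_torus x) = x"
 by (rule Quotient3_abs_rep[OF Quotient3_torus])

lemma exp_2pi_i_eq_1_iff: "exp (\<i> * of_real (2 * pi * x)) = 1 \<longleftrightarrow> x \<in> \<int>"
proof -
 have "exp (\<i> * of_real (2 * pi * x)) = 1 \<longleftrightarrow> (\<exists>n::int. 2 * pi * x = of_int (2 * n) * pi)"
  by (subst exp_eq_1) simp
 also have "... \<longleftrightarrow> x \<in> \<int>" by (auto elim!: Ints_cases)
 finally show ?thesis .
qed

lemma exp_2pi_i_eq_iff: "exp (\<i> * of_real (2 * pi * x)) = exp (\<i> * of_real (2 * pi * y)) \<longleftrightarrow> x - y \<in> \<int>"
proof -
 have "exp (\<i> * of_real (2 * pi * x)) = exp (\<i> * of_real (2 * pi * (x - y))) * exp (\<i> * of_real (2 * pi * y))"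
  by (simp add: exp_add[symmetric] algebra_simps)
 thus ?thesis using exp_2pi_i_eq_1_iff[of "x - y"] by auto
qed

text \<open>The lifts in \<open>has_velocity\<close> change with the point and need not be
  continuous elsewhere, so they cannot be glued directly. The exponential of a coordinate difference
  does not depend on the lift; its derivative vanishes at every point, so it keeps its initial value
  1.\<close>

lemma torus_curve_lift:
 assumes L: "0 < L" and v: "\<And>t. t \<in> {0..L} \<Longrightarrow> has_velocity \<gamma> {0..L} t (d t)"
  and G: "\<And>t. t \<in> {0..L} \<Longrightarrow> (G has_vector_derivative d t) (at t within {0..L})" and G0: "\<gamma> 0 = to_torus (G 0)"
  and t: "t \<in> {0..L}"
 shows "\<gamma> t = to_torus (G t)"
proof -
 have "rep_torus (\<gamma> t) $ i - G t $ i \<in> \<int>" for i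
 proof -
  define h where "h s = exp (\<i> * of_real (2 * pi * (rep_torus (\<gamma> s) $ i - G s $ i)))" for s
  have "(h has_vector_derivative 0) (at s within {0..L})" if s: "s \<in> {0..L}" for s
  proof -
   obtain c where c: "\<forall>r\<in>{0..L}. \<gamma> r = to_torus (c r)" "(c has_vector_derivative d s) (at s within {0..L})"
    using v[OF s] unfolding has_velocity_def by blast
   have "((\<lambda>r. c r $ i - G r $ i) has_vector_derivative d s $ i - d s $ i) (at s within {0..L})"
    by (intro has_vector_derivative_diff bounded_linear.has_vector_derivative[OF bounded_linear_vec_nth] c(2) G[OF s])
   hence "((\<lambda>r. 2 * pi * (c r $ i - G r $ i)) has_vector_derivative 2 * pi * 0) (at s within {0..L})"
    using bounded_linear.has_vector_derivative[OF bounded_linear_mult_right] by fastforce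
   hence "((\<lambda>r. \<i> * of_real (2 * pi * (c r $ i - G r $ i))) has_vector_derivative \<i> * of_real (2 * pi * 0)) (at s within {0..L})"
    by (intro bounded_linear.has_vector_derivative[OF bounded_linear_mult_right] has_vector_derivative_of_real)
     (simp only: has_real_derivative_iff_has_vector_derivative)
   from field_vector_diff_chain_within[OF this, where g=exp and g'="exp (\<i> * of_real (2 * pi * (c s $ i - G s $ i)))"]
   have "((\<lambda>r. exp (\<i> * of_real (2 * pi * (c r $ i - G r $ i)))) has_vector_derivative 0) (at s within {0..L})"
    by (auto intro!: DERIV_subset[OF DERIV_exp] simp: o_def)
   moreover have "h r = exp (\<i> * of_real (2 * pi * (c r $ i - G r $ i)))" if "r \<in> {0..L}" for r
   proof -
    have "to_torus (rep_torus (\<gamma> r)) = to_torus (c r)" using c(1) that by (simp add: to_torus_rep)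
    thus ?thesis unfolding h_def exp_2pi_i_eq_iff by (simp add: to_torus_eq_iff)
   qed
   ultimately show ?thesis
    by (metis (no_types, lifting) has_vector_derivative_transform[OF s])
  qed
  then obtain k where k: "\<And>s. s \<in> {0..L} \<Longrightarrow> h s = k"
   using has_vector_derivative_zero_constant[of "{0..L}" h] by auto
  have "to_torus (rep_torus (\<gamma> 0)) = to_torus (G 0)" using G0 by (simp add: to_torus_rep)
  hence "h 0 = 1" unfolding h_def exp_2pi_i_eq_1_iff by (simp add: to_torus_eq_iff)
  hence "h t = 1" using k[of 0] k[OF t] L by simp
  thus ?thesis unfolding h_def exp_2pi_i_eq_1_iff .
 qed
 hence "to_torus (rep_torus (\<gamma> t)) = to_torus (G t)" unfolding to_torus_eq_iff by blast
 thus ?thesis by (simp add: to_torus_rep)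
qed

text \<open>The lift is the primitive of the velocity, and the curvature bounds are extremal values
  on the compact interval; nowhere zero curvature enters as a positive minimum.\<close>

lemma arc_length_curve_lift:
 assumes curve: "arc_length_curve L \<gamma>" and curv: "\<And>t. t \<in> {0..L} \<Longrightarrow> curvature L \<gamma> t \<noteq> 0"
 obtains G D kp\<^sub>0 kp where "plane_curve L G D kp\<^sub>0 kp" "\<And>t. t \<in> {0..L} \<Longrightarrow> \<gamma> t = to_torus (G t)"
  "\<And>t. t \<in> {0..L} \<Longrightarrow> velocity \<gamma> {0..L} t = D 0 t"
proof -
 have L: "0 < L" and sm: "smooth_curve L \<gamma>" and un: "\<And>t. t \<in> {0..L} \<Longrightarrow> norm (velocity \<gamma> {0..L} t) = 1"
  using curve unfolding arc_length_curve_def by auto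
 obtain D where D: "\<And>t. t \<in> {0..L} \<Longrightarrow> has_velocity \<gamma> {0..L} t (D 0 t)"
  "\<And>k t. t \<in> {0..L} \<Longrightarrow> (D k has_vector_derivative D (Suc k) t) (at t within {0..L})"
  using sm unfolding smooth_curve_def by blast
 have vel: "velocity \<gamma> {0..L} t = D 0 t" if "t \<in> {0..L}" for t by (rule velocity_eq[OF D(1)[OF that] that L])
 have cD: "continuous_on {0..L} (D k)" for k
  unfolding continuous_on_eq_continuous_within using D(2) has_vector_derivative_continuous by blast
 define G where "G t = rep_torus (\<gamma> 0) + integral {0..t} (D 0)" for t
 have dG: "(G has_vector_derivative D 0 t) (at t within {0..L})" if "t \<in> {0..L}" for t
  unfolding G_def using has_vector_derivative_add[OF has_vector_derivative_const integral_has_vector_derivative[OF cD that]] by simp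
 have G0: "\<gamma> 0 = to_torus (G 0)" by (simp add: G_def to_torus_rep)
 have k1: "D 1 t \<noteq> 0" if t: "t \<in> {0..L}" for t
 proof -
  have "(velocity \<gamma> {0..L} has_vector_derivative D (Suc 0) t) (at t within {0..L})"
   by (rule has_vector_derivative_transform[OF t _ D(2)[OF t, of 0]]) (rule vel)
  hence "vector_derivative (velocity \<gamma> {0..L}) (at t within {0..L}) = D 1 t"
   using vector_derivative_within_cbox[of 0 L t] t L by simp
  thus ?thesis using curv[OF t] by (simp add: curvature_def)
 qed
 have ne: "{0..L} \<noteq> {}" using L by auto
 obtain x where x: "x \<in> {0..L}" "\<And>t. t \<in> {0..L} \<Longrightarrow> norm (D 1 x) \<le> norm (D 1 t)"
  using continuous_attains_inf[OF compact_Icc ne continuous_on_norm[OF cD[of 1]]] by blast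
 obtain y where y: "\<And>t. t \<in> {0..L} \<Longrightarrow> norm (D 1 t) \<le> norm (D 1 y)"
  using continuous_attains_sup[OF compact_Icc ne continuous_on_norm[OF cD[of 1]]] by blast
 obtain z where z: "\<And>t. t \<in> {0..L} \<Longrightarrow> norm (D 2 t) \<le> norm (D 2 z)"
  using continuous_attains_sup[OF compact_Icc ne continuous_on_norm[OF cD[of 2]]] by blast
 have "plane_curve L G D (norm (D 1 x)) (norm (D 1 y) + norm (D 2 z))"
 proof
  show "0 < L" by fact
  show "0 < norm (D 1 x)" using k1[OF x(1)] by simp
  fix t assume t: "t \<in> {0..L}"
  show "(G has_vector_derivative D 0 t) (at t within {0..L})" by (rule dG[OF t])
  show "norm (D 0 t) = 1" using un[OF t] vel[OF t] by simp
  show "norm (D 1 x) \<le> norm (D 1 t)" by (rule x(2)[OF t])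
  show "norm (D 1 t) \<le> norm (D 1 y) + norm (D 2 z)" using y[OF t] by (rule order_trans) simp
  show "norm (D 2 t) \<le> norm (D 1 y) + norm (D 2 z)" using z[OF t] by (rule order_trans) simp
  fix k show "(D k has_vector_derivative D (Suc k) t) (at t within {0..L})" by (rule D(2)[OF t])
 qed
 thus thesis
  using torus_curve_lift[OF L D(1) dG G0] vel by (rule that)
qed

section \<open>Lattice points on circles\<close>

lemma lattice_vec_add: "lattice_vec (x + y) = lattice_vec x + lattice_vec y"
 and lattice_vec_diff: "lattice_vec (x - y) = lattice_vec x - lattice_vec y"
 by (simp_all add: lattice_vec_def vec_eq_iff)

lemma lattice_points_iff: "l \<in> LP n \<longleftrightarrow> (l $ 1)^2 + (l $ 2)^2 = int n"
 unfolding lattice_points_def mem_Collect_eq norm_lattice_vec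
 by (metis of_int_eq_iff of_int_of_nat_eq)

lemma norm_lattice_vec_ge_1: assumes "l \<noteq> 0" shows "1 \<le> norm (lattice_vec l)"
proof -
 have "l $ 1 \<noteq> 0 \<or> l $ 2 \<noteq> 0" using assms by (auto simp: vec_eq_iff forall_2)
 hence "0 < (l $ 1)^2 + (l $ 2)^2" by (auto simp: add_pos_nonneg add_nonneg_pos)
 hence "1 \<le> (l $ 1)^2 + (l $ 2)^2" by linarith
 hence "1 \<le> (norm (lattice_vec l))^2" unfolding norm_lattice_vec by linarith
 thus ?thesis using power2_le_imp_le[of 1 "norm (lattice_vec l)"] by simp
qed

text \<open>The classical relation between side lengths, circumradius and area: the product of the
  sides is four times the circumradius times the area. Here it is squared, with squared circumradius
  \<open>n\<close> and area half the determinant.\<close>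

lemma triangle_area_circle:
 fixes x y a b c d n :: int
 assumes "x^2 + y^2 = n" "(x + a)^2 + (y + b)^2 = n" "(x + c)^2 + (y + d)^2 = n"
 shows "4 * n * (a * d - b * c)^2 = (a^2 + b^2) * (c^2 + d^2) * ((a - c)^2 + (b - d)^2)"
proof -
 have 1: "2 * (x * a + y * b) = - (a^2 + b^2)" using assms(1,2) by (simp add: power2_eq_square algebra_simps)
 have 2: "2 * (x * c + y * d) = - (c^2 + d^2)" using assms(1,3) by (simp add: power2_eq_square algebra_simps)
 have "4 * n * (a * d - b * c)^2 = (2 * x * (a * d - b * c))^2 + (2 * y * (a * d - b * c))^2"
  unfolding assms(1)[symmetric] by (simp add: power2_eq_square algebra_simps)
 also have "2 * x * (a * d - b * c) = d * (2 * (x * a + y * b)) - b * (2 * (x * c + y * d))" by algebra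
 also have "2 * y * (a * d - b * c) = a * (2 * (x * c + y * d)) - c * (2 * (x * a + y * b))" by algebra
 finally show ?thesis unfolding 1 2 by (simp add: power2_eq_square algebra_simps)
qed

text \<open>The sides are nonzero, so by \<open>triangle_area_circle\<close> the determinant is a
  nonzero integer and its square is at least 1. Inscribed lattice triangles are therefore never
  small.\<close>

lemma lattice_triangle:
 assumes "p \<in> LP n" "q \<in> LP n" "s \<in> LP n"
  and "p \<noteq> q" "p \<noteq> s" "q \<noteq> s"
 shows "(q $ 1 - p $ 1) * (s $ 2 - p $ 2) \<noteq> (q $ 2 - p $ 2) * (s $ 1 - p $ 1)"
  and "4 * real n \<le> (norm (lattice_vec (p - q)))^2 * (norm (lattice_vec (p - s)))^2 * (norm (lattice_vec (q - s)))^2"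
proof -
 define a b c d where "a = q $ 1 - p $ 1" and "b = q $ 2 - p $ 2" and "c = s $ 1 - p $ 1" and "d = s $ 2 - p $ 2"
 have eq: "4 * int n * (a * d - b * c)^2 = (a^2 + b^2) * (c^2 + d^2) * ((a - c)^2 + (b - d)^2)"
  by (rule triangle_area_circle[of "p $ 1" "p $ 2"]) (use assms in \<open>auto simp: lattice_points_iff a_def b_def c_def d_def\<close>)
 have pos: "0 < (l $ 1)^2 + (l $ 2)^2" if "l \<noteq> 0" for l :: "int ^ 2"
 proof -
  have "l $ 1 \<noteq> 0 \<or> l $ 2 \<noteq> 0" using that by (auto simp: vec_eq_iff forall_2)
  thus ?thesis by (auto simp: add_pos_nonneg add_nonneg_pos)
 qed
 have "0 < a^2 + b^2" "0 < c^2 + d^2" "0 < (a - c)^2 + (b - d)^2"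
  using pos[of "q - p"] pos[of "s - p"] pos[of "q - s"] assms(4-6) by (auto simp: a_def b_def c_def d_def)
 hence "0 < (a^2 + b^2) * (c^2 + d^2) * ((a - c)^2 + (b - d)^2)" by (intro mult_pos_pos)
 hence nz: "a * d - b * c \<noteq> 0" using eq by auto
 thus "(q $ 1 - p $ 1) * (s $ 2 - p $ 2) \<noteq> (q $ 2 - p $ 2) * (s $ 1 - p $ 1)"
  by (simp add: a_def b_def c_def d_def)
 have "0 < (a * d - b * c)^2" using nz by simp
 hence "1 \<le> (a * d - b * c)^2" by linarith
 hence "4 * int n * 1 \<le> 4 * int n * (a * d - b * c)^2" by (intro mult_left_mono) auto
 hence "4 * int n \<le> (a^2 + b^2) * (c^2 + d^2) * ((a - c)^2 + (b - d)^2)" using eq by simp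
 hence "real_of_int (4 * int n) \<le> real_of_int ((a^2 + b^2) * (c^2 + d^2) * ((a - c)^2 + (b - d)^2))"
  by (simp only: of_int_le_iff)
 moreover have "(norm (lattice_vec (p - q)))^2 = real_of_int (a^2 + b^2)"
   "(norm (lattice_vec (p - s)))^2 = real_of_int (c^2 + d^2)"
   "(norm (lattice_vec (q - s)))^2 = real_of_int ((a - c)^2 + (b - d)^2)"
  unfolding norm_lattice_vec by (auto simp: a_def b_def c_def d_def power2_commute)
 ultimately show "4 * real n \<le> (norm (lattice_vec (p - q)))^2 * (norm (lattice_vec (p - s)))^2 * (norm (lattice_vec (q - s)))^2"
  by simp
qed

lemma card_le_2I:
 assumes "finite A" "\<And>p q s. p \<in> A \<Longrightarrow> q \<in> A \<Longrightarrow> s \<in> A \<Longrightarrow> p \<noteq> q \<Longrightarrow> p \<noteq> s \<Longrightarrow> q \<noteq> s \<Longrightarrow> False"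
 shows "card A \<le> 2"
proof (rule ccontr)
 assume "\<not> card A \<le> 2"
 hence "3 \<le> card A" by simp
 then obtain B where B: "B \<subseteq> A" "card B = 3" using obtain_subset_with_card_n by metis
 then obtain p q s where "B = {p, q, s}" "p \<noteq> q" "p \<noteq> s" "q \<noteq> s"
  unfolding card_3_iff by auto
 thus False using assms(2)[of p q s] B(1) by auto
qed

definition sum_reps :: "nat \<Rightarrow> int ^ 2 \<Rightarrow> (int ^ 2) set" where
 "sum_reps n w = {l \<in> LP n. w - l \<in> LP n}"

lemma card_sum_reps_le: "card (sum_reps n w) \<le> card (LP n)"
 unfolding sum_reps_def by (intro card_mono finite_lattice_points) auto

text \<open>If \<open>l\<close> and \<open>w - l\<close> both lie on the circle, then
  \<open>l\<close> lies on a line perpendicular to \<open>w\<close>. Three such points would be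
  collinear, which \<open>lattice_triangle\<close> excludes.\<close>

lemma card_sum_reps_nonzero:
 assumes "w \<noteq> 0" shows "card (sum_reps n w) \<le> 2"
proof (rule card_le_2I)
 show "finite (sum_reps n w)" unfolding sum_reps_def using finite_lattice_points by simp
 fix p q s assume "p \<in> sum_reps n w" "q \<in> sum_reps n w" "s \<in> sum_reps n w" and ne: "p \<noteq> q" "p \<noteq> s" "q \<noteq> s"
 hence *: "p \<in> LP n" "q \<in> LP n" "s \<in> LP n"
  "w - p \<in> LP n" "w - q \<in> LP n" "w - s \<in> LP n"
  by (auto simp: sum_reps_def)
 have line: "2 * (w $ 1 * l $ 1 + w $ 2 * l $ 2) = (w $ 1)^2 + (w $ 2)^2"
  if "l \<in> LP n" "w - l \<in> LP n" for l
 proof -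
  have "(l $ 1)^2 + (l $ 2)^2 = int n" "(w $ 1 - l $ 1)^2 + (w $ 2 - l $ 2)^2 = int n"
   using that by (simp_all add: lattice_points_iff)
  thus ?thesis by (simp add: power2_eq_square algebra_simps)
 qed
 have 1: "w $ 1 * (q $ 1 - p $ 1) + w $ 2 * (q $ 2 - p $ 2) = 0"
  using line[OF *(1,4)] line[OF *(2,5)] by (simp add: algebra_simps)
 have 2: "w $ 1 * (s $ 1 - p $ 1) + w $ 2 * (s $ 2 - p $ 2) = 0"
  using line[OF *(1,4)] line[OF *(3,6)] by (simp add: algebra_simps)
 define \<Delta> where "\<Delta> = (q $ 1 - p $ 1) * (s $ 2 - p $ 2) - (q $ 2 - p $ 2) * (s $ 1 - p $ 1)"
 have "w $ 1 * \<Delta> = 0" "w $ 2 * \<Delta> = 0" unfolding \<Delta>_def using 1 2 by algebra+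
 moreover have "\<Delta> \<noteq> 0" using lattice_triangle(1)[OF *(1-3) ne] by (simp add: \<Delta>_def)
 ultimately have "w = 0" by (simp add: vec_eq_iff forall_2)
 thus False using assms by simp
qed

text \<open>The exponent is dictated by \<open>lattice_triangle\<close>: three sides of length at
  most twice the gap have a squared product of at most \<open>64 * lattice_gap n ^ 6 = n\<close>,
  short of the required \<open>4 * n\<close>.\<close>

definition lattice_gap :: "nat \<Rightarrow> real" where "lattice_gap n = real n powr (1/6) / 2"

lemma lattice_gap_power: assumes "1 \<le> n" shows "lattice_gap n ^ 6 = real n / 64"
proof -
 have "lattice_gap n ^ 6 = (real n powr (1/6)) ^ 6 / 64" by (simp add: lattice_gap_def power_divide)
 also have "(real n powr (1/6)) ^ 6 = real n powr (1/6 * real 6)" using assms by (simp only: powr_powr[symmetric] powr_realpow powr_gt_zero)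
 finally show ?thesis by simp
qed

lemma lattice_gap_pos: "1 \<le> n \<Longrightarrow> 0 < lattice_gap n"
 by (simp add: lattice_gap_def)

lemma card_lattice_cluster:
 assumes n: "1 \<le> n" and A: "A \<subseteq> LP n"
  and close: "\<And>p q. p \<in> A \<Longrightarrow> q \<in> A \<Longrightarrow> norm (lattice_vec (p - q)) \<le> 2 * lattice_gap n"
 shows "card A \<le> 2"
proof (rule card_le_2I)
 show "finite A" using A finite_lattice_points by (rule finite_subset)
 fix p q s assume *: "p \<in> A" "q \<in> A" "s \<in> A" and ne: "p \<noteq> q" "p \<noteq> s" "q \<noteq> s"
 have sq: "(norm (lattice_vec (p - q)))^2 \<le> (2 * lattice_gap n)^2" if "p \<in> A" "q \<in> A" for p q
  using close[OF that] by (intro power_mono) auto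
 have "4 * real n \<le> (norm (lattice_vec (p - q)))^2 * (norm (lattice_vec (p - s)))^2 * (norm (lattice_vec (q - s)))^2"
  using * A by (intro lattice_triangle(2) ne) auto
 also have "... \<le> (2 * lattice_gap n)^2 * (2 * lattice_gap n)^2 * (2 * lattice_gap n)^2"
  using * sq by (intro mult_mono) auto
 also have "... = 64 * lattice_gap n ^ 6" by simp
 finally show False using n by (simp add: lattice_gap_power)
qed

lemma card_fibers_le:
 assumes fin: "finite A" and fib: "\<And>y. card {x \<in> A. h x = y} \<le> 2" and im: "h ` A \<subseteq> {a..b::int}"
 shows "card A \<le> 2 * nat (b - a + 1)"
proof -
 have "card A = (\<Sum>y\<in>h ` A. card {x \<in> A. h x = y})"
  unfolding card_eq_sum by (rule sum.image_gen[OF fin])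
 also have "... \<le> (\<Sum>y\<in>h ` A. 2)" by (intro sum_mono fib)
 also have "... = 2 * card (h ` A)" by simp
 also have "card (h ` A) \<le> card {a..b}" using im by (intro card_mono) auto
 finally show ?thesis by simp
qed

text \<open>On the sector where the \<open>j\<close>-th coordinate dominates and has sign \<open>s\<close>, the circle is a
 1-Lipschitz graph over the \<open>i\<close>-th coordinate.\<close>

lemma card_lattice_sector:
 fixes i j :: 2 and s :: int
 assumes n: "1 \<le> n" and ij: "i \<noteq> j" and s: "s = 1 \<or> s = -1" and r: "0 \<le> rh"
 shows "real (card {l \<in> LP n. norm (lattice_vec (l - w)) \<le> rh \<and> \<bar>l $ i\<bar> \<le> s * l $ j})
  \<le> 2 * (2 * rh / lattice_gap n + 2)"
proof -
 define A where "A = {l \<in> LP n. norm (lattice_vec (l - w)) \<le> rh \<and> \<bar>l $ i\<bar> \<le> s * l $ j}"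
 define g where "g = lattice_gap n"
 have g: "0 < g" using lattice_gap_pos[OF n] by (simp add: g_def)
 define h where "h l = \<lfloor>real_of_int (l $ i) / g\<rfloor>" for l :: "int ^ 2"
 have fin: "finite A" unfolding A_def using finite_lattice_points by simp
 have sum2: "f 1 + f 2 = f i + f j" for f :: "2 \<Rightarrow> int"
  using ij exhaust_2[of i] exhaust_2[of j] by auto
 have steep: "\<bar>p $ j - q $ j\<bar> \<le> \<bar>p $ i - q $ i\<bar>" if "p \<in> A" "q \<in> A" for p q
 proof -
  have pq: "(p $ i)^2 + (p $ j)^2 = int n" "(q $ i)^2 + (q $ j)^2 = int n"
   using that sum2[of "\<lambda>k. (p $ k)^2"] sum2[of "\<lambda>k. (q $ k)^2"] by (auto simp: A_def lattice_points_iff)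
  have pos: "\<bar>p $ i\<bar> \<le> s * p $ j" "\<bar>q $ i\<bar> \<le> s * q $ j" using that by (auto simp: A_def)
  have "s * p $ j + s * q $ j \<noteq> 0"
  proof
   assume z: "s * p $ j + s * q $ j = 0"
   hence "p $ i = 0" "s * p $ j = 0" using pos by linarith+
   thus False using pq(1) n s by auto
  qed
  hence P: "0 < s * p $ j + s * q $ j" using pos by linarith
  have ss: "s * s = 1" using s by auto
  \<comment> \<open>On one circle the differences of squares in the two coordinates are opposite;
    within the sector the sum of the \<open>j\<close>-coordinates dominates that of the
    \<open>i\<close>-coordinates and can be cancelled.\<close>
  have "(s * p $ j + s * q $ j) * (s * p $ j - s * q $ j) = (s * s) * ((p $ j)^2 - (q $ j)^2)"
   by (simp add: power2_eq_square algebra_simps)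
  also have "... = (q $ i - p $ i) * (q $ i + p $ i)"
   using pq unfolding ss by (simp add: power2_eq_square algebra_simps)
  finally have "\<bar>s * p $ j + s * q $ j\<bar> * \<bar>s * p $ j - s * q $ j\<bar> = \<bar>q $ i - p $ i\<bar> * \<bar>q $ i + p $ i\<bar>"
   unfolding abs_mult[symmetric] by (rule arg_cong)
  hence "(s * p $ j + s * q $ j) * \<bar>s * p $ j - s * q $ j\<bar> = \<bar>q $ i - p $ i\<bar> * \<bar>q $ i + p $ i\<bar>"
   unfolding abs_of_pos[OF P] .
  also have "... \<le> \<bar>q $ i - p $ i\<bar> * (s * p $ j + s * q $ j)"
   using pos by (intro mult_left_mono) linarith+
  finally have "(s * p $ j + s * q $ j) * \<bar>s * p $ j - s * q $ j\<bar> \<le> (s * p $ j + s * q $ j) * \<bar>q $ i - p $ i\<bar>"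
   by (simp only: mult.commute)
  hence "\<bar>s * p $ j - s * q $ j\<bar> \<le> \<bar>q $ i - p $ i\<bar>" using P by (simp only: mult_le_cancel_left_pos)
  thus ?thesis using s by auto
 qed
 have fib: "card {x \<in> A. h x = y} \<le> 2" for y
 proof (rule card_lattice_cluster[OF n])
  show "{x \<in> A. h x = y} \<subseteq> LP n" by (auto simp: A_def)
  fix p q assume pq: "p \<in> {x \<in> A. h x = y}" "q \<in> {x \<in> A. h x = y}"
  have "\<bar>real_of_int (p $ i) / g - real_of_int (q $ i) / g\<bar> \<le> 1"
   using pq unfolding h_def mem_Collect_eq by linarith
  hence "\<bar>real_of_int (p $ i) - real_of_int (q $ i)\<bar> \<le> g"
   using g by (simp add: diff_divide_distrib[symmetric])
  moreover have "\<bar>real_of_int (p $ j) - real_of_int (q $ j)\<bar> \<le> \<bar>real_of_int (p $ i) - real_of_int (q $ i)\<bar>"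
   using steep[of p q] pq by (metis (no_types, lifting) mem_Collect_eq of_int_abs of_int_diff of_int_le_iff)
  ultimately have c: "\<bar>(lattice_vec (p - q)) $ k\<bar> \<le> g" for k
   using ij exhaust_2[of i] exhaust_2[of j] exhaust_2[of k] by (auto simp: lattice_vec_def)
  have "norm (lattice_vec (p - q)) \<le> (\<Sum>k\<in>UNIV. \<bar>(lattice_vec (p - q)) $ k\<bar>)" by (rule norm_le_l1_cart)
  also have "... \<le> (\<Sum>k\<in>(UNIV::2 set). g)" by (intro sum_mono c)
  finally show "norm (lattice_vec (p - q)) \<le> 2 * lattice_gap n" by (simp add: g_def)
 qed
 define a b where "a = \<lfloor>(real_of_int (w $ i) - rh) / g\<rfloor>" and "b = \<lfloor>(real_of_int (w $ i) + rh) / g\<rfloor>"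
 have im: "h ` A \<subseteq> {a..b}"
 proof
  fix y assume "y \<in> h ` A"
  then obtain l where l: "l \<in> A" "y = h l" by auto
  have "\<bar>(lattice_vec (l - w)) $ i\<bar> \<le> rh"
   using component_le_norm_cart[of "lattice_vec (l - w)" i] l by (auto simp: A_def)
  hence "real_of_int (w $ i) - rh \<le> real_of_int (l $ i)" "real_of_int (l $ i) \<le> real_of_int (w $ i) + rh"
   by (auto simp: lattice_vec_def)
  thus "y \<in> {a..b}"
   unfolding l(2) h_def a_def b_def using g by (auto intro!: floor_mono divide_right_mono)
 qed
 have ab: "a \<le> b" unfolding a_def b_def using r g by (intro floor_mono divide_right_mono) auto
 have "real (card A) \<le> real (2 * nat (b - a + 1))" using card_fibers_le[OF fin fib im] by (simp only: of_nat_le_iff)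
 also have "... = 2 * (real_of_int b - real_of_int a + 1)" using ab by simp
 also have "... \<le> 2 * (2 * rh / g + 2)"
 proof -
  have "real_of_int b \<le> (real_of_int (w $ i) + rh) / g" "(real_of_int (w $ i) - rh) / g - 1 \<le> real_of_int a"
   unfolding a_def b_def by linarith+
  moreover have "(real_of_int (w $ i) + rh) / g - (real_of_int (w $ i) - rh) / g = 2 * rh / g"
   by (simp add: diff_divide_distrib[symmetric])
  ultimately show ?thesis by simp
 qed
 finally show ?thesis unfolding A_def g_def .
qed

lemma card_lattice_ball:
 assumes n: "1 \<le> n" and r: "0 \<le> rh"
 shows "real (card {l \<in> LP n. norm (lattice_vec (l - w)) \<le> rh}) \<le> 16 * (rh / lattice_gap n + 1)"
proof -
 define B where "B i j s = {l \<in> LP n. norm (lattice_vec (l - w)) \<le> rh \<and> \<bar>l $ i\<bar> \<le> s * l $ j}" for i j :: 2 and s :: int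
 have fin: "finite (B i j s)" for i j s unfolding B_def using finite_lattice_points by simp
 have cB: "real (card (B i j s)) \<le> 2 * (2 * rh / lattice_gap n + 2)" if "i \<noteq> j" "s = 1 \<or> s = -1" for i j s
  unfolding B_def by (rule card_lattice_sector[OF n that r])
 have "{l \<in> LP n. norm (lattice_vec (l - w)) \<le> rh} \<subseteq> (B 1 2 1 \<union> B 1 2 (-1)) \<union> (B 2 1 1 \<union> B 2 1 (-1))"
 proof
  fix l assume "l \<in> {l \<in> LP n. norm (lattice_vec (l - w)) \<le> rh}"
  moreover have "\<bar>l $ 1\<bar> \<le> 1 * l $ 2 \<or> \<bar>l $ 1\<bar> \<le> (-1) * l $ 2 \<or> \<bar>l $ 2\<bar> \<le> 1 * l $ 1 \<or> \<bar>l $ 2\<bar> \<le> (-1) * l $ 1" by linarith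
  ultimately show "l \<in> (B 1 2 1 \<union> B 1 2 (-1)) \<union> (B 2 1 1 \<union> B 2 1 (-1))" unfolding B_def by blast
 qed
 hence "card {l \<in> LP n. norm (lattice_vec (l - w)) \<le> rh} \<le> card ((B 1 2 1 \<union> B 1 2 (-1)) \<union> (B 2 1 1 \<union> B 2 1 (-1)))"
  by (intro card_mono) (auto simp: fin)
 also have "... \<le> (card (B 1 2 1) + card (B 1 2 (-1))) + (card (B 2 1 1) + card (B 2 1 (-1)))"
  by (intro order_trans[OF card_Un_le] add_mono card_Un_le)
 finally have "real (card {l \<in> LP n. norm (lattice_vec (l - w)) \<le> rh})
   \<le> real (card (B 1 2 1)) + real (card (B 1 2 (-1))) + (real (card (B 2 1 1)) + real (card (B 2 1 (-1))))"
  by linarith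
 also have "... \<le> 4 * (2 * (2 * rh / lattice_gap n + 2))"
  using cB[of 1 2 1] cB[of 1 2 "-1"] cB[of 2 1 1] cB[of 2 1 "-1"] by simp
 finally show ?thesis by simp
qed

text \<open>Three shells, each contributing the number of points in the outer ball divided by the
  inner radius. With gap of order n^(1/6), the break points n^(1/4) and n^(3/8) make the terms decay
  like n^(-1/12), n^(-1/24) and n^(-1/24).\<close>

definition far_bound :: "nat \<Rightarrow> real" where
 "far_bound n = 16 * (real n powr (1/4) / lattice_gap n + 1) / lattice_gap n
   + 16 * (real n powr (3/8) / lattice_gap n + 1) / real n powr (1/4)
   + 16 * (real n powr (1/2) / lattice_gap n + 1) / real n powr (3/8)"

lemma far_bound_tendsto_0: "far_bound \<longlonglongrightarrow> 0"
 unfolding far_bound_def lattice_gap_def by real_asymp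

lemma sum_shell_le:
 fixes F :: "'a \<Rightarrow> real"
 assumes "finite A" "real (card {x \<in> A. F x \<le> rh}) \<le> c" "0 < d"
 shows "(\<Sum>x\<in>{x \<in> A. d < F x \<and> F x \<le> rh}. 1 / F x) \<le> c / d"
proof -
 have "(\<Sum>x\<in>{x \<in> A. d < F x \<and> F x \<le> rh}. 1 / F x) \<le> real (card {x \<in> A. d < F x \<and> F x \<le> rh}) * (1 / d)"
  using assms(3) by (intro sum_bounded_above) (auto intro!: divide_left_mono)
 also have "... \<le> real (card {x \<in> A. F x \<le> rh}) * (1 / d)"
  using assms(1,3) by (intro mult_right_mono) (auto intro!: card_mono)
 also have "... \<le> c * (1 / d)" using assms by (intro mult_right_mono) auto
 finally show ?thesis by simp
qed

lemma sum_far_le: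
 assumes n: "1 \<le> n"
 shows "(\<Sum>l\<in>{l \<in> LP n. lattice_gap n < norm (lattice_vec (l - w))}. 1 / norm (lattice_vec (l - w))) \<le> far_bound n"
proof -
 let ?F = "\<lambda>l. norm (lattice_vec (l - w))"
 let ?\<Lambda> = "LP n"
 have n0: "0 < real n" using n by simp
 define S1 where "S1 = {l \<in> ?\<Lambda>. lattice_gap n < ?F l \<and> ?F l \<le> real n powr (1/4)}"
 define S2 where "S2 = {l \<in> ?\<Lambda>. real n powr (1/4) < ?F l \<and> ?F l \<le> real n powr (3/8)}"
 \<comment> \<open>An outer radius beyond all distances; the points of the last shell are counted as
   part of the whole circle, a ball of radius sqrt n about the origin.\<close>
 define rh where "rh = Max (insert 0 (?F ` ?\<Lambda>))"
 define S3 where "S3 = {l \<in> ?\<Lambda>. real n powr (3/8) < ?F l \<and> ?F l \<le> rh}"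
 have fin: "finite S1" "finite S2" "finite S3" unfolding S1_def S2_def S3_def using finite_lattice_points by auto
 have "{l \<in> ?\<Lambda>. lattice_gap n < ?F l} \<subseteq> S1 \<union> (S2 \<union> S3)"
 proof
  fix l assume l: "l \<in> {l \<in> ?\<Lambda>. lattice_gap n < ?F l}"
  hence "?F l \<le> rh" unfolding rh_def using finite_lattice_points by (intro Max_ge) auto
  thus "l \<in> S1 \<union> (S2 \<union> S3)" using l unfolding S1_def S2_def S3_def by auto
 qed
 hence "(\<Sum>l\<in>{l \<in> ?\<Lambda>. lattice_gap n < ?F l}. 1 / ?F l) \<le> (\<Sum>l\<in>S1 \<union> (S2 \<union> S3). 1 / ?F l)"
  using fin by (intro sum_mono2) auto
 also have "... \<le> (\<Sum>l\<in>S1. 1 / ?F l) + ((\<Sum>l\<in>S2. 1 / ?F l) + (\<Sum>l\<in>S3. 1 / ?F l))"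
 proof -
  have un: "(\<Sum>l\<in>A \<union> B. 1 / ?F l) \<le> (\<Sum>l\<in>A. 1 / ?F l) + (\<Sum>l\<in>B. 1 / ?F l)" if "finite A" "finite B" for A B
  proof -
   have "0 \<le> (\<Sum>l\<in>A \<inter> B. 1 / ?F l)" by (intro sum_nonneg) auto
   thus ?thesis using sum.union_inter[OF that, of "\<lambda>l. 1 / ?F l"] by linarith
  qed
  show ?thesis using un[of S1 "S2 \<union> S3"] un[of S2 S3] fin by simp
 qed
 also have "... \<le> far_bound n"
 proof -
  have "(\<Sum>l\<in>S1. 1 / ?F l) \<le> 16 * (real n powr (1/4) / lattice_gap n + 1) / lattice_gap n"
   unfolding S1_def using n by (intro sum_shell_le finite_lattice_points card_lattice_ball lattice_gap_pos) auto
  moreover have "(\<Sum>l\<in>S2. 1 / ?F l) \<le> 16 * (real n powr (3/8) / lattice_gap n + 1) / real n powr (1/4)"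
   unfolding S2_def using n by (intro sum_shell_le finite_lattice_points card_lattice_ball lattice_gap_pos) auto
  moreover have "(\<Sum>l\<in>S3. 1 / ?F l) \<le> 16 * (real n powr (1/2) / lattice_gap n + 1) / real n powr (3/8)"
   unfolding S3_def
  proof (intro sum_shell_le finite_lattice_points)
   have "{l \<in> ?\<Lambda>. ?F l \<le> rh} \<subseteq> {l \<in> ?\<Lambda>. norm (lattice_vec (l - 0)) \<le> real n powr (1/2)}"
    using n0 by (auto simp: lattice_points_def powr_half_sqrt real_le_rsqrt)
   hence "real (card {l \<in> ?\<Lambda>. ?F l \<le> rh}) \<le> real (card {l \<in> ?\<Lambda>. norm (lattice_vec (l - 0)) \<le> real n powr (1/2)})"
    using finite_lattice_points by (simp only: of_nat_le_iff) (intro card_mono, auto)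
   also have "... \<le> 16 * (real n powr (1/2) / lattice_gap n + 1)" using n by (intro card_lattice_ball) auto
   finally show "real (card {l \<in> ?\<Lambda>. ?F l \<le> rh}) \<le> 16 * (real n powr (1/2) / lattice_gap n + 1)" .
  qed (use n in auto)
  ultimately show ?thesis unfolding far_bound_def by linarith
 qed
 finally show ?thesis .
qed

section \<open>Sums of inverse norms over sums of lattice points\<close>

definition inv_norm :: "int ^ 2 \<Rightarrow> real" where
 "inv_norm v = (if v = 0 then 0 else 1 / norm (lattice_vec v))"

lemma inv_norm_nonneg: "0 \<le> inv_norm v"
 by (simp add: inv_norm_def)

lemma inv_norm_le: assumes "0 < d"
 shows "inv_norm v \<le> of_bool (v \<noteq> 0 \<and> norm (lattice_vec v) \<le> d) + of_bool (d < norm (lattice_vec v) \<and> norm (lattice_vec v) \<le> g) * (1 / d)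
   + (if g < norm (lattice_vec v) then 1 / norm (lattice_vec v) else 0)"
proof -
 have "1 / norm (lattice_vec v) \<le> 1" if "v \<noteq> 0" using norm_lattice_vec_ge_1[OF that] by (simp add: divide_le_eq_1)
 moreover have "1 / norm (lattice_vec v) \<le> 1 / d" if "d < norm (lattice_vec v)" using that assms by (intro frac_le) auto
 ultimately show ?thesis using assms by (auto simp: inv_norm_def)
qed

lemma real_card_filter: "finite A \<Longrightarrow> real (card {x \<in> A. P x}) = (\<Sum>x\<in>A. of_bool (P x))"
 by (simp add: sum.If_cases Int_def)

text \<open>Three ranges of distance from \<open>w\<close>: up to \<open>d\<close> the terms are at
  most 1 and are counted; between \<open>d\<close> and the gap there are at most two points; beyond
  the gap \<open>far_bound\<close> takes over.\<close>

lemma sum_inv_norm_le: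
 assumes n: "1 \<le> n" and d: "0 < d"
 shows "(\<Sum>l\<in>LP n. inv_norm (l - w))
  \<le> real (card {l \<in> LP n. l \<noteq> w \<and> norm (lattice_vec (l - w)) \<le> d}) + 2 / d + far_bound n"
proof -
 let ?\<Lambda> = "LP n" and ?F = "\<lambda>l. norm (lattice_vec (l - w))" and ?g = "lattice_gap n"
 have f: "finite ?\<Lambda>" by (rule finite_lattice_points)
 have "(\<Sum>l\<in>?\<Lambda>. inv_norm (l - w)) \<le> (\<Sum>l\<in>?\<Lambda>. of_bool (l - w \<noteq> 0 \<and> ?F l \<le> d) + of_bool (d < ?F l \<and> ?F l \<le> ?g) * (1 / d)
   + (if ?g < ?F l then 1 / ?F l else 0))"
  by (intro sum_mono inv_norm_le d)
 also have "... = real (card {l \<in> ?\<Lambda>. l \<noteq> w \<and> ?F l \<le> d}) + real (card {l \<in> ?\<Lambda>. d < ?F l \<and> ?F l \<le> ?g}) * (1 / d)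
   + (\<Sum>l\<in>{l \<in> ?\<Lambda>. ?g < ?F l}. 1 / ?F l)"
  unfolding sum.distrib sum.inter_filter[OF f] real_card_filter[OF f] sum_distrib_right right_minus_eq by (rule refl)
 also have "... \<le> real (card {l \<in> ?\<Lambda>. l \<noteq> w \<and> ?F l \<le> d}) + 2 * (1 / d) + far_bound n"
 proof (intro add_mono mult_right_mono sum_far_le n)
  have "card {l \<in> ?\<Lambda>. d < ?F l \<and> ?F l \<le> ?g} \<le> 2"
  proof (rule card_lattice_cluster[OF n])
   fix p q assume "p \<in> {l \<in> ?\<Lambda>. d < ?F l \<and> ?F l \<le> ?g}" "q \<in> {l \<in> ?\<Lambda>. d < ?F l \<and> ?F l \<le> ?g}"
   moreover have "lattice_vec (p - q) = lattice_vec (p - w) - lattice_vec (q - w)" by (simp add: lattice_vec_diff)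
   ultimately show "norm (lattice_vec (p - q)) \<le> 2 * ?g"
    using norm_triangle_ineq4[of "lattice_vec (p - w)" "lattice_vec (q - w)"] by simp
  qed auto
  thus "real (card {l \<in> ?\<Lambda>. d < ?F l \<and> ?F l \<le> ?g}) \<le> 2" by simp
 qed (use d in auto)
 finally show ?thesis by simp
qed

definition int_ball :: "nat \<Rightarrow> (int ^ 2) set" where
 "int_ball d = {v. norm (lattice_vec v) \<le> real d}"

lemma int_ball_card: "finite (int_ball d)" "card (int_ball d) \<le> (2 * d + 1)^2"
proof -
 let ?B = "{- int d..int d} \<times> {- int d..int d}"
 have sub: "int_ball d \<subseteq> (\<lambda>(a, b). vector [a, b]) ` ?B"
 proof
  fix l assume "l \<in> int_ball d"
  hence "\<bar>real_of_int (l $ i)\<bar> \<le> real d" for i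
   using component_le_norm_cart[of "lattice_vec l" i] by (simp add: int_ball_def lattice_vec_def)
  hence "\<bar>l $ i\<bar> \<le> int d" for i
   by (metis of_int_abs of_int_le_iff of_int_of_nat_eq)
  from this[of 1] this[of 2] show "l \<in> (\<lambda>(a, b). vector [a, b]) ` ?B"
   by (intro image_eqI[of _ _ "(l $ 1, l $ 2)"]) (auto simp: vec_eq_iff forall_2)
 qed
 show "finite (int_ball d)" using sub by (rule finite_subset) simp
 have "card (int_ball d) \<le> card ((\<lambda>(a, b). vector [a, b] :: int ^ 2) ` ?B)" using sub by (intro card_mono) auto
 also have "... \<le> card ?B" by (rule card_image_le) simp
 also have "... = (2 * d + 1)^2"
 proof -
  have "nat (int d - - int d + 1) = 2 * d + 1" by simp
  thus ?thesis by (simp only: card_cartesian_product card_atLeastAtMost_int power2_eq_square)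
 qed
 finally show "card (int_ball d) \<le> (2 * d + 1)^2" .
qed

lemma card_lattice_points_le: "card (LP n) \<le> (2 * n + 1)^2"
proof -
 have "LP n \<subseteq> int_ball n"
 proof
  fix l assume "l \<in> LP n"
  hence "(norm (lattice_vec l))^2 \<le> real n * real n"
   by (cases n) (auto simp: lattice_points_def)
  thus "l \<in> int_ball n" by (simp add: int_ball_def power2_eq_square[symmetric])
 qed
 thus ?thesis using card_mono[OF int_ball_card(1)] int_ball_card(2) le_trans by blast
qed

lemma sum_pairs_indicator:
 "(\<Sum>l\<in>LP n. \<Sum>m\<in>LP n. of_bool (l + m = v)) = (of_nat (card (sum_reps n v)) :: real)"
proof -
 have "(\<Sum>m\<in>LP n. of_bool (l + m = v)) = (of_bool (v - l \<in> LP n) :: real)" for l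
 proof -
  have "(l + m = v) = (m = v - l)" for m by auto
  thus ?thesis using finite_lattice_points by simp
 qed
 thus ?thesis
  using finite_lattice_points by (simp add: sum_reps_def sum.If_cases Int_def)
qed

text \<open>Once \<open>k\<close> and \<open>l\<close> are chosen, the sum of the other two is
  prescribed and has at most two representations, unless it is zero. The exceptional pairs are those
  with \<open>k + l = v\<close>.\<close>

lemma sum_quads_indicator_le:
 "(\<Sum>k\<in>LP n. \<Sum>l\<in>LP n. \<Sum>m\<in>LP n. \<Sum>p\<in>LP n. of_bool (k + l + m + p = v))
  \<le> 2 * (real (card (LP n)))^2 + real (card (LP n)) * real (card (sum_reps n v))"
proof -
 let ?\<Lambda> = "LP n" and ?N = "real (card (LP n))"
 have "(\<Sum>m\<in>?\<Lambda>. \<Sum>p\<in>?\<Lambda>. of_bool (k + l + m + p = v)) \<le> 2 + ?N * of_bool (k + l = v)" for k l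
 proof -
  have "(k + l + m + p = v) = (m + p = v - (k + l))" for m p by (auto simp: algebra_simps)
  hence "(\<Sum>m\<in>?\<Lambda>. \<Sum>p\<in>?\<Lambda>. of_bool (k + l + m + p = v)) = real (card (sum_reps n (v - (k + l))))"
   by (simp only: sum_pairs_indicator)
  also have "... \<le> 2 + ?N * of_bool (k + l = v)"
  proof (cases "k + l = v")
   case True
   thus ?thesis using card_sum_reps_le[of n 0] by simp
  next
   case False
   thus ?thesis using card_sum_reps_nonzero[of "v - (k + l)" n] by simp
  qed
  finally show ?thesis .
 qed
 hence "(\<Sum>k\<in>?\<Lambda>. \<Sum>l\<in>?\<Lambda>. \<Sum>m\<in>?\<Lambda>. \<Sum>p\<in>?\<Lambda>. of_bool (k + l + m + p = v))
   \<le> (\<Sum>k\<in>?\<Lambda>. \<Sum>l\<in>?\<Lambda>. 2 + ?N * of_bool (k + l = v))" by (intro sum_mono)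
 also have "... = 2 * ?N^2 + ?N * (\<Sum>k\<in>?\<Lambda>. \<Sum>l\<in>?\<Lambda>. of_bool (k + l = v))"
  by (simp add: sum.distrib sum_distrib_left power2_eq_square)
 finally show ?thesis unfolding sum_pairs_indicator .
qed

lemma sum_small_nonzero:
 "of_bool (v \<noteq> 0 \<and> norm (lattice_vec v) \<le> real d) = (\<Sum>x\<in>int_ball d - {0}. of_bool (v = x) :: real)"
 using int_ball_card(1)[of d] by (auto simp: int_ball_def)

text \<open>Sums of norm at most \<open>d\<close> are grouped by their value: the ball holds a
  number of values depending on \<open>d\<close> alone, each taken by at most two pairs.\<close>

lemma pair_sum_le:
 assumes n: "1 \<le> n" and d: "1 \<le> d"
 defines "N \<equiv> real (card (LP n))"
 shows "(\<Sum>k\<in>LP n. \<Sum>l\<in>LP n. inv_norm (k + l))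
  \<le> 2 * (2 * real d + 1)^2 + 2 * N / real d + far_bound n * N"
proof -
 let ?\<Lambda> = "LP n"
 have "(\<Sum>l\<in>?\<Lambda>. inv_norm (k + l)) \<le> (\<Sum>l\<in>?\<Lambda>. of_bool (k + l \<noteq> 0 \<and> norm (lattice_vec (k + l)) \<le> real d)) + (2 / real d + far_bound n)" for k
 proof -
  have "l - (- k) = k + l" "(l \<noteq> - k) = (k + l \<noteq> 0)" for l :: "int ^ 2"
   by (simp add: add.commute, metis add.commute add_eq_0_iff minus_minus)
  thus ?thesis
   using sum_inv_norm_le[OF n, of "real d" "- k"] d by (simp only: real_card_filter[OF finite_lattice_points]) simp
 qed
 hence "(\<Sum>k\<in>?\<Lambda>. \<Sum>l\<in>?\<Lambda>. inv_norm (k + l)) \<le> (\<Sum>k\<in>?\<Lambda>. (\<Sum>l\<in>?\<Lambda>. of_bool (k + l \<noteq> 0 \<and> norm (lattice_vec (k + l)) \<le> real d)) + (2 / real d + far_bound n))"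
  by (rule sum_mono)
 also have "... = (\<Sum>k\<in>?\<Lambda>. \<Sum>l\<in>?\<Lambda>. \<Sum>x\<in>int_ball d - {0}. of_bool (k + l = x)) + N * (2 / real d + far_bound n)"
  unfolding sum.distrib sum_small_nonzero by (simp add: N_def distrib_left)
 also have "(\<Sum>k\<in>?\<Lambda>. \<Sum>l\<in>?\<Lambda>. \<Sum>x\<in>int_ball d - {0}. of_bool (k + l = x)) = (\<Sum>x\<in>int_ball d - {0}. \<Sum>k\<in>?\<Lambda>. \<Sum>l\<in>?\<Lambda>. of_bool (k + l = x) :: real)"
  unfolding sum.swap[of _ ?\<Lambda> "int_ball d - {0}"] ..
 also have "... \<le> (\<Sum>x\<in>int_ball d - {0}. 2)"
  unfolding sum_pairs_indicator using card_sum_reps_nonzero by (intro sum_mono) auto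
 also have "... = 2 * real (card (int_ball d - {0}))" by simp
 also have "... \<le> 2 * (2 * real d + 1)^2"
 proof -
  have "card (int_ball d - {0}) \<le> (2 * d + 1)^2"
   using card_mono[OF int_ball_card(1), of "int_ball d - {0}" d] int_ball_card(2)[of d] by force
  hence "real (card (int_ball d - {0})) \<le> real ((2 * d + 1)^2)" by (simp only: of_nat_le_iff)
  thus ?thesis by (simp add: add.commute)
 qed
 finally show ?thesis by (simp add: algebra_simps)
qed

text \<open>The same grouping as for pairs; a small nonzero sum is taken by only order
  \<open>N^2\<close> quadruples, against the normalisation \<open>N ^ 3\<close>.\<close>

lemma quad_sum_le:
 assumes n: "1 \<le> n" and d: "1 \<le> d"
 defines "N \<equiv> real (card (LP n))"
 shows "(\<Sum>k\<in>LP n. \<Sum>l\<in>LP n. \<Sum>m\<in>LP n. \<Sum>p\<in>LP n. inv_norm (k + l + m + p))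
  \<le> (2 * real d + 1)^2 * (2 * N^2 + 2 * N) + 2 * N ^ 3 / real d + far_bound n * N ^ 3"
proof -
 let ?\<Lambda> = "LP n"
 let ?S = "\<lambda>f. (\<Sum>k\<in>?\<Lambda>. \<Sum>l\<in>?\<Lambda>. \<Sum>m\<in>?\<Lambda>. f k l m)"
 have "(\<Sum>p\<in>?\<Lambda>. inv_norm (k + p)) \<le> (\<Sum>p\<in>?\<Lambda>. of_bool (k + p \<noteq> 0 \<and> norm (lattice_vec (k + p)) \<le> real d)) + (2 / real d + far_bound n)" for k
 proof -
  have "l - (- k) = k + l" "(l \<noteq> - k) = (k + l \<noteq> 0)" for l :: "int ^ 2"
   by (simp add: add.commute, metis add.commute add_eq_0_iff minus_minus)
  thus ?thesis
   using sum_inv_norm_le[OF n, of "real d" "- k"] d by (simp only: real_card_filter[OF finite_lattice_points]) simp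
 qed
 hence "?S (\<lambda>k l m. \<Sum>p\<in>?\<Lambda>. inv_norm (k + l + m + p))
   \<le> ?S (\<lambda>k l m. (\<Sum>p\<in>?\<Lambda>. of_bool (k + l + m + p \<noteq> 0 \<and> norm (lattice_vec (k + l + m + p)) \<le> real d)) + (2 / real d + far_bound n))"
  by (intro sum_mono)
 also have "... = ?S (\<lambda>k l m. \<Sum>p\<in>?\<Lambda>. \<Sum>x\<in>int_ball d - {0}. of_bool (k + l + m + p = x)) + N ^ 3 * (2 / real d + far_bound n)"
  unfolding sum.distrib sum_small_nonzero by (simp add: N_def power3_eq_cube distrib_left)
 also have "?S (\<lambda>k l m. \<Sum>p\<in>?\<Lambda>. \<Sum>x\<in>int_ball d - {0}. of_bool (k + l + m + p = x))
   = (\<Sum>x\<in>int_ball d - {0}. ?S (\<lambda>k l m. \<Sum>p\<in>?\<Lambda>. of_bool (k + l + m + p = x) :: real))"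
  unfolding sum.swap[of _ ?\<Lambda> "int_ball d - {0}"] ..
 also have "... \<le> (\<Sum>x\<in>int_ball d - {0}. 2 * N^2 + 2 * N)"
 proof (rule sum_mono)
  fix x assume "x \<in> int_ball d - {0}"
  hence "real (card (sum_reps n x)) \<le> 2" using card_sum_reps_nonzero by auto
  hence "N * real (card (sum_reps n x)) \<le> N * 2" unfolding N_def by (intro mult_left_mono) auto
  thus "?S (\<lambda>k l m. \<Sum>p\<in>?\<Lambda>. of_bool (k + l + m + p = x)) \<le> 2 * N^2 + 2 * N"
   using sum_quads_indicator_le[of x n] unfolding N_def by linarith
 qed
 also have "... = real (card (int_ball d - {0})) * (2 * N^2 + 2 * N)" by simp
 also have "... \<le> (2 * real d + 1)^2 * (2 * N^2 + 2 * N)"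
 proof (rule mult_right_mono)
  have "card (int_ball d - {0}) \<le> (2 * d + 1)^2"
   using card_mono[OF int_ball_card(1), of "int_ball d - {0}" d] int_ball_card(2)[of d] by force
  hence "real (card (int_ball d - {0})) \<le> real ((2 * d + 1)^2)" by (simp only: of_nat_le_iff)
  thus "real (card (int_ball d - {0})) \<le> (2 * real d + 1)^2" by (simp add: add.commute)
 qed (simp add: N_def)
 finally show ?thesis by (simp add: algebra_simps)
qed

lemma eventually_large_n:
 assumes "filterlim (\<lambda>k. card (LP (nn k))) at_top sequentially"
 shows "filterlim nn at_top sequentially"
 unfolding filterlim_at_top
proof
 fix m
 have "\<forall>\<^sub>F k in sequentially. (2 * m + 1)\<^sup>2 + 1 \<le> card (LP (nn k))"
  using assms unfolding filterlim_at_top by blast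
 thus "\<forall>\<^sub>F k in sequentially. m \<le> nn k"
 proof eventually_elim
  case (elim k)
  show "m \<le> nn k"
  proof (rule ccontr)
   assume "\<not> m \<le> nn k"
   hence "(2 * nn k + 1)^2 \<le> (2 * m + 1)^2" by (intro power_mono) auto
   thus False using elim card_lattice_points_le[of "nn k"] by linarith
  qed
 qed
qed

text \<open>The cutoff \<open>d\<close> is fixed large first, so that \<open>2 / d\<close> is small;
  the dependence of \<open>B\<close> on \<open>d\<close> is then defeated by the growth of
  \<open>N\<close>.\<close>

lemma tendsto_0_of_bounds:
 fixes a N e :: "nat \<Rightarrow> real"
 assumes N: "filterlim N at_top sequentially" and e: "e \<longlonglongrightarrow> 0" and a: "\<And>k. 0 \<le> a k"
  and bnd: "\<And>k d. 1 \<le> d \<Longrightarrow> a k \<le> B d / N k + 2 / real d + e k"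
 shows "a \<longlonglongrightarrow> 0"
proof (rule LIMSEQ_I)
 fix ep :: real assume ep: "0 < ep"
 obtain d where d: "0 < d" "8 / ep < real d" using reals_Archimedean2[of "8 / ep"] ep
  by (metis divide_pos_pos gr0I less_asym of_nat_0 zero_less_numeral)
 have d2: "2 / real d < ep / 4" using d ep by (simp add: field_simps)
 have "(\<lambda>k. B d / N k) \<longlonglongrightarrow> 0" by (intro tendsto_divide_0[OF tendsto_const] filterlim_at_top_imp_at_infinity N)
 hence "\<forall>\<^sub>F k in sequentially. B d / N k < ep / 4" using ep by (intro order_tendstoD) auto
 moreover have "\<forall>\<^sub>F k in sequentially. e k < ep / 4" using e ep by (intro order_tendstoD) auto
 ultimately have "\<forall>\<^sub>F k in sequentially. norm (a k - 0) < ep"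
 proof eventually_elim
  case (elim k)
  have "a k \<le> B d / N k + 2 / real d + e k" using bnd[of d k] d by simp
  hence "a k < ep" using elim d2 ep by linarith
  thus ?case using a[of k] by simp
 qed
 thus "\<exists>n0. \<forall>n\<ge>n0. norm (a n - 0) < ep" by (simp add: eventually_sequentially)
qed

context
 fixes nn :: "nat \<Rightarrow> nat"
 assumes nn: "\<And>k. 1 \<le> nn k" and lim: "filterlim (\<lambda>k. card (LP (nn k))) at_top sequentially"
  and ne: "\<And>k. LP (nn k) \<noteq> {}"
begin

lemma card_lattice_pos: "0 < real (card (LP (nn k)))"
 using ne finite_lattice_points by (simp add: card_gt_0_iff)

lemma real_card_lim: "filterlim (\<lambda>k. real (card (LP (nn k)))) at_top sequentially"
 using filterlim_compose[OF filterlim_real_sequentially lim] .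

lemma far_bound_lim: "(\<lambda>k. far_bound (nn k)) \<longlonglongrightarrow> 0"
 using filterlim_compose[OF far_bound_tendsto_0 eventually_large_n[OF lim]] .

lemma pair_sum_tendsto_0:
 "(\<lambda>k. (\<Sum>l\<in>LP (nn k). \<Sum>m\<in>LP (nn k). inv_norm (l + m)) / real (card (LP (nn k)))) \<longlonglongrightarrow> 0"
proof (rule tendsto_0_of_bounds[OF real_card_lim far_bound_lim])
 fix k d :: nat assume d: "1 \<le> d"
 let ?N = "real (card (LP (nn k)))"
 have "(\<Sum>l\<in>LP (nn k). \<Sum>m\<in>LP (nn k). inv_norm (l + m)) / ?N
   \<le> (2 * (2 * real d + 1)^2 + 2 * ?N / real d + far_bound (nn k) * ?N) / ?N"
  by (intro divide_right_mono pair_sum_le nn d) simp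
 also have "... = 2 * (2 * real d + 1)^2 / ?N + 2 / real d + far_bound (nn k)"
  using card_lattice_pos[of k] by (simp add: add_divide_distrib)
 finally show "(\<Sum>l\<in>LP (nn k). \<Sum>m\<in>LP (nn k). inv_norm (l + m)) / ?N
  \<le> 2 * (2 * real d + 1)^2 / ?N + 2 / real d + far_bound (nn k)" .
qed (intro divide_nonneg_nonneg sum_nonneg inv_norm_nonneg, simp)

lemma quad_sum_tendsto_0:
 "(\<lambda>k. (\<Sum>l\<in>LP (nn k). \<Sum>m\<in>LP (nn k). \<Sum>p\<in>LP (nn k). \<Sum>q\<in>LP (nn k).
   inv_norm (l + m + p + q)) / real (card (LP (nn k))) ^ 3) \<longlonglongrightarrow> 0"
proof (rule tendsto_0_of_bounds[OF real_card_lim far_bound_lim])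
 fix k d :: nat assume d: "1 \<le> d"
 let ?N = "real (card (LP (nn k)))" and ?\<Lambda> = "LP (nn k)"
 let ?Q = "\<Sum>l\<in>?\<Lambda>. \<Sum>m\<in>?\<Lambda>. \<Sum>p\<in>?\<Lambda>. \<Sum>q\<in>?\<Lambda>. inv_norm (l + m + p + q)"
 have N1: "1 \<le> ?N" using card_lattice_pos[of k] by simp
 have "?Q / ?N ^ 3 \<le> ((2 * real d + 1)^2 * (2 * ?N^2 + 2 * ?N) + 2 * ?N ^ 3 / real d + far_bound (nn k) * ?N ^ 3) / ?N ^ 3"
  by (intro divide_right_mono quad_sum_le nn d) simp
 also have "... = (2 * real d + 1)^2 * ((2 * ?N^2 + 2 * ?N) / ?N ^ 3) + 2 / real d + far_bound (nn k)"
  using card_lattice_pos[of k] add_divide_distrib[of "(2 * real d + 1)^2 * (2 * ?N^2 + 2 * ?N) + 2 * ?N ^ 3 / real d" "far_bound (nn k) * ?N ^ 3" "?N ^ 3"]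
   add_divide_distrib[of "(2 * real d + 1)^2 * (2 * ?N^2 + 2 * ?N)" "2 * ?N ^ 3 / real d" "?N ^ 3"] by simp
 also have "... \<le> (2 * real d + 1)^2 * (4 / ?N) + 2 / real d + far_bound (nn k)"
 proof (intro add_right_mono mult_left_mono)
  have "?N * 1 \<le> ?N * ?N" using N1 by (intro mult_left_mono) auto
  hence "(2 * ?N^2 + 2 * ?N) / ?N ^ 3 \<le> (4 * ?N^2) / ?N ^ 3" by (intro divide_right_mono) (auto simp: power2_eq_square)
  also have "... = 4 / ?N" using N1 by (simp add: power2_eq_square power3_eq_cube)
  finally show "(2 * ?N^2 + 2 * ?N) / ?N ^ 3 \<le> 4 / ?N" .
 qed simp
 also have "... = (2 * real d + 1)^2 * 4 / ?N + 2 / real d + far_bound (nn k)" by simp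
 finally show "?Q / ?N ^ 3 \<le> (2 * real d + 1)^2 * 4 / ?N + 2 / real d + far_bound (nn k)" .
qed (intro divide_nonneg_nonneg sum_nonneg inv_norm_nonneg, simp)

end

lemma zero_quads_le:
 "(\<Sum>k\<in>LP n. \<Sum>l\<in>LP n. \<Sum>m\<in>LP n. \<Sum>p\<in>LP n. of_bool (k + l + m + p = 0))
  \<le> 3 * (real (card (LP n)))^2"
proof -
 have "real (card (LP n)) * real (card (sum_reps n 0)) \<le> real (card (LP n)) * real (card (LP n))"
  by (intro mult_left_mono) (simp_all add: card_sum_reps_le)
 thus ?thesis using sum_quads_indicator_le[of 0 n] by (simp add: power2_eq_square)
qed

section \<open>Riemann sums\<close>

lemma riemann_sums_tendsto:
 fixes g :: "real \<Rightarrow> 'a :: euclidean_space"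
 assumes L: "0 < L" and K: "0 < K" and g: "continuous_on {0..L} g"
 shows "(\<lambda>p. (L / real (K * Suc p)) *\<^sub>R (\<Sum>i<K * Suc p. g (real i * (L / real (K * Suc p))))) \<longlonglongrightarrow> integral {0..L} g"
proof (rule LIMSEQ_I)
 fix e :: real assume e: "0 < e"
 have "uniformly_continuous_on {0..L} g" by (rule compact_uniformly_continuous[OF g compact_Icc])
 then obtain d where d: "0 < d" "\<And>x x'. x \<in> {0..L} \<Longrightarrow> x' \<in> {0..L} \<Longrightarrow> dist x' x < d \<Longrightarrow> dist (g x') (g x) < e / (2 * L)"
  unfolding uniformly_continuous_on_def using e L by (metis divide_pos_pos mult_pos_pos zero_less_numeral)
 have int: "g integrable_on {0..L}" by (rule integrable_continuous_interval[OF g])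
 have est: "norm ((L / real m) *\<^sub>R (\<Sum>i<m. g (real i * (L / real m))) - integral {0..L} g) < e"
  if m: "0 < m" "L / real m < d" for m :: nat
 proof -
  define h where "h = L / real m"
  have h: "0 < h" "real m * h = L" "h < d" using L m by (auto simp: h_def)
  have node: "real i * h \<le> L" if "i \<le> m" for i
   using that h mult_right_mono[of "real i" "real m" h] by auto
  have "norm (h *\<^sub>R (\<Sum>i<j. g (real i * h)) - integral {0..real j * h} g) \<le> real j * h * (e / (2 * L))" if "j \<le> m" for j
   using that
  proof (induction j)
   case 0
   thus ?case by simp
  next
   case (Suc j)
   let ?a = "real j * h" and ?b = "real (Suc j) * h"
   have ab: "0 \<le> ?a" "?a \<le> ?b" "?b \<le> L" "?b - ?a = h" using h node[of "Suc j"] Suc.prems by (auto simp: distrib_right)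
   have sub: "g integrable_on {?a..?b}" by (rule integrable_subinterval_real[OF int]) (use ab in auto)
   have "norm (integral {?a..?b} (\<lambda>x. g ?a - g x)) \<le> e / (2 * L) * (?b - ?a)"
   proof (rule integral_bound[OF ab(2)])
    show "continuous_on {?a..?b} (\<lambda>x. g ?a - g x)"
     by (intro continuous_intros continuous_on_subset[OF g]) (use ab in auto)
    fix x assume x: "x \<in> {?a..?b}"
    have "dist (g ?a) (g x) < e / (2 * L)"
    proof (rule d(2))
     show "x \<in> {0..L}" "?a \<in> {0..L}" using x ab unfolding atLeastAtMost_iff by linarith+
     show "dist ?a x < d" using x ab h(3) unfolding atLeastAtMost_iff dist_real_def by linarith
    qed
    thus "norm (g ?a - g x) \<le> e / (2 * L)" by (simp add: dist_norm)
   qed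
   moreover have "integral {?a..?b} (\<lambda>x. g ?a - g x) = h *\<^sub>R g ?a - integral {?a..?b} g"
    using Henstock_Kurzweil_Integration.integral_diff[OF integrable_const_ivl sub, of "g ?a"] ab by simp
   ultimately have st: "norm (h *\<^sub>R g ?a - integral {?a..?b} g) \<le> h * (e / (2 * L))"
    using ab(4) by (simp only: mult.commute)
   have "integral {0..?b} g = integral {0..?a} g + integral {?a..?b} g"
    by (rule Henstock_Kurzweil_Integration.integral_combine[symmetric]) (use ab integrable_subinterval_real[OF int, of 0 ?b] in auto)
   hence "h *\<^sub>R (\<Sum>i<Suc j. g (real i * h)) - integral {0..?b} g
     = (h *\<^sub>R (\<Sum>i<j. g (real i * h)) - integral {0..?a} g) + (h *\<^sub>R g ?a - integral {?a..?b} g)"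
    by (simp add: scaleR_add_right)
   hence "norm (h *\<^sub>R (\<Sum>i<Suc j. g (real i * h)) - integral {0..?b} g) \<le> ?a * (e / (2 * L)) + h * (e / (2 * L))"
    using norm_triangle_le[OF add_mono[OF Suc.IH st]] Suc.prems by simp
   also have "... = ?b * (e / (2 * L))" by (simp only: of_nat_Suc distrib_right mult_1 add.commute)
   finally show ?case .
  qed
  from this[of m] have "norm (h *\<^sub>R (\<Sum>i<m. g (real i * h)) - integral {0..L} g) \<le> L * (e / (2 * L))"
   using h(2) by simp
  also have "... < e" using e L by simp
  finally show ?thesis unfolding h_def .
 qed
 have "(\<lambda>p. L / real (K * Suc p)) \<longlonglongrightarrow> 0"
 proof -
  have "(\<lambda>k. (L / real K) * (1 / real (Suc k))) \<longlonglongrightarrow> (L / real K) * 0"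
   by (intro tendsto_mult tendsto_const LIMSEQ_Suc[OF lim_1_over_n])
  moreover have "(L / real K) * (1 / real (Suc k)) = L / real (K * Suc k)" for k by (simp only: of_nat_mult) simp
  ultimately show ?thesis by (simp only: mult_zero_right)
 qed
 hence "\<forall>\<^sub>F p in sequentially. L / real (K * Suc p) < d" using d(1) by (intro order_tendstoD)
 then obtain p0 where p0: "\<And>p. p0 \<le> p \<Longrightarrow> L / real (K * Suc p) < d" unfolding eventually_sequentially by blast
 show "\<exists>no. \<forall>p\<ge>no. norm ((L / real (K * Suc p)) *\<^sub>R (\<Sum>i<K * Suc p. g (real i * (L / real (K * Suc p)))) - integral {0..L} g) < e"
  using est[of "K * Suc _"] p0 K by (intro exI[of _ p0] allI impI est) auto
qed

text \<open>The Riemann sums of a kernel of finite rank factor into one-dimensional ones.\<close>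

lemma riemann_double_sums_tendsto:
 fixes W :: "'k \<Rightarrow> real \<Rightarrow> complex" and q :: "real \<Rightarrow> real \<Rightarrow> real"
 assumes L: "0 < L" and K: "0 < K" and W: "\<And>k. k \<in> I \<Longrightarrow> continuous_on {0..L} (W k)"
  and q: "\<And>t s. t \<in> {0..L} \<Longrightarrow> s \<in> {0..L} \<Longrightarrow> complex_of_real (q t s) = (\<Sum>k\<in>I. W k t * cnj (W k s))"
 shows "(\<lambda>p. (L / real (K * Suc p))^2 * (\<Sum>i<K * Suc p. \<Sum>j<K * Suc p. q (real i * (L / real (K * Suc p))) (real j * (L / real (K * Suc p)))))
  \<longlonglongrightarrow> (\<Sum>k\<in>I. (cmod (integral {0..L} (W k)))\<^sup>2)"
proof -
 define R where "R k p = (L / real (K * Suc p)) *\<^sub>R (\<Sum>i<K * Suc p. W k (real i * (L / real (K * Suc p))))" for k p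
 have "(\<lambda>p. (\<Sum>k\<in>I. (cmod (R k p))\<^sup>2)) \<longlonglongrightarrow> (\<Sum>k\<in>I. (cmod (integral {0..L} (W k)))\<^sup>2)"
  unfolding R_def by (intro tendsto_sum tendsto_power tendsto_norm riemann_sums_tendsto L K W)
 moreover have "(\<Sum>k\<in>I. (cmod (R k p))\<^sup>2)
   = (L / real (K * Suc p))^2 * (\<Sum>i<K * Suc p. \<Sum>j<K * Suc p. q (real i * (L / real (K * Suc p))) (real j * (L / real (K * Suc p))))" for p
 proof -
  define m where "m = K * Suc p"
  define h where "h = L / real m"
  have m: "0 < m" using K by (simp add: m_def)
  have node: "real i * h \<in> {0..L}" if "i < m" for i
  proof -
   have "real i * h \<le> real m * h" using that L by (intro mult_right_mono) (auto simp: h_def)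
   thus ?thesis using L m by (simp add: h_def)
  qed
  have "complex_of_real (h^2 * (\<Sum>i<m. \<Sum>j<m. q (real i * h) (real j * h)))
    = (of_real h)^2 * (\<Sum>i<m. \<Sum>j<m. \<Sum>k\<in>I. W k (real i * h) * cnj (W k (real j * h)))"
   unfolding of_real_mult of_real_power of_real_sum using node q by (intro arg_cong2[where f="(*)"] refl sum.cong) auto
  also have "... = (of_real h)^2 * (\<Sum>k\<in>I. \<Sum>i<m. \<Sum>j<m. W k (real i * h) * cnj (W k (real j * h)))"
   unfolding sum.swap[of _ "{..<m}" I] ..
  also have "... = (of_real h)^2 * (\<Sum>k\<in>I. (\<Sum>i<m. W k (real i * h)) * cnj (\<Sum>j<m. W k (real j * h)))"
   unfolding sum_product cnj_sum ..
  also have "... = (\<Sum>k\<in>I. (of_real h * (\<Sum>i<m. W k (real i * h))) * cnj (of_real h * (\<Sum>i<m. W k (real i * h))))"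
   by (subst sum_distrib_left) (intro sum.cong refl, simp only: complex_cnj_mult complex_cnj_complex_of_real power2_eq_square mult_ac)
  also have "... = (\<Sum>k\<in>I. complex_of_real ((cmod (R k p))^2))"
   by (intro sum.cong refl) (simp only: R_def m_def[symmetric] h_def[symmetric] scaleR_conv_of_real complex_norm_square)
  finally have "complex_of_real (h^2 * (\<Sum>i<m. \<Sum>j<m. q (real i * h) (real j * h))) = complex_of_real (\<Sum>k\<in>I. (cmod (R k p))\<^sup>2)"
   by (simp only: of_real_sum)
  thus ?thesis unfolding of_real_eq_iff h_def m_def by (rule sym)
 qed
 ultimately show ?thesis by simp
qed

section \<open>Isotropy of the lattice points and the functional B\<close>

definition rot :: "int ^ 2 \<Rightarrow> int ^ 2" where "rot l = vector [- (l $ 2), l $ 1]"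

lemma sum_rot: "(\<Sum>l\<in>LP n. g (rot l)) = (\<Sum>l\<in>LP n. g l)"
 by (rule sum.reindex_bij_witness[where i="\<lambda>l. - rot l" and j=rot])
  (auto simp: rot_def lattice_points_iff vec_eq_iff forall_2)

text \<open>The set is invariant under a quarter turn, which equalises the second moments of the two
  coordinates and changes the sign of the mixed one.\<close>

lemma lattice_isotropy:
 "(\<Sum>l\<in>LP n. (lattice_vec l \<bullet> x)\<^sup>2) = real n * real (card (LP n)) / 2 * (norm x)^2"
proof -
 let ?\<Lambda> = "LP n"
 let ?a = "\<lambda>l :: int ^ 2. real_of_int (l $ 1)" and ?b = "\<lambda>l :: int ^ 2. real_of_int (l $ 2)"
 have ab: "(\<Sum>l\<in>?\<Lambda>. (?b l)^2) = (\<Sum>l\<in>?\<Lambda>. (?a l)^2)"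
  using sum_rot[of "\<lambda>l. (?a l)^2" n] by (simp add: rot_def)
 have "(\<Sum>l\<in>?\<Lambda>. ?a l * ?b l) = (\<Sum>l\<in>?\<Lambda>. ?a (rot l) * ?b (rot l))" by (rule sum_rot[symmetric])
 also have "... = - (\<Sum>l\<in>?\<Lambda>. ?a l * ?b l)" by (simp add: rot_def sum_negf mult.commute)
 finally have c: "(\<Sum>l\<in>?\<Lambda>. ?a l * ?b l) = 0" by simp
 have "(?a l)^2 + (?b l)^2 = real n" if "l \<in> ?\<Lambda>" for l
  using that unfolding lattice_points_def mem_Collect_eq norm_lattice_vec by simp
 hence "(\<Sum>l\<in>?\<Lambda>. (?a l)^2 + (?b l)^2) = (\<Sum>l\<in>?\<Lambda>. real n)" by (intro sum.cong) auto
 hence t: "(\<Sum>l\<in>?\<Lambda>. (?a l)^2) = real n * real (card ?\<Lambda>) / 2" using ab by (simp add: sum.distrib mult.commute)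
 have "(lattice_vec l \<bullet> x)^2 = (?a l)^2 * (x $ 1)^2 + (?b l)^2 * (x $ 2)^2 + (?a l * ?b l) * (2 * x $ 1 * x $ 2)" for l
  by (simp add: inner_vec_def UNIV_2 lattice_vec_def power2_eq_square algebra_simps)
 hence "(\<Sum>l\<in>?\<Lambda>. (lattice_vec l \<bullet> x)^2)
   = (\<Sum>l\<in>?\<Lambda>. (?a l)^2) * (x $ 1)^2 + (\<Sum>l\<in>?\<Lambda>. (?b l)^2) * (x $ 2)^2 + (\<Sum>l\<in>?\<Lambda>. ?a l * ?b l) * (2 * x $ 1 * x $ 2)"
  by (simp only: sum.distrib sum_distrib_right)
 also have "... = real n * real (card ?\<Lambda>) / 2 * ((x $ 1)^2 + (x $ 2)^2)"
  unfolding ab c t by (simp add: distrib_left)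
 finally show ?thesis by (simp add: norm_vec_def L2_set_def UNIV_2)
qed

lemma set_lebesgue_integral_continuous:
 fixes g :: "real \<Rightarrow> real"
 assumes "continuous_on {a..b} g"
 shows "(LBINT t:{a..b}. g t) = integral {a..b} g"
 by (rule set_borel_integral_eq_integral(2)) (unfold set_integrable_def, rule borel_integrable_compact[OF compact_Icc assms])

lemma integral_spectral_measure:
 assumes n: "1 \<le> n" and g: "g \<in> borel_measurable borel"
 shows "(LINT te|spectral_measure n. g te) = (\<Sum>l\<in>LP n. g (lattice_vec l /\<^sub>R sqrt (real n))) / real (card (LP n))"
proof -
 have "g \<in> borel_measurable (restrict_space borel (sphere 0 1))" using g by (rule measurable_restrict_space1)
 thus ?thesis
  unfolding spectral_measure_def
  by (subst integral_distr[OF measurable_lattice_direction[OF n]]) (auto simp: integral_uniform_count_measure finite_lattice_points)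
qed

context plane_curve
begin

text \<open>Scaled so that the squares average to 1 over the lattice points; this is what gives the
  normalised derivative of the wave unit variance.\<close>

definition freq :: "nat \<Rightarrow> int ^ 2 \<Rightarrow> real \<Rightarrow> real" where
 "freq n l t = sqrt 2 * (lattice_vec l \<bullet> D 0 t) / sqrt (real n)"

definition curve_coeff :: "nat \<Rightarrow> int ^ 2 \<Rightarrow> real" where
 "curve_coeff n l = integral {0..L} (\<lambda>t. (freq n l t)^2 - 1)"

lemma continuous_freq: "continuous_on {0..L} (freq n l)"
 unfolding freq_def divide_inverse by (intro continuous_intros continuous_D)

lemma freq_uminus: "freq n (- l) t = - freq n l t"
 by (simp add: freq_def lattice_vec_uminus)

lemma sum_freq_sq:
 assumes "1 \<le> n" "t \<in> {0..L}"
 shows "(\<Sum>l\<in>LP n. (freq n l t)\<^sup>2) = real (card (LP n))"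
proof -
 have "(\<Sum>l\<in>LP n. (freq n l t)\<^sup>2) = (2 / real n) * (\<Sum>l\<in>LP n. (lattice_vec l \<bullet> D 0 t)\<^sup>2)"
  by (simp add: freq_def power_mult_distrib power_divide sum_distrib_left)
 thus ?thesis using assms unit_speed[OF assms(2)] by (simp add: lattice_isotropy)
qed

text \<open>The spectral measure is a finite average, so the double integral factors for each
  lattice point into the square of \<open>p l\<close>, where
  \<open>curve_coeff n l = 2 * p l - L\<close>. By isotropy the \<open>p l\<close> have mean
  \<open>L / 2\<close>, and the linear terms of the expanded squares leave exactly
  \<open>- L^2\<close>.\<close>

lemma B_functional_eq:
 assumes n: "1 \<le> n" and ne: "LP n \<noteq> {}"
  and vel: "\<And>t. t \<in> {0..L} \<Longrightarrow> velocity \<gamma> {0..L} t = D 0 t"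
 shows "4 * B_functional L \<gamma> (spectral_measure n) - L^2
  = (\<Sum>l\<in>LP n. (curve_coeff n l)\<^sup>2) / real (card (LP n))"
proof -
 let ?\<Lambda> = "LP n" and ?N = "real (card (LP n))"
 have N: "0 < ?N" using ne finite_lattice_points by (simp add: card_gt_0_iff)
 define q where "q l t = (freq n l t)^2 / 2" for l t
 have cq: "continuous_on {0..L} (q l)" for l unfolding q_def by (intro continuous_intros continuous_freq) auto
 have iq: "q l integrable_on {0..L}" for l by (rule integrable_continuous_interval[OF cq])
 define p where "p l = integral {0..L} (q l)" for l
 have inner: "(LINT te|spectral_measure n. (te \<bullet> D 0 t1)\<^sup>2 * (te \<bullet> D 0 t2)^2) = (\<Sum>l\<in>?\<Lambda>. q l t1 * q l t2) / ?N" for t1 t2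
 proof -
  have "(\<lambda>te. (te \<bullet> D 0 t1)^2 * (te \<bullet> D 0 t2)^2) \<in> borel_measurable borel" by measurable
  moreover have "((lattice_vec l /\<^sub>R sqrt (real n)) \<bullet> D 0 t)^2 = q l t" for l t
  proof -
   have "(lattice_vec l /\<^sub>R sqrt (real n)) \<bullet> D 0 t = (lattice_vec l \<bullet> D 0 t) / sqrt (real n)"
    by (simp only: inner_scaleR_left divide_inverse mult.commute)
   thus ?thesis by (simp only: q_def freq_def power_mult_distrib power_divide real_sqrt_pow2) simp
  qed
  ultimately show ?thesis by (simp only: integral_spectral_measure[OF n])
 qed
 have 1: "(LBINT t2:{0..L}. LINT te|spectral_measure n. (te \<bullet> velocity \<gamma> {0..L} t1)\<^sup>2 * (te \<bullet> velocity \<gamma> {0..L} t2)^2)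
   = (\<Sum>l\<in>?\<Lambda>. q l t1 * p l) / ?N" if t1: "t1 \<in> {0..L}" for t1
 proof -
  have "(LBINT t2:{0..L}. LINT te|spectral_measure n. (te \<bullet> velocity \<gamma> {0..L} t1)\<^sup>2 * (te \<bullet> velocity \<gamma> {0..L} t2)^2)
    = (LBINT t2:{0..L}. (\<Sum>l\<in>?\<Lambda>. q l t1 * q l t2) / ?N)"
   by (rule set_lebesgue_integral_cong) (auto simp: vel vel[OF t1] inner[symmetric])
  also have "... = integral {0..L} (\<lambda>t2. (\<Sum>l\<in>?\<Lambda>. q l t1 * q l t2) / ?N)"
   by (intro set_lebesgue_integral_continuous continuous_intros cq) (use N in auto)
  also have "... = (\<Sum>l\<in>?\<Lambda>. q l t1 * p l) / ?N"
   unfolding integral_divide p_def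
   by (subst Henstock_Kurzweil_Integration.integral_sum) (auto simp: finite_lattice_points intro!: integrable_continuous_interval continuous_intros cq)
  finally show ?thesis .
 qed
 have "B_functional L \<gamma> (spectral_measure n) = (LBINT t1:{0..L}. (\<Sum>l\<in>?\<Lambda>. q l t1 * p l) / ?N)"
  unfolding B_functional_def by (rule set_lebesgue_integral_cong) (auto simp: 1)
 also have "... = integral {0..L} (\<lambda>t1. (\<Sum>l\<in>?\<Lambda>. q l t1 * p l) / ?N)"
  by (intro set_lebesgue_integral_continuous continuous_intros cq) (use N in auto)
 also have "... = (\<Sum>l\<in>?\<Lambda>. p l * p l) / ?N"
  unfolding integral_divide
  by (subst Henstock_Kurzweil_Integration.integral_sum) (auto simp: finite_lattice_points p_def intro!: integrable_continuous_interval continuous_intros cq)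
 finally have B: "B_functional L \<gamma> (spectral_measure n) = (\<Sum>l\<in>?\<Lambda>. p l * p l) / ?N" .
 have cc: "curve_coeff n l = 2 * p l - L" for l
 proof -
  have "curve_coeff n l = integral {0..L} (\<lambda>t. 2 * q l t - 1)" by (simp add: curve_coeff_def q_def)
  also have "... = integral {0..L} (\<lambda>t. 2 * q l t) - integral {0..L} (\<lambda>t. 1)"
   using iq by (intro Henstock_Kurzweil_Integration.integral_diff) (auto intro: integrable_on_cmult_left)
  finally show ?thesis using L_pos by (simp add: p_def)
 qed
 have "(\<Sum>l\<in>?\<Lambda>. p l) = integral {0..L} (\<lambda>t. \<Sum>l\<in>?\<Lambda>. q l t)"
  unfolding p_def by (rule Henstock_Kurzweil_Integration.integral_sum[symmetric]) (auto simp: finite_lattice_points iq)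
 also have "... = integral {0..L} (\<lambda>t. ?N / 2)"
  by (intro Henstock_Kurzweil_Integration.integral_cong) (simp add: q_def sum_divide_distrib[symmetric] sum_freq_sq[OF n])
 finally have sp: "(\<Sum>l\<in>?\<Lambda>. p l) = ?N * L / 2" using L_pos by simp
 have "(\<Sum>l\<in>?\<Lambda>. (curve_coeff n l)^2) = (\<Sum>l\<in>?\<Lambda>. 4 * (p l * p l) - 4 * L * p l + L^2)"
  unfolding cc by (intro sum.cong refl) (simp add: power2_eq_square algebra_simps)
 also have "... = 4 * (\<Sum>l\<in>?\<Lambda>. p l * p l) - 4 * L * (\<Sum>l\<in>?\<Lambda>. p l) + ?N * L^2"
  by (simp add: sum.distrib sum_subtractf sum_distrib_left)
 also have "... = 4 * (\<Sum>l\<in>?\<Lambda>. p l * p l) - ?N * L^2" unfolding sp by (simp add: power2_eq_square)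
 finally show ?thesis unfolding B using N by (simp add: diff_divide_distrib)
qed

end

section \<open>Arithmetic random waves\<close>

context prob_space
begin

lemma normal_scaled_moments:
 assumes X: "distributed M lborel X (\<lambda>x. ennreal (normal_density 0 (sqrt (1 / 2)) x))"
  and [measurable]: "g \<in> borel_measurable borel" and g: "has_bochner_integral lborel (\<lambda>x. std_normal_density x * g x) (c::real)"
 shows "has_bochner_integral M (\<lambda>w. g (sqrt 2 * X w)) c"
proof -
 have "distributed M lborel (\<lambda>w. (X w - 0) / sqrt (1/2)) std_normal_density"
  using X by (subst (asm) normal_standard_normal_convert) simp_all
 moreover have "(\<lambda>w. (X w - 0) / sqrt (1/2)) = (\<lambda>w. sqrt 2 * X w)" by (simp add: real_sqrt_divide fun_eq_iff)
 ultimately have d: "distributed M lborel (\<lambda>w. sqrt 2 * X w) std_normal_density" by simp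
 show ?thesis
  unfolding has_bochner_integral_iff
  using g distributed_integral[OF d, of g] distributed_integrable[OF d, of g]
  by (auto simp: has_bochner_integral_iff)
qed

lemma normal_scaled_measurable:
 assumes X: "distributed M lborel X (\<lambda>x. ennreal (normal_density 0 (sqrt (1 / 2)) x))"
 shows "X \<in> borel_measurable M"
 using distributed_measurable[OF X] by simp

lemma normal_scaled_char:
 assumes X: "distributed M lborel X (\<lambda>x. ennreal (normal_density 0 (sqrt (1 / 2)) x))"
 shows "char (distr M borel X) t = of_real (exp (- t\<^sup>2 / 4))"
proof -
 have [measurable]: "X \<in> borel_measurable M" using normal_scaled_measurable[OF X] .
 have "distributed M lborel (\<lambda>w. (X w - 0) / sqrt (1/2)) std_normal_density"
  using X by (subst (asm) normal_standard_normal_convert) simp_all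
 moreover have "(\<lambda>w. (X w - 0) / sqrt (1/2)) = (\<lambda>w. sqrt 2 * X w)" by (simp add: real_sqrt_divide fun_eq_iff)
 ultimately have d: "distributed M lborel (\<lambda>w. sqrt 2 * X w) std_normal_density" by simp
 have "distr M borel (\<lambda>w. sqrt 2 * X w) = std_normal_distribution"
  using distributed_distr_eq_density[OF d] by (simp cong: distr_cong)
 hence "char (distr M borel (\<lambda>w. sqrt 2 * X w)) (t / sqrt 2) = of_real (exp (- (t / sqrt 2)\<^sup>2 / 2))"
  by (simp add: char_std_normal_distribution)
 moreover have "char (distr M borel (\<lambda>w. sqrt 2 * X w)) (t / sqrt 2) = char (distr M borel X) t"
  by (simp add: char_def integral_distr)
 ultimately show ?thesis by (simp add: power_divide)
qed

lemma sum_indep_centered_second_moment: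
 assumes "finite I" "indep_vars (\<lambda>_. borel) Y I"
  and "\<And>i. i \<in> I \<Longrightarrow> integrable M (\<lambda>w. (Y i w :: real)^2)" "\<And>i. i \<in> I \<Longrightarrow> expectation (Y i) = 0"
 shows "integrable M (\<lambda>w. (\<Sum>i\<in>I. Y i w)^2) \<and> expectation (\<lambda>w. (\<Sum>i\<in>I. Y i w)^2) = (\<Sum>i\<in>I. expectation (\<lambda>w. (Y i w)^2))"
 using assms
proof (induction I rule: finite_induct)
 case empty
 thus ?case by simp
next
 case (insert i I)
 have iv: "indep_vars (\<lambda>_. borel) Y I" using indep_vars_subset[OF insert.prems(1)] by auto
 have meas: "Y j \<in> borel_measurable M" if "j \<in> insert i I" for j
  using insert.prems(1) that unfolding indep_vars_def by auto
 define S where "S w = (\<Sum>j\<in>I. Y j w)" for w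
 have S[measurable]: "S \<in> borel_measurable M" unfolding S_def using meas by (intro borel_measurable_sum) auto
 have Yi[measurable]: "Y i \<in> borel_measurable M" using meas by auto
 have IH: "integrable M (\<lambda>w. (S w)^2)" "expectation (\<lambda>w. (S w)^2) = (\<Sum>j\<in>I. expectation (\<lambda>w. (Y j w)^2))"
  using insert.IH[OF iv] insert.prems(2,3) by (auto simp: S_def)
 have int: "integrable M (Y i)" "integrable M S"
  using square_integrable_imp_integrable[OF Yi] square_integrable_imp_integrable[OF S] insert.prems(2) IH(1) by auto
 have ind: "indep_var borel (Y i) borel S"
  using indep_vars_sum[OF insert.hyps insert.prems(1)] unfolding S_def .
 have prod: "integrable M (\<lambda>w. Y i w * S w)" "expectation (\<lambda>w. Y i w * S w) = 0"
  using indep_var_integrable[OF ind int] indep_var_lebesgue_integral[OF ind int] insert.prems(3)[of i] by auto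
 have eq: "(\<Sum>j\<in>insert i I. Y j w)^2 = (Y i w)^2 + (2 * (Y i w * S w) + (S w)^2)" for w
  using insert.hyps by (simp add: S_def power2_sum)
 have sq: "integrable M (\<lambda>w. (Y i w)^2)" using insert.prems(2) by auto
 show ?case
  unfolding eq using sq prod IH insert.hyps by auto
qed

end

text \<open>One point of each antipodal pair, chosen by lexicographic sign: a set without opposite
  points, on which \<open>gaussian_coefficients\<close> provides independence.\<close>

definition half_points :: "nat \<Rightarrow> (int ^ 2) set" where
 "half_points n = {l \<in> LP n. 0 < l $ 1 \<or> l $ 1 = 0 \<and> 0 < l $ 2}"

lemma half_points_subset: "half_points n \<subseteq> LP n" and finite_half_points: "finite (half_points n)"
 and half_points_uminus: "l \<in> half_points n \<Longrightarrow> - l \<notin> half_points n"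
 using finite_lattice_points by (auto simp: half_points_def)

lemma sum_half_points:
 fixes g :: "int ^ 2 \<Rightarrow> 'b :: comm_monoid_add"
 assumes "1 \<le> n"
 shows "(\<Sum>l\<in>LP n. g l) = (\<Sum>l\<in>half_points n. g l + g (- l))"
proof -
 have "LP n = half_points n \<union> uminus ` half_points n"
 proof (intro equalityI subsetI)
  fix l assume l: "l \<in> LP n"
  have "l \<noteq> 0" using l assms by (auto simp: lattice_points_iff)
  hence "l \<in> half_points n \<or> - l \<in> half_points n"
   using l by (auto simp: half_points_def uminus_lattice_points_iff vec_eq_iff forall_2)
  thus "l \<in> half_points n \<union> uminus ` half_points n" by (metis UnCI image_eqI minus_minus)
 next
  fix l assume "l \<in> half_points n \<union> uminus ` half_points n"
  thus "l \<in> LP n" using subsetD[OF half_points_subset] by (auto simp: uminus_lattice_points_iff)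
 qed
 moreover have "half_points n \<inter> uminus ` half_points n = {}" using half_points_uminus by auto
 moreover have "(\<Sum>l\<in>uminus ` half_points n. g l) = (\<Sum>l\<in>half_points n. g (- l))"
  by (subst sum.reindex) (auto)
 ultimately show ?thesis using finite_half_points by (simp add: sum.union_disjoint sum.distrib)
qed

text \<open>For \<open>hermitian\<close> coefficients the sum is already real on
  \<open>space M\<close>; taking the real part makes the variable real-valued by type.\<close>

definition wave_var :: "(int ^ 2 \<Rightarrow> 'w \<Rightarrow> complex) \<Rightarrow> nat \<Rightarrow> (int ^ 2 \<Rightarrow> complex) \<Rightarrow> 'w \<Rightarrow> real" where
 "wave_var a n b w = Re (\<Sum>l\<in>LP n. a l w * b l)"

definition hermitian :: "nat \<Rightarrow> (int ^ 2 \<Rightarrow> complex) \<Rightarrow> bool" where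
 "hermitian n b \<longleftrightarrow> (\<forall>l\<in>LP n. b (- l) = cnj (b l))"

definition wave_space :: "(int ^ 2 \<Rightarrow> 'w \<Rightarrow> complex) \<Rightarrow> nat \<Rightarrow> ('w \<Rightarrow> real) set" where
 "wave_space a n = wave_var a n ` {b. hermitian n b}"

locale gaussian_wave = prob_space M for M :: "'w measure" +
 fixes a :: "int ^ 2 \<Rightarrow> 'w \<Rightarrow> complex" and n :: nat
 assumes n: "1 \<le> n" and coeffs: "gaussian_coefficients M (LP n) a"
begin

lemmas coeffs_unfolded = coeffs[unfolded gaussian_coefficients_def]

lemma
 assumes l: "l \<in> LP n"
 shows coeff_Re: "distributed M lborel (\<lambda>w. Re (a l w)) (\<lambda>x. ennreal (normal_density 0 (sqrt (1 / 2)) x))"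
  and coeff_Im: "distributed M lborel (\<lambda>w. Im (a l w)) (\<lambda>x. ennreal (normal_density 0 (sqrt (1 / 2)) x))"
  and coeff_indep: "indep_var borel (\<lambda>w. Re (a l w)) borel (\<lambda>w. Im (a l w))"
  and coeff_uminus: "w \<in> space M \<Longrightarrow> a (- l) w = cnj (a l w)"
 using coeffs_unfolded[THEN conjunct1, rule_format, OF l] coeffs_unfolded[THEN conjunct2, THEN conjunct1, rule_format, OF l]
 by simp_all

lemma half_indep: "indep_vars (\<lambda>_. borel) a (half_points n)"
 using coeffs_unfolded[THEN conjunct2, THEN conjunct2, rule_format, OF half_points_subset half_points_uminus] .

lemma coeff_meas: "l \<in> LP n \<Longrightarrow> (\<lambda>w. Re (a l w)) \<in> borel_measurable M"
 "l \<in> LP n \<Longrightarrow> (\<lambda>w. Im (a l w)) \<in> borel_measurable M"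
 using normal_scaled_measurable coeff_Re coeff_Im by blast+

lemma coeff_moments:
 assumes l: "l \<in> LP n"
 shows "has_bochner_integral M (\<lambda>w. (sqrt 2 * Re (a l w)) ^ (2 * k)) (fact (2 * k) / (2 ^ k * fact k))"
  "has_bochner_integral M (\<lambda>w. (sqrt 2 * Im (a l w)) ^ (2 * k)) (fact (2 * k) / (2 ^ k * fact k))"
  "has_bochner_integral M (\<lambda>w. (sqrt 2 * Re (a l w)) ^ (2 * k + 1)) 0"
  "has_bochner_integral M (\<lambda>w. (sqrt 2 * Im (a l w)) ^ (2 * k + 1)) 0"
 using normal_scaled_moments[OF coeff_Re[OF l] _ std_normal_moment_even[of k]]
  normal_scaled_moments[OF coeff_Im[OF l] _ std_normal_moment_even[of k]]
  normal_scaled_moments[OF coeff_Re[OF l] _ std_normal_moment_odd[of k]]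
  normal_scaled_moments[OF coeff_Im[OF l] _ std_normal_moment_odd[of k]] by auto

lemma coeff_low_moments:
 assumes l: "l \<in> LP n"
 shows "integrable M (\<lambda>w. Re (a l w))" "expectation (\<lambda>w. Re (a l w)) = 0"
  "integrable M (\<lambda>w. Im (a l w))" "expectation (\<lambda>w. Im (a l w)) = 0"
  "integrable M (\<lambda>w. (Re (a l w))^2)" "expectation (\<lambda>w. (Re (a l w))^2) = 1 / 2"
  "integrable M (\<lambda>w. (Im (a l w))^2)" "expectation (\<lambda>w. (Im (a l w))^2) = 1 / 2"
  "expectation (\<lambda>w. Re (a l w) * Im (a l w)) = 0" "integrable M (\<lambda>w. Re (a l w) * Im (a l w))"
proof -
 show 1: "integrable M (\<lambda>w. Re (a l w))" "expectation (\<lambda>w. Re (a l w)) = 0"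
  "integrable M (\<lambda>w. Im (a l w))" "expectation (\<lambda>w. Im (a l w)) = 0"
  using coeff_moments(3,4)[OF l, of 0] by (auto simp: has_bochner_integral_iff)
 show "integrable M (\<lambda>w. (Re (a l w))^2)" "expectation (\<lambda>w. (Re (a l w))^2) = 1 / 2"
  "integrable M (\<lambda>w. (Im (a l w))^2)" "expectation (\<lambda>w. (Im (a l w))^2) = 1 / 2"
  using coeff_moments(1,2)[OF l, of 1] by (auto simp: has_bochner_integral_iff power_mult_distrib)
 show "expectation (\<lambda>w. Re (a l w) * Im (a l w)) = 0"
  using indep_var_lebesgue_integral[OF coeff_indep[OF l] 1(1,3)] 1 by simp
 show "integrable M (\<lambda>w. Re (a l w) * Im (a l w))"
  using indep_var_integrable[OF coeff_indep[OF l] 1(1,3)] .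
qed

lemma coeff_linear:
 assumes l: "l \<in> LP n"
 shows "integrable M (\<lambda>w. (Re (a l w * d))^2)" "expectation (\<lambda>w. Re (a l w * d)) = 0"
  "expectation (\<lambda>w. (Re (a l w * d))^2) = (cmod d)^2 / 2"
  "char (distr M borel (\<lambda>w. Re (a l w * d))) 1 = of_real (exp (- (cmod d)\<^sup>2 / 4))"
proof -
 note m = coeff_low_moments[OF l]
 have eq: "(Re (a l w * d))^2 = (Re d)^2 * (Re (a l w))^2 - (2 * Re d * Im d) * (Re (a l w) * Im (a l w)) + (Im d)^2 * (Im (a l w))^2" for w
  by (simp add: power2_eq_square algebra_simps)
 show "integrable M (\<lambda>w. (Re (a l w * d))^2)" unfolding eq using m by auto
 show "expectation (\<lambda>w. (Re (a l w * d))^2) = (cmod d)^2 / 2"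
  unfolding eq using m by (simp add: cmod_power2 add_divide_distrib del: eq_divide_eq_numeral1 divide_eq_eq_numeral1)
 show "expectation (\<lambda>w. Re (a l w * d)) = 0" using m by simp
 have meas[measurable]: "(\<lambda>w. Re (a l w)) \<in> borel_measurable M" "(\<lambda>w. Im (a l w)) \<in> borel_measurable M"
  using coeff_meas[OF l] by auto
 have iv: "indep_var borel (\<lambda>w. Re d * Re (a l w)) borel (\<lambda>w. - Im d * Im (a l w))"
  using indep_var_compose[OF coeff_indep[OF l], of "\<lambda>x. Re d * x" borel "\<lambda>x. - Im d * x" borel] by (simp add: o_def)
 have c: "char (distr M borel (\<lambda>w. c * X w)) 1 = of_real (exp (- c\<^sup>2 / 4))"
  if X: "distributed M lborel X (\<lambda>x. ennreal (normal_density 0 (sqrt (1 / 2)) x))" for X c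
 proof -
  have [measurable]: "X \<in> borel_measurable M" using normal_scaled_measurable[OF X] .
  have "char (distr M borel (\<lambda>w. c * X w)) 1 = char (distr M borel X) c" by (simp add: char_def integral_distr)
  thus ?thesis using normal_scaled_char[OF X] by simp
 qed
 have "char (distr M borel (\<lambda>w. Re (a l w * d))) 1 = char (distr M borel (\<lambda>w. Re d * Re (a l w) + - Im d * Im (a l w))) 1"
  by (simp add: mult.commute)
 also have "... = char (distr M borel (\<lambda>w. Re d * Re (a l w))) 1 * char (distr M borel (\<lambda>w. - Im d * Im (a l w))) 1"
  by (rule char_distr_add[OF iv])
 also have "... = of_real (exp (- (Re d)\<^sup>2 / 4)) * of_real (exp (- (- Im d)\<^sup>2 / 4))"
  unfolding c[OF coeff_Re[OF l]] c[OF coeff_Im[OF l]] ..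
 also have "... = of_real (exp (- (cmod d)\<^sup>2 / 4))"
  by (simp add: cmod_power2 of_real_mult[symmetric] exp_add[symmetric] del: of_real_mult)
 finally show "char (distr M borel (\<lambda>w. Re (a l w * d))) 1 = of_real (exp (- (cmod d)\<^sup>2 / 4))" .
qed

lemma wave_var_half:
 assumes "hermitian n b" "w \<in> space M"
 shows "wave_var a n b w = (\<Sum>l\<in>half_points n. Re (a l w * (2 * b l)))"
proof -
 have "Re (a l w * b l) + Re (a (- l) w * b (- l)) = Re (a l w * (2 * b l))" if "l \<in> half_points n" for l
  using subsetD[OF half_points_subset that] assms coeff_uminus[of l w] by (auto simp: hermitian_def)
 thus ?thesis unfolding wave_var_def Re_sum sum_half_points[OF n] by (intro sum.cong refl) auto
qed

lemma wave_var_measurable [measurable]: "wave_var a n b \<in> borel_measurable M"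
proof -
 have "wave_var a n b = (\<lambda>w. \<Sum>l\<in>LP n. Re (a l w) * Re (b l) - Im (a l w) * Im (b l))"
  by (simp add: wave_var_def fun_eq_iff)
 also have "... \<in> borel_measurable M" using coeff_meas by measurable
 finally show ?thesis .
qed

lemma hermitian_sum_sq:
 assumes "hermitian n b"
 shows "(\<Sum>l\<in>LP n. (cmod (b l))\<^sup>2) = (\<Sum>l\<in>half_points n. (cmod (2 * b l))\<^sup>2 / 2)"
 unfolding sum_half_points[OF n]
proof (intro sum.cong refl)
 fix l assume "l \<in> half_points n"
 hence "b (- l) = cnj (b l)" using assms subsetD[OF half_points_subset] by (auto simp: hermitian_def)
 thus "(cmod (b l))^2 + (cmod (b (- l)))^2 = (cmod (2 * b l))^2 / 2" by simp
qed

lemma wave_var_moments: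
 assumes b: "hermitian n b"
 shows "integrable M (\<lambda>w. (wave_var a n b w)^2)"
  "expectation (\<lambda>w. (wave_var a n b w)^2) = (\<Sum>l\<in>LP n. (cmod (b l))\<^sup>2)"
  "(CLINT w|M. iexp (wave_var a n b w)) = of_real (exp (- (\<Sum>l\<in>LP n. (cmod (b l))\<^sup>2) / 2))"
proof -
 let ?Y = "\<lambda>l w. Re (a l w * (2 * b l))"
 have l: "l \<in> LP n" if "l \<in> half_points n" for l using that by (rule subsetD[OF half_points_subset])
 have iv: "indep_vars (\<lambda>_. borel) ?Y (half_points n)"
  using indep_vars_compose2[OF half_indep, of "\<lambda>l z. Re (z * (2 * b l))" "\<lambda>_. borel"] by simp
 have s: "integrable M (\<lambda>w. (\<Sum>l\<in>half_points n. ?Y l w)^2)"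
   "expectation (\<lambda>w. (\<Sum>l\<in>half_points n. ?Y l w)^2) = (\<Sum>l\<in>half_points n. (cmod (2 * b l))\<^sup>2 / 2)"
  using sum_indep_centered_second_moment[OF finite_half_points iv coeff_linear(1,2)[OF l]]
  by (simp_all only: coeff_linear(3)[OF l] cong: sum.cong)
 show "integrable M (\<lambda>w. (wave_var a n b w)^2)"
  using s(1) by (rule Bochner_Integration.integrable_cong[THEN iffD1, rotated 2]) (auto simp: wave_var_half[OF b])
 have "expectation (\<lambda>w. (wave_var a n b w)^2) = expectation (\<lambda>w. (\<Sum>l\<in>half_points n. ?Y l w)^2)"
  by (rule Bochner_Integration.integral_cong) (auto simp: wave_var_half[OF b])
 thus "expectation (\<lambda>w. (wave_var a n b w)^2) = (\<Sum>l\<in>LP n. (cmod (b l))\<^sup>2)"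
  using s(2) hermitian_sum_sq[OF b] by simp
 have "(CLINT w|M. iexp (wave_var a n b w)) = (CLINT w|M. iexp (\<Sum>l\<in>half_points n. ?Y l w))"
  by (rule Bochner_Integration.integral_cong) (auto simp: wave_var_half[OF b])
 also have "... = char (distr M borel (\<lambda>w. \<Sum>l\<in>half_points n. ?Y l w)) 1"
 proof -
  have "(\<lambda>w. \<Sum>l\<in>half_points n. ?Y l w) \<in> borel_measurable M"
   using iv unfolding indep_vars_def by (intro borel_measurable_sum) auto
  thus ?thesis by (simp add: char_def integral_distr)
 qed
 also have "... = (\<Prod>l\<in>half_points n. char (distr M borel (?Y l)) 1)" by (rule char_distr_sum[OF iv])
 also have "... = (\<Prod>l\<in>half_points n. of_real (exp (- (cmod (2 * b l))\<^sup>2 / 4)))"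
  by (intro prod.cong refl coeff_linear(4) l)
 also have "... = of_real (exp (\<Sum>l\<in>half_points n. - (cmod (2 * b l))\<^sup>2 / 4))"
  by (simp add: exp_sum finite_half_points)
 also have "(\<Sum>l\<in>half_points n. - (cmod (2 * b l))\<^sup>2 / 4) = - (\<Sum>l\<in>LP n. (cmod (b l))\<^sup>2) / 2"
  unfolding hermitian_sum_sq[OF b] sum_negf[symmetric] sum_divide_distrib by (intro sum.cong refl) simp
 finally show "(CLINT w|M. iexp (wave_var a n b w)) = of_real (exp (- (\<Sum>l\<in>LP n. (cmod (b l))\<^sup>2) / 2))" .
qed

lemma wave_var_add: "(\<lambda>w. wave_var a n b w + wave_var a n c w) = wave_var a n (\<lambda>l. b l + c l)"
 by (simp add: fun_eq_iff wave_var_def distrib_left sum.distrib)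

lemma wave_var_scale: "(\<lambda>w. r * wave_var a n b w) = wave_var a n (\<lambda>l. of_real r * b l)"
proof
 fix w
 have "(\<Sum>l\<in>LP n. a l w * (of_real r * b l)) = of_real r * (\<Sum>l\<in>LP n. a l w * b l)"
  by (simp add: sum_distrib_left mult_ac)
 thus "r * wave_var a n b w = wave_var a n (\<lambda>l. of_real r * b l) w" by (simp add: wave_var_def)
qed

lemma hermitian_add: "hermitian n b \<Longrightarrow> hermitian n c \<Longrightarrow> hermitian n (\<lambda>l. b l + c l)"
 and hermitian_scale: "hermitian n b \<Longrightarrow> hermitian n (\<lambda>l. of_real r * b l)"
 by (auto simp: hermitian_def)

sublocale gauss_space M "wave_space a n"
proof
 fix X assume "X \<in> wave_space a n"
 then obtain b where b: "hermitian n b" "X = wave_var a n b" unfolding wave_space_def by auto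
 show "X \<in> borel_measurable M" unfolding b(2) by measurable
 show "integrable M (\<lambda>w. (X w)^2)" unfolding b(2) by (rule wave_var_moments(1)[OF b(1)])
 show "(CLINT w|M. iexp (X w)) = complex_of_real (exp (- expectation (\<lambda>w. (X w)^2) / 2))"
  unfolding b(2) wave_var_moments(2,3)[OF b(1)] ..
 show "(\<lambda>w. c * X w) \<in> wave_space a n" for c
  unfolding b(2) wave_var_scale wave_space_def using hermitian_scale[OF b(1)] by auto
 fix Y assume "Y \<in> wave_space a n"
 then obtain c where c: "hermitian n c" "Y = wave_var a n c" unfolding wave_space_def by auto
 show "(\<lambda>w. X w + Y w) \<in> wave_space a n"
  unfolding b(2) c(2) wave_var_add wave_space_def using hermitian_add[OF b(1) c(1)] by auto
qed

lemma wave_var_mem: "hermitian n b \<Longrightarrow> wave_var a n b \<in> wave_space a n"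
 by (simp add: wave_space_def)

lemma ip_wave_var_self: "hermitian n b \<Longrightarrow> ip (wave_var a n b) (wave_var a n b) = (\<Sum>l\<in>LP n. (cmod (b l))\<^sup>2)"
 unfolding ip_self by (rule wave_var_moments(2))

text \<open>Polarisation of \<open>ip_wave_var_self\<close>.\<close>

lemma ip_wave_var:
 assumes b: "hermitian n b" and c: "hermitian n c"
 shows "ip (wave_var a n b) (wave_var a n c) = (\<Sum>l\<in>LP n. Re (b l * cnj (c l)))"
proof -
 let ?X = "wave_var a n b" and ?Y = "wave_var a n c"
 have XY: "?X \<in> wave_space a n" "?Y \<in> wave_space a n" using b c by (auto simp: wave_var_mem)
 have "ip ?X ?X + 2 * ip ?X ?Y + ip ?Y ?Y = ip (\<lambda>w. ?X w + ?Y w) (\<lambda>w. ?X w + ?Y w)"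
 proof -
  have "ip (\<lambda>w. ?X w + ?Y w) (\<lambda>w. ?X w + ?Y w) = (ip ?X ?X + ip ?X ?Y) + (ip ?Y ?X + ip ?Y ?Y)"
   by (simp only: ip_add_left[OF XY H_add[OF XY]] ip_add_right[OF XY XY(1)] ip_add_right[OF XY XY(2)])
  moreover have "ip ?Y ?X = ip ?X ?Y" by (rule ip_commute)
  ultimately show ?thesis by simp
 qed
 also have "... = (\<Sum>l\<in>LP n. (cmod (b l + c l))\<^sup>2)"
  unfolding wave_var_add by (rule ip_wave_var_self[OF hermitian_add[OF b c]])
 also have "... = (\<Sum>l\<in>LP n. (cmod (b l))\<^sup>2 + 2 * Re (b l * cnj (c l)) + (cmod (c l))^2)"
  unfolding cmod_power2 by (intro sum.cong refl) (simp add: power2_eq_square algebra_simps)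
 also have "... = ip ?X ?X + 2 * (\<Sum>l\<in>LP n. Re (b l * cnj (c l))) + ip ?Y ?Y"
  by (simp add: sum.distrib sum_distrib_left ip_wave_var_self b c)
 finally show ?thesis by simp
qed

lemma nrm_wave_var_le:
 assumes b: "hermitian n b" and ne: "LP n \<noteq> {}"
  and B: "\<And>l. l \<in> LP n \<Longrightarrow> cmod (b l) \<le> B / sqrt (real (card (LP n)))"
 shows "nrm (wave_var a n b) \<le> B"
proof -
 let ?N = "real (card (LP n))"
 have N: "0 < ?N" using ne finite_lattice_points by (simp add: card_gt_0_iff)
 obtain l0 where "l0 \<in> LP n" using ne by auto
 from order_trans[OF norm_ge_zero B[OF this]] N have B0: "0 \<le> B" by (simp add: zero_le_divide_iff)
 have "(\<Sum>l\<in>LP n. (cmod (b l))\<^sup>2) \<le> (\<Sum>l\<in>LP n. (B / sqrt ?N)\<^sup>2)"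
  by (intro sum_mono power_mono B) auto
 also have "... = B^2" using N by (simp add: power_divide)
 finally show ?thesis using B0 unfolding nrm_def ip_wave_var_self[OF b] by (simp add: real_le_lsqrt)
qed

end

section \<open>The wave along the curve as a Gaussian process\<close>

locale wave_process = plane_curve L G D kp\<^sub>0 kp + gaussian_wave M a n
 for L :: real and G :: "real \<Rightarrow> real ^ 2" and D kp\<^sub>0 kp
  and M :: "'w measure" and a :: "int ^ 2 \<Rightarrow> 'w \<Rightarrow> complex" and n :: nat +
 assumes ne: "LP n \<noteq> {}"
begin

text \<open>The standard deviation of the derivative of the wave along the curve: by isotropy the
  squares of \<open>2 * pi * (lattice_vec l \<bullet> D 0 t)\<close> average to
  \<open>2 * pi^2 * n\<close>.\<close>

definition "sg = pi * sqrt (2 * real n)"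
text \<open>The first entry is twice the constant in \<open>phase_taylor\<close>, as the remainder
  in \<open>gauss_process\<close> is written with \<open>C1 / 2\<close>. The second gives
  \<open>1 \<le> C1 * L\<close>, so that the curve is long enough to be cut into cells of the
  prescribed size.\<close>

definition "C1 = max (2 * (2 + kp)) (1 / L)"
abbreviation "N \<equiv> real (card (LP n))"

definition phase :: "int ^ 2 \<Rightarrow> real \<Rightarrow> complex" where
 "phase l t = exp (\<i> * of_real (2 * pi * (lattice_vec l \<bullet> G t)))"

definition dphase :: "int ^ 2 \<Rightarrow> real \<Rightarrow> complex" where
 "dphase l t = \<i> * of_real (freq n l t) * phase l t"

definition "f t = wave_var a n (\<lambda>l. phase l t / of_real (sqrt N))"
definition "y t = wave_var a n (\<lambda>l. dphase l t / of_real (sqrt N))"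

lemma N_pos: "0 < N" using ne finite_lattice_points by (simp add: card_gt_0_iff)

lemma sg_bounds: "0 < sg" "sqrt 2 \<le> sg"
proof -
 have "sqrt 2 * 1 \<le> sqrt (2 * real n) * pi" using n pi_gt3 by (intro mult_mono) auto
 thus "sqrt 2 \<le> sg" by (simp add: sg_def mult.commute)
 thus "0 < sg" by (smt (verit) real_sqrt_gt_zero)
qed

lemma C1_bounds: "1 \<le> C1" "2 * (2 + kp) \<le> C1" "1 / L \<le> C1"
 using kp_pos by (auto simp: C1_def)

lemma norm_phase: "cmod (phase l t) = 1"
 unfolding phase_def by (rule norm_exp_i_times)

lemma phase_uminus: "phase (- l) t = cnj (phase l t)"
 by (simp add: phase_def lattice_vec_uminus exp_cnj)

lemma phase_add: "phase (l + m) t = phase l t * phase m t"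
 by (simp add: phase_def lattice_vec_add exp_add[symmetric] algebra_simps)

lemma norm_dphase: "cmod (dphase l t) = \<bar>freq n l t\<bar>"
 by (simp add: dphase_def norm_mult norm_phase)

lemma dphase_uminus: "dphase (- l) t = cnj (dphase l t)"
 by (simp add: dphase_def phase_uminus freq_uminus)

lemma hermitian_phase: "hermitian n (\<lambda>l. phase l t / of_real (sqrt N))"
 and hermitian_dphase: "hermitian n (\<lambda>l. dphase l t / of_real (sqrt N))"
 by (auto simp: hermitian_def phase_uminus dphase_uminus)

definition "dfreq l t = sqrt 2 * (lattice_vec l \<bullet> D 1 t) / sqrt (real n)"

lemma lattice_norm: "l \<in> LP n \<Longrightarrow> norm (lattice_vec l) = sqrt (real n)"
 by (simp add: lattice_points_def real_sqrt_unique)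

lemma freq_bound: "l \<in> LP n \<Longrightarrow> t \<in> {0..L} \<Longrightarrow> \<bar>freq n l t\<bar> \<le> sqrt 2"
proof -
 assume l: "l \<in> LP n" and t: "t \<in> {0..L}"
 have "\<bar>lattice_vec l \<bullet> D 0 t\<bar> \<le> sqrt (real n) * 1"
  using Cauchy_Schwarz_ineq2[of "lattice_vec l" "D 0 t"] lattice_norm[OF l] unit_speed[OF t] by simp
 thus ?thesis using n by (simp add: freq_def abs_mult divide_le_eq)
qed

lemma dfreq_bound: "l \<in> LP n \<Longrightarrow> t \<in> {0..L} \<Longrightarrow> \<bar>dfreq l t\<bar> \<le> sqrt 2 * kp"
proof -
 assume l: "l \<in> LP n" and t: "t \<in> {0..L}"
 have "\<bar>lattice_vec l \<bullet> D 1 t\<bar> \<le> sqrt (real n) * norm (D 1 t)"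
  using Cauchy_Schwarz_ineq2[of "lattice_vec l" "D 1 t"] lattice_norm[OF l] by simp
 also have "... \<le> sqrt (real n) * kp" using curv_high(1)[OF t] by (intro mult_left_mono) auto
 finally have "\<bar>lattice_vec l \<bullet> D 1 t\<bar> \<le> sqrt (real n) * kp" .
 thus ?thesis using n by (simp add: dfreq_def abs_mult divide_le_eq mult.commute)
qed

lemma freq_deriv: "t \<in> {0..L} \<Longrightarrow> (freq n l has_real_derivative dfreq l t) (at t within {0..L})"
proof -
 assume t: "t \<in> {0..L}"
 have "((\<lambda>t. (sqrt 2 / sqrt (real n)) *\<^sub>R (lattice_vec l \<bullet> D 0 t)) has_vector_derivative (sqrt 2 / sqrt (real n)) *\<^sub>R (lattice_vec l \<bullet> D 1 t)) (at t within {0..L})"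
  using D_deriv[OF t, of 0]
  by (intro bounded_linear.has_vector_derivative[OF bounded_linear_scaleR_right] bounded_linear.has_vector_derivative[OF bounded_linear_inner_right]) simp
 thus ?thesis unfolding has_real_derivative_iff_has_vector_derivative freq_def dfreq_def by simp
qed

lemma phase_deriv: "t \<in> {0..L} \<Longrightarrow> (phase l has_vector_derivative of_real sg * dphase l t) (at t within {0..L})"
proof -
 assume t: "t \<in> {0..L}"
 have "((\<lambda>t. (2 * pi) *\<^sub>R (lattice_vec l \<bullet> G t)) has_vector_derivative (2 * pi) *\<^sub>R (lattice_vec l \<bullet> D 0 t)) (at t within {0..L})"
  using G_deriv[OF t]
  by (intro bounded_linear.has_vector_derivative[OF bounded_linear_scaleR_right] bounded_linear.has_vector_derivative[OF bounded_linear_inner_right])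
 moreover have "(2 * pi) *\<^sub>R (lattice_vec l \<bullet> D 0 t) = sg * freq n l t"
 proof -
  have "sqrt (2 * real n) * sqrt 2 / sqrt (real n) = 2" using n by (simp add: real_sqrt_mult)
  hence "pi * (lattice_vec l \<bullet> D 0 t) * (sqrt (2 * real n) * sqrt 2 / sqrt (real n)) = pi * (lattice_vec l \<bullet> D 0 t) * 2" by simp
  thus ?thesis by (simp add: sg_def freq_def mult_ac)
 qed
 ultimately have "((\<lambda>t. \<i> * of_real (2 * pi * (lattice_vec l \<bullet> G t))) has_vector_derivative \<i> * of_real (sg * freq n l t)) (at t within {0..L})"
  by (intro bounded_linear.has_vector_derivative[OF bounded_linear_mult_right] has_vector_derivative_of_real)
   (simp only: has_real_derivative_iff_has_vector_derivative real_scaleR_def)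
 from field_vector_diff_chain_within[OF this, where g=exp and g'="phase l t"]
 show ?thesis unfolding o_def phase_def[symmetric]
  by (rule has_vector_derivative_eq_rhs) (auto intro!: DERIV_subset[OF DERIV_exp] simp: phase_def dphase_def)
qed

lemma continuous_phase: "continuous_on {0..L} (phase l)"
 unfolding continuous_on_eq_continuous_within using phase_deriv has_vector_derivative_continuous by blast

definition "ddphase l t = \<i> * (of_real (dfreq l t) + \<i> * of_real (sg * (freq n l t)^2)) * phase l t"

lemma dphase_deriv: "t \<in> {0..L} \<Longrightarrow> (dphase l has_vector_derivative ddphase l t) (at t within {0..L})"
proof -
 assume t: "t \<in> {0..L}"
 have 1: "((\<lambda>t. of_real (freq n l t) :: complex) has_vector_derivative of_real (dfreq l t)) (at t within {0..L})"
  using freq_deriv[OF t] by (intro has_vector_derivative_of_real)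
 have "((\<lambda>t. \<i> * (of_real (freq n l t) * phase l t)) has_vector_derivative
   \<i> * (of_real (freq n l t) * (of_real sg * dphase l t) + of_real (dfreq l t) * phase l t)) (at t within {0..L})"
  by (intro bounded_linear.has_vector_derivative[OF bounded_linear_mult_right] has_vector_derivative_mult 1 phase_deriv t)
 moreover have "(\<lambda>t. \<i> * (of_real (freq n l t) * phase l t)) = dphase l" by (simp add: dphase_def fun_eq_iff)
 moreover have "\<i> * (of_real (freq n l t) * (of_real sg * dphase l t) + of_real (dfreq l t) * phase l t) = ddphase l t"
  by (simp add: dphase_def ddphase_def power2_eq_square algebra_simps)
 ultimately show ?thesis by simp
qed

lemma norm_ddphase: "l \<in> LP n \<Longrightarrow> t \<in> {0..L} \<Longrightarrow> cmod (ddphase l t) \<le> sg * (2 + kp)"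
proof -
 assume l: "l \<in> LP n" and t: "t \<in> {0..L}"
 have "cmod (ddphase l t) = cmod (of_real (dfreq l t) + \<i> * of_real (sg * (freq n l t)^2))"
  by (simp add: ddphase_def norm_mult norm_phase)
 also have "... \<le> \<bar>dfreq l t\<bar> + \<bar>sg * (freq n l t)^2\<bar>"
  by (rule order_trans[OF norm_triangle_ineq]) (simp add: norm_mult norm_power)
 also have "... \<le> sg * kp + sg * 2"
 proof (rule add_mono)
  have "sqrt 2 * kp \<le> sg * kp" using sg_bounds kp_pos by (intro mult_right_mono) auto
  thus "\<bar>dfreq l t\<bar> \<le> sg * kp" using dfreq_bound[OF l t] by linarith
  have "\<bar>freq n l t\<bar>\<^sup>2 \<le> (sqrt 2)^2" by (rule power_mono[OF freq_bound[OF l t]]) simp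
  thus "\<bar>sg * (freq n l t)^2\<bar> \<le> sg * 2" using sg_bounds by simp
 qed
 finally show ?thesis by (simp add: distrib_left)
qed

lemma dphase_lipschitz:
 assumes l: "l \<in> LP n" and "s \<in> {0..L}" "t \<in> {0..L}"
 shows "cmod (dphase l s - dphase l t) \<le> sg * (2 + kp) * \<bar>s - t\<bar>"
proof -
 have "cmod (dphase l s - dphase l t) \<le> sg * (2 + kp) * norm (s - t)"
 proof (rule differentiable_bound[where S="{0..L}" and f'="\<lambda>x h. h *\<^sub>R ddphase l x"])
  fix x assume x: "x \<in> {0..L}"
  show "(dphase l has_derivative (\<lambda>h. h *\<^sub>R ddphase l x)) (at x within {0..L})"
   using dphase_deriv[OF x] by (simp add: has_vector_derivative_def)
  show "onorm (\<lambda>h. h *\<^sub>R ddphase l x) \<le> sg * (2 + kp)"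
  proof (rule onorm_le)
   fix h :: real
   have "\<bar>h\<bar> * cmod (ddphase l x) \<le> \<bar>h\<bar> * (sg * (2 + kp))" by (intro mult_left_mono norm_ddphase l x) auto
   thus "norm (h *\<^sub>R ddphase l x) \<le> sg * (2 + kp) * norm h" by (simp add: mult.commute)
  qed
 qed (use assms in auto)
 thus ?thesis by simp
qed

lemma phase_taylor:
 assumes l: "l \<in> LP n" and st: "s \<in> {0..L}" "t \<in> {0..L}"
 shows "cmod (phase l s - phase l t - of_real ((s - t) * sg) * dphase l t) \<le> (2 + kp) * (sg * (s - t))^2"
proof -
 have sub: "closed_segment t s \<subseteq> {0..L}" using st by (auto simp: closed_segment_eq_real_ivl)
 have "cmod (phase l s - phase l t - (s - t) *\<^sub>R (of_real sg * dphase l t)) \<le> norm (s - t) * (sg * (sg * (2 + kp) * \<bar>s - t\<bar>))"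
 proof (rule vector_differentiable_bound_linearization[where S="closed_segment t s" and ?x0.0=t and f'="\<lambda>t. of_real sg * dphase l t"])
  fix x assume x: "x \<in> closed_segment t s"
  hence xL: "x \<in> {0..L}" using sub by auto
  show "(phase l has_vector_derivative of_real sg * dphase l x) (at x within closed_segment t s)"
   by (rule has_vector_derivative_within_subset[OF phase_deriv[OF xL] sub])
  have "\<bar>x - t\<bar> \<le> \<bar>s - t\<bar>" using x by (auto simp: closed_segment_eq_real_ivl split: if_splits)
  hence "sg * (2 + kp) * \<bar>x - t\<bar> \<le> sg * (2 + kp) * \<bar>s - t\<bar>" using sg_bounds kp_pos by (intro mult_left_mono) auto
  hence "cmod (dphase l x - dphase l t) \<le> sg * (2 + kp) * \<bar>s - t\<bar>" using dphase_lipschitz[OF l xL st(2)] by linarith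
  hence "sg * cmod (dphase l x - dphase l t) \<le> sg * (sg * (2 + kp) * \<bar>s - t\<bar>)" using sg_bounds by (intro mult_left_mono) auto
  thus "norm (of_real sg * dphase l x - of_real sg * dphase l t) \<le> sg * (sg * (2 + kp) * \<bar>s - t\<bar>)"
   using sg_bounds by (simp add: right_diff_distrib[symmetric] norm_mult)
 qed auto
 also have "... = (2 + kp) * (sg * (s - t))^2"
  by (simp add: power2_eq_square)
 finally show ?thesis by (simp add: scaleR_conv_of_real mult.assoc)
qed

lemma wave_var_diff: "wave_var a n b w - wave_var a n c w = wave_var a n (\<lambda>l. b l - c l) w"
 by (simp add: wave_var_def right_diff_distrib sum_subtractf)

lemma sum_phase_prod: "(\<Sum>l\<in>LP n. Re (u l / of_real (sqrt N) * cnj (v l / of_real (sqrt N))))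
  = (\<Sum>l\<in>LP n. Re (u l * cnj (v l))) / N"
proof -
 have "u l / of_real (sqrt N) * cnj (v l / of_real (sqrt N)) = (u l * cnj (v l)) / of_real N" for l
 proof -
  have "complex_of_real (sqrt N) * complex_of_real (sqrt N) = of_real N"
   unfolding of_real_mult[symmetric] by simp
  thus ?thesis by simp
 qed
 thus ?thesis by (simp add: sum_divide_distrib)
qed

lemma f_mem: "f t \<in> wave_space a n" and y_mem: "y t \<in> wave_space a n"
 unfolding f_def y_def by (intro wave_var_mem hermitian_phase hermitian_dphase)+

lemma ip_ff: "ip (f t) (f s) = (\<Sum>l\<in>LP n. Re (phase l t * cnj (phase l s))) / N"
 and ip_fy: "ip (f t) (y s) = (\<Sum>l\<in>LP n. Re (phase l t * cnj (dphase l s))) / N"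
 and ip_yf: "ip (y t) (f s) = (\<Sum>l\<in>LP n. Re (dphase l t * cnj (phase l s))) / N"
 and ip_yy: "ip (y t) (y s) = (\<Sum>l\<in>LP n. Re (dphase l t * cnj (dphase l s))) / N"
 unfolding f_def y_def sum_phase_prod[symmetric] by (intro ip_wave_var hermitian_phase hermitian_dphase)+

sublocale gauss_process M "wave_space a n" f y L sg C1
proof
 show "0 < L" by (rule L_pos)
 show "0 < sg" by (rule sg_bounds)
 show "1 \<le> C1" by (rule C1_bounds)
 fix t assume t: "t \<in> {0..L}"
 show "f t \<in> wave_space a n" "y t \<in> wave_space a n" by (rule f_mem, rule y_mem)
 show "ip (f t) (f t) = 1"
  unfolding ip_ff complex_norm_square[symmetric] norm_phase using N_pos by simp
 show "ip (y t) (y t) = 1"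
  unfolding ip_yy complex_norm_square[symmetric] norm_dphase using N_pos sum_freq_sq[OF n t] by simp
 have "Re (phase l t * cnj (dphase l t)) = 0" for l by (simp add: dphase_def)
 thus "ip (f t) (y t) = 0" unfolding ip_fy by simp
 show "((\<lambda>t. f t w) has_real_derivative sg * y t w) (at t within {0..L})" for w
 proof -
  have "((\<lambda>t. Re (\<Sum>l\<in>LP n. (a l w / of_real (sqrt N)) * phase l t)) has_vector_derivative
    Re (\<Sum>l\<in>LP n. (a l w / of_real (sqrt N)) * (of_real sg * dphase l t))) (at t within {0..L})"
   by (intro bounded_linear.has_vector_derivative[OF bounded_linear_Re] has_vector_derivative_sum
     bounded_linear.has_vector_derivative[OF bounded_linear_mult_right] phase_deriv t)
  moreover have "Re (\<Sum>l\<in>LP n. (a l w / of_real (sqrt N)) * (of_real sg * dphase l t)) = sg * y t w"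
   unfolding y_def wave_var_def Re_sum sum_distrib_left by (intro sum.cong refl) (simp add: algebra_simps)
  moreover have "(\<lambda>t. Re (\<Sum>l\<in>LP n. (a l w / of_real (sqrt N)) * phase l t)) = (\<lambda>t. f t w)"
   by (simp add: f_def wave_var_def)
  ultimately show ?thesis unfolding has_real_derivative_iff_has_vector_derivative by simp
 qed
 fix s assume s: "s \<in> {0..L}"
 show "nrm (\<lambda>w. f s w - f t w - (s - t) * sg * y t w) \<le> C1 / 2 * (sg * (s - t))^2"
 proof -
  let ?b = "\<lambda>l. (phase l s - phase l t - of_real ((s - t) * sg) * dphase l t) / of_real (sqrt N)"
  have "(\<lambda>w. f s w - f t w - (s - t) * sg * y t w) = wave_var a n ?b"
  proof
   fix w
   have "(s - t) * sg * y t w = wave_var a n (\<lambda>l. of_real ((s - t) * sg) * (dphase l t / of_real (sqrt N))) w"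
    unfolding y_def using fun_cong[OF wave_var_scale[of "(s - t) * sg"]] .
   thus "f s w - f t w - (s - t) * sg * y t w = wave_var a n ?b w"
    unfolding f_def by (simp add: wave_var_diff diff_divide_distrib)
  qed
  moreover have "nrm (wave_var a n ?b) \<le> (2 + kp) * (sg * (s - t))^2"
  proof (rule nrm_wave_var_le[OF _ ne])
   show "hermitian n ?b" by (simp add: hermitian_def phase_uminus dphase_uminus)
   fix l assume l: "l \<in> LP n"
   show "cmod (?b l) \<le> (2 + kp) * (sg * (s - t))^2 / sqrt N"
    using phase_taylor[OF l s t] by (simp only: norm_divide norm_of_real real_sqrt_abs2 abs_of_nonneg real_sqrt_ge_zero of_nat_0_le_iff) (intro divide_right_mono, auto)
  qed
  moreover have "(2 + kp) * (sg * (s - t))^2 \<le> C1 / 2 * (sg * (s - t))^2"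
   using C1_bounds(2) by (intro mult_right_mono) auto
  ultimately show ?thesis by simp
 qed
 show "nrm (\<lambda>w. y s w - y t w) \<le> C1 * sg * \<bar>s - t\<bar>"
 proof -
  let ?b = "\<lambda>l. (dphase l s - dphase l t) / of_real (sqrt N)"
  have "(\<lambda>w. y s w - y t w) = wave_var a n ?b" unfolding y_def wave_var_diff diff_divide_distrib ..
  moreover have "nrm (wave_var a n ?b) \<le> sg * (2 + kp) * \<bar>s - t\<bar>"
  proof (rule nrm_wave_var_le[OF _ ne])
   show "hermitian n ?b" by (simp add: hermitian_def dphase_uminus)
   fix l assume l: "l \<in> LP n"
   show "cmod (?b l) \<le> sg * (2 + kp) * \<bar>s - t\<bar> / sqrt N"
    using dphase_lipschitz[OF l s t] by (simp only: norm_divide norm_of_real real_sqrt_abs2 abs_of_nonneg real_sqrt_ge_zero of_nat_0_le_iff) (intro divide_right_mono, auto)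
  qed
  moreover have "sg * (2 + kp) * \<bar>s - t\<bar> \<le> C1 * sg * \<bar>s - t\<bar>"
  proof (rule mult_right_mono)
   have "sg * (2 + kp) \<le> sg * C1" using C1_bounds(2) sg_bounds kp_pos by (intro mult_left_mono) auto
   thus "sg * (2 + kp) \<le> C1 * sg" by (simp add: mult.commute)
  qed simp
  ultimately show ?thesis by simp
 qed
next
 fix w assume "w \<in> space M"
 show "\<exists>B. \<forall>t\<in>{0..L}. \<forall>s\<in>{0..L}. \<bar>y s w - y t w\<bar> \<le> B * \<bar>s - t\<bar>"
 proof (intro exI ballI)
  fix t s assume t: "t \<in> {0..L}" and s: "s \<in> {0..L}"
  have "\<bar>y s w - y t w\<bar> \<le> cmod (\<Sum>l\<in>LP n. a l w * ((dphase l s - dphase l t) / of_real (sqrt N)))"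
   unfolding y_def wave_var_diff diff_divide_distrib[symmetric] unfolding wave_var_def by (rule abs_Re_le_cmod)
  also have "... \<le> (\<Sum>l\<in>LP n. cmod (a l w) * ((sg * (2 + kp) * \<bar>s - t\<bar>) / sqrt N))"
  proof (rule sum_norm_le)
   fix l assume l: "l \<in> LP n"
   show "cmod (a l w * ((dphase l s - dphase l t) / of_real (sqrt N))) \<le> cmod (a l w) * ((sg * (2 + kp) * \<bar>s - t\<bar>) / sqrt N)"
    unfolding norm_mult norm_divide norm_of_real using dphase_lipschitz[OF l s t] N_pos by (intro mult_left_mono divide_mono) auto
  qed
  also have "... = (\<Sum>l\<in>LP n. cmod (a l w) * ((sg * (2 + kp)) / sqrt N)) * \<bar>s - t\<bar>"
   by (simp add: sum_distrib_right mult.assoc)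
  finally show "\<bar>y s w - y t w\<bar> \<le> (\<Sum>l\<in>LP n. cmod (a l w) * ((sg * (2 + kp)) / sqrt N)) * \<bar>s - t\<bar>" .
 qed
qed

end

section \<open>The covariance kernels as sums over pairs and quadruples of lattice points\<close>

lemma sum_fourth_power:
 fixes x :: "'i \<Rightarrow> complex"
 shows "(\<Sum>i\<in>A. x i) ^ 4 = (\<Sum>(i, j, k, l)\<in>A \<times> A \<times> A \<times> A. x i * x j * x k * x l)"
proof -
 have "(\<Sum>i\<in>A. x i) ^ 4 = (\<Sum>i\<in>A. x i) * ((\<Sum>i\<in>A. x i) * ((\<Sum>i\<in>A. x i) * (\<Sum>i\<in>A. x i)))"
  by (simp add: eval_nat_numeral)
 also have "... = (\<Sum>i\<in>A. \<Sum>j\<in>A. \<Sum>k\<in>A. \<Sum>l\<in>A. x i * x j * x k * x l)"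
  unfolding sum_distrib_right[of x A] unfolding sum_distrib_left mult.assoc ..
 finally show ?thesis by (simp add: sum.cartesian_product)
qed

lemma sum_square_pairs:
 fixes x :: "'i \<Rightarrow> complex"
 shows "(\<Sum>i\<in>A. x i)^2 = (\<Sum>(i, j)\<in>A \<times> A. x i * x j)"
 by (simp add: power2_eq_square sum_product sum.cartesian_product)

context wave_process
begin

lemma hermitian_sum_real:
 assumes "\<And>l. l \<in> LP n \<Longrightarrow> u (- l) = cnj (u l)" "\<And>l. l \<in> LP n \<Longrightarrow> v (- l) = cnj (v l)"
 shows "complex_of_real (\<Sum>l\<in>LP n. Re (u l * cnj (v l))) = (\<Sum>l\<in>LP n. u l * cnj (v l))"
proof -
 let ?z = "\<Sum>l\<in>LP n. u l * cnj (v l)"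
 have "cnj ?z = (\<Sum>l\<in>LP n. u (- l) * cnj (v (- l)))"
  unfolding cnj_sum using assms by (intro sum.cong) auto
 also have "... = ?z" by (rule sum.reindex_bij_witness[of _ uminus uminus]) (auto simp: uminus_lattice_points_iff)
 finally have "?z \<in> \<real>" by (simp add: Reals_cnj_iff)
 thus ?thesis unfolding Re_sum[symmetric] by (simp add: complex_is_Real_iff complex_eq_iff)
qed

lemma ip_complex:
 "complex_of_real (ip (f t) (f s)) = (\<Sum>l\<in>LP n. phase l t * cnj (phase l s)) / of_real N"
 "complex_of_real (ip (f t) (y s)) = (\<Sum>l\<in>LP n. phase l t * cnj (dphase l s)) / of_real N"
 "complex_of_real (ip (y t) (f s)) = (\<Sum>l\<in>LP n. dphase l t * cnj (phase l s)) / of_real N"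
 "complex_of_real (ip (y t) (y s)) = (\<Sum>l\<in>LP n. dphase l t * cnj (dphase l s)) / of_real N"
 unfolding ip_ff ip_fy ip_yf ip_yy of_real_divide
 by (simp_all only: hermitian_sum_real phase_uminus dphase_uminus)

text \<open>The signs in \<open>quad_cov\<close> are such that, after expansion over pairs of
  lattice points, each pair contributes one product \<open>W2 p t * cnj (W2 p s)\<close>. The double
  integral of the kernel thus becomes a sum of squared moduli of single integrals.\<close>

definition W2 :: "(int ^ 2) \<times> (int ^ 2) \<Rightarrow> real \<Rightarrow> complex" where
 "W2 = (\<lambda>(l, m) t. (phase l t * phase m t - dphase l t * dphase m t) / of_real N)"

text \<open>The same factorisation for \<open>quart_cov\<close>, with a plus sign since all four of
  its terms enter positively and a derivative phase to the fourth order brings no sign.\<close>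

definition W4 :: "(int ^ 2) \<times> (int ^ 2) \<times> (int ^ 2) \<times> (int ^ 2) \<Rightarrow> real \<Rightarrow> complex" where
 "W4 = (\<lambda>(k, l, m, p) t. (phase k t * phase l t * phase m t * phase p t + dphase k t * dphase l t * dphase m t * dphase p t) / of_real (N^2))"

lemma continuous_dphase: "continuous_on {0..L} (dphase l)"
 unfolding continuous_on_eq_continuous_within using dphase_deriv has_vector_derivative_continuous by blast

lemma continuous_W: "continuous_on {0..L} (W2 p)" "continuous_on {0..L} (W4 q)"
 using N_pos by (auto simp: W2_def W4_def case_prod_unfold intro!: continuous_intros continuous_phase continuous_dphase)

lemma quad_cov_eq:
 "complex_of_real (quad_cov t s) = (\<Sum>p\<in>LP n \<times> LP n. W2 p t * cnj (W2 p s))"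
proof -
 let ?A = "LP n \<times> LP n"
 have "complex_of_real (quad_cov t s) = (\<Sum>(l, m)\<in>?A. (phase l t * cnj (phase l s)) * (phase m t * cnj (phase m s))
   - (dphase l t * cnj (phase l s)) * (dphase m t * cnj (phase m s)) - (phase l t * cnj (dphase l s)) * (phase m t * cnj (dphase m s))
   + (dphase l t * cnj (dphase l s)) * (dphase m t * cnj (dphase m s))) / (of_real N)^2"
  unfolding quad_cov_def of_real_add of_real_diff of_real_power ip_complex power_divide sum_square_pairs case_prod_unfold sum.distrib sum_subtractf
  by (simp add: add_divide_distrib diff_divide_distrib)
 also have "... = (\<Sum>p\<in>?A. W2 p t * cnj (W2 p s))"
  unfolding sum_divide_distrib W2_def case_prod_unfold
  by (intro sum.cong refl) (simp add: power2_eq_square algebra_simps)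
 finally show ?thesis .
qed

lemma quart_cov_eq:
 "complex_of_real (quart_cov t s) = (\<Sum>p\<in>LP n \<times> LP n \<times> LP n \<times> LP n. W4 p t * cnj (W4 p s))"
proof -
 let ?A = "LP n \<times> LP n \<times> LP n \<times> LP n"
 let ?x = "\<lambda>u v l. u l t * cnj (v l s) :: complex"
 let ?X = "\<lambda>u v k l m p. ?x u v k * ?x u v l * ?x u v m * ?x u v p"
 have "complex_of_real (quart_cov t s) = (\<Sum>(k, l, m, p)\<in>?A. ?X phase phase k l m p + ?X dphase phase k l m p
   + ?X phase dphase k l m p + ?X dphase dphase k l m p) / (of_real N) ^ 4"
  unfolding quart_cov_def of_real_add of_real_power ip_complex power_divide sum_fourth_power case_prod_unfold sum.distrib
  by (simp add: add_divide_distrib)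
 also have "... = (\<Sum>p\<in>?A. W4 p t * cnj (W4 p s))"
  unfolding sum_divide_distrib W4_def case_prod_unfold
 proof (intro sum.cong refl)
  fix q assume "q \<in> ?A"
  define k l m p where "k = fst q" and "l = fst (snd q)" and "m = fst (snd (snd q))" and "p = snd (snd (snd q))"
  have "(complex_of_real N) ^ 4 = of_real (N^2) * of_real (N^2)" by (simp add: eval_nat_numeral)
  moreover have "?X phase phase k l m p + ?X dphase phase k l m p + ?X phase dphase k l m p + ?X dphase dphase k l m p
   = (phase k t * phase l t * phase m t * phase p t + dphase k t * dphase l t * dphase m t * dphase p t)
    * cnj (phase k s * phase l s * phase m s * phase p s + dphase k s * dphase l s * dphase m s * dphase p s)"
   by (simp add: algebra_simps)
  ultimately show "(?X phase phase (fst q) (fst (snd q)) (fst (snd (snd q))) (snd (snd (snd q)))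
    + ?X dphase phase (fst q) (fst (snd q)) (fst (snd (snd q))) (snd (snd (snd q)))
    + ?X phase dphase (fst q) (fst (snd q)) (fst (snd (snd q))) (snd (snd (snd q)))
    + ?X dphase dphase (fst q) (fst (snd q)) (fst (snd (snd q))) (snd (snd (snd q)))) / (complex_of_real N) ^ 4
   = (phase (fst q) t * phase (fst (snd q)) t * phase (fst (snd (snd q))) t * phase (snd (snd (snd q))) t
     + dphase (fst q) t * dphase (fst (snd q)) t * dphase (fst (snd (snd q))) t * dphase (snd (snd (snd q))) t) / of_real (N^2)
    * cnj ((phase (fst q) s * phase (fst (snd q)) s * phase (fst (snd (snd q))) s * phase (snd (snd (snd q))) s
     + dphase (fst q) s * dphase (fst (snd q)) s * dphase (fst (snd (snd q))) s * dphase (snd (snd (snd q))) s) / of_real (N^2))"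
   unfolding k_def[symmetric] l_def[symmetric] m_def[symmetric] p_def[symmetric]
   by (simp only: complex_cnj_divide complex_cnj_complex_of_real times_divide_times_eq)
 qed
 finally show ?thesis .
qed

text \<open>A common bound for the amplitudes in \<open>W2\<close> and \<open>W4\<close> and for
  their derivatives: 5 bounds one plus a product of four frequencies, and \<open>16 * kp\<close>
  bounds the derivative of such a product.\<close>

definition "amp = 5 + 16 * kp"

lemma freq_prod_bounds:
 assumes "k \<in> LP n" "l \<in> LP n" "t \<in> {0..L}"
 shows "\<bar>freq n k t * freq n l t\<bar> \<le> 2" "\<bar>freq n k t * dfreq l t + dfreq k t * freq n l t\<bar> \<le> 4 * kp"
proof -
 have "\<bar>freq n k t\<bar> * \<bar>freq n l t\<bar> \<le> sqrt 2 * sqrt 2" by (intro mult_mono freq_bound assms) auto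
 thus "\<bar>freq n k t * freq n l t\<bar> \<le> 2" by (simp add: abs_mult)
 have "\<bar>freq n k t\<bar> * \<bar>dfreq l t\<bar> \<le> sqrt 2 * (sqrt 2 * kp)" by (intro mult_mono freq_bound dfreq_bound assms) auto
 moreover have "\<bar>dfreq k t\<bar> * \<bar>freq n l t\<bar> \<le> (sqrt 2 * kp) * sqrt 2" using kp_pos by (intro mult_mono freq_bound dfreq_bound assms) auto
 ultimately show "\<bar>freq n k t * dfreq l t + dfreq k t * freq n l t\<bar> \<le> 4 * kp"
  using abs_triangle_ineq[of "freq n k t * dfreq l t" "dfreq k t * freq n l t"]
  by (simp add: abs_mult mult.assoc[symmetric] mult.commute[of "sqrt 2 * kp"])
qed

lemma continuous_dfreq: "continuous_on {0..L} (dfreq l)"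
 unfolding dfreq_def[abs_def] divide_inverse by (intro continuous_intros continuous_D)

lemma freq_prod_deriv:
 assumes "t \<in> {0..L}"
 shows "((\<lambda>t. freq n k t * freq n l t) has_real_derivative freq n k t * dfreq l t + dfreq k t * freq n l t) (at t within {0..L})"
 using DERIV_mult'[OF freq_deriv[OF assms, of k] freq_deriv[OF assms, of l]] .

lemma norm_amplitude_integral_le:
 assumes v: "v \<noteq> 0"
  and dg: "\<And>t. t \<in> {0..L} \<Longrightarrow> (g has_real_derivative g' t) (at t within {0..L})"
  and cg: "continuous_on {0..L} g'"
  and g: "\<And>t. t \<in> {0..L} \<Longrightarrow> \<bar>g t\<bar> \<le> amp" "\<And>t. t \<in> {0..L} \<Longrightarrow> \<bar>g' t\<bar> \<le> amp"
 shows "(cmod (integral {0..L} (\<lambda>t. of_real (g t) * phase v t)))^2 \<le> (osc_const * amp)^2 * inv_norm v"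
proof -
 have "cmod (integral {0..L} (\<lambda>t. of_real (g t) * phase v t)) \<le> osc_const * amp / sqrt (norm (lattice_vec v))"
  unfolding phase_def
  by (rule oscillatory_integral_bound[OF norm_lattice_vec_ge_1[OF v], where g'="\<lambda>t. of_real (g' t)"])
   (use dg cg g in \<open>auto intro!: has_vector_derivative_of_real continuous_intros\<close>)
 hence "(cmod (integral {0..L} (\<lambda>t. of_real (g t) * phase v t)))^2 \<le> (osc_const * amp / sqrt (norm (lattice_vec v)))^2"
  by (intro power_mono) auto
 also have "... = (osc_const * amp)^2 * inv_norm v" using v by (simp add: inv_norm_def power_divide)
 finally show ?thesis .
qed

text \<open>For antipodal points the phases cancel and the integral is
  \<open>- curve_coeff n l\<close> up to the factor \<open>1 / N\<close>: these pairs carry the main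
  term of the variance. All other pairs oscillate with the nonzero frequency
  \<open>l + m\<close>.\<close>

lemma integral_W2:
 assumes l: "l \<in> LP n" and m: "m \<in> LP n"
 shows "(cmod (integral {0..L} (W2 (l, m))))^2 \<le> (of_bool (l + m = 0) * (curve_coeff n l)^2 + (osc_const * amp)^2 * inv_norm (l + m)) / N^2"
proof -
 have W: "W2 (l, m) = (\<lambda>t. of_real (1 + freq n l t * freq n m t) * phase (l + m) t / of_real N)"
  by (simp add: W2_def dphase_def phase_add algebra_simps)
 have "(cmod (integral {0..L} (\<lambda>t. of_real (1 + freq n l t * freq n m t) * phase (l + m) t)))^2
   \<le> of_bool (l + m = 0) * (curve_coeff n l)^2 + (osc_const * amp)^2 * inv_norm (l + m)"
 proof (cases "l + m = 0")
  case True
  hence m: "m = - l" by (simp add: add_eq_0_iff)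
  have ph: "phase 0 t = 1" for t by (simp add: phase_def lattice_vec_def inner_vec_def)
  have "integral {0..L} (\<lambda>t. of_real (1 + freq n l t * freq n m t) * phase (l + m) t) = integral {0..L} (\<lambda>t. complex_of_real (- ((freq n l t)^2 - 1)))"
   unfolding True ph unfolding m freq_uminus by (simp add: power2_eq_square)
  also have "... = of_real (integral {0..L} (\<lambda>t. - ((freq n l t)^2 - 1)))"
  proof -
   have "(\<lambda>t. - ((freq n l t)^2 - 1)) integrable_on {0..L}"
    by (intro integrable_continuous_interval continuous_intros continuous_freq)
   from has_integral_of_real[OF integrable_integral[OF this]] show ?thesis by (rule integral_unique)
  qed
  also have "integral {0..L} (\<lambda>t. - ((freq n l t)^2 - 1)) = - curve_coeff n l"
   unfolding curve_coeff_def by (rule integral_neg)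
  finally show ?thesis using True by (simp add: inv_norm_def)
 next
  case False
  have "(cmod (integral {0..L} (\<lambda>t. of_real (1 + freq n l t * freq n m t) * phase (l + m) t)))^2 \<le> (osc_const * amp)^2 * inv_norm (l + m)"
  proof (rule norm_amplitude_integral_le[OF False, where g'="\<lambda>t. freq n l t * dfreq m t + dfreq l t * freq n m t"])
   fix t assume t: "t \<in> {0..L}"
   show "((\<lambda>t. 1 + freq n l t * freq n m t) has_real_derivative freq n l t * dfreq m t + dfreq l t * freq n m t) (at t within {0..L})"
    using DERIV_add[OF DERIV_const freq_prod_deriv[OF t]] by simp
   show "\<bar>1 + freq n l t * freq n m t\<bar> \<le> amp" "\<bar>freq n l t * dfreq m t + dfreq l t * freq n m t\<bar> \<le> amp"
    using freq_prod_bounds[OF l m t] unfolding amp_def by linarith+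
  qed (intro continuous_intros continuous_freq continuous_dfreq)
  thus ?thesis using False by simp
 qed
 moreover have "cmod (integral {0..L} (W2 (l, m))) = cmod (integral {0..L} (\<lambda>t. of_real (1 + freq n l t * freq n m t) * phase (l + m) t)) / N"
  unfolding W integral_divide norm_divide norm_of_real by simp
 ultimately show ?thesis by (simp add: power_divide divide_right_mono)
qed

text \<open>Quadruples with sum zero do not oscillate, but by \<open>zero_quads_le\<close> there are
  at most \<open>3 * N^2\<close> of them, so the trivial bound \<open>5 * L\<close> is
  enough.\<close>

lemma integral_W4:
 assumes mem: "k \<in> LP n" "l \<in> LP n" "m \<in> LP n" "p \<in> LP n"
 shows "(cmod (integral {0..L} (W4 (k, l, m, p))))^2 \<le> (of_bool (k + l + m + p = 0) * (25 * L^2) + (osc_const * amp)^2 * inv_norm (k + l + m + p)) / N ^ 4"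
proof -
 let ?h = "\<lambda>t. 1 + (freq n k t * freq n l t) * (freq n m t * freq n p t)"
 let ?v = "k + l + m + p"
 have W: "W4 (k, l, m, p) = (\<lambda>t. of_real (?h t) * phase ?v t / of_real (N^2))"
  by (simp add: W4_def dphase_def phase_add algebra_simps)
 have h5: "\<bar>?h t\<bar> \<le> 5" if t: "t \<in> {0..L}" for t
 proof -
  have "\<bar>freq n k t * freq n l t\<bar> * \<bar>freq n m t * freq n p t\<bar> \<le> 2 * 2"
   by (intro mult_mono freq_prod_bounds mem t) auto
  thus ?thesis unfolding abs_mult[symmetric] by linarith
 qed
 have "(cmod (integral {0..L} (\<lambda>t. of_real (?h t) * phase ?v t)))^2
   \<le> of_bool (?v = 0) * (25 * L^2) + (osc_const * amp)^2 * inv_norm ?v"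
 proof (cases "?v = 0")
  case True
  have "cmod (integral {0..L} (\<lambda>t. of_real (?h t) * phase ?v t)) \<le> 5 * (L - 0)"
  proof (rule integral_bound)
   fix t assume t: "t \<in> {0..L}"
   show "cmod (of_real (?h t) * phase ?v t) \<le> 5" unfolding norm_mult norm_phase norm_of_real using h5[OF t] by simp
  qed (use L_pos in \<open>auto intro!: continuous_intros continuous_freq continuous_phase\<close>)
  hence "(cmod (integral {0..L} (\<lambda>t. of_real (?h t) * phase ?v t)))^2 \<le> (5 * (L - 0))^2" by (intro power_mono) auto
  thus ?thesis using True by (simp add: inv_norm_def)
 next
  case False
  let ?h' = "\<lambda>t. (freq n k t * freq n l t) * (freq n m t * dfreq p t + dfreq m t * freq n p t)
    + (freq n k t * dfreq l t + dfreq k t * freq n l t) * (freq n m t * freq n p t)"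
  have "(cmod (integral {0..L} (\<lambda>t. of_real (?h t) * phase ?v t)))^2 \<le> (osc_const * amp)^2 * inv_norm ?v"
  proof (rule norm_amplitude_integral_le[OF False, where g'="?h'"])
   fix t assume t: "t \<in> {0..L}"
   show "(?h has_real_derivative ?h' t) (at t within {0..L})"
    using DERIV_add[OF DERIV_const DERIV_mult'[OF freq_prod_deriv[OF t] freq_prod_deriv[OF t]]] by simp
   show "\<bar>?h t\<bar> \<le> amp" using h5[OF t] kp_pos unfolding amp_def by linarith
   have "\<bar>freq n k t * freq n l t\<bar> * \<bar>freq n m t * dfreq p t + dfreq m t * freq n p t\<bar> \<le> 2 * (4 * kp)"
    by (intro mult_mono freq_prod_bounds mem t) auto
   moreover have "\<bar>freq n k t * dfreq l t + dfreq k t * freq n l t\<bar> * \<bar>freq n m t * freq n p t\<bar> \<le> (4 * kp) * 2"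
    using kp_pos by (intro mult_mono freq_prod_bounds mem t) auto
   ultimately show "\<bar>?h' t\<bar> \<le> amp" unfolding amp_def abs_mult[symmetric] by linarith
  qed (intro continuous_intros continuous_freq continuous_dfreq)
  thus ?thesis using False by simp
 qed
 moreover have "cmod (integral {0..L} (W4 (k, l, m, p))) = cmod (integral {0..L} (\<lambda>t. of_real (?h t) * phase ?v t)) / N^2"
  unfolding W integral_divide norm_divide norm_of_real by simp
 moreover have "(N^2)^2 = N ^ 4" by simp
 ultimately show ?thesis by (simp only: power_divide) (intro divide_right_mono, auto)
qed

definition "mesh_size = nat \<lceil>64 * C1 * (sg * L)\<rceil>"

text \<open>Since \<open>C1 * (sg * L)\<close> is at least 1, rounding 64 times this number up to an
  integer does not go beyond 128 times it.\<close>

lemma mesh_size: "0 < mesh_size" "C1 * (sg * (L / mesh_size)) \<le> 1/64" "1 / (128 * C1) \<le> sg * (L / mesh_size)"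
proof -
 define x where "x = C1 * (sg * L)"
 have "1 \<le> C1 * L" using C1_bounds(3) L_pos by (simp add: field_simps)
 moreover have "1 \<le> sg" using sg_bounds(2) by (rule order_trans[rotated]) simp
 ultimately have "1 * 1 \<le> (C1 * L) * sg" by (intro mult_mono) auto
 hence x: "1 \<le> x" by (simp add: x_def mult_ac)
 define K where "K = real mesh_size"
 have K: "64 * x \<le> K" "K \<le> 64 * x + 1"
 proof -
  have "mesh_size = nat \<lceil>64 * x\<rceil>" by (simp add: mesh_size_def x_def mult.assoc)
  hence "K = real_of_int \<lceil>64 * x\<rceil>" using x by (simp add: K_def)
  thus "64 * x \<le> K" "K \<le> 64 * x + 1" by linarith+
 qed
 have Kp: "0 < K" using K x by linarith
 thus "0 < mesh_size" by (simp add: K_def)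
 have "x / K \<le> 1 / 64" using K Kp by simp
 thus "C1 * (sg * (L / mesh_size)) \<le> 1/64" by (simp add: x_def K_def)
 have "1 / 128 \<le> x / K" using K Kp x by simp
 hence "1 / 128 / C1 \<le> x / K / C1" using C1_bounds(1) by (intro divide_right_mono) auto
 thus "1 / (128 * C1) \<le> sg * (L / mesh_size)" using C1_bounds(1) by (simp add: x_def K_def)
qed

definition pair_sum :: real where
 "pair_sum = (\<Sum>l\<in>LP n. \<Sum>m\<in>LP n. inv_norm (l + m))"

definition quad_sum :: real where
 "quad_sum = (\<Sum>k\<in>LP n. \<Sum>l\<in>LP n. \<Sum>m\<in>LP n. \<Sum>p\<in>LP n. inv_norm (k + l + m + p))"

definition var_main :: real where
 "var_main = real n / N^2 * (\<Sum>l\<in>LP n. (curve_coeff n l)\<^sup>2)"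

definition var_error :: real where
 "var_error = (osc_const * amp)^2 * (pair_sum / N)
   + (12 + 2 * pi^2 * (2 * 16 ^ 4 * (128 * C1)^2)) * (75 * L^2 / N + (osc_const * amp)^2 * (quad_sum / N ^ 3))"

lemma sum_W2_le:
 shows "(\<Sum>p\<in>LP n \<times> LP n. (cmod (integral {0..L} (W2 p)))\<^sup>2)
  \<le> ((\<Sum>l\<in>LP n. (curve_coeff n l)\<^sup>2) + (osc_const * amp)^2 * pair_sum) / N^2"
proof -
 let ?\<Lambda> = "LP n"
 have "(\<Sum>p\<in>?\<Lambda> \<times> ?\<Lambda>. (cmod (integral {0..L} (W2 p)))^2) = (\<Sum>l\<in>?\<Lambda>. \<Sum>m\<in>?\<Lambda>. (cmod (integral {0..L} (W2 (l, m))))^2)"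
  by (simp add: sum.cartesian_product)
 also have "... \<le> (\<Sum>l\<in>?\<Lambda>. \<Sum>m\<in>?\<Lambda>. (of_bool (l + m = 0) * (curve_coeff n l)^2 + (osc_const * amp)^2 * inv_norm (l + m)) / N^2)"
  by (intro sum_mono integral_W2)
 also have "... = ((\<Sum>l\<in>?\<Lambda>. (\<Sum>m\<in>?\<Lambda>. of_bool (l + m = 0)) * (curve_coeff n l)^2) + (osc_const * amp)^2 * pair_sum) / N^2"
  by (simp only: sum_divide_distrib[symmetric] sum.distrib sum_distrib_right[symmetric] sum_distrib_left[symmetric] pair_sum_def)
 also have "(\<Sum>l\<in>?\<Lambda>. (\<Sum>m\<in>?\<Lambda>. of_bool (l + m = 0)) * (curve_coeff n l)^2) = (\<Sum>l\<in>?\<Lambda>. (curve_coeff n l)^2)"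
 proof (intro sum.cong refl)
  fix l assume l: "l \<in> ?\<Lambda>"
  have "(l + m = 0) = (m = - l)" for m by (auto simp: add_eq_0_iff)
  hence "(\<Sum>m\<in>?\<Lambda>. of_bool (l + m = 0)) = (1::real)"
   using l finite_lattice_points by (simp add: uminus_lattice_points_iff)
  thus "(\<Sum>m\<in>?\<Lambda>. of_bool (l + m = 0)) * (curve_coeff n l)^2 = (curve_coeff n l)^2" by simp
 qed
 finally show ?thesis .
qed

lemma sum_W4_le:
 shows "(\<Sum>p\<in>LP n \<times> LP n \<times> LP n \<times> LP n. (cmod (integral {0..L} (W4 p)))\<^sup>2)
  \<le> (3 * N^2 * (25 * L^2) + (osc_const * amp)^2 * quad_sum) / N ^ 4"
proof -
 let ?\<Lambda> = "LP n"
 have "(\<Sum>p\<in>?\<Lambda> \<times> ?\<Lambda> \<times> ?\<Lambda> \<times> ?\<Lambda>. (cmod (integral {0..L} (W4 p)))^2)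
   = (\<Sum>k\<in>?\<Lambda>. \<Sum>l\<in>?\<Lambda>. \<Sum>m\<in>?\<Lambda>. \<Sum>p\<in>?\<Lambda>. (cmod (integral {0..L} (W4 (k, l, m, p))))^2)"
  by (simp add: sum.cartesian_product)
 also have "... \<le> (\<Sum>k\<in>?\<Lambda>. \<Sum>l\<in>?\<Lambda>. \<Sum>m\<in>?\<Lambda>. \<Sum>p\<in>?\<Lambda>. (of_bool (k + l + m + p = 0) * (25 * L^2) + (osc_const * amp)^2 * inv_norm (k + l + m + p)) / N ^ 4)"
  by (intro sum_mono integral_W4)
 also have "... = ((\<Sum>k\<in>?\<Lambda>. \<Sum>l\<in>?\<Lambda>. \<Sum>m\<in>?\<Lambda>. \<Sum>p\<in>?\<Lambda>. of_bool (k + l + m + p = 0)) * (25 * L^2) + (osc_const * amp)^2 * quad_sum) / N ^ 4"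
  by (simp only: sum_divide_distrib[symmetric] sum.distrib sum_distrib_right[symmetric] sum_distrib_left[symmetric] quad_sum_def)
 also have "... \<le> (3 * N^2 * (25 * L^2) + (osc_const * amp)^2 * quad_sum) / N ^ 4"
  by (intro divide_right_mono add_right_mono mult_right_mono zero_quads_le) auto
 finally show ?thesis .
qed

lemma zero_count_variance:
 shows "integrable M (\<lambda>w. (zero_count w)^2)" "expectation zero_count = sg * L / pi"
  "expectation (\<lambda>w. (zero_count w)^2) \<le> (sg * L / pi)^2 + var_main + real n / N * var_error"
proof -
 define Iq where "Iq = (\<Sum>p\<in>LP n \<times> LP n. (cmod (integral {0..L} (W2 p)))\<^sup>2)"
 define IF where "IF = (\<Sum>p\<in>LP n \<times> LP n \<times> LP n \<times> LP n. (cmod (integral {0..L} (W4 p)))\<^sup>2)"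
 note lims = riemann_double_sums_tendsto[OF L_pos mesh_size(1) continuous_W(1) quad_cov_eq]
  riemann_double_sums_tendsto[OF L_pos mesh_size(1) continuous_W(2) quart_cov_eq]
 note zm = zero_count_moments[OF mesh_size lims]
 show "integrable M (\<lambda>w. (zero_count w)^2)" "expectation zero_count = sg * L / pi" by (rule zm)+
 \<comment> \<open>\<open>C_sing\<close> comes from a context that also fixes a number of steps per
   cell; its value does not depend on it, and 1 is taken.\<close>
 have "expectation (\<lambda>w. (zero_count w)^2) \<le> (sg * L / pi)^2 + sg^2 * (Iq / (2 * pi^2) + (6 / pi^2 + 2 * 16 ^ 4 * (128 * C1)^2) * IF)"
  using zm(3) unfolding Iq_def IF_def C_sing_def[OF mesh_size(1) zero_less_one mesh_size(2,3)] .
 also have "sg^2 * (Iq / (2 * pi^2) + (6 / pi^2 + 2 * 16 ^ 4 * (128 * C1)^2) * IF)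
   = real n * (Iq + (12 + 2 * pi^2 * (2 * 16 ^ 4 * (128 * C1)^2)) * IF)"
 proof -
  \<comment> \<open>This factor turns \<open>Iq / (2 * pi^2)\<close> into \<open>Iq\<close> and
    \<open>6 / pi^2\<close> into 12.\<close>
  have "sg^2 = 2 * pi^2 * real n" by (simp add: sg_def power_mult_distrib)
  thus ?thesis by (simp add: field_simps)
 qed
 also have "real n * (Iq + (12 + 2 * pi^2 * (2 * 16 ^ 4 * (128 * C1)^2)) * IF)
   \<le> real n * (((\<Sum>l\<in>LP n. (curve_coeff n l)\<^sup>2) + (osc_const * amp)^2 * pair_sum) / N^2
     + (12 + 2 * pi^2 * (2 * 16 ^ 4 * (128 * C1)^2)) * ((3 * N^2 * (25 * L^2) + (osc_const * amp)^2 * quad_sum) / N ^ 4))"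
  using sum_W2_le sum_W4_le unfolding Iq_def IF_def by (intro mult_left_mono add_mono) auto
 also have "... = var_main + real n / N * var_error"
 proof -
  have 1: "(x + A * u) / N^2 = x / N^2 + A * (u / N) / N" for x A u :: real
   by (simp add: add_divide_distrib power2_eq_square)
  have 2: "(3 * N^2 * (25 * L^2) + A * u) / N ^ 4 = (75 * L^2 / N + A * (u / N ^ 3)) / N" for A u :: real
  proof -
   have "(3 * N^2 * (25 * L^2) + A * u) / N ^ 4 = 3 * N^2 * (25 * L^2) / N ^ 4 + A * u / N ^ 4" by (rule add_divide_distrib)
   also have "3 * N^2 * (25 * L^2) / N ^ 4 = 75 * L^2 / N / N" by (simp add: eval_nat_numeral)
   also have "A * u / N ^ 4 = A * (u / N ^ 3) / N" by (simp add: eval_nat_numeral)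
   finally show ?thesis by (simp add: add_divide_distrib)
  qed
  have "r * (x / N^2 + P / N + B * (Q / N)) = r / N^2 * x + r / N * (P + B * Q)" for r x P Q B :: real
   by (simp add: algebra_simps add_divide_distrib)
  thus ?thesis unfolding 1 2 var_main_def var_error_def .
 qed
 finally show "expectation (\<lambda>w. (zero_count w)^2) \<le> (sg * L / pi)^2 + var_main + real n / N * var_error" by simp
qed

end

section \<open>Centered squares of the coefficients and their sums\<close>

context gaussian_wave
begin

text \<open>The coefficients that single out one lattice point: the resulting variable is
  \<open>sqrt 2 * Re (a l w * z)\<close>. The choices 1 and \<i> give the real and, up to sign, the
  imaginary part of \<open>a l\<close>, each with unit variance.\<close>

definition coord :: "complex \<Rightarrow> int ^ 2 \<Rightarrow> int ^ 2 \<Rightarrow> complex" where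
 "coord z l m = (if m = l then z / of_real (sqrt 2) else if m = - l then cnj z / of_real (sqrt 2) else 0)"

lemma nonzero: assumes l: "l \<in> LP n" shows "l \<noteq> - l"
proof
 assume *: "l = - l"
 have z: "l $ i = 0" for i
 proof -
  have "l $ i = (- l) $ i" by (rule arg_cong[OF *])
  thus ?thesis unfolding vector_uminus_component equal_neg_zero .
 qed
 have "int n = 0" using l unfolding lattice_points_iff z by simp
 thus False using n by simp
qed

lemma hermitian_coord: assumes l: "l \<in> LP n" shows "hermitian n (coord z l)"
 unfolding hermitian_def
proof
 fix m
 have "(- m = l) = (m = - l)" by (metis minus_minus)
 thus "coord z l (- m) = cnj (coord z l m)" using nonzero[OF l] by (simp add: coord_def)
qed

lemma sum_coord:
 fixes g :: "complex \<Rightarrow> int ^ 2 \<Rightarrow> real"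
 assumes l: "l \<in> LP n" and g: "\<And>m. g 0 m = 0"
 shows "(\<Sum>m\<in>LP n. g (coord z l m) m) = g (z / of_real (sqrt 2)) l + g (cnj z / of_real (sqrt 2)) (- l)"
proof -
 have "(\<Sum>m\<in>LP n. g (coord z l m) m) = (\<Sum>m\<in>{l, - l}. g (coord z l m) m)"
  using l g by (intro sum.mono_neutral_right finite_lattice_points) (auto simp: coord_def uminus_lattice_points_iff)
 also have "... = g (z / of_real (sqrt 2)) l + g (cnj z / of_real (sqrt 2)) (- l)"
  using nonzero[OF l] by (auto simp: coord_def)
 finally show ?thesis .
qed

lemma wave_var_coord:
 assumes l: "l \<in> LP n" and w: "w \<in> space M"
 shows "wave_var a n (coord z l) w = sqrt 2 * Re (a l w * z)"
proof -
 have s2: "x / sqrt 2 + x / sqrt 2 = sqrt 2 * x" for x :: real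
  by (simp add: field_simps)
 have "wave_var a n (coord z l) w = (\<Sum>m\<in>LP n. Re (a m w * coord z l m))"
  by (simp add: wave_var_def)
 also have "... = Re (a l w * (z / of_real (sqrt 2))) + Re (a (- l) w * (cnj z / of_real (sqrt 2)))"
  by (rule sum_coord[OF l, where g="\<lambda>c m. Re (a m w * c)"]) simp
 also have "... = Re (a l w * z) / sqrt 2 + Re (a l w * z) / sqrt 2"
  unfolding coeff_uminus[OF l w] times_divide_eq_right Re_divide_of_real by simp
 finally show ?thesis unfolding s2 .
qed

lemma ip_coord:
 assumes l: "l \<in> LP n" and c: "hermitian n c"
 shows "ip (wave_var a n (coord z l)) (wave_var a n c) = sqrt 2 * Re (z * cnj (c l))"
proof -
 have s2: "x / sqrt 2 + x / sqrt 2 = sqrt 2 * x" for x :: real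
  by (simp add: field_simps)
 have "ip (wave_var a n (coord z l)) (wave_var a n c) = Re (z / of_real (sqrt 2) * cnj (c l)) + Re (cnj z / of_real (sqrt 2) * cnj (c (- l)))"
  unfolding ip_wave_var[OF hermitian_coord[OF l] c]
  by (rule sum_coord[OF l, where g="\<lambda>x m. Re (x * cnj (c m))"]) simp
 also have "c (- l) = cnj (c l)" using c l by (simp add: hermitian_def)
 also have "Re (z / of_real (sqrt 2) * cnj (c l)) + Re (cnj z / of_real (sqrt 2) * cnj (cnj (c l)))
   = Re (z * cnj (c l)) / sqrt 2 + Re (z * cnj (c l)) / sqrt 2"
  unfolding times_divide_eq_left Re_divide_of_real by simp
 finally show ?thesis unfolding s2 .
qed

lemma ip_coord_self:
 assumes l: "l \<in> LP n" and z: "cmod z = 1"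
 shows "ip (wave_var a n (coord z l)) (wave_var a n (coord z l)) = 1"
proof -
 have "coord z l l = z / of_real (sqrt 2)" by (simp add: coord_def)
 hence "ip (wave_var a n (coord z l)) (wave_var a n (coord z l)) = sqrt 2 * (Re (z * cnj z) / sqrt 2)"
  unfolding ip_coord[OF l hermitian_coord[OF l]] by simp
 thus ?thesis using z unfolding complex_norm_square[symmetric] by simp
qed

definition excess :: "int ^ 2 \<Rightarrow> 'w \<Rightarrow> real" where
 "excess l w = (cmod (a l w))^2 - 1"

lemma excess_eq:
 assumes l: "l \<in> LP n" and w: "w \<in> space M"
 shows "excess l w = ((wave_var a n (coord 1 l) w)^2 + (wave_var a n (coord \<i> l) w)^2) / 2 - 1"
 unfolding wave_var_coord[OF l w] by (simp add: excess_def cmod_power2 power_mult_distrib)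

lemma excess_measurable: assumes l: "l \<in> LP n" shows "excess l \<in> borel_measurable M"
proof -
 have [measurable]: "(\<lambda>w. Re (a l w)) \<in> borel_measurable M" "(\<lambda>w. Im (a l w)) \<in> borel_measurable M"
  using coeff_meas[OF l] by auto
 show ?thesis unfolding excess_def[abs_def] cmod_power2 by measurable
qed

lemma excess_moments:
 assumes l: "l \<in> LP n"
 shows "integrable M (excess l)" "expectation (excess l) = 0"
  "integrable M (\<lambda>w. (excess l w)^2)" "expectation (\<lambda>w. (excess l w)^2) = 1"
  "integrable M (\<lambda>w. \<bar>excess l w\<bar> ^ 3)" "expectation (\<lambda>w. \<bar>excess l w\<bar> ^ 3) \<le> 43"
proof -
 define p q where "p w = (sqrt 2 * Re (a l w))^2" and "q w = (sqrt 2 * Im (a l w))^2" for w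
 have [measurable]: "(\<lambda>w. Re (a l w)) \<in> borel_measurable M" "(\<lambda>w. Im (a l w)) \<in> borel_measurable M" "excess l \<in> borel_measurable M"
  using coeff_meas[OF l] excess_measurable[OF l] by auto
 have ex: "excess l w = (p w - 1) / 2 + (q w - 1) / 2" for w
  by (simp add: excess_def cmod_power2 p_def q_def power_mult_distrib diff_divide_distrib)
 have pk: "has_bochner_integral M (\<lambda>w. (p w) ^ k) (fact (2 * k) / (2 ^ k * fact k))"
  and qk: "has_bochner_integral M (\<lambda>w. (q w) ^ k) (fact (2 * k) / (2 ^ k * fact k))" for k
  using coeff_moments(1,2)[OF l, of k] by (simp_all only: p_def q_def power_mult)
 have f: "fact 2 = (2::real)" "fact 4 = (24::real)" "fact 6 = (720::real)" "fact 3 = (6::real)"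
  by (simp_all add: fact_numeral)
 have m: "integrable M p" "expectation p = 1" "integrable M q" "expectation q = 1"
  "integrable M (\<lambda>w. (p w)^2)" "expectation (\<lambda>w. (p w)^2) = 3" "integrable M (\<lambda>w. (q w)^2)" "expectation (\<lambda>w. (q w)^2) = 3"
  "integrable M (\<lambda>w. (p w) ^ 3)" "expectation (\<lambda>w. (p w) ^ 3) = 15" "integrable M (\<lambda>w. (q w) ^ 3)" "expectation (\<lambda>w. (q w) ^ 3) = 15"
  using pk[of 1] qk[of 1] pk[of 2] qk[of 2] pk[of 3] qk[of 3] by (simp_all add: has_bochner_integral_iff f)
 have iv: "indep_var borel p borel q"
  using indep_var_compose[OF coeff_indep[OF l], of "\<lambda>x. (sqrt 2 * x)^2" borel "\<lambda>x. (sqrt 2 * x)^2" borel]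
  by (simp add: o_def p_def[abs_def] q_def[abs_def])
 have pq: "integrable M (\<lambda>w. p w * q w)" "expectation (\<lambda>w. p w * q w) = 1"
  using indep_var_integrable[OF iv m(1,3)] indep_var_lebesgue_integral[OF iv m(1,3)] m by auto
 show 1: "integrable M (excess l)" unfolding ex[abs_def] using m by auto
 show "expectation (excess l) = 0" unfolding ex[abs_def] using m by (simp add: prob_space)
 have e2: "(excess l w)^2 = 1 / 4 * (p w)^2 + (1 / 4 * (q w)^2 + (1 / 2 * (p w * q w) + (1 + (- p w - q w))))" for w
  unfolding ex by (simp add: power2_eq_square field_simps)
 show "integrable M (\<lambda>w. (excess l w)^2)" unfolding e2 using m pq by auto
 show "expectation (\<lambda>w. (excess l w)^2) = 1" unfolding e2 using m pq by (simp add: prob_space)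
 have e3: "\<bar>excess l w\<bar> ^ 3 \<le> 9 * (1 + (p w) ^ 3 / 8 + (q w) ^ 3 / 8)" for w
 proof -
  \<comment> \<open>The power mean inequality for three nonnegative numbers.\<close>
  have cube: "(1 + x + z) ^ 3 \<le> 9 * (1 + x ^ 3 + z ^ 3)" if "0 \<le> x" "0 \<le> z" for x z :: real
  proof -
   have amgm: "3 * (x^2 * z) \<le> 2 * x ^ 3 + z ^ 3" if "0 \<le> x" "0 \<le> z" for x z :: real
   proof -
    have "0 \<le> (x - z)^2 * (2 * x + z)" using that by auto
    thus ?thesis by (simp add: power2_eq_square power3_eq_cube algebra_simps)
   qed
   have t: "6 * (x * z) \<le> 2 * (1 + x ^ 3 + z ^ 3)"
   proof -
    have "0 \<le> (1 + x + z) * ((1 - x)^2 + (x - z)^2 + (z - 1)^2)" using that by auto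
    thus ?thesis by (simp add: power2_eq_square power3_eq_cube algebra_simps)
   qed
   have "(1 + x + z) ^ 3 = 1 + x ^ 3 + z ^ 3 + 3 * (1^2 * x) + 3 * (1^2 * z) + 3 * (x^2 * 1) + 3 * (x^2 * z) + 3 * (z^2 * 1) + 3 * (z^2 * x) + 6 * (x * z)"
    by (simp add: power2_eq_square power3_eq_cube algebra_simps)
   thus ?thesis
    using amgm[of 1 x] amgm[of 1 z] amgm[of x 1] amgm[of z 1] amgm[of x z] amgm[of z x] t that by simp
  qed
  have pq0: "0 \<le> p w" "0 \<le> q w" by (simp_all add: p_def q_def)
  have "\<bar>excess l w\<bar> \<le> 1 + p w / 2 + q w / 2" unfolding ex diff_divide_distrib abs_le_iff using pq0 by auto
  hence "\<bar>excess l w\<bar> ^ 3 \<le> (1 + p w / 2 + q w / 2) ^ 3" by (intro power_mono) auto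
  also have "... \<le> 9 * (1 + (p w / 2) ^ 3 + (q w / 2) ^ 3)" using pq0 by (intro cube) auto
  finally show ?thesis by (simp add: power_divide)
 qed
 have b: "integrable M (\<lambda>w. 9 * (1 + (p w) ^ 3 / 8 + (q w) ^ 3 / 8))" using m by auto
 show i3: "integrable M (\<lambda>w. \<bar>excess l w\<bar> ^ 3)"
  by (rule Bochner_Integration.integrable_bound[OF b]) (use e3 in \<open>auto intro: order_trans[OF _ abs_ge_self]\<close>)
 have "expectation (\<lambda>w. \<bar>excess l w\<bar> ^ 3) \<le> expectation (\<lambda>w. 9 * (1 + (p w) ^ 3 / 8 + (q w) ^ 3 / 8))"
  by (intro integral_mono i3 b e3)
 \<comment> \<open>The normal sixth moment is 15, and \<open>9 * (1 + 15/8 + 15/8)\<close> is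
   42.75.\<close>
 also have "... \<le> 43" using m by (simp add: prob_space)
 finally show "expectation (\<lambda>w. \<bar>excess l w\<bar> ^ 3) \<le> 43" .
qed

lemma excess_indep: "indep_vars (\<lambda>_. borel) (\<lambda>l w. c l * excess l w) (half_points n)"
 using indep_vars_compose2[OF half_indep, of "\<lambda>l z. c l * ((cmod z)^2 - 1)" "\<lambda>_. borel"] by (simp add: excess_def)

text \<open>The third absolute moment controls the deviation of the characteristic function from
  \<open>1 - c^2 / 2\<close>, with 8 rounding up 43/6; the term \<open>c ^ 4 / 8\<close> is the
  deviation of the exponential from the same polynomial.\<close>

lemma excess_char:
 assumes l: "l \<in> LP n"
 shows "cmod (char (distr M borel (\<lambda>w. c * excess l w)) 1 - of_real (exp (- c\<^sup>2 / 2))) \<le> 8 * \<bar>c\<bar> ^ 3 + c ^ 4 / 8"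
proof -
 note m = excess_moments[OF l]
 have [measurable]: "excess l \<in> borel_measurable M" by (rule excess_measurable[OF l])
 have v: "variance (excess l) = 1" using m(2,4) by simp
 have "char (distr M borel (\<lambda>w. c * excess l w)) 1 = char (distr M borel (excess l)) c" by (simp add: char_def integral_distr)
 moreover have "cmod (char (distr M borel (excess l)) c - (1 - c^2 * 1 / 2))
   \<le> (c^2 / 6) * expectation (\<lambda>w. min (6 * (excess l w)^2) (\<bar>c\<bar> * \<bar>excess l w\<bar> ^ 3))"
  by (rule char_approx3'[OF excess_measurable[OF l] m(1,3,2) v refl])
 moreover have "(c^2 / 6) * expectation (\<lambda>w. min (6 * (excess l w)^2) (\<bar>c\<bar> * \<bar>excess l w\<bar> ^ 3)) \<le> (c^2 / 6) * (\<bar>c\<bar> * 43)"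
 proof (rule mult_left_mono)
  have "expectation (\<lambda>w. min (6 * (excess l w)^2) (\<bar>c\<bar> * \<bar>excess l w\<bar> ^ 3)) \<le> expectation (\<lambda>w. \<bar>c\<bar> * \<bar>excess l w\<bar> ^ 3)"
   using m by (intro integral_mono integrable_min) auto
  also have "... \<le> \<bar>c\<bar> * 43" using m(6) by (simp add: mult_left_mono)
  finally show "expectation (\<lambda>w. min (6 * (excess l w)^2) (\<bar>c\<bar> * \<bar>excess l w\<bar> ^ 3)) \<le> \<bar>c\<bar> * 43" .
 qed simp
 moreover have "(c^2 / 6) * (\<bar>c\<bar> * 43) \<le> 8 * \<bar>c\<bar> ^ 3"
 proof -
  have "(c^2 / 6) * (\<bar>c\<bar> * 43) = 43 / 6 * \<bar>c\<bar> ^ 3" by (simp add: power3_eq_cube power2_eq_square)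
  also have "... \<le> 8 * \<bar>c\<bar> ^ 3" by (intro mult_right_mono) auto
  finally show ?thesis .
 qed
 moreover have "cmod ((1 - c^2 * 1 / 2) - complex_of_real (exp (- c\<^sup>2 / 2))) \<le> c ^ 4 / 8"
 proof -
  define x where "x = c^2 / 2"
  have x: "0 \<le> x" by (simp add: x_def)
  have lo: "1 - x \<le> exp (- x)" using exp_ge_add_one_self[of "- x"] by simp
  have "1 + x \<le> exp x" by (rule exp_ge_add_one_self)
  hence "exp (- x) \<le> 1 / (1 + x)" using x by (simp add: exp_minus field_simps)
  also have "... \<le> 1 - x + x^2"
  proof -
   have "1 \<le> (1 - x + x^2) * (1 + x)" using x by (simp add: power2_eq_square algebra_simps)
   thus ?thesis using x by (simp add: divide_le_eq)
  qed
  finally have hi: "exp (- x) \<le> 1 - x + x^2" .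
  have hi2: "exp (- x) \<le> 1 - x + x^2 / 2"
  proof -
   have "exp (- x) \<le> 1 - x + x^2 / 2"
    using x
   proof -
    define h where "h z = 1 - z + z^2 / 2 - exp (- z)" for z :: real
    have "h 0 \<le> h x"
    proof (rule DERIV_nonneg_imp_nondecreasing[OF x])
     fix z :: real assume "0 \<le> z" "z \<le> x"
     have "(h has_real_derivative (- 1 + z + exp (- z))) (at z)"
      unfolding h_def by (auto intro!: derivative_eq_intros)
     moreover have "0 \<le> - 1 + z + exp (- z)" using exp_ge_add_one_self[of "- z"] by simp
     ultimately show "\<exists>d. (h has_real_derivative d) (at z) \<and> 0 \<le> d" by blast
    qed
    thus ?thesis by (simp add: h_def)
   qed
   thus ?thesis .
  qed
  have "\<bar>(1 - x) - exp (- x)\<bar> \<le> x^2 / 2" using lo hi2 by linarith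
  moreover have "x^2 / 2 = c ^ 4 / 8" by (simp add: x_def power_divide)
  moreover have "(1 - c^2 * 1 / 2) - complex_of_real (exp (- c\<^sup>2 / 2)) = of_real ((1 - x) - exp (- x))" by (simp add: x_def)
  ultimately show ?thesis by (simp only: norm_of_real)
 qed
 ultimately show ?thesis
  using norm_triangle_ineq[of "char (distr M borel (excess l)) c - (1 - c^2 * 1 / 2)" "(1 - c^2 * 1 / 2) - complex_of_real (exp (- c\<^sup>2 / 2))"] by simp
qed

text \<open>Characteristic functions have modulus at most 1, so the difference of two products is at
  most the sum of the differences of their factors. Each of these is at least cubic in
  \<open>s l\<close>; taking out one or two factors \<open>ep\<close> leaves the squares, which sum
  to 1.\<close>

lemma excess_sum_char:
 fixes s :: "int ^ 2 \<Rightarrow> real" and t :: real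
 assumes s2: "(\<Sum>l\<in>half_points n. (s l)\<^sup>2) = 1" and ep: "\<And>l. l \<in> half_points n \<Longrightarrow> \<bar>s l\<bar> \<le> ep"
 shows "cmod ((CLINT w|M. iexp (t * (\<Sum>l\<in>half_points n. s l * excess l w))) - of_real (exp (- t\<^sup>2 / 2))) \<le> 8 * \<bar>t\<bar> ^ 3 * ep + t ^ 4 * ep^2 / 8"
proof -
 let ?H = "half_points n"
 let ?Y = "\<lambda>l w. (t * s l) * excess l w"
 have l: "l \<in> LP n" if "l \<in> ?H" for l using that by (rule subsetD[OF half_points_subset])
 have meas: "(\<lambda>w. \<Sum>l\<in>?H. ?Y l w) \<in> borel_measurable M"
  using excess_measurable[OF l] by (intro borel_measurable_sum borel_measurable_times) auto
 have "(CLINT w|M. iexp (t * (\<Sum>l\<in>?H. s l * excess l w))) = (CLINT w|M. iexp (\<Sum>l\<in>?H. ?Y l w))"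
  by (simp add: sum_distrib_left mult.assoc)
 also have "... = char (distr M borel (\<lambda>w. \<Sum>l\<in>?H. ?Y l w)) 1"
  using meas by (simp add: char_def integral_distr)
 also have "... = (\<Prod>l\<in>?H. char (distr M borel (?Y l)) 1)" by (rule char_distr_sum[OF excess_indep])
 finally have 1: "(CLINT w|M. iexp (t * (\<Sum>l\<in>?H. s l * excess l w))) = (\<Prod>l\<in>?H. char (distr M borel (?Y l)) 1)" .
 have "(\<Prod>l\<in>?H. of_real (exp (- (t * s l)\<^sup>2 / 2))) = complex_of_real (exp (\<Sum>l\<in>?H. - (t * s l)\<^sup>2 / 2))"
  by (simp add: exp_sum finite_half_points)
 also have "(\<Sum>l\<in>?H. - (t * s l)\<^sup>2 / 2) = - t\<^sup>2 / 2 * (\<Sum>l\<in>?H. (s l)\<^sup>2)"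
  by (simp add: sum_distrib_left power_mult_distrib)
 finally have 2: "(\<Prod>l\<in>?H. of_real (exp (- (t * s l)\<^sup>2 / 2))) = complex_of_real (exp (- t\<^sup>2 / 2))" unfolding s2 by simp
 have "cmod ((\<Prod>l\<in>?H. char (distr M borel (?Y l)) 1) - (\<Prod>l\<in>?H. of_real (exp (- (t * s l)\<^sup>2 / 2))))
   \<le> (\<Sum>l\<in>?H. cmod (char (distr M borel (?Y l)) 1 - of_real (exp (- (t * s l)\<^sup>2 / 2))))"
 proof (rule norm_prod_diff)
  fix l assume "l \<in> ?H"
  hence "?Y l \<in> borel_measurable M" using excess_measurable[OF l] by simp
  then interpret d: real_distribution "distr M borel (?Y l)" by (rule real_distribution_distr)
  show "cmod (char (distr M borel (?Y l)) 1) \<le> 1" by (rule d.cmod_char_le_1)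
  show "cmod (complex_of_real (exp (- (t * s l)\<^sup>2 / 2))) \<le> 1" by simp
 qed
 also have "... \<le> (\<Sum>l\<in>?H. (8 * \<bar>t\<bar> ^ 3 * ep + t ^ 4 * ep^2 / 8) * (s l)^2)"
 proof (rule sum_mono)
  fix l assume lH: "l \<in> ?H"
  have "cmod (char (distr M borel (?Y l)) 1 - of_real (exp (- (t * s l)\<^sup>2 / 2))) \<le> 8 * \<bar>t * s l\<bar> ^ 3 + (t * s l) ^ 4 / 8"
   by (rule excess_char[OF l[OF lH]])
  also have "... = (8 * \<bar>t\<bar> ^ 3 * \<bar>s l\<bar> + t ^ 4 * \<bar>s l\<bar>\<^sup>2 / 8) * (s l)^2"
   by (simp add: abs_mult power3_eq_cube power4_eq_xxxx power2_eq_square algebra_simps)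
  also have "... \<le> (8 * \<bar>t\<bar> ^ 3 * ep + t ^ 4 * ep^2 / 8) * (s l)^2"
   using ep[OF lH] by (intro mult_right_mono add_mono mult_left_mono divide_right_mono power_mono) auto
  finally show "cmod (char (distr M borel (?Y l)) 1 - of_real (exp (- (t * s l)\<^sup>2 / 2))) \<le> (8 * \<bar>t\<bar> ^ 3 * ep + t ^ 4 * ep^2 / 8) * (s l)^2" .
 qed
 also have "... = 8 * \<bar>t\<bar> ^ 3 * ep + t ^ 4 * ep^2 / 8" unfolding sum_distrib_left[symmetric] s2 by simp
 finally show ?thesis unfolding 1 2 .
qed

end

section \<open>The linear statistic and the limit law\<close>

context wave_process
begin

lemma curve_coeff_uminus: "curve_coeff n (- l) = curve_coeff n l"
 by (simp add: curve_coeff_def freq_uminus)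

lemma abs_curve_coeff_le:
 assumes l: "l \<in> LP n" shows "\<bar>curve_coeff n l\<bar> \<le> L"
proof -
 have "norm (curve_coeff n l) \<le> 1 * (L - 0)"
  unfolding curve_coeff_def
 proof (rule integral_bound)
  fix t assume t: "t \<in> {0..L}"
  have "\<bar>freq n l t\<bar>\<^sup>2 \<le> (sqrt 2)^2" by (rule power_mono[OF freq_bound[OF l t]]) simp
  thus "norm ((freq n l t)^2 - 1) \<le> 1" by (simp add: abs_le_iff)
 qed (use L_pos in \<open>auto intro!: continuous_intros continuous_freq\<close>)
 thus ?thesis by simp
qed

lemma continuous_Re_coord: "continuous_on {0..L} (\<lambda>t. (ip (wave_var a n (coord z l)) (y t))^2 - (ip (wave_var a n (coord z l)) (f t))^2)"
 if l: "l \<in> LP n"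
proof -
 have "continuous_on {0..L} (\<lambda>t. (sqrt 2 * Re (z * cnj (dphase l t / of_real (sqrt N))))^2 - (sqrt 2 * Re (z * cnj (phase l t / of_real (sqrt N))))^2)"
  using N_pos by (intro continuous_intros continuous_phase continuous_dphase) auto
 thus ?thesis unfolding f_def y_def ip_coord[OF l hermitian_dphase] ip_coord[OF l hermitian_phase] .
qed

text \<open>\<open>excess l\<close> is half the sum of two squares of unit Gaussian variables, minus
  1. In the two covariances the real and imaginary parts combine to squared moduli, leaving
  \<open>2 / N\<close> times the integral of \<open>freq^2 - 1\<close>.\<close>

lemma zero_count_excess:
 assumes l: "l \<in> LP n"
 shows "integrable M (\<lambda>w. zero_count w * excess l w)"
  "expectation (\<lambda>w. zero_count w * excess l w) = sg / (pi * N) * curve_coeff n l"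
proof -
 let ?xs = "\<lambda>z. wave_var a n (coord z l)"
 let ?j = "\<lambda>z t. (ip (?xs z) (y t))\<^sup>2 - (ip (?xs z) (f t))^2"
 note sq = zero_count_variance(1)
 have lim: "(\<lambda>p. L / real (mesh_size * Suc p) * (\<Sum>i<mesh_size * Suc p. ?j z (real i * (L / real (mesh_size * Suc p))))) \<longlonglongrightarrow> integral {0..L} (?j z)" for z
  using riemann_sums_tendsto[OF L_pos mesh_size(1) continuous_Re_coord[OF l]] unfolding real_scaleR_def .
 note cov = zero_count_square_covariance[OF mesh_size sq wave_var_mem[OF hermitian_coord[OF l]] lim]
 have intj: "?j z integrable_on {0..L}" for z
  by (rule integrable_continuous_interval[OF continuous_Re_coord[OF l]])
 have J: "integral {0..L} (?j 1) + integral {0..L} (?j \<i>) = 2 / N * curve_coeff n l"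
 proof -
  have "integral {0..L} (?j 1) + integral {0..L} (?j \<i>) = integral {0..L} (\<lambda>t. ?j 1 t + ?j \<i> t)"
   by (rule Henstock_Kurzweil_Integration.integral_add[symmetric]) (rule intj)+
  also have "... = integral {0..L} (\<lambda>t. 2 / N * ((freq n l t)^2 - 1))"
  proof (rule Henstock_Kurzweil_Integration.integral_cong)
   fix t
   have sq2: "(sqrt 2 * Re (1 * cnj (c / of_real (sqrt N))))^2 + (sqrt 2 * Re (\<i> * cnj (c / of_real (sqrt N))))^2 = 2 / N * (cmod c)^2" for c
    using N_pos by (simp add: cmod_power2 field_simps)
   have "?j 1 t + ?j \<i> t = 2 / N * (cmod (dphase l t))^2 - 2 / N * (cmod (phase l t))^2"
    unfolding f_def y_def ip_coord[OF l hermitian_dphase] ip_coord[OF l hermitian_phase] sq2[symmetric] by simp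
   also have "... = 2 / N * ((freq n l t)^2 - 1)" by (simp add: norm_phase norm_dphase right_diff_distrib)
   finally show "?j 1 t + ?j \<i> t = 2 / N * ((freq n l t)^2 - 1)" .
  qed
  finally show ?thesis unfolding curve_coeff_def integral_mult_right .
 qed
 have eq: "zero_count w * excess l w = (zero_count w * (?xs 1 w)^2 + zero_count w * (?xs \<i> w)^2) / 2 - zero_count w"
  if "w \<in> space M" for w
  unfolding excess_eq[OF l that] by (simp add: field_simps)
 have zi: "integrable M zero_count"
  using sq by (rule square_integrable_imp_integrable[rotated]) measurable
 show "integrable M (\<lambda>w. zero_count w * excess l w)"
 proof (subst Bochner_Integration.integrable_cong[OF refl eq])
  show "integrable M (\<lambda>w. (zero_count w * (?xs 1 w)^2 + zero_count w * (?xs \<i> w)^2) / 2 - zero_count w)"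
   using cov(1) zi by auto
 qed auto
 have self: "ip (?xs 1) (?xs 1) = 1" "ip (?xs \<i>) (?xs \<i>) = 1" by (rule ip_coord_self[OF l], simp)+
 have "expectation (\<lambda>w. zero_count w * excess l w) = expectation (\<lambda>w. (zero_count w * (?xs 1 w)^2 + zero_count w * (?xs \<i> w)^2) / 2 - zero_count w)"
  by (rule Bochner_Integration.integral_cong[OF refl eq])
 also have "... = (expectation (\<lambda>w. zero_count w * (?xs 1 w)^2) + expectation (\<lambda>w. zero_count w * (?xs \<i> w)^2)) / 2 - expectation zero_count"
  using cov(1) zi by simp
 also have "... = sg / pi * (integral {0..L} (?j 1) + integral {0..L} (?j \<i>)) / 2"
  unfolding cov(2) self zero_count_variance(2) by (simp add: field_simps)
 also have "... = sg / (pi * N) * curve_coeff n l" unfolding J by simp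
 finally show "expectation (\<lambda>w. zero_count w * excess l w) = sg / (pi * N) * curve_coeff n l" .
qed

text \<open>The weights are the covariances of the zero count with \<open>excess l\<close>. Over
  \<open>half_points\<close> these are independent, centered and of unit variance, so this is the
  orthogonal projection of the centered zero count on their span.\<close>

definition lin_stat :: "'w \<Rightarrow> real" where
 "lin_stat w = (\<Sum>l\<in>half_points n. (sg / (pi * N) * curve_coeff n l) * excess l w)"

lemma half_mem: "l \<in> half_points n \<Longrightarrow> l \<in> LP n"
 by (rule subsetD[OF half_points_subset])

lemma sum_half_coeff: "(\<Sum>l\<in>half_points n. (sg / (pi * N) * curve_coeff n l)\<^sup>2) = var_main"
proof -
 have "(\<Sum>l\<in>LP n. (curve_coeff n l)\<^sup>2) = 2 * (\<Sum>l\<in>half_points n. (curve_coeff n l)\<^sup>2)"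
  unfolding sum_half_points[OF n] by (simp add: curve_coeff_uminus sum_distrib_left)
 moreover have "(sg / (pi * N))^2 = 2 * real n / N^2"
  by (simp add: sg_def power_divide)
 ultimately show ?thesis
  unfolding power_mult_distrib sum_distrib_left[symmetric] var_main_def by simp
qed

lemma lin_stat_measurable [measurable]: "lin_stat \<in> borel_measurable M"
 unfolding lin_stat_def[abs_def] using excess_measurable[OF half_mem] by (intro borel_measurable_sum borel_measurable_times) auto

lemma lin_stat_moments:
 shows "integrable M (\<lambda>w. (lin_stat w)^2)" "expectation (\<lambda>w. (lin_stat w)^2) = var_main"
  "integrable M lin_stat" "expectation lin_stat = 0"
proof -
 let ?Y = "\<lambda>l w. (sg / (pi * N) * curve_coeff n l) * excess l w"
 note em = excess_moments[OF half_mem]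
 have i: "integrable M (\<lambda>w. (?Y l w)^2)" "expectation (?Y l) = 0"
  "expectation (\<lambda>w. (?Y l w)^2) = (sg / (pi * N) * curve_coeff n l)^2" if "l \<in> half_points n" for l
  using em(1-4)[OF that] by (simp_all only: power_mult_distrib integrable_mult_right integral_mult_right_zero mult_zero_right mult_1_right)
 note s = sum_indep_centered_second_moment[OF finite_half_points excess_indep i(1,2)]
 show "integrable M (\<lambda>w. (lin_stat w)^2)" unfolding lin_stat_def using s by blast
 have "expectation (\<lambda>w. (lin_stat w)^2) = (\<Sum>l\<in>half_points n. expectation (\<lambda>w. (?Y l w)^2))"
  unfolding lin_stat_def using s by blast
 also have "... = (\<Sum>l\<in>half_points n. (sg / (pi * N) * curve_coeff n l)\<^sup>2)" by (intro sum.cong refl i(3))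
 finally show "expectation (\<lambda>w. (lin_stat w)^2) = var_main" unfolding sum_half_coeff .
 show "integrable M lin_stat" unfolding lin_stat_def[abs_def]
  using em(1) by (intro Bochner_Integration.integrable_sum integrable_mult_right) auto
 have "expectation lin_stat = (\<Sum>l\<in>half_points n. expectation (?Y l))"
  unfolding lin_stat_def[abs_def] using em(1) by (intro Bochner_Integration.integral_sum integrable_mult_right) auto
 also have "... = 0" using i(2) by (intro sum.neutral) blast
 finally show "expectation lin_stat = 0" .
qed

lemma zero_count_lin_stat:
 shows "integrable M (\<lambda>w. zero_count w * lin_stat w)" "expectation (\<lambda>w. zero_count w * lin_stat w) = var_main"
proof -
 let ?k = "\<lambda>l. sg / (pi * N) * curve_coeff n l"
 have eq: "zero_count w * lin_stat w = (\<Sum>l\<in>half_points n. ?k l * (zero_count w * excess l w))" for w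
  by (simp add: lin_stat_def sum_distrib_left mult_ac)
 note z = zero_count_excess[OF half_mem]
 show "integrable M (\<lambda>w. zero_count w * lin_stat w)"
  unfolding eq using z(1) by (intro Bochner_Integration.integrable_sum integrable_mult_right) auto
 have "expectation (\<lambda>w. zero_count w * lin_stat w) = (\<Sum>l\<in>half_points n. expectation (\<lambda>w. ?k l * (zero_count w * excess l w)))"
  unfolding eq using z(1) by (intro Bochner_Integration.integral_sum integrable_mult_right) auto
 also have "... = (\<Sum>l\<in>half_points n. (?k l)\<^sup>2)"
  by (intro sum.cong refl) (simp only: integral_mult_right_zero z(2) power2_eq_square)
 finally show "expectation (\<lambda>w. zero_count w * lin_stat w) = var_main" unfolding sum_half_coeff .
qed

text \<open>The lower bound is Bessel's inequality: covariance with the projection and variance of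
  the projection are both \<open>var_main\<close>, so the mean square of the remainder is the
  difference of the two variances.\<close>

lemma variance_zero_count_bounds:
 shows "var_main \<le> variance zero_count" "variance zero_count \<le> var_main + real n / N * var_error"
proof -
 note zv = zero_count_variance
 have zi: "integrable M zero_count" using zv(1) by (rule square_integrable_imp_integrable[rotated]) measurable
 have v: "variance zero_count = expectation (\<lambda>w. (zero_count w)^2) - (expectation zero_count)^2"
  by (rule variance_eq[OF zi zv(1)])
 thus "variance zero_count \<le> var_main + real n / N * var_error" using zv(2,3) by simp
 let ?X = "\<lambda>w. zero_count w - expectation zero_count"
 have eq: "(?X w - lin_stat w)^2 = (?X w)^2 - 2 * (zero_count w * lin_stat w) + 2 * expectation zero_count * lin_stat w + (lin_stat w)^2" for w
  by (simp add: power2_eq_square algebra_simps)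
 have xi: "integrable M (\<lambda>w. (?X w)^2)"
  unfolding power2_diff using zv(1) zi by auto
 have "0 \<le> expectation (\<lambda>w. (?X w - lin_stat w)^2)" by (rule Bochner_Integration.integral_nonneg) simp
 also have "... = variance zero_count - 2 * var_main + 2 * expectation zero_count * 0 + var_main"
  unfolding eq using xi zero_count_lin_stat lin_stat_moments by simp
 finally show "var_main \<le> variance zero_count" by simp
qed

lemma expectation_iexp_diff_le:
 assumes [measurable]: "X \<in> borel_measurable M" "Y \<in> borel_measurable M"
  and i: "integrable M (\<lambda>w. (X w - Y w)^2)"
 shows "cmod ((CLINT w|M. iexp (t * X w)) - (CLINT w|M. iexp (t * Y w))) \<le> \<bar>t\<bar> * sqrt (expectation (\<lambda>w. (X w - Y w)^2))"
proof -
 have int: "integrable M (\<lambda>w. X w - Y w)" using i by (rule square_integrable_imp_integrable[rotated]) measurable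
 have ie: "integrable M (\<lambda>w. iexp (t * X w))" "integrable M (\<lambda>w. iexp (t * Y w))"
  by (rule integrable_const_bound[where B=1], simp, measurable)+
 have "cmod ((CLINT w|M. iexp (t * X w)) - (CLINT w|M. iexp (t * Y w))) = cmod (CLINT w|M. iexp (t * X w) - iexp (t * Y w))"
  by (simp only: Bochner_Integration.integral_diff[OF ie])
 also have "... \<le> expectation (\<lambda>w. cmod (iexp (t * X w) - iexp (t * Y w)))" by (rule integral_norm_bound)
 also have "... \<le> expectation (\<lambda>w. \<bar>t\<bar> * \<bar>X w - Y w\<bar>)"
 proof (rule integral_mono)
  show "integrable M (\<lambda>w. cmod (iexp (t * X w) - iexp (t * Y w)))" using ie by (intro integrable_norm Bochner_Integration.integrable_diff)
  show "integrable M (\<lambda>w. \<bar>t\<bar> * \<bar>X w - Y w\<bar>)" using int by (intro integrable_mult_right integrable_abs)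
  fix w
  have "iexp (t * X w) - iexp (t * Y w) = iexp (t * Y w) * (iexp (t * X w - t * Y w) - 1)"
   by (simp add: right_diff_distrib exp_add[symmetric])
  hence "cmod (iexp (t * X w) - iexp (t * Y w)) = cmod (iexp (t * X w - t * Y w) - 1)"
   by (simp only: norm_mult norm_exp_i_times mult_1_left)
  also have "... \<le> \<bar>t * X w - t * Y w\<bar>" using iexp_approx1[of "t * X w - t * Y w" 0] by simp
  finally show "cmod (iexp (t * X w) - iexp (t * Y w)) \<le> \<bar>t\<bar> * \<bar>X w - Y w\<bar>"
   by (simp only: right_diff_distrib[symmetric] abs_mult)
 qed
 also have "... = \<bar>t\<bar> * expectation (\<lambda>w. \<bar>X w - Y w\<bar>)" by simp
 also have "... \<le> \<bar>t\<bar> * sqrt (expectation (\<lambda>w. (X w - Y w)^2))"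
 proof (rule mult_left_mono)
  let ?E = "expectation (\<lambda>w. \<bar>X w - Y w\<bar>)"
  have "0 \<le> variance (\<lambda>w. \<bar>X w - Y w\<bar>)" by (rule Bochner_Integration.integral_nonneg) simp
  also have "... = expectation (\<lambda>w. \<bar>X w - Y w\<bar>\<^sup>2) - ?E^2"
   using int i by (intro variance_eq) auto
  finally have "?E^2 \<le> expectation (\<lambda>w. (X w - Y w)^2)" by simp
  thus "?E \<le> sqrt (expectation (\<lambda>w. (X w - Y w)^2))" by (rule real_le_rsqrt)
 qed simp
 finally show ?thesis .
qed

text \<open>The normalised count and the normalised linear statistic are both unit vectors in mean
  square, and their pairing is \<open>sqrt (v / V)\<close>. Hence their squared distance is at most
  \<open>2 * (V - v) / V\<close>, and \<open>v \<ge> real n / N * ep\<close> turns this into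
  \<open>2 * (var_error / ep)\<close>. The same lower bound makes every single weight of the linear
  statistic small, as the central limit estimate demands.\<close>

lemma zero_count_char_bound:
 assumes ep: "0 < ep" and bt: "ep \<le> (\<Sum>l\<in>LP n. (curve_coeff n l)\<^sup>2) / N"
 shows "cmod ((CLINT w|M. iexp (t * ((zero_count w - expectation zero_count) / sqrt (variance zero_count)))) - of_real (exp (- t\<^sup>2 / 2)))
  \<le> \<bar>t\<bar> * sqrt (2 * (var_error / ep)) + (8 * \<bar>t\<bar> ^ 3 * sqrt (2 * L^2 / (N * ep)) + t ^ 4 * (sqrt (2 * L^2 / (N * ep)))^2 / 8)"
proof -
 define v V where "v = var_main" and "V = variance zero_count"
 have n0: "0 < real n" using n by simp
 have v_ge: "real n / N * ep \<le> v"
 proof -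
  have "real n / N * ep \<le> real n / N * ((\<Sum>l\<in>LP n. (curve_coeff n l)\<^sup>2) / N)"
   using bt by (intro mult_left_mono) auto
  thus ?thesis by (simp add: v_def var_main_def power2_eq_square)
 qed
 have nN: "0 < real n / N * ep" using n0 N_pos ep by simp
 have v: "0 < v" using v_ge nN by linarith
 have vV: "v \<le> V" "V \<le> v + real n / N * var_error" using variance_zero_count_bounds by (auto simp: v_def V_def)
 have V: "0 < V" using v vV by linarith
 note zv = zero_count_variance
 have zi: "integrable M zero_count" using zv(1) by (rule square_integrable_imp_integrable[rotated]) measurable
 let ?X = "\<lambda>w. (zero_count w - expectation zero_count) / sqrt V" and ?S = "\<lambda>w. lin_stat w / sqrt v"
 have xi: "integrable M (\<lambda>w. (zero_count w - expectation zero_count)^2)" unfolding power2_diff using zv(1) zi by auto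
 have eq: "(?X w - ?S w)^2 = (1 / V) * (zero_count w - expectation zero_count)^2
   - (2 / (sqrt V * sqrt v)) * (zero_count w * lin_stat w) + (2 * expectation zero_count / (sqrt V * sqrt v)) * lin_stat w + (1 / v) * (lin_stat w)^2" for w
 proof -
  have "((z - e) / p - s / q)^2 = (1 / p^2) * (z - e)^2 - (2 / (p * q)) * (z * s) + (2 * e / (p * q)) * s + (1 / q^2) * s^2"
   if "p \<noteq> 0" "q \<noteq> 0" for z e p s q :: real
   using that by (simp add: power2_eq_square field_simps)
  from this[of "sqrt V" "sqrt v"] v V show ?thesis by simp
 qed
 have sqi: "integrable M (\<lambda>w. (?X w - ?S w)^2)"
  unfolding eq using xi zero_count_lin_stat lin_stat_moments by auto
 have "expectation (\<lambda>w. (?X w - ?S w)^2) = (1 / V) * V - (2 / (sqrt V * sqrt v)) * v + (2 * expectation zero_count / (sqrt V * sqrt v)) * 0 + (1 / v) * v"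
  unfolding eq using xi zero_count_lin_stat lin_stat_moments by (simp add: v_def[symmetric]) (simp add: V_def)
 also have "... = 2 - 2 * (sqrt v / sqrt V)"
 proof -
  have "v / (sqrt V * sqrt v) = sqrt v / sqrt V"
  proof -
   have "v / (sqrt V * sqrt v) = v / sqrt v / sqrt V" by (simp only: divide_divide_eq_left mult.commute)
   also have "v / sqrt v = sqrt v" using v by (simp add: real_div_sqrt)
   finally show ?thesis .
  qed
  thus ?thesis using v V by simp
 qed
 also have "... \<le> 2 * (var_error / ep)"
 proof -
  \<comment> \<open>A number between 0 and 1 is at most its square root, which removes the roots
    from the distance.\<close>
  have "v / V \<le> sqrt (v / V)"
  proof (rule real_le_rsqrt)
   have "v / V * (v / V) \<le> v / V * 1" using v V vV by (intro mult_left_mono) auto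
   thus "(v / V)^2 \<le> v / V" by (simp add: power2_eq_square)
  qed
  hence "1 - sqrt v / sqrt V \<le> 1 - v / V" by (simp add: real_sqrt_divide)
  also have "... = (V - v) / V" using V by (simp add: diff_divide_distrib)
  also have "... \<le> (real n / N * var_error) / V" using vV V by (intro divide_right_mono) auto
  also have "... \<le> (real n / N * var_error) / (real n / N * ep)"
   using vV v_ge by (intro divide_left_mono mult_pos_pos[OF V nN]) linarith+
  also have "... = var_error / ep" using n0 N_pos by simp
  finally show ?thesis by simp
 qed
 finally have L2: "expectation (\<lambda>w. (?X w - ?S w)^2) \<le> 2 * (var_error / ep)" .
 have 1: "cmod ((CLINT w|M. iexp (t * ?X w)) - (CLINT w|M. iexp (t * ?S w))) \<le> \<bar>t\<bar> * sqrt (2 * (var_error / ep))"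
 proof -
  have "cmod ((CLINT w|M. iexp (t * ?X w)) - (CLINT w|M. iexp (t * ?S w))) \<le> \<bar>t\<bar> * sqrt (expectation (\<lambda>w. (?X w - ?S w)^2))"
   by (rule expectation_iexp_diff_le[OF _ _ sqi]) measurable
  also have "... \<le> \<bar>t\<bar> * sqrt (2 * (var_error / ep))" using L2 by (intro mult_left_mono real_sqrt_le_mono) auto
  finally show ?thesis .
 qed
 define s where "s l = sg / (pi * N) * curve_coeff n l / sqrt v" for l
 have S: "?S w = (\<Sum>l\<in>half_points n. s l * excess l w)" for w
  by (simp add: lin_stat_def s_def sum_divide_distrib)
 have 2: "cmod ((CLINT w|M. iexp (t * ?S w)) - of_real (exp (- t\<^sup>2 / 2))) \<le> 8 * \<bar>t\<bar> ^ 3 * sqrt (2 * L^2 / (N * ep)) + t ^ 4 * (sqrt (2 * L^2 / (N * ep)))^2 / 8"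
  unfolding S
 proof (rule excess_sum_char)
  have "(\<Sum>l\<in>half_points n. (s l)\<^sup>2) = (\<Sum>l\<in>half_points n. (sg / (pi * N) * curve_coeff n l)\<^sup>2) / v"
   using v by (simp add: s_def power_divide power_mult_distrib sum_divide_distrib)
  thus "(\<Sum>l\<in>half_points n. (s l)\<^sup>2) = 1" unfolding sum_half_coeff using v by (simp add: v_def)
  fix l assume l: "l \<in> half_points n"
  have "(s l)^2 = (sg / (pi * N))^2 * (curve_coeff n l)^2 / v"
   using v by (simp add: s_def power_divide power_mult_distrib)
  also have "(sg / (pi * N))^2 = 2 * real n / N^2" by (simp add: sg_def power_divide)
  also have "2 * real n / N^2 * (curve_coeff n l)^2 / v \<le> 2 * real n / N^2 * L^2 / (real n / N * ep)"
  proof (intro frac_le mult_left_mono v_ge nN)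
   have "\<bar>curve_coeff n l\<bar>\<^sup>2 \<le> L^2" by (intro power_mono abs_curve_coeff_le half_mem l) simp
   thus "(curve_coeff n l)^2 \<le> L^2" by simp
  qed auto
  also have "... = 2 * L^2 / (N * ep)" using n0 by (simp add: power2_eq_square)
  finally have "sqrt ((s l)^2) \<le> sqrt (2 * L^2 / (N * ep))" by (rule real_sqrt_le_mono)
  thus "\<bar>s l\<bar> \<le> sqrt (2 * L^2 / (N * ep))" by simp
 qed
 show ?thesis
  using 1 2 norm_triangle_ineq[of "(CLINT w|M. iexp (t * ?X w)) - (CLINT w|M. iexp (t * ?S w))" "(CLINT w|M. iexp (t * ?S w)) - of_real (exp (- t\<^sup>2 / 2))"]
  unfolding V_def by simp
qed

lemma nodal_intersections_eq:
 assumes \<gamma>: "\<And>t. t \<in> {0..L} \<Longrightarrow> \<gamma> t = to_torus (G t)" and w: "w \<in> space M"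
 shows "nodal_intersections a L \<gamma> n w = zero_count w"
proof -
 have "random_wave a n w (\<gamma> t) = 0 \<longleftrightarrow> f t w = 0" if t: "t \<in> {0..L}" for t
 proof -
  have "random_wave a n w (\<gamma> t) = (\<Sum>l\<in>LP n. a l w * exp (2 * of_real pi * \<i> * of_real (lattice_vec l \<bullet> G t))) / of_real (sqrt N)"
   unfolding \<gamma>[OF t] by (rule random_wave.abs_eq)
  also have "... = (\<Sum>l\<in>LP n. a l w * (phase l t / of_real (sqrt N)))"
   by (simp add: sum_divide_distrib phase_def mult_ac)
  finally have "Re (random_wave a n w (\<gamma> t)) = f t w" by (simp add: f_def wave_var_def)
  moreover have "random_wave a n w (\<gamma> t) \<in> \<real>" by (rule random_wave_real[OF coeffs w])
  ultimately show ?thesis by (auto simp: complex_is_Real_iff complex_eq_iff)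
 qed
 thus ?thesis unfolding nodal_intersections_def zero_count_def by (metis (mono_tags, lifting) Collect_cong)
qed

end

lemma (in wave_process) normalized_nodal_char:
 assumes \<gamma>: "\<And>t. t \<in> {0..L} \<Longrightarrow> \<gamma> t = to_torus (G t)"
 defines "Z \<equiv> nodal_intersections a L \<gamma> n"
 shows "(\<lambda>w. (Z w - expectation Z) / sqrt (variance Z)) \<in> borel_measurable M"
  and "char (distr M borel (\<lambda>w. (Z w - expectation Z) / sqrt (variance Z))) t
   = (CLINT w|M. iexp (t * ((zero_count w - expectation zero_count) / sqrt (variance zero_count))))"
proof -
 have eq: "Z w = zero_count w" if "w \<in> space M" for w
  unfolding Z_def by (rule nodal_intersections_eq[OF \<gamma> that])
 have e: "expectation Z = expectation zero_count" by (rule Bochner_Integration.integral_cong[OF refl eq])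
 have v: "variance Z = variance zero_count" unfolding e by (rule Bochner_Integration.integral_cong[OF refl]) (simp add: eq)
 show meas: "(\<lambda>w. (Z w - expectation Z) / sqrt (variance Z)) \<in> borel_measurable M"
  by (rule measurable_cong[THEN iffD2, where g1="\<lambda>w. (zero_count w - expectation Z) / sqrt (variance Z)"]) (simp add: eq, measurable)
 have "char (distr M borel (\<lambda>w. (Z w - expectation Z) / sqrt (variance Z))) t
   = (CLINT w|M. iexp (t * ((Z w - expectation Z) / sqrt (variance Z))))"
  unfolding char_def by (rule integral_distr[OF meas]) measurable
 also have "... = (CLINT w|M. iexp (t * ((zero_count w - expectation zero_count) / sqrt (variance zero_count))))"
  unfolding v unfolding e by (rule Bochner_Integration.integral_cong[OF refl]) (simp only: eq)
 finally show "char (distr M borel (\<lambda>w. (Z w - expectation Z) / sqrt (variance Z))) t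
   = (CLINT w|M. iexp (t * ((zero_count w - expectation zero_count) / sqrt (variance zero_count))))" .
qed

theorem theorem1p1:
  fixes L :: real and \<gamma> :: "real \<Rightarrow> torus"
    and M :: "'w measure" and a :: "int ^ 2 \<Rightarrow> 'w \<Rightarrow> complex"
    and nn :: "nat \<Rightarrow> nat"
  assumes curve: "arc_length_curve L \<gamma>"
    and curv: "\<And>t. t \<in> {0..L} \<Longrightarrow> curvature L \<gamma> t \<noteq> 0"
    and prob: "prob_space M"
    and coeffs: "\<And>n. n \<in> sums_of_two_squares \<Longrightarrow> 1 \<le> n \<Longrightarrow>
      gaussian_coefficients M (lattice_points n) a"
    and nn: "\<And>k. nn k \<in> sums_of_two_squares" "\<And>k. 1 \<le> nn k"
    and card_lim: "filterlim (\<lambda>k. card (lattice_points (nn k))) at_top sequentially"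
    and bounded_away: "\<exists>\<epsilon>>0. \<forall>k. \<epsilon> \<le> \<bar>4 * B_functional L \<gamma> (spectral_measure (nn k)) - L\<^sup>2\<bar>"
  shows "weak_conv_m
    (\<lambda>k. distr M borel (\<lambda>w.
        (nodal_intersections a L \<gamma> (nn k) w
           - prob_space.expectation M (nodal_intersections a L \<gamma> (nn k)))
        / sqrt (prob_space.variance M (nodal_intersections a L \<gamma> (nn k)))))
    std_normal_distribution"
proof -
 obtain G D kp\<^sub>0 kp where pc: "plane_curve L G D kp\<^sub>0 kp" and \<gamma>: "\<And>t. t \<in> {0..L} \<Longrightarrow> \<gamma> t = to_torus (G t)"
  and vel: "\<And>t. t \<in> {0..L} \<Longrightarrow> velocity \<gamma> {0..L} t = D 0 t"
  by (rule arc_length_curve_lift[OF curve curv]) (assumption, rule that)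
 obtain ep where ep: "0 < ep" "\<And>k. ep \<le> \<bar>4 * B_functional L \<gamma> (spectral_measure (nn k)) - L^2\<bar>"
  using bounded_away by auto
 have ne: "LP (nn k) \<noteq> {}" for k by (rule lattice_points_nonempty[OF nn(1)])
 have wp: "wave_process L G D kp\<^sub>0 kp M a (nn k)" for k
  by (intro wave_process.intro pc gaussian_wave.intro prob gaussian_wave_axioms.intro nn coeffs wave_process_axioms.intro ne)
 let ?N = "\<lambda>k. real (card (LP (nn k)))"
 have bt: "ep \<le> (\<Sum>l\<in>LP (nn k). (plane_curve.curve_coeff L D (nn k) l)^2) / ?N k" for k
 proof -
  have "4 * B_functional L \<gamma> (spectral_measure (nn k)) - L^2
    = (\<Sum>l\<in>LP (nn k). (plane_curve.curve_coeff L D (nn k) l)^2) / ?N k"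
   by (rule plane_curve.B_functional_eq[OF pc nn(2) ne vel])
  moreover have "0 \<le> (\<Sum>l\<in>LP (nn k). (plane_curve.curve_coeff L D (nn k) l)^2) / ?N k"
   by (intro divide_nonneg_nonneg sum_nonneg) auto
  ultimately show ?thesis using ep(2)[of k] by simp
 qed
 let ?Z = "\<lambda>k. nodal_intersections a L \<gamma> (nn k)"
 let ?X = "\<lambda>k w. (?Z k w - prob_space.expectation M (?Z k)) / sqrt (prob_space.variance M (?Z k))"
 define err where "err k = wave_process.var_error L kp\<^sub>0 kp (nn k)" for k
 have err: "err \<longlonglongrightarrow> 0"
 proof -
  have inv: "(\<lambda>k. A / ?N k) \<longlonglongrightarrow> 0" for A
   by (intro tendsto_divide_0[OF tendsto_const] filterlim_at_top_imp_at_infinity real_card_lim[OF nn(2) card_lim ne])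
  have "(\<lambda>k. (plane_curve.osc_const L kp\<^sub>0 kp * wave_process.amp kp)^2 * (wave_process.pair_sum (nn k) / ?N k)
   + (12 + 2 * pi^2 * (2 * 16 ^ 4 * (128 * wave_process.C1 L kp)^2)) * (75 * L^2 / ?N k + (plane_curve.osc_const L kp\<^sub>0 kp * wave_process.amp kp)^2 * (wave_process.quad_sum (nn k) / ?N k ^ 3)))
   \<longlonglongrightarrow> (plane_curve.osc_const L kp\<^sub>0 kp * wave_process.amp kp)\<^sup>2 * 0 + (12 + 2 * pi^2 * (2 * 16 ^ 4 * (128 * wave_process.C1 L kp)^2)) * (0 + (plane_curve.osc_const L kp\<^sub>0 kp * wave_process.amp kp)^2 * 0)"
   unfolding wave_process.pair_sum_def[OF wp] wave_process.quad_sum_def[OF wp]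
   by (intro tendsto_intros inv pair_sum_tendsto_0[OF nn(2) card_lim ne] quad_sum_tendsto_0[OF nn(2) card_lim ne])
  thus ?thesis unfolding err_def wave_process.var_error_def[OF wp] by simp
 qed
 show ?thesis
 proof (rule levy_continuity)
  show "real_distribution (distr M borel (?X k))" for k
   by (rule prob_space.real_distribution_distr[OF prob wave_process.normalized_nodal_char(1)[OF wp \<gamma>]])
  show "real_distribution std_normal_distribution" by (rule real_dist_normal_dist)
  fix t
  define dl where "dl k = sqrt (2 * L^2 / (?N k * ep))" for k
  have dl: "dl \<longlonglongrightarrow> 0"
  proof -
   have "(\<lambda>k. sqrt (2 * L^2 / ep / ?N k)) \<longlonglongrightarrow> sqrt 0"
    by (intro tendsto_real_sqrt tendsto_divide_0[OF tendsto_const] filterlim_at_top_imp_at_infinity real_card_lim[OF nn(2) card_lim ne])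
   thus ?thesis unfolding dl_def by (simp add: mult.commute)
  qed
  have bnd: "cmod (char (distr M borel (?X k)) t - of_real (exp (- t\<^sup>2 / 2)))
    \<le> \<bar>t\<bar> * sqrt (2 * (err k / ep)) + (8 * \<bar>t\<bar> ^ 3 * dl k + t ^ 4 * (dl k)^2 / 8)" for k
   unfolding err_def dl_def
   by (subst wave_process.normalized_nodal_char(2)[OF wp \<gamma>], assumption)
    (rule wave_process.zero_count_char_bound[OF wp ep(1) bt])
  have "(\<lambda>k. \<bar>t\<bar> * sqrt (2 * (err k / ep)) + (8 * \<bar>t\<bar> ^ 3 * dl k + t ^ 4 * (dl k)^2 / 8))
    \<longlonglongrightarrow> \<bar>t\<bar> * sqrt (2 * (0 / ep)) + (8 * \<bar>t\<bar> ^ 3 * 0 + t ^ 4 * 0^2 / 8)"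
   using ep(1) by (intro tendsto_intros err dl) auto
  hence lim: "(\<lambda>k. \<bar>t\<bar> * sqrt (2 * (err k / ep)) + (8 * \<bar>t\<bar> ^ 3 * dl k + t ^ 4 * (dl k)^2 / 8)) \<longlonglongrightarrow> 0" by simp
  have "(\<lambda>k. char (distr M borel (?X k)) t - of_real (exp (- t\<^sup>2 / 2))) \<longlonglongrightarrow> 0"
   by (rule Lim_null_comparison[OF _ lim]) (use bnd in auto)
  thus "(\<lambda>k. char (distr M borel (?X k)) t) \<longlonglongrightarrow> char std_normal_distribution t"
   unfolding char_std_normal_distribution by (simp add: LIM_zero_iff)
 qed
qed

end
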